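(* Let $T$ be a singular integral operator with kernel $k(x,y)$ (in the sense specified in the context). Let $\vec q=(q_1,\ldots,q_n)$ with $1<q_j<\infty$ for every $j$, and let $1<p<\infty$ satisfy $$\frac np\le\sum_{j=1}^n\frac1{q_j}.$$ Then there is a constant $C>0$ such that $$\|Tf\|_{\mathcal M^p_{\vec q}(\mathbb R^n)}\le C\,\|f\|_{\mathcal M^p_{\vec q}(\mathbb R^n)}$$ for all $f\in\mathcal M^p_{\vec q}(\mathbb R^n)$.
   Context: For $\vec q\in(0,\infty)^n$ the mixed Lebesgue norm is $$\|f\|_{\vec q}=\left(\int_{\mathbb R}\cdots\left(\int_{\mathbb R}\left(\int_{\mathbb R}|f(x_1,\ldots,x_n)|^{q_1}\,dx_1\right)^{q_2/q_1}dx_2\right)^{q_3/q_2}\cdots dx_n\right)^{1/q_n}.$$ For $p\in(0,\infty)$ with $\sum_j1/q_j\ge n/p$, the mixed Morrey norm is $$\|f\|_{\mathcal M^p_{\vec q}(\mathbb R^n)}=\sup_Q|Q|^{\frac1p-\frac1n\sum_{j=1}^n\frac1{q_j}}\|f\chi_Q\|_{\vec q},$$ the supremum being over all cubes $Q\subset\mathbb R^n$ with sides parallel to the coordinate axes; $\mathcal M^p_{\vec q}(\mathbb R^n)$ is the set of measurable $f$ for which it is finite, and $\mathcal M^p_q(\mathbb R^n)$ denotes the case $q_1=\cdots=q_n=q$ (the classical Morrey space; $\mathcal M^p_p=L^p$). Singular integral operator: $T$ is a linear operator with a kernel $k(x,y)$, $x\ne y$, such that (1) there is $C>0$ with $|k(x,y)|\le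 C|x-y|^{-n}$; (2) there are $\epsilon>0$ and $C>0$ with $|k(x,y)-k(z,y)|+|k(y,x)-k(y,z)|\le C\frac{|x-z|^\epsilon}{|x-y|^{n+\epsilon}}$ whenever $|x-y|\ge2|x-z|$ and $x\neq y$; (3) for every compactly supported $f\in L^\infty(\mathbb R^n)$, $Tf(x)=\int_{\mathbb R^n}k(x,y)f(y)\,dy$ for $x\notin\operatorname{supp}(f)$. It is a standing assumption that $T$ extends to a bounded linear operator on $\mathcal M^p_q(\mathbb R^n)$ for all $1<q\le p<\infty$ (in particular on $L^p(\mathbb R^n)$, $1<p<\infty$). This extension is the usual one: for any cube $Q$ and a.e. $x\in Q$, $Tf(x)=T(f\chi_{2Q})(x)+\int_{\mathbb R^n\setminus2Q}k(x,y)f(y)\,dy$, where $2Q$ is the cube with the same center and twice the side length and $T(f\chi_{2Q})$ is given by the $L^q$-bounded operator. On $\mathcal M^p_{\vec q}(\mathbb R^n)$, which is contained in $\mathcal M^p_{\min(q_1,\ldots,q_n)}(\mathbb R^n)$, $T$ means the restriction of the operator on the latter space. *)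

theory Defs
  imports "HOL-Analysis.Analysis"
begin

type_synonym 'n cfun = "(real, 'n) vec \<Rightarrow> complex"

text \<open>
  Real powers of extended nonnegative reals. Only positive exponents are used, so that
  \<open>0\<close> and \<open>\<infinity>\<close> are fixed.
\<close>

definition ennreal_powr :: "ennreal \<Rightarrow> real \<Rightarrow> ennreal" where
  "ennreal_powr a s = (if a = \<infinity> then \<infinity> else ennreal (enn2real a powr s))"

definition upd_coord :: "real ^ 'n \<Rightarrow> 'n \<Rightarrow> real \<Rightarrow> real ^ 'n" where
  "upd_coord x j t = (\<chi> i. if i = j then t else x $ i)"

text \<open>
  The coordinates in the list are integrated out from left to right, so the head of the list
  is the innermost integral. The argument \<open>r\<close> is the exponent of the coordinate that was
  integrated last: the next integrand is raised to the power \<open>q\<^sub>j / r\<close>, and the final result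
  to the power \<open>1 / r\<close>. Integrated coordinates become dummy arguments of the integrand.
\<close>

primrec iterated_integral ::
  "real ^ 'n \<Rightarrow> real \<Rightarrow> 'n list \<Rightarrow> (real ^ 'n \<Rightarrow> ennreal) \<Rightarrow> real ^ 'n \<Rightarrow> ennreal" where
  "iterated_integral q r [] F = (\<lambda>x. ennreal_powr (F x) (1 / r))"
| "iterated_integral q r (j # js) F =
     iterated_integral q (q $ j) js
       (\<lambda>x. \<integral>\<^sup>+ t. ennreal_powr (F (upd_coord x j t)) (q $ j / r) \<partial>lebesgue)"

text \<open>
  The order of the index type is the order \<open>x\<^sub>1, \<dots>, x\<^sub>n\<close> of integration. After all coordinates
  have been integrated the function is constant, and it is read off at \<open>0\<close>.
\<close>

definition mixed_norm :: "real ^ 'n::{finite,linorder} \<Rightarrow> 'n cfun \<Rightarrow> ennreal" where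
  "mixed_norm q f =
     iterated_integral q 1 (sorted_list_of_set UNIV) (\<lambda>x. ennreal (norm (f x))) 0"

definition cube :: "real ^ 'n \<Rightarrow> real \<Rightarrow> (real ^ 'n) set" where
  "cube c l = cbox (\<chi> i. c $ i - l / 2) (\<chi> i. c $ i + l / 2)"

definition cubes :: "(real ^ 'n) set set" where
  "cubes = {cube c l | c l. 0 < l}"

definition mixed_morrey_norm ::
  "real \<Rightarrow> real ^ 'n::{finite,linorder} \<Rightarrow> 'n cfun \<Rightarrow> ennreal" where
  "mixed_morrey_norm p q f =
     (SUP Q\<in>cubes.
        ennreal (measure lebesgue Q powr (1 / p - 1 / real CARD('n) * (\<Sum>j\<in>UNIV. 1 / q $ j)))
        * mixed_norm q (\<lambda>x. indicator Q x *\<^sub>R f x))"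

definition mixed_morrey ::
  "real \<Rightarrow> real ^ 'n::{finite,linorder} \<Rightarrow> 'n cfun set" where
  "mixed_morrey p q = {f \<in> borel_measurable lebesgue. mixed_morrey_norm p q f < \<infinity>}"

text \<open>The classical Morrey space; \<open>vec q\<close> is the vector all of whose entries are \<open>q\<close>.\<close>

abbreviation morrey_norm ::
  "real \<Rightarrow> real \<Rightarrow> ('n::{finite,linorder}) cfun \<Rightarrow> ennreal" where
  "morrey_norm p q \<equiv> mixed_morrey_norm p (vec q)"

abbreviation morrey ::
  "real \<Rightarrow> real \<Rightarrow> ('n::{finite,linorder}) cfun set" where
  "morrey p q \<equiv> mixed_morrey p (vec q)"

text \<open>
  Operators act on functions rather than on classes modulo null sets, so identities between
  images are required almost everywhere only.
\<close>

definition AE_linear_on ::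
  "('n::finite) cfun set \<Rightarrow> ('n cfun \<Rightarrow> 'n cfun) \<Rightarrow> bool" where
  "AE_linear_on S T \<longleftrightarrow>
     (\<forall>f\<in>S. \<forall>g\<in>S. AE x in lebesgue. T (\<lambda>y. f y + g y) x = T f x + T g x) \<and>
     (\<forall>f\<in>S. \<forall>a. AE x in lebesgue. T (\<lambda>y. a * f y) x = a * T f x)"

definition Linf_comp :: "('n::finite) cfun set" where
  "Linf_comp = {f \<in> borel_measurable lebesgue.
     (\<exists>B. AE x in lebesgue. norm (f x) \<le> B) \<and> compact (closure {x. f x \<noteq> 0})}"

definition singular_kernel :: "(real ^ 'n \<Rightarrow> real ^ 'n \<Rightarrow> complex) \<Rightarrow> bool" where
  "singular_kernel k \<longleftrightarrow>
     (\<exists>C>0. \<forall>x y. x \<noteq> y \<longrightarrow> norm (k x y) \<le> C * norm (x - y) powr (- real CARD('n))) \<and>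
     (\<exists>\<epsilon>>0. \<exists>C>0. \<forall>x y z. x \<noteq> y \<and> norm (x - y) \<ge> 2 * norm (x - z) \<longrightarrow>
        norm (k x y - k z y) + norm (k y x - k y z)
          \<le> C * (norm (x - z) powr \<epsilon> / norm (x - y) powr (real CARD('n) + \<epsilon>)))"

definition singular_integral_operator ::
  "(real ^ 'n \<Rightarrow> real ^ 'n \<Rightarrow> complex) \<Rightarrow>
   ('n cfun \<Rightarrow> 'n cfun) \<Rightarrow> bool" where
  "singular_integral_operator k T \<longleftrightarrow>
     singular_kernel k \<and> AE_linear_on Linf_comp T \<and>
     (\<forall>f\<in>Linf_comp. AE x in lebesgue. x \<notin> closure {y. f y \<noteq> 0} \<longrightarrow>
        T f x = (LINT y|lebesgue. k x y * f y))"

definition bounded_linear_on_morrey ::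
  "real \<Rightarrow> real \<Rightarrow>
   (('n::{finite,linorder}) cfun \<Rightarrow> 'n cfun) \<Rightarrow> bool" where
  "bounded_linear_on_morrey p q T \<longleftrightarrow>
     AE_linear_on (morrey p q) T \<and>
     (\<exists>C>0. \<forall>f\<in>morrey p q.
        T f \<in> morrey p q \<and> morrey_norm p q (T f) \<le> ennreal C * morrey_norm p q f)"

text \<open>
  A single map \<open>T\<close> represents the operator together with all its extensions to the Morrey
  spaces. In particular \<open>T (f \<chi>\<^bsub>2Q\<^esub>)\<close> below is the value of the operator on
  \<open>L\<^sup>q = morrey q q\<close>. Values of \<open>T\<close> outside the Morrey spaces are irrelevant.
\<close>

definition extends_to_morrey ::
  "((real, 'n::{finite,linorder}) vec \<Rightarrow> (real, 'n) vec \<Rightarrow> complex) \<Rightarrow>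
   ('n cfun \<Rightarrow> 'n cfun) \<Rightarrow> bool" where
  "extends_to_morrey k T \<longleftrightarrow>
     (\<forall>p q. 1 < q \<and> q \<le> p \<longrightarrow>
        bounded_linear_on_morrey p q T \<and>
        (\<forall>f\<in>morrey p q. \<forall>c l. 0 < l \<longrightarrow>
           (AE x in lebesgue. x \<in> cube c l \<longrightarrow>
              T f x = T (\<lambda>y. indicator (cube c (2 * l)) y *\<^sub>R f y) x
                + (LINT y:(- cube c (2 * l))|lebesgue. k x y * f y))))"

end

theory Submission
  imports Defs
begin

text \<open>
  Regard \<open>Tg\<close> as a function of the outer coordinates with values in the mixed norm space of the inner
  ones. If this vector-valued operator is bounded with one outer exponent \<open>s\<close>, then it is bounded with
  every outer exponent \<open>1 < r < \<infinity>\<close>: smaller exponents follow from the Calderon-Zygmund decomposition in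
  the outer coordinates, larger ones from a good-\<open>\<lambda>\<close> inequality on stopping cubes. With outer exponent
  \<open>q\<^sub>j\<close> the coordinate \<open>j\<close> moves from the outer to the inner ones by Fubini, so that, starting
  from the bounds on all \<open>L\<^sup>r\<close>, the coordinates can be absorbed one at a time.

  On a cube \<open>Q\<close>, split \<open>f\<close> at \<open>2Q\<close>. The mixed norm bound controls \<open>T(f \<chi>\<^bsub>2Q\<^esub>)\<close>, after an approximation
  of \<open>f \<chi>\<^bsub>2Q\<^esub>\<close> by bounded functions in \<open>L\<^bsup>min q\<^esup>\<close>. The remaining integral is at most a multiple of
  \<open>\<Sum>\<^sub>m (2\<^sup>m\<ell>(Q))\<^bsup>-n/p\<^esup>\<close> times the Morrey norm, by the decay of the kernel on the shells
  \<open>2\<^bsup>m+1\<^esup>Q - 2\<^sup>mQ\<close> and Hoelder's inequality in every coordinate.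
\<close>

section \<open>Powers of extended nonnegative reals\<close>

text \<open>No vector-valued integration occurs: the inner norm of a function on the full space is
  again a function on the full space, one that ignores the inner coordinates, so the outer theory is
  scalar. This works because, by Minkowski's inequality and translation invariance, the inner norm
  of an integral against the dyadic kernel majorant is bounded by an integral against an integrable
  kernel in the outer coordinates alone. Lowering the exponent uses smoothness of \<open>k\<close>
  in its second variable (cancellation of the bad part), raising it uses smoothness in the first
  (slow variation of the far part), so no adjoint operator appears. Bounded Borel functions of
  bounded support are the test class: they can be cut into good and bad or near and far pieces
  within the class, and every quantity that is cancelled or absorbed is finite on them. The
  identities for \<open>T\<close> hold only almost everywhere and only finite additivity is used, so
  families of cubes are cut to finite ones and null sets are followed through Fubini's
  theorem.\<close>

abbreviation epow (infixr "powe" 80) where "a powe s \<equiv> ennreal_powr a s"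

lemma epow_ennreal: "0 \<le> x \<Longrightarrow> ennreal x powe s = ennreal (x powr s)"
  by (simp add: ennreal_powr_def)

lemma epow_top [simp]: "top powe s = top"
  by (simp add: ennreal_powr_def)

lemma epow_0 [simp]: "0 powe s = 0"
  by (simp add: ennreal_powr_def)

lemma epow_1 [simp]: "1 powe s = 1"
  by (simp add: ennreal_powr_def)

lemma epow_one [simp]: "a powe 1 = a"
  by (cases a) (auto simp: epow_ennreal)

lemma epow_eq_0_iff [simp]: "a powe s = 0 \<longleftrightarrow> a = 0"
  by (cases a) (auto simp: epow_ennreal)

lemma epow_eq_top_iff [simp]: "a powe s = top \<longleftrightarrow> a = top"
  by (cases a) (auto simp: epow_ennreal)

lemma epow_less_top_iff [simp]: "a powe s < top \<longleftrightarrow> a < top"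
  by (cases a) (auto simp: epow_ennreal)

lemma epow_mono: "a \<le> b \<Longrightarrow> 0 \<le> s \<Longrightarrow> a powe s \<le> b powe s"
  by (cases a; cases b) (auto simp: epow_ennreal top_unique intro!: ennreal_leI powr_mono2)

lemma epow_epow: "(a powe s) powe t = a powe (s * t)"
  by (cases a) (auto simp: epow_ennreal powr_powr)

lemma epow_mult: "(a * b) powe s = a powe s * b powe s"
proof (cases a)
  case (real x)
  note a = this
  show ?thesis
  proof (cases b)
    case (real y)
    then show ?thesis using a by (simp add: epow_ennreal powr_mult flip: ennreal_mult)
  next
    case top
    then show ?thesis using a by (cases "x = 0") (auto simp: epow_ennreal ennreal_mult_top)
  qed
next
  case top
  then show ?thesis by (cases "b = 0") (auto simp: ennreal_top_mult)
qed

lemma epow_add: "a powe (s + t) = a powe s * a powe t"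
  by (cases a) (auto simp: epow_ennreal powr_add ennreal_mult)

lemma epow_inverse:
  assumes "0 < a" "a < top" shows "inverse a powe s = inverse (a powe s)"
proof -
  obtain r where "a = ennreal r" "0 < r" using assms by (cases a) auto
  then show ?thesis by (simp add: epow_ennreal inverse_ennreal inverse_powr)
qed

lemma epow_le_iff: "0 < s \<Longrightarrow> a powe s \<le> b powe s \<longleftrightarrow> a \<le> b"
  using epow_mono[of a b s] epow_mono[of "a powe s" "b powe s" "1 / s"] by (auto simp: epow_epow)

lemma epow_le_swap: "0 < s \<Longrightarrow> a powe s \<le> b \<longleftrightarrow> a \<le> b powe (1 / s)"
  using epow_le_iff[of s a "b powe (1 / s)"] by (simp add: epow_epow)

lemma epow_measurable [measurable]:
  "f \<in> borel_measurable M \<Longrightarrow> (\<lambda>x. f x powe s) \<in> borel_measurable M"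
proof -
  assume [measurable]: "f \<in> borel_measurable M"
  have "(\<lambda>x. f x powe s) = (\<lambda>x. if f x = top then top else ennreal (enn2real (f x) powr s))"
    by (auto simp: ennreal_powr_def)
  then show ?thesis by simp
qed

lemma epow_add_le: 
  assumes "0 < s" shows "(a + b) powe s \<le> ennreal (2 powr s) * (a powe s + b powe s)"
proof -
  have "(a + b) powe s \<le> (2 * max a b) powe s"
    using assms by (intro epow_mono) (auto simp: max_def mult_2 add_mono)
  also have "\<dots> = ennreal (2 powr s) * (max a b) powe s"
    using epow_ennreal[of 2 s] by (simp add: epow_mult)
  also have "\<dots> \<le> ennreal (2 powr s) * (a powe s + b powe s)"
    by (intro mult_left_mono) (auto simp: max_def)
  finally show ?thesis .
qed

text \<open>A positive power is an order isomorphism of \<open>ennreal\<close> whose inverse is the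
  power 1/s (\<open>epow_le_swap\<close>), so it commutes with suprema.\<close>

lemma epow_SUP:
  fixes f :: "nat \<Rightarrow> ennreal"
  assumes "0 < s"
  shows "(SUP n. f n) powe s = (SUP n. f n powe s)"
proof (rule antisym)
  show "(SUP n. f n) powe s \<le> (SUP n. f n powe s)"
    unfolding epow_le_swap[OF assms]
    by (intro SUP_least) (auto simp flip: epow_le_swap[OF assms] intro: SUP_upper)
  show "(SUP n. f n powe s) \<le> (SUP n. f n) powe s"
    using assms by (intro SUP_least epow_mono SUP_upper) auto
qed

section \<open>Hoelder and Minkowski inequalities\<close>

lemma ennreal_mult_divide_cancel: "0 < a \<Longrightarrow> a < top \<Longrightarrow> a * (b / a) = (b::ennreal)"
  by (metis ennreal_times_divide mult.commute mult_divide_eq_ennreal not_gr_zero top.not_eq_extremum)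

lemma Young_ennreal:
  assumes "1 < p" "1 < q" "1 / p + 1 / q = (1::real)"
  shows "a * b \<le> ennreal (1 / p) * a powe p + ennreal (1 / q) * b powe q"
proof (cases a)
  case (real x)
  note a = this
  show ?thesis
  proof (cases b)
    case (real y)
    have "x * y \<le> x powr p / p + y powr q / q" using assms a real by (intro Youngs_inequality) auto
    then show ?thesis using assms a real
      by (simp add: epow_ennreal flip: ennreal_mult ennreal_plus)
  next
    case top then show ?thesis using a assms by (simp add: ennreal_mult_top)
  qed
next
  case top then show ?thesis using assms by (simp add: ennreal_mult_top)
qed

text \<open>Normalising both factors to norm 1 reduces the claim to Young's inequality, whose
  constants 1/p and 1/q then add up to 1. Norms equal to 0 or \<open>top\<close> are split off first
  because they cannot be divided out; a zero norm makes the product vanish almost everywhere, also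
  against an infinite norm.\<close>

lemma Hoelder_ennreal:
  assumes pq: "1 < p" "1 < q" "1 / p + 1 / q = (1::real)"
    and [measurable]: "f \<in> borel_measurable M" "g \<in> borel_measurable M"
  shows "(\<integral>\<^sup>+x. f x * g x \<partial>M) \<le> (\<integral>\<^sup>+x. f x powe p \<partial>M) powe (1 / p) * (\<integral>\<^sup>+x. g x powe q \<partial>M) powe (1 / q)"
proof -
  let ?A = "\<integral>\<^sup>+x. f x powe p \<partial>M" and ?B = "\<integral>\<^sup>+x. g x powe q \<partial>M"
  consider "?A = 0" | "?B = 0" | "?A = top" "?B \<noteq> 0" | "?B = top" "?A \<noteq> 0"
    | "0 < ?A" "?A < top" "0 < ?B" "?B < top"
    by (metis not_gr_zero top.not_eq_extremum)
  then show ?thesis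
  proof cases
    case 1
    then have "AE x in M. f x = 0" by (simp add: nn_integral_0_iff_AE)
    then have "(\<integral>\<^sup>+x. f x * g x \<partial>M) = 0" by (subst nn_integral_0_iff_AE) (auto elim!: eventually_mono)
    then show ?thesis by simp
  next
    case 2
    then have "AE x in M. g x = 0" by (simp add: nn_integral_0_iff_AE)
    then have "(\<integral>\<^sup>+x. f x * g x \<partial>M) = 0" by (subst nn_integral_0_iff_AE) (auto elim!: eventually_mono)
    then show ?thesis by simp
  next
    case 3 then show ?thesis by (simp add: ennreal_top_mult)
  next
    case 4 then show ?thesis by (simp add: ennreal_mult_top)
  next
    case 5
    define a where "a = ?A powe (1 / p)"
    define b where "b = ?B powe (1 / q)"
    have a: "0 < a" "a < top" and b: "0 < b" "b < top"
      using 5 by (auto simp: a_def b_def zero_less_iff_neq_zero)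
    have *: "(\<integral>\<^sup>+x. (f x / a) powe p \<partial>M) = 1" "(\<integral>\<^sup>+x. (g x / b) powe q \<partial>M) = 1"
    proof -
      have "a powe p = ?A" "b powe q = ?B" using pq by (auto simp: a_def b_def epow_epow)
      have "(f x / a) powe p = f x powe p * inverse ?A" for x
        unfolding divide_ennreal_def epow_mult epow_inverse[OF a] \<open>a powe p = ?A\<close> ..
      then show "(\<integral>\<^sup>+x. (f x / a) powe p \<partial>M) = 1"
        using 5 by (simp add: nn_integral_multc) (metis divide_ennreal_def ennreal_divide_self less_top not_gr_zero)
      have "(g x / b) powe q = g x powe q * inverse ?B" for x
        unfolding divide_ennreal_def epow_mult epow_inverse[OF b] \<open>b powe q = ?B\<close> ..
      then show "(\<integral>\<^sup>+x. (g x / b) powe q \<partial>M) = 1"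
        using 5 by (simp add: nn_integral_multc) (metis divide_ennreal_def ennreal_divide_self less_top not_gr_zero)
    qed
    have "(\<integral>\<^sup>+x. f x * g x \<partial>M) = (\<integral>\<^sup>+x. (a * b) * ((f x / a) * (g x / b)) \<partial>M)"
    proof (intro nn_integral_cong)
      fix x
      have "f x * g x = (a * (f x / a)) * (b * (g x / b))"
        using a b by (simp add: ennreal_mult_divide_cancel)
      then show "f x * g x = (a * b) * ((f x / a) * (g x / b))" by (simp add: ac_simps)
    qed
    also have "\<dots> \<le> (\<integral>\<^sup>+x. (a * b) * (ennreal (1 / p) * (f x / a) powe p + ennreal (1 / q) * (g x / b) powe q) \<partial>M)"
      by (intro nn_integral_mono mult_left_mono Young_ennreal pq) auto
    also have "\<dots> = (a * b) * (ennreal (1 / p) * 1 + ennreal (1 / q) * 1)"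
      using * by (simp add: nn_integral_cmult nn_integral_add)
    also have "\<dots> = a * b" using pq by (simp flip: ennreal_plus)
    finally show ?thesis by (simp add: a_def b_def)
  qed
qed

text \<open>Truncation in height and to an exhausting sequence of sets. It supplies the finite
  integrals by which the proof of Minkowski's inequality divides.\<close>

lemma min_indicator_SUP:
  fixes s :: ennreal
  assumes "t \<in> A m" "incseq A"
  shows "(SUP n::nat. min s (of_nat n) * indicator (A n) t) = s"
proof (rule antisym)
  show "(SUP n::nat. min s (of_nat n) * indicator (A n) t) \<le> s"
    by (intro SUP_least) (auto simp: indicator_def)
  show "s \<le> (SUP n::nat. min s (of_nat n) * indicator (A n) t)"
    unfolding le_SUP_iff
  proof (intro allI impI)
    fix y assume y: "y < s"
    then have "y < top" by (metis less_top top.extremum_strict order_less_trans not_top_less)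
    then obtain n where "y < of_nat n" using ennreal_Ex_less_of_nat by blast
    moreover have "(of_nat n :: ennreal) \<le> of_nat (max n m)" by simp
    ultimately have "y < of_nat (max n m)" by (rule less_le_trans)
    moreover have "t \<in> A (max n m)" using assms by (meson incseqD max.cobounded2 subsetD)
    ultimately show "\<exists>n\<in>UNIV. y < min s (of_nat n) * indicator (A n) t"
      using y by (intro bexI[of _ "max n m"]) auto
  qed
qed

text \<open>For the inner integral S, writing S^q = S * S^(q-1) and applying Hoelder's inequality
  for fixed w gives A \<le> R * A^(1/q'), where A is the integral of S^q. Cancelling A^(1/q') needs
  A finite, hence the detour over truncations of S and monotone convergence.\<close>

lemma Minkowski_integral:
  assumes M: "sigma_finite_measure M" and N: "sigma_finite_measure N" and q: "1 \<le> q"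
    and [measurable]: "(\<lambda>(t, w). F t w) \<in> borel_measurable (M \<Otimes>\<^sub>M N)"
  shows "(\<integral>\<^sup>+t. (\<integral>\<^sup>+w. F t w \<partial>N) powe q \<partial>M) powe (1 / q)
    \<le> (\<integral>\<^sup>+w. (\<integral>\<^sup>+t. F t w powe q \<partial>M) powe (1 / q) \<partial>N)"
proof (cases "q = 1")
  case True
  interpret pair_sigma_finite M N using M N by (simp add: pair_sigma_finite_def)
  show ?thesis using True Fubini'[of F] by simp
next
  case False
  then have q1: "1 < q" using q by simp
  define q' where "q' = q / (q - 1)"
  have q': "1 < q'" "1 / q + 1 / q' = 1" "(q - 1) * q' = q" "(1 / q') = 1 - 1 / q"
    using q1 by (auto simp: q'_def field_simps)
  interpret M: sigma_finite_measure M by fact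
  interpret N: sigma_finite_measure N by fact
  interpret pair_sigma_finite M N using M N by (simp add: pair_sigma_finite_def)
  define S where "S t = (\<integral>\<^sup>+w. F t w \<partial>N)" for t
  have [measurable]: "S \<in> borel_measurable M" unfolding S_def by measurable
  define R where "R = (\<integral>\<^sup>+w. (\<integral>\<^sup>+t. F t w powe q \<partial>M) powe (1 / q) \<partial>N)"
  have [measurable]: "(\<lambda>w. F t w) \<in> borel_measurable N" if "t \<in> space M" for t
    using that by measurable
  have bound: "(\<integral>\<^sup>+t. S' t powe q \<partial>M) powe (1 / q) \<le> R"
    if [measurable]: "S' \<in> borel_measurable M" and le: "\<And>t. t \<in> space M \<Longrightarrow> S' t \<le> S t" 
      and fin: "(\<integral>\<^sup>+t. S' t powe q \<partial>M) < top" for S'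
  proof -
    let ?A = "\<integral>\<^sup>+t. S' t powe q \<partial>M"
    have "?A = (\<integral>\<^sup>+t. S' t * S' t powe (q - 1) \<partial>M)"
      using epow_add[of _ 1 "q - 1"] by simp
    also have "\<dots> \<le> (\<integral>\<^sup>+t. S t * S' t powe (q - 1) \<partial>M)"
      by (intro nn_integral_mono mult_right_mono le) auto
    also have "\<dots> = (\<integral>\<^sup>+t. (\<integral>\<^sup>+w. F t w * S' t powe (q - 1) \<partial>N) \<partial>M)"
      unfolding S_def by (intro nn_integral_cong nn_integral_multc[symmetric]) measurable
    also have "\<dots> = (\<integral>\<^sup>+w. (\<integral>\<^sup>+t. F t w * S' t powe (q - 1) \<partial>M) \<partial>N)"
      by (intro Fubini'[symmetric]) measurable
    also have "\<dots> \<le> (\<integral>\<^sup>+w. (\<integral>\<^sup>+t. F t w powe q \<partial>M) powe (1 / q) * ?A powe (1 / q') \<partial>N)"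
    proof (intro nn_integral_mono)
      fix w assume [simp]: "w \<in> space N"
      have [measurable]: "(\<lambda>t. F t w) \<in> borel_measurable M" by measurable
      show "(\<integral>\<^sup>+t. F t w * S' t powe (q - 1) \<partial>M) \<le> (\<integral>\<^sup>+t. F t w powe q \<partial>M) powe (1 / q) * ?A powe (1 / q')"
        using Hoelder_ennreal[OF q1 q'(1,2), of "\<lambda>t. F t w" M "\<lambda>t. S' t powe (q - 1)"]
        by (simp add: epow_epow q'(3))
    qed
    also have "\<dots> = R * ?A powe (1 / q')"
      unfolding R_def by (intro nn_integral_multc) measurable
    finally have A: "?A \<le> R * ?A powe (1 / q')" .
    show ?thesis
    proof (cases "?A = 0")
      case False
      have "?A = ?A powe (1 / q) * ?A powe (1 / q')"
        using q'(2) by (simp flip: epow_add)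
      then have "?A powe (1 / q) * ?A powe (1 / q') \<le> R * ?A powe (1 / q')" using A by simp
      moreover have "?A powe (1 / q') \<noteq> 0" "?A powe (1 / q') \<noteq> top" using False fin by auto
      ultimately show ?thesis
        by (metis divide_right_mono_ennreal mult_divide_eq_ennreal)
    qed simp
  qed
  obtain A :: "nat \<Rightarrow> _ set" where A: "range A \<subseteq> sets M" "(\<Union>i. A i) = space M" "\<And>i. emeasure M (A i) \<noteq> \<infinity>" "incseq A"
    using M.sigma_finite_incseq by blast
  have [measurable]: "A i \<in> sets M" for i using A(1) by auto
  let ?S = "\<lambda>n t. min (S t) (of_nat n) * indicator (A n) t"
  have le: "(\<integral>\<^sup>+t. ?S n t powe q \<partial>M) \<le> R powe q" for n
  proof -
    have "(\<integral>\<^sup>+t. ?S n t powe q \<partial>M) \<le> (\<integral>\<^sup>+t. of_nat n powe q * indicator (A n) t \<partial>M)"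
      using q by (intro nn_integral_mono) (auto simp: indicator_def intro!: epow_mono)
    also have "\<dots> < top" using A(3)[of n] 
      by (simp add: nn_integral_cmult ennreal_mult_less_top less_top of_nat_less_top)
    finally have "(\<integral>\<^sup>+t. ?S n t powe q \<partial>M) powe (1 / q) \<le> R"
      by (intro bound) (auto simp: indicator_def)
    then show ?thesis using q1 epow_le_swap[of "1 / q"] by simp
  qed
  have "(\<integral>\<^sup>+t. S t powe q \<partial>M) = (\<integral>\<^sup>+t. (SUP n. ?S n t powe q) \<partial>M)"
  proof (intro nn_integral_cong)
    fix t assume "t \<in> space M"
    then obtain m where m: "t \<in> A m" using A(2) by auto
    show "S t powe q = (SUP n. ?S n t powe q)"
      using q1 by (subst epow_SUP[symmetric]) (auto simp: min_indicator_SUP[OF m A(4)])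
  qed
  also have "\<dots> = (SUP n. \<integral>\<^sup>+t. ?S n t powe q \<partial>M)"
  proof (intro nn_integral_monotone_convergence_SUP)
    show "incseq (\<lambda>n t. ?S n t powe q)"
    proof (intro incseq_SucI le_funI epow_mono mult_mono)
      fix n t
      show "min (S t) (of_nat n) \<le> min (S t) (of_nat (Suc n))"
        by (intro min.mono order_refl of_nat_mono) simp
      show "(indicator (A n) t :: ennreal) \<le> indicator (A (Suc n)) t"
        using A(4) by (auto simp: indicator_def incseq_Suc_iff)
    qed (use q in auto)
  qed measurable
  also have "\<dots> \<le> R powe q" by (intro SUP_least le)
  finally show ?thesis using q1 epow_le_swap[of "1 / q"] by (simp add: S_def R_def)
qed

section \<open>Coordinate splitting of Lebesgue measure\<close>

definition merge_coords :: "'n set \<Rightarrow> real ^ 'n \<Rightarrow> real ^ 'n \<Rightarrow> real ^ 'n" where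
  "merge_coords I x y = (\<chi> i. if i \<in> I then x $ i else y $ i)"

lemma merge_coords_nth [simp]: "merge_coords I x y $ i = (if i \<in> I then x $ i else y $ i)"
  by (simp add: merge_coords_def)

lemma upd_coord_nth [simp]: "upd_coord x j t $ i = (if i = j then t else x $ i)"
  by (simp add: upd_coord_def)

lemma vec_measurableI:
  fixes f :: "'a \<Rightarrow> real ^ 'n"
  assumes "\<And>i. (\<lambda>x. f x $ i) \<in> borel_measurable M"
  shows "f \<in> borel_measurable M"
proof (rule borel_measurable_euclidean_space[THEN iffD2], rule ballI)
  fix b :: "real ^ 'n" assume "b \<in> Basis"
  then obtain i where "b = axis i 1" by (auto simp: Basis_vec_def)
  then show "(\<lambda>x. f x \<bullet> b) \<in> borel_measurable M"
    using assms[of i] by (simp add: inner_axis)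
qed

lemma nth_measurable [measurable (raw)]:
  fixes f :: "'a \<Rightarrow> real ^ 'n"
  shows "f \<in> borel_measurable M \<Longrightarrow> (\<lambda>x. f x $ i) \<in> borel_measurable M"
  by (rule measurable_compose[OF _ borel_measurable_nth])

lemma merge_coords_measurable [measurable (raw)]:
  fixes f g :: "'a \<Rightarrow> real ^ 'n"
  assumes [measurable]: "f \<in> borel_measurable M" "g \<in> borel_measurable M"
  shows "(\<lambda>x. merge_coords I (f x) (g x)) \<in> borel_measurable M"
  by (rule vec_measurableI) (simp add: nth_measurable assms)

lemma upd_coord_measurable [measurable (raw)]:
  fixes f :: "'a \<Rightarrow> real ^ 'n"
  assumes [measurable]: "f \<in> borel_measurable M" "g \<in> borel_measurable M"
  shows "(\<lambda>x. upd_coord (f x) j (g x)) \<in> borel_measurable M"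
  by (rule vec_measurableI) (simp add: nth_measurable assms)

lemma prod_Basis_vec:
  fixes w :: "real ^ 'n"
  shows "(\<Prod>b\<in>Basis. w \<bullet> b) = (\<Prod>i\<in>UNIV. w $ i)"
proof -
  have "(\<Prod>b\<in>Basis. w \<bullet> b) = (\<Prod>b\<in>range (\<lambda>i::'n. axis i (1::real)). w \<bullet> b)"
    by (intro prod.cong) (auto simp: Basis_vec_def)
  also have "\<dots> = (\<Prod>i\<in>UNIV. w $ i)"
    by (subst prod.reindex) (auto simp: inj_on_def axis_eq_axis inner_axis)
  finally show ?thesis .
qed

lemma prod_Basis_vec_prod:
  fixes w :: "(real ^ 'n) \<times> (real ^ 'n)"
  shows "(\<Prod>b\<in>Basis. w \<bullet> b) = (\<Prod>i\<in>UNIV. fst w $ i * snd w $ i)"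
proof -
  have "(\<Prod>b\<in>Basis. w \<bullet> b) = (\<Prod>b\<in>(\<lambda>u. (u, 0)) ` Basis. w \<bullet> b) * (\<Prod>b\<in>(\<lambda>u. (0, u)) ` Basis. w \<bullet> b)"
    unfolding Basis_prod_def by (rule prod.union_disjoint) auto
  also have "\<dots> = (\<Prod>b\<in>Basis. fst w \<bullet> b) * (\<Prod>b\<in>Basis. snd w \<bullet> b)"
    by (subst (1 2) prod.reindex) (auto simp: inj_on_def inner_prod_def)
  finally show ?thesis by (simp add: prod_Basis_vec prod.distrib)
qed

text \<open>Exchanging coordinates between two points permutes the axes of the doubled space, so
  boxes go to boxes with the same product of side lengths. The Fubini statements for subsets of the
  coordinates rest on this.\<close>

lemma distr_swap:
  "distr lborel borel (\<lambda>p. (merge_coords I (fst p) (snd p), merge_coords I (snd p) (fst p)))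
    = (lborel :: ((real ^ 'n) \<times> (real ^ 'n)) measure)" (is "distr lborel borel ?\<Phi> = _")
proof (rule lborel_eqI[symmetric])
  have [measurable]: "fst \<in> borel_measurable (borel :: ((real^'n)\<times>(real^'n)) measure)"
    "snd \<in> borel_measurable (borel :: ((real^'n)\<times>(real^'n)) measure)"
    by (auto simp flip: borel_prod)
  have \<Phi>[measurable]: "?\<Phi> \<in> borel_measurable borel"
    unfolding borel_prod[symmetric] by (intro measurable_Pair merge_coords_measurable) (auto simp: borel_prod)
  fix l u :: "(real ^ 'n) \<times> (real ^ 'n)"
  assume le: "\<And>b. b \<in> Basis \<Longrightarrow> l \<bullet> b \<le> u \<bullet> b"
  have le1: "fst l $ i \<le> fst u $ i" for i 
    using le[of "(axis i 1, 0)"] by (auto simp: Basis_prod_def Basis_vec_def inner_prod_def inner_axis)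
  have le2: "snd l $ i \<le> snd u $ i" for i 
    using le[of "(0, axis i 1)"] by (auto simp: Basis_prod_def Basis_vec_def inner_prod_def inner_axis)
  have box_iff: "p \<in> box a b \<longleftrightarrow> (\<forall>i. fst a $ i < fst p $ i \<and> fst p $ i < fst b $ i \<and> snd a $ i < snd p $ i \<and> snd p $ i < snd b $ i)"
    for p a b :: "(real ^ 'n) \<times> (real ^ 'n)"
    by (auto simp: box_def Basis_prod_def Basis_vec_def inner_prod_def inner_axis ball_Un)
  have "emeasure (distr lborel borel ?\<Phi>) (box l u) = emeasure lborel (?\<Phi> -` box l u)"
    by (simp add: emeasure_distr)
  also have "?\<Phi> -` box l u = box (?\<Phi> l) (?\<Phi> u)"
    by (auto simp: box_iff split: if_splits)
  also have "emeasure lborel \<dots> = ennreal (\<Prod>b\<in>Basis. (?\<Phi> u - ?\<Phi> l) \<bullet> b)"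
  proof (rule emeasure_lborel_box)
    fix b :: "(real ^ 'n) \<times> (real ^ 'n)" assume "b \<in> Basis"
    then show "?\<Phi> l \<bullet> b \<le> ?\<Phi> u \<bullet> b"
      using le1 le2 by (auto simp: Basis_prod_def Basis_vec_def inner_prod_def inner_axis)
  qed
  also have "(\<Prod>b\<in>Basis. (?\<Phi> u - ?\<Phi> l) \<bullet> b) = (\<Prod>b\<in>Basis. (u - l) \<bullet> b)"
    by (simp add: prod_Basis_vec_prod) (intro prod.cong, auto)
  finally show "emeasure (distr lborel borel ?\<Phi>) (box l u) = ennreal (\<Prod>b\<in>Basis. (u - l) \<bullet> b)" .
qed simp

text \<open>
  Lebesgue measure in the coordinates of \<open>J\<close>, realised on the full space by giving every other
  coordinate the uniform distribution on the unit interval.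
\<close>

definition ucube :: "'n set \<Rightarrow> (real ^ 'n) set" where
  "ucube J = {x. \<forall>i. i \<notin> J \<longrightarrow> x $ i \<in> {0..1}}"

definition vol_on :: "'n set \<Rightarrow> (real ^ 'n) measure" where
  "vol_on J = density lborel (indicator (ucube J))"

lemma ucube_borel [measurable]: "ucube J \<in> sets borel"
  unfolding ucube_def by measurable

lemma sets_mu [measurable_cong, simp]: "sets (vol_on J) = sets borel"
  by (simp add: vol_on_def)

lemma space_mu [simp]: "space (vol_on J) = UNIV"
  by (simp add: vol_on_def)

lemma vol_on_UNIV [simp]: "vol_on UNIV = lborel"
  by (rule measure_eqI) (auto simp: vol_on_def ucube_def emeasure_density)

lemma nn_integral_mu:
  "F \<in> borel_measurable borel \<Longrightarrow> (\<integral>\<^sup>+x. F x \<partial>vol_on J) = (\<integral>\<^sup>+x. indicator (ucube J) x * F x \<partial>lborel)"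
  unfolding vol_on_def by (subst nn_integral_density) auto

lemma sigma_finite_mu: "sigma_finite_measure (vol_on J)"
  unfolding vol_on_def by (subst sigma_finite_measure.sigma_finite_iff_density_finite[OF lborel.sigma_finite_measure_axioms]) (auto simp: indicator_def)

text \<open>Stated for any set squeezed between the open and the closed box over \<open>J\<close>,
  so that it serves half-open dyadic cubes, their neighbourhoods, and open and closed boxes
  alike.\<close>

lemma emeasure_mu_between:
  fixes l u :: "real ^ 'n"
  assumes [measurable]: "S \<in> sets borel" and le: "\<And>i. i \<in> J \<Longrightarrow> l $ i \<le> u $ i"
    and 1: "\<And>x. (\<And>i. i \<in> J \<Longrightarrow> l $ i < x $ i \<and> x $ i < u $ i) \<Longrightarrow> x \<in> S"
    and 2: "\<And>x i. x \<in> S \<Longrightarrow> i \<in> J \<Longrightarrow> l $ i \<le> x $ i \<and> x $ i \<le> u $ i"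
  shows "emeasure (vol_on J) S = ennreal (\<Prod>i\<in>J. u $ i - l $ i)"
proof -
  let ?l = "merge_coords J l 0" and ?u = "merge_coords J u (\<chi> i. 1)"
  have le': "\<And>b. b \<in> Basis \<Longrightarrow> ?l \<bullet> b \<le> ?u \<bullet> b"
    using le by (auto simp: Basis_vec_def inner_axis)
  have eq: "(\<Prod>b\<in>Basis. (?u - ?l) \<bullet> b) = (\<Prod>i\<in>J. u $ i - l $ i)"
    unfolding prod_Basis_vec by (rule prod.mono_neutral_cong_right) auto
  have "emeasure (vol_on J) S = emeasure lborel (S \<inter> ucube J)"
    unfolding vol_on_def by (subst emeasure_density) (auto simp flip: indicator_inter_arith simp: mult.commute)
  moreover have "emeasure lborel (S \<inter> ucube J) \<le> emeasure lborel (cbox ?l ?u)"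
    using 2 by (intro emeasure_mono) (auto simp: mem_box_cart ucube_def)
  moreover have "emeasure lborel (box ?l ?u) \<le> emeasure lborel (S \<inter> ucube J)"
  proof (intro emeasure_mono subsetI IntI)
    fix x assume x: "x \<in> box ?l ?u"
    then show "x \<in> S" by (intro 1) (auto simp: mem_box_cart split: if_splits)
    show "x \<in> ucube J" using x by (auto simp: mem_box_cart ucube_def less_imp_le split: if_splits)
  qed auto
  ultimately show ?thesis
    using le' by (simp add: emeasure_lborel_cbox emeasure_lborel_box eq[symmetric])
qed

lemma emeasure_ucube: "emeasure lborel (ucube {} :: (real ^ 'n) set) = 1"
proof -
  have "emeasure (vol_on UNIV) (ucube {} :: (real ^ 'n) set) = ennreal (\<Prod>i\<in>(UNIV :: 'n set). ((\<chi> i. 1) :: real ^ 'n) $ i - (0 :: real ^ 'n) $ i)"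
    by (rule emeasure_mu_between) (auto simp: ucube_def less_imp_le)
  then show ?thesis by simp
qed

lemma nn_integral_swap:
  assumes [measurable]: "F \<in> borel_measurable (borel \<Otimes>\<^sub>M borel)"
  shows "(\<integral>\<^sup>+x. \<integral>\<^sup>+y. F (x, y) \<partial>lborel \<partial>lborel)
    = (\<integral>\<^sup>+x. \<integral>\<^sup>+y. F (merge_coords I x y, merge_coords I y x) \<partial>lborel \<partial>lborel)"
proof -
  have [measurable]: "F \<in> borel_measurable borel" using assms by (simp add: borel_prod)
  have [measurable]: "(\<lambda>p. (merge_coords I (fst p) (snd p), merge_coords I (snd p) (fst p))) \<in> borel_measurable borel"
    unfolding borel_prod[symmetric] by measurable
  have "(\<integral>\<^sup>+x. \<integral>\<^sup>+y. F (x, y) \<partial>lborel \<partial>lborel) = (\<integral>\<^sup>+p. F p \<partial>(lborel \<Otimes>\<^sub>M lborel))"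
    by (rule lborel.nn_integral_fst) simp
  also have "\<dots> = (\<integral>\<^sup>+p. F p \<partial>distr lborel borel (\<lambda>p. (merge_coords I (fst p) (snd p), merge_coords I (snd p) (fst p))))"
    by (simp add: lborel_prod distr_swap)
  also have "\<dots> = (\<integral>\<^sup>+p. F (merge_coords I (fst p) (snd p), merge_coords I (snd p) (fst p)) \<partial>lborel)"
    by (subst nn_integral_distr) auto
  also have "\<dots> = (\<integral>\<^sup>+p. F (merge_coords I (fst p) (snd p), merge_coords I (snd p) (fst p)) \<partial>(lborel \<Otimes>\<^sub>M lborel))"
    by (simp add: lborel_prod)
  also have "\<dots> = (\<integral>\<^sup>+x. \<integral>\<^sup>+y. F (merge_coords I x y, merge_coords I y x) \<partial>lborel \<partial>lborel)"
    by (subst lborel.nn_integral_fst[symmetric]) auto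
  finally show ?thesis .
qed

lemma vol_on_split:
  fixes F :: "real ^ 'n \<Rightarrow> ennreal"
  assumes [measurable]: "F \<in> borel_measurable borel"
  shows "(\<integral>\<^sup>+x. F x \<partial>vol_on K) = (\<integral>\<^sup>+x. \<integral>\<^sup>+y. F (merge_coords I x y) \<partial>vol_on (K - I) \<partial>vol_on (K \<inter> I))"
proof -
  let ?c = "\<lambda>(K :: 'n set) x. indicator (ucube K) x :: ennreal"
  have "(\<integral>\<^sup>+x. F x \<partial>vol_on K) = (\<integral>\<^sup>+x. ?c K x * F x \<partial>lborel)"
    by (rule nn_integral_mu) simp
  \<comment> \<open>The dummy point y ranges over the unit cube, which has volume 1. After the
    exchange of coordinates it carries those outside \<open>I\<close>, and the unit-interval
    conditions regroup into \<open>ucube (K \<inter> I)\<close> for x and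
    \<open>ucube (K - I)\<close> for y.\<close>
  also have "\<dots> = (\<integral>\<^sup>+x. \<integral>\<^sup>+y. ?c K x * F x * ?c {} y \<partial>lborel \<partial>lborel)"
    by (subst nn_integral_cmult) (auto simp: emeasure_ucube)
  also have "\<dots> = (\<integral>\<^sup>+x. \<integral>\<^sup>+y. ?c K (merge_coords I x y) * F (merge_coords I x y) * ?c {} (merge_coords I y x) \<partial>lborel \<partial>lborel)"
    using nn_integral_swap[of "\<lambda>(x, y). ?c K x * F x * ?c {} y" I] by simp
  also have "\<dots> = (\<integral>\<^sup>+x. \<integral>\<^sup>+y. ?c (K \<inter> I) x * (?c (K - I) y * F (merge_coords I x y)) \<partial>lborel \<partial>lborel)"
    by (intro nn_integral_cong) (auto simp: indicator_def ucube_def split: if_splits)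
  also have "\<dots> = (\<integral>\<^sup>+x. ?c (K \<inter> I) x * (\<integral>\<^sup>+y. F (merge_coords I x y) \<partial>vol_on (K - I)) \<partial>lborel)"
    by (intro nn_integral_cong) (subst nn_integral_cmult, auto simp: nn_integral_mu)
  also have "\<dots> = (\<integral>\<^sup>+x. \<integral>\<^sup>+y. F (merge_coords I x y) \<partial>vol_on (K - I) \<partial>vol_on (K \<inter> I))"
  proof -
    interpret sigma_finite_measure "vol_on (K - I)" by (rule sigma_finite_mu)
    show ?thesis by (rule nn_integral_mu[symmetric]) measurable
  qed
  finally show ?thesis .
qed

lemma distr_mu_singleton: "distr (vol_on {j}) borel (\<lambda>y. y $ j) = lborel"
proof (rule lborel_eqI[symmetric])
  fix l u :: real assume "\<And>b. b \<in> Basis \<Longrightarrow> l \<bullet> b \<le> u \<bullet> b"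
  then have lu: "l \<le> u" by simp
  have "emeasure (distr (vol_on {j}) borel (\<lambda>y. y $ j)) (box l u) = emeasure (vol_on {j}) ((\<lambda>y. y $ j) -` box l u)"
    by (subst emeasure_distr) auto
  also have "\<dots> = ennreal (\<Prod>i\<in>{j}. (\<chi> i. u) $ i - (\<chi> i. l) $ i)"
    using lu by (intro emeasure_mu_between measurable_sets_borel[of _ borel]) (auto simp: box_real)
  finally show "emeasure (distr (vol_on {j}) borel (\<lambda>y. y $ j)) (box l u) = ennreal (\<Prod>b\<in>Basis. (u - l) \<bullet> b)"
    by simp
qed simp

lemma vol_on_coord:
  fixes F :: "real ^ 'n \<Rightarrow> ennreal"
  assumes [measurable]: "F \<in> borel_measurable borel" and j: "j \<in> K"
  shows "(\<integral>\<^sup>+x. F x \<partial>vol_on K) = (\<integral>\<^sup>+x. \<integral>\<^sup>+t. F (upd_coord x j t) \<partial>lborel \<partial>vol_on (K - {j}))"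
proof -
  have "K - (- {j}) = {j}" "K \<inter> - {j} = K - {j}" using j by auto
  moreover have "(\<integral>\<^sup>+y. F (merge_coords (- {j}) x y) \<partial>vol_on {j}) = (\<integral>\<^sup>+t. F (upd_coord x j t) \<partial>lborel)" for x
  proof -
    have "merge_coords (- {j}) x y = upd_coord x j (y $ j)" for y by (simp add: vec_eq_iff)
    then have "(\<integral>\<^sup>+y. F (merge_coords (- {j}) x y) \<partial>vol_on {j}) = (\<integral>\<^sup>+t. F (upd_coord x j t) \<partial>distr (vol_on {j}) borel (\<lambda>y. y $ j))"
      by (subst nn_integral_distr) auto
    then show ?thesis by (simp add: distr_mu_singleton)
  qed
  ultimately show ?thesis using vol_on_split[of F K "- {j}"] by simp
qed

section \<open>Iterated mixed norms\<close>

text \<open>The root is taken at every step, whereas \<open>iterated_integral\<close> postpones it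
  to the next exponent. Each step is then a genuine norm, to which Minkowski's inequality
  applies.\<close>

definition coord_norm :: "real \<Rightarrow> 'n \<Rightarrow> (real ^ 'n \<Rightarrow> ennreal) \<Rightarrow> real ^ 'n \<Rightarrow> ennreal" where
  "coord_norm q j F x = (\<integral>\<^sup>+t. F (upd_coord x j t) powe q \<partial>lborel) powe (1 / q)"

primrec iter_norm :: "real ^ 'n \<Rightarrow> 'n list \<Rightarrow> (real ^ 'n \<Rightarrow> ennreal) \<Rightarrow> real ^ 'n \<Rightarrow> ennreal" where
  "iter_norm q [] F = F"
| "iter_norm q (j # js) F = iter_norm q js (coord_norm (q $ j) j F)"

lemma iter_norm_append: "iter_norm q (js @ ks) F = iter_norm q ks (iter_norm q js F)"
  by (induction js arbitrary: F) auto

lemma mixed_norm_eq_mn: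
  assumes "\<forall>j. 1 \<le> q $ j"
  shows "mixed_norm q f = iter_norm q (sorted_list_of_set UNIV) (\<lambda>x. ennreal (norm (f x))) 0"
proof -
  have "iterated_integral q r js F = iter_norm q js (\<lambda>x. F x powe (1 / r))" if "0 < r" for r js F
    using that
  proof (induction js arbitrary: r F)
    case (Cons j js)
    have j: "0 < q $ j" using assms by (meson less_le_trans zero_less_one)
    show ?case
      using Cons.IH[OF j] Cons.prems j by (simp add: coord_norm_def[abs_def] nn_integral_completion epow_epow)
  qed simp
  from this[of 1] show ?thesis by (simp add: mixed_norm_def)
qed

lemma coord_norm_measurable_gen [measurable (raw)]:
  fixes F :: "'a \<Rightarrow> real ^ 'n \<Rightarrow> ennreal"
  assumes [measurable]: "case_prod F \<in> borel_measurable (M \<Otimes>\<^sub>M borel)"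
  shows "case_prod (\<lambda>w. coord_norm q j (F w)) \<in> borel_measurable (M \<Otimes>\<^sub>M borel)"
  unfolding coord_norm_def by measurable

text \<open>The parameter w is carried along because Minkowski's inequality and Fubini's theorem
  need joint measurability.\<close>

lemma iter_norm_measurable_gen:
  fixes F :: "'a \<Rightarrow> real ^ 'n \<Rightarrow> ennreal"
  assumes "case_prod F \<in> borel_measurable (M \<Otimes>\<^sub>M borel)"
  shows "case_prod (\<lambda>w. iter_norm q js (F w)) \<in> borel_measurable (M \<Otimes>\<^sub>M borel)"
  using assms by (induction js arbitrary: F) (auto intro: coord_norm_measurable_gen)

lemma coord_norm_measurable [measurable (raw)]:
  assumes [measurable]: "F \<in> borel_measurable borel"
  shows "coord_norm q j F \<in> borel_measurable borel"
  unfolding coord_norm_def[abs_def] by measurable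

lemma iter_norm_measurable [measurable (raw)]:
  assumes "F \<in> borel_measurable borel"
  shows "iter_norm q js F \<in> borel_measurable borel"
  using assms by (induction js arbitrary: F) (auto intro: coord_norm_measurable)

lemma coord_norm_mono_fibre:
  assumes "0 \<le> q" "\<And>t. F (upd_coord x j t) \<le> G (upd_coord x j t)"
  shows "coord_norm q j F x \<le> coord_norm q j G x"
  unfolding coord_norm_def using assms by (intro epow_mono nn_integral_mono) auto

text \<open>The value at \<open>x\<close> sees only the fibre of points that share the outer
  coordinates of \<open>x\<close>. This is what allows a function to be replaced by another one over
  a single outer cube.\<close>

lemma iter_norm_mono_fibre:
  assumes q: "\<forall>j. 1 \<le> q $ j" and "\<And>y. (\<And>i. i \<notin> set js \<Longrightarrow> y $ i = x $ i) \<Longrightarrow> F y \<le> G y"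
  shows "iter_norm q js F x \<le> iter_norm q js G x"
  using assms(2)
proof (induction js arbitrary: F G)
  case (Cons j js)
  have "0 \<le> q $ j" using q by (meson order_trans zero_le_one)
  then show ?case
    by (auto intro!: Cons.IH coord_norm_mono_fibre Cons.prems)
qed auto

lemma iter_norm_cong_fibre:
  assumes "\<forall>j. 1 \<le> q $ j" "\<And>y. (\<And>i. i \<notin> set js \<Longrightarrow> y $ i = x $ i) \<Longrightarrow> F y = G y"
  shows "iter_norm q js F x = iter_norm q js G x"
  using assms by (intro antisym iter_norm_mono_fibre) auto

lemma iter_norm_mono: "\<forall>j. 1 \<le> q $ j \<Longrightarrow> (\<And>y. F y \<le> G y) \<Longrightarrow> iter_norm q js F x \<le> iter_norm q js G x"
  by (rule iter_norm_mono_fibre)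

lemma iter_norm_indep:
  fixes x y :: "real ^ 'n"
  assumes "\<And>i. i \<notin> set js \<Longrightarrow> x $ i = y $ i"
  shows "iter_norm q js F x = iter_norm q js F y"
proof -
  \<comment> \<open>The induction must keep track of the set \<open>A\<close> of coordinates that
    the integrand already ignores; integrating over \<open>j\<close> adds \<open>j\<close> to
    it.\<close>
  have "\<forall>x y. (\<forall>i. i \<notin> A \<union> set js \<longrightarrow> x $ i = y $ i) \<longrightarrow> iter_norm q js F x = iter_norm q js F y"
    if "\<forall>x y. (\<forall>i. i \<notin> A \<longrightarrow> x $ i = y $ i) \<longrightarrow> F x = F y" for A
    using that
  proof (induction js arbitrary: F A)
    case (Cons j js)
    have "\<forall>x y. (\<forall>i. i \<notin> insert j A \<longrightarrow> x $ i = y $ i) \<longrightarrow> coord_norm (q $ j) j F x = coord_norm (q $ j) j F y"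
    proof (intro allI impI)
      fix x y :: "real ^ 'n" assume *: "\<forall>i. i \<notin> insert j A \<longrightarrow> x $ i = y $ i"
      have "F (upd_coord x j t) = F (upd_coord y j t)" for t
        using * by (intro Cons.prems[rule_format]) auto
      then show "coord_norm (q $ j) j F x = coord_norm (q $ j) j F y" by (simp add: coord_norm_def)
    qed
    from Cons.IH[OF this] show ?case by simp
  qed simp
  moreover have "\<forall>x y. (\<forall>i. i \<notin> {} \<longrightarrow> x $ i = y $ i) \<longrightarrow> F x = F y"
    by (simp flip: vec_eq_iff)
  ultimately have "\<forall>x y. (\<forall>i. i \<notin> {} \<union> set js \<longrightarrow> x $ i = y $ i) \<longrightarrow> iter_norm q js F x = iter_norm q js F y"
    by blast
  then show ?thesis using assms by simp
qed

lemma coord_norm_cmult_fibre: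
  assumes "1 \<le> q" and [measurable]: "F \<in> borel_measurable borel" and "\<And>t. c (upd_coord x j t) = c x"
  shows "coord_norm q j (\<lambda>x. c x * F x) x = c x * coord_norm q j F x"
  using assms by (simp add: coord_norm_def epow_mult nn_integral_cmult epow_epow)

lemma iter_norm_cmult_fibre:
  assumes q: "\<forall>j. 1 \<le> q $ j" and "F \<in> borel_measurable borel"
    and c: "\<And>x y. (\<And>i. i \<notin> set js \<Longrightarrow> x $ i = y $ i) \<Longrightarrow> c x = c y"
  shows "iter_norm q js (\<lambda>x. c x * F x) x = c x * iter_norm q js F x"
  using assms(2) c
proof (induction js arbitrary: F)
  case (Cons j js)
  have "c (upd_coord x j t) = c x" for x t by (rule Cons.prems(2)) auto
  then have eq: "coord_norm (q $ j) j (\<lambda>x. c x * F x) = (\<lambda>x. c x * coord_norm (q $ j) j F x)"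
    using q Cons.prems(1) by (intro ext coord_norm_cmult_fibre) simp_all
  have "iter_norm q js (\<lambda>x. c x * coord_norm (q $ j) j F x) x = c x * iter_norm q js (coord_norm (q $ j) j F) x"
    by (intro Cons.IH coord_norm_measurable Cons.prems) auto
  then show ?case by (simp only: iter_norm.simps eq)
next
  case Nil
  show ?case unfolding iter_norm.simps ..
qed

lemma iter_norm_cmult:
  assumes "\<forall>j. 1 \<le> q $ j" "F \<in> borel_measurable borel"
  shows "iter_norm q js (\<lambda>x. c * F x) x = c * iter_norm q js F x"
  using iter_norm_cmult_fibre[OF assms, of js "\<lambda>_. c"] by simp

lemma coord_norm_Minkowski:
  assumes "1 \<le> q" "sigma_finite_measure M" and [measurable]: "case_prod F \<in> borel_measurable (M \<Otimes>\<^sub>M borel)"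
  shows "coord_norm q j (\<lambda>x. \<integral>\<^sup>+w. F w x \<partial>M) x \<le> (\<integral>\<^sup>+w. coord_norm q j (F w) x \<partial>M)"
proof -
  interpret sigma_finite_measure M by fact
  show ?thesis unfolding coord_norm_def
    using assms by (intro Minkowski_integral lborel.sigma_finite_measure_axioms) auto
qed

text \<open>Each coordinate norm passes under the integral by Minkowski's inequality, and
  monotonicity of the remaining norms carries the bound outwards. With a counting measure for
  \<open>M\<close> this becomes the triangle inequality for finite sums and for series.\<close>

lemma iter_norm_Minkowski:
  assumes q: "\<forall>j. 1 \<le> q $ j" and M: "sigma_finite_measure M" and "case_prod F \<in> borel_measurable (M \<Otimes>\<^sub>M borel)"
  shows "iter_norm q js (\<lambda>x. \<integral>\<^sup>+w. F w x \<partial>M) x \<le> (\<integral>\<^sup>+w. iter_norm q js (F w) x \<partial>M)"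
  using assms(3)
proof (induction js arbitrary: F)
  case (Cons j js)
  have "iter_norm q (j # js) (\<lambda>x. \<integral>\<^sup>+w. F w x \<partial>M) x \<le> iter_norm q js (\<lambda>x. \<integral>\<^sup>+w. coord_norm (q $ j) j (F w) x \<partial>M) x"
    using q Cons.prems M by (auto intro!: iter_norm_mono coord_norm_Minkowski)
  also have "\<dots> \<le> (\<integral>\<^sup>+w. iter_norm q js (coord_norm (q $ j) j (F w)) x \<partial>M)"
    by (rule Cons.IH) (rule coord_norm_measurable_gen[OF Cons.prems])
  finally show ?case by simp
qed simp

lemma iter_norm_suminf:
  assumes q: "\<forall>j. 1 \<le> q $ j" and [measurable]: "\<And>k::nat. F k \<in> borel_measurable borel"
  shows "iter_norm q js (\<lambda>x. \<Sum>k. F k x) x \<le> (\<Sum>k. iter_norm q js (F k) x)"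
  using iter_norm_Minkowski[OF q sigma_finite_measure_count_space, where F = F and js = js and x = x, of UNIV] assms(2)
  by (simp add: nn_integral_count_space_nat measurable_pair_measure_countable1)

lemma iter_norm_sum:
  assumes q: "\<forall>j. 1 \<le> q $ j" and [measurable]: "\<And>k. k \<in> S \<Longrightarrow> F k \<in> borel_measurable borel" and "finite S"
  shows "iter_norm q js (\<lambda>x. \<Sum>k\<in>S. F k x) x \<le> (\<Sum>k\<in>S. iter_norm q js (F k) x)"
  using iter_norm_Minkowski[OF q sigma_finite_measure_count_space_finite[OF \<open>finite S\<close>], where F = F and js = js and x = x] \<open>finite S\<close>
  by (simp add: nn_integral_count_space_finite measurable_pair_measure_countable1 countable_finite)

lemma iter_norm_add:
  assumes q: "\<forall>j. 1 \<le> q $ j" and [measurable]: "F \<in> borel_measurable borel" "G \<in> borel_measurable borel"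
  shows "iter_norm q js (\<lambda>x. F x + G x) x \<le> iter_norm q js F x + iter_norm q js G x"
  using iter_norm_sum[OF q, of UNIV "\<lambda>b. if b then F else G" js x] by (simp add: UNIV_bool add.commute)

section \<open>Almost everywhere comparison and limits of iterated norms\<close>

lemma coord_norm_AE_mono:
  assumes "0 \<le> q" "j \<in> K" "AE x in vol_on K. F x \<le> G x"
  shows "AE x in vol_on (K - {j}). coord_norm q j F x \<le> coord_norm q j G x"
proof -
  obtain N where N: "{x. \<not> F x \<le> G x} \<subseteq> N" "N \<in> null_sets (vol_on K)"
    using assms(3) by (auto elim!: AE_E simp: null_sets_def)
  then have [measurable]: "N \<in> sets borel" by (auto dest: null_setsD2)
  have "0 = (\<integral>\<^sup>+x. indicator N x \<partial>vol_on K)" using N by auto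
  also have "\<dots> = (\<integral>\<^sup>+x. \<integral>\<^sup>+t. indicator N (upd_coord x j t) \<partial>lborel \<partial>vol_on (K - {j}))"
    using assms by (intro vol_on_coord) auto
  finally have "AE x in vol_on (K - {j}). (\<integral>\<^sup>+t. indicator N (upd_coord x j t) \<partial>lborel) = 0"
    by (subst nn_integral_0_iff_AE[symmetric]) auto
  then show ?thesis
  proof (rule AE_mp, intro AE_I2 impI)
    fix x assume "(\<integral>\<^sup>+t. indicator N (upd_coord x j t) \<partial>lborel) = (0::ennreal)"
    then have "AE t in lborel. upd_coord x j t \<notin> N"
      by (subst (asm) nn_integral_0_iff_AE) (auto simp: indicator_def split: if_splits)
    then show "coord_norm q j F x \<le> coord_norm q j G x"
      unfolding coord_norm_def using assms(1) N(1) 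
      by (intro epow_mono nn_integral_mono_AE) (auto elim!: eventually_mono intro!: epow_mono)
  qed
qed

text \<open>By Fubini's theorem a null set in the coordinates of \<open>K\<close> has null sections
  over almost every choice of the remaining ones, and one coordinate is removed at a time.
  Identities for the operator, which hold only almost everywhere, enter the iterated norms in this
  way.\<close>

lemma iter_norm_AE_mono:
  assumes q: "\<forall>j. 1 \<le> q $ j" and "distinct js" "set js \<subseteq> K" "AE x in vol_on K. F x \<le> G x"
  shows "AE x in vol_on (K - set js). iter_norm q js F x \<le> iter_norm q js G x"
  using assms(2-)
proof (induction js arbitrary: F G K)
  case (Cons j js)
  have j: "0 \<le> q $ j" using q by (meson order_trans zero_le_one)
  have "AE x in vol_on (K - {j} - set js). iter_norm q js (coord_norm (q $ j) j F) x \<le> iter_norm q js (coord_norm (q $ j) j G) x"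
    using Cons.prems j by (intro Cons.IH coord_norm_AE_mono) auto
  moreover have eq: "K - {j} - set js = K - set (j # js)" by auto
  ultimately show ?case unfolding eq by simp
qed (simp only: list.set Diff_empty iter_norm.simps)

lemma iter_norm_SUP:
  assumes q: "\<forall>j. 1 \<le> q $ j" and "\<And>n::nat. F n \<in> borel_measurable borel" "incseq F"
  shows "iter_norm q js (\<lambda>x. SUP n. F n x) x = (SUP n. iter_norm q js (F n) x)"
  using assms(2-)
proof (induction js arbitrary: F)
  case (Cons j js)
  have j: "0 < q $ j" using q by (meson less_le_trans zero_less_one)
  note [measurable] = Cons.prems(1)
  have le: "F m x \<le> F n x" if "m \<le> n" for m n x using incseqD[OF Cons.prems(2) that] by (rule le_funD)
  have mono: "incseq (\<lambda>n. coord_norm (q $ j) j (F n))"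
    using j by (intro monoI le_funI coord_norm_mono_fibre le) auto
  have "coord_norm (q $ j) j (\<lambda>x. SUP n. F n x) = (\<lambda>x. SUP n. coord_norm (q $ j) j (F n) x)"
  proof
    fix x
    have "(\<integral>\<^sup>+t. (SUP n. F n (upd_coord x j t)) powe q $ j \<partial>lborel)
      = (SUP n. \<integral>\<^sup>+t. F n (upd_coord x j t) powe q $ j \<partial>lborel)"
      unfolding epow_SUP[OF j] using j
      by (intro nn_integral_monotone_convergence_SUP monoI le_funI epow_mono le) auto
    then show "coord_norm (q $ j) j (\<lambda>x. SUP n. F n x) x = (SUP n. coord_norm (q $ j) j (F n) x)"
      using j by (simp add: coord_norm_def epow_SUP)
  qed
  then show ?case using Cons.IH[of "\<lambda>n. coord_norm (q $ j) j (F n)"] mono by (simp add: coord_norm_measurable Cons.prems)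
qed simp

text \<open>Fatou's lemma for iterated norms, from monotone convergence applied to the infima of the
  tails.\<close>

lemma iter_norm_liminf:
  assumes q: "\<forall>j. 1 \<le> q $ j" and [measurable]: "\<And>n::nat. F n \<in> borel_measurable borel"
  shows "iter_norm q js (\<lambda>x. liminf (\<lambda>n. F n x)) x \<le> liminf (\<lambda>n. iter_norm q js (F n) x)"
proof -
  have "iter_norm q js (\<lambda>x. liminf (\<lambda>n. F n x)) x = (SUP n. iter_norm q js (\<lambda>x. INF m\<in>{n..}. F m x) x)"
    unfolding liminf_SUP_INF
    by (intro iter_norm_SUP q) (auto simp: incseq_def le_fun_def intro!: INF_superset_mono)
  also have "\<dots> \<le> (SUP n. INF m\<in>{n..}. iter_norm q js (F m) x)"
    by (intro SUP_mono bexI INF_greatest iter_norm_mono q INF_lower) auto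
  finally show ?thesis by (simp add: liminf_SUP_INF)
qed

text \<open>When the outer exponent equals the exponent of coordinate \<open>j\<close>, root and
  power cancel and only Fubini's theorem remains. This is what lets \<open>j\<close> change from an
  outer to an inner coordinate.\<close>

lemma coord_norm_power_integral:
  assumes [measurable]: "F \<in> borel_measurable borel" and j: "j \<in> K" and r: "0 < r"
  shows "(\<integral>\<^sup>+x. coord_norm r j F x powe r \<partial>vol_on (K - {j})) = (\<integral>\<^sup>+x. F x powe r \<partial>vol_on K)"
  using vol_on_coord[OF _ j, of "\<lambda>x. F x powe r"] r by (simp add: coord_norm_def epow_epow)

section \<open>Dyadic cubes in the coordinates of a subset\<close>

abbreviation side :: "int \<Rightarrow> real" where "side k \<equiv> 2 powr real_of_int k"

text \<open>Indices outside \<open>J\<close> are set to 0, so that a cylinder over a dyadic cube in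
  the coordinates of \<open>J\<close> has one index function per generation and cubes can be
  compared by equality of functions.\<close>

definition dyadic_index :: "'n set \<Rightarrow> int \<Rightarrow> real ^ 'n \<Rightarrow> 'n \<Rightarrow> int" where
  "dyadic_index J k x = (\<lambda>i. if i \<in> J then \<lfloor>x $ i / side k\<rfloor> else 0)"

definition index_cube :: "'n set \<Rightarrow> int \<times> ('n \<Rightarrow> int) \<Rightarrow> (real ^ 'n) set" where
  "index_cube J s = {y. dyadic_index J (fst s) y = snd s}"

abbreviation dyadic_cube :: "'n set \<Rightarrow> int \<Rightarrow> real ^ 'n \<Rightarrow> (real ^ 'n) set" where
  "dyadic_cube J k x \<equiv> index_cube J (k, dyadic_index J k x)"

definition neighbours :: "'n set \<Rightarrow> int \<Rightarrow> real ^ 'n \<Rightarrow> (real ^ 'n) set" where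
  "neighbours J k x = {y. \<forall>i\<in>J. \<bar>dyadic_index J k y i - dyadic_index J k x i\<bar> \<le> 1}"

definition cube_vol :: "'n set \<Rightarrow> int \<Rightarrow> ennreal" where
  "cube_vol J k = ennreal (side k ^ card J)"

lemma cube_vol_pos [simp]: "0 < cube_vol J k" "cube_vol J k \<noteq> 0" "cube_vol J k < top" "cube_vol J k \<noteq> top"
  by (auto simp: cube_vol_def)

lemma cube_vol_add: "cube_vol J (k + int a) = 2 ^ (a * card J) * cube_vol J k"
proof -
  have "side (k + int a) = 2 ^ a * side k" by (simp add: powr_add powr_realpow)
  then show ?thesis
    by (simp add: cube_vol_def power_mult_distrib ennreal_mult power_mult ennreal_power flip: ennreal_numeral)
qed

lemma mem_dy: "y \<in> dyadic_cube J k x \<longleftrightarrow> dyadic_index J k y = dyadic_index J k x"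
  by (simp add: index_cube_def)

lemma self_dy [simp]: "x \<in> dyadic_cube J k x"
  by (simp add: mem_dy)

lemma dyadic_cube_cong: "dyadic_index J k x = dyadic_index J k y \<Longrightarrow> dyadic_cube J k x = dyadic_cube J k y"
  by simp

lemma neighbours_cong: "dyadic_index J k x = dyadic_index J k y \<Longrightarrow> neighbours J k x = neighbours J k y"
  by (simp add: neighbours_def)

text \<open>Nesting of the dyadic grid: the coarser side is an integer multiple of the finer one, so
  the coarser index is an integer quotient of the finer index.\<close>

lemma floor_coarsen:
  assumes "k \<le> k'" shows "\<lfloor>t / side k'\<rfloor> = \<lfloor>t / side k\<rfloor> div 2 ^ nat (k' - k)"
proof -
  have "side k' = side k * real_of_int (2 ^ nat (k' - k))"
    using assms by (simp flip: powr_realpow powr_add)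
  then have "t / side k' = (t / side k) / real_of_int (2 ^ nat (k' - k))" by simp
  then show ?thesis by (simp only: floor_divide_real_eq_div zero_le_power zero_le_numeral)
qed

lemma dyadic_index_coarsen: "k \<le> k' \<Longrightarrow> dyadic_index J k' x = (\<lambda>i. dyadic_index J k x i div 2 ^ nat (k' - k))"
  by (auto simp: dyadic_index_def floor_coarsen[of k k'])

lemma dyadic_index_mono: "dyadic_index J k x = dyadic_index J k y \<Longrightarrow> k \<le> k' \<Longrightarrow> dyadic_index J k' x = dyadic_index J k' y"
  by (simp add: dyadic_index_coarsen[of k k'])

lemma dyadic_cube_mono: "k \<le> k' \<Longrightarrow> dyadic_cube J k x \<subseteq> dyadic_cube J k' x"
  by (auto simp: mem_dy intro: dyadic_index_mono)

lemma div_diff_le_1: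
  fixes a b p :: int
  assumes "\<bar>a - b\<bar> \<le> 1" "0 < p" shows "\<bar>a div p - b div p\<bar> \<le> 1"
proof -
  have "a div p \<le> (b + p) div p" by (rule zdiv_mono1) (use assms in auto)
  moreover have "b div p \<le> (a + p) div p" by (rule zdiv_mono1) (use assms in auto)
  ultimately show ?thesis using assms(2) by auto
qed

text \<open>Indices that differ by at most 1 still do so after integer division, so cubes that are
  adjacent at one generation are adjacent or equal at every coarser one.\<close>

lemma neighbours_mono: "k \<le> k' \<Longrightarrow> neighbours J k x \<subseteq> neighbours J k' x"
  by (auto simp: neighbours_def dyadic_index_coarsen[of k k'] intro!: div_diff_le_1)

lemma neighbours_sym: "y \<in> neighbours J k x \<longleftrightarrow> x \<in> neighbours J k y"
  by (auto simp: neighbours_def abs_minus_commute)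

lemma index_cube_measurable [measurable]: "index_cube J s \<in> sets borel"
proof -
  have "index_cube J s = {y. \<forall>i. (if i \<in> J then \<lfloor>y $ i / side (fst s)\<rfloor> else 0) = snd s i}"
    by (auto simp: index_cube_def dyadic_index_def fun_eq_iff)
  also have "\<dots> \<in> sets borel" by measurable
  finally show ?thesis .
qed

lemma mem_dy_floor: "y \<in> dyadic_cube J k x \<longleftrightarrow> (\<forall>i\<in>J. side k * dyadic_index J k x i \<le> y $ i \<and> y $ i < side k * (dyadic_index J k x i + 1))"
  unfolding mem_dy unfolding dyadic_index_def fun_eq_iff by (auto simp: floor_eq_iff field_simps)

lemma mem_tri_floor:
  "y \<in> neighbours J k x \<longleftrightarrow> (\<forall>i\<in>J. side k * (dyadic_index J k x i - 1) \<le> y $ i \<and> y $ i < side k * (dyadic_index J k x i + 2))"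
proof -
  have "\<bar>\<lfloor>t\<rfloor> - m\<bar> \<le> 1 \<longleftrightarrow> of_int m - 1 \<le> t \<and> t < of_int m + 2" for t :: real and m :: int
    by linarith
  then show ?thesis by (auto simp: neighbours_def dyadic_index_def field_simps)
qed

lemma neighbours_measurable [measurable]: "neighbours J k x \<in> sets borel"
proof -
  have "neighbours J k x = {y. \<forall>i. i \<in> J \<longrightarrow> side k * (dyadic_index J k x i - 1) \<le> y $ i \<and> y $ i < side k * (dyadic_index J k x i + 2)}"
    by (auto simp: mem_tri_floor)
  also have "\<dots> \<in> sets borel" by measurable
  finally show ?thesis .
qed

lemma emeasure_dy: "emeasure (vol_on J) (dyadic_cube J k x) = cube_vol J k"
proof -
  have "emeasure (vol_on J) (dyadic_cube J k x)
    = ennreal (\<Prod>i\<in>J. (\<chi> i. side k * (dyadic_index J k x i + 1)) $ i - (\<chi> i. side k * dyadic_index J k x i) $ i)"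
    by (rule emeasure_mu_between) (auto simp: mem_dy_floor less_imp_le)
  also have "\<dots> = cube_vol J k" by (simp add: cube_vol_def algebra_simps)
  finally show ?thesis .
qed

lemma emeasure_tri: "emeasure (vol_on J) (neighbours J k x) = 3 ^ card J * cube_vol J k"
proof -
  have "emeasure (vol_on J) (neighbours J k x)
    = ennreal (\<Prod>i\<in>J. (\<chi> i. side k * (dyadic_index J k x i + 2)) $ i - (\<chi> i. side k * (dyadic_index J k x i - 1)) $ i)"
    by (rule emeasure_mu_between) (auto simp: mem_tri_floor less_imp_le intro!: mult_left_mono)
  also have "(\<Prod>i\<in>J. (\<chi> i. side k * (dyadic_index J k x i + 2)) $ i - (\<chi> i. side k * (dyadic_index J k x i - 1)) $ i) = (3 * side k) ^ card J"
    by (simp add: algebra_simps)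
  finally show ?thesis
    by (simp add: cube_vol_def power_mult_distrib ennreal_mult ennreal_power flip: ennreal_numeral)
qed

lemma neighbours_near: "\<forall>i\<in>J. \<bar>y $ i - x $ i\<bar> \<le> side k \<Longrightarrow> y \<in> neighbours J k x"
proof -
  assume *: "\<forall>i\<in>J. \<bar>y $ i - x $ i\<bar> \<le> side k"
  have "\<bar>\<lfloor>y $ i / side k\<rfloor> - \<lfloor>x $ i / side k\<rfloor>\<bar> \<le> 1" if "i \<in> J" for i
  proof -
    have "\<bar>y $ i / side k - x $ i / side k\<bar> = \<bar>y $ i - x $ i\<bar> / side k"
      by (simp add: diff_divide_distrib[symmetric] abs_divide)
    also have "\<dots> \<le> 1" using * that by (simp add: divide_le_eq)
    finally show ?thesis by linarith
  qed
  then show ?thesis by (simp add: neighbours_def dyadic_index_def)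
qed

text \<open>Supplies the separation between a cube and the complement of its neighbourhood for the
  kernel estimates; it is measured in a single outer coordinate.\<close>

lemma not_tri_far: 
  assumes "y \<notin> neighbours J k x" "z \<in> dyadic_cube J k x" shows "\<exists>i\<in>J. \<bar>y $ i - z $ i\<bar> > side k"
  using neighbours_near[of J y z k] assms neighbours_cong[of J k x z] by (force simp: mem_dy)

lemma dyadic_cube_dist: "y \<in> dyadic_cube J k x \<Longrightarrow> z \<in> dyadic_cube J k x \<Longrightarrow> i \<in> J \<Longrightarrow> \<bar>y $ i - z $ i\<bar> \<le> side k"
  by (auto simp: mem_dy_floor algebra_simps dest!: bspec)

section \<open>Stopping cubes and the dyadic maximal function\<close>

lemma int_max_ex:
  fixes P :: "int \<Rightarrow> bool"
  assumes "P k0" "\<And>k. k > b \<Longrightarrow> \<not> P k"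
  shows "\<exists>k. P k \<and> (\<forall>k'>k. \<not> P k')"
proof -
  have "k0 \<le> b" using assms by force
  define n where "n = (LEAST n. P (b - int n))"
  have "P (b - int (nat (b - k0)))" using \<open>k0 \<le> b\<close> assms(1) by simp
  then have "P (b - int n)" unfolding n_def by (rule LeastI)
  moreover have "\<not> P k'" if "k' > b - int n" for k'
  proof (cases "k' > b")
    case False
    have "\<not> P (b - int (nat (b - k')))" using that False unfolding n_def by (intro not_less_Least) auto
    then show ?thesis using False by simp
  qed (use assms in auto)
  ultimately show ?thesis by blast
qed

text \<open>The selected cubes are those at the largest generation for which \<open>P\<close> holds,
  and an upper bound on the generations makes it exist. Two selected cubes through a common point
  have the same generation by maximality, hence the same index, which gives disjointness.\<close>

lemma stopping_cubes:
  fixes P :: "int \<Rightarrow> real ^ 'n \<Rightarrow> bool"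
  assumes P: "\<And>k x y. dyadic_index J k x = dyadic_index J k y \<Longrightarrow> P k x \<Longrightarrow> P k y"
    and bdd: "\<And>x. \<exists>b. \<forall>k>b. \<not> P k x"
  shows "\<exists>S. disjoint_family_on (index_cube J) S \<and> (\<Union>s\<in>S. index_cube J s) = {x. \<exists>k. P k x} \<and>
    (\<forall>s\<in>S. \<forall>x\<in>index_cube J s. P (fst s) x \<and> (\<forall>k>fst s. \<not> P k x)) \<and>
    (\<forall>s\<in>S. \<exists>x. s = (fst s, dyadic_index J (fst s) x))"
proof (intro exI conjI)
  define S where "S = {(k, dyadic_index J k x) |k x. P k x \<and> (\<forall>k'>k. \<not> P k' x)}"
  have *: "P k y \<and> (\<forall>k'>k. \<not> P k' y)" if "P k x \<and> (\<forall>k'>k. \<not> P k' x)" "dyadic_index J k y = dyadic_index J k x" for k x y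
    using that P[of k x y] P[of _ y x] dyadic_index_mono[of J k y x] by auto
  have 3: "P (fst s) x \<and> (\<forall>k>fst s. \<not> P k x)" if "s \<in> S" "x \<in> index_cube J s" for s x
  proof -
    obtain k y where s: "s = (k, dyadic_index J k y)" and y: "P k y \<and> (\<forall>k'>k. \<not> P k' y)"
      using \<open>s \<in> S\<close> unfolding S_def by blast
    have "dyadic_index J k x = dyadic_index J k y" using \<open>x \<in> index_cube J s\<close> unfolding s mem_dy .
    from *[OF y this] show ?thesis unfolding s fst_conv .
  qed
  then show "\<forall>s\<in>S. \<forall>x\<in>index_cube J s. P (fst s) x \<and> (\<forall>k>fst s. \<not> P k x)" by blast
  show "\<forall>s\<in>S. \<exists>x. s = (fst s, dyadic_index J (fst s) x)"
    by (auto simp: S_def)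
  show "(\<Union>s\<in>S. index_cube J s) = {x. \<exists>k. P k x}"
  proof (intro equalityI subsetI)
    fix x assume "x \<in> {x. \<exists>k. P k x}"
    then obtain k where "P k x \<and> (\<forall>k'>k. \<not> P k' x)" using bdd[of x] int_max_ex[of "\<lambda>k. P k x"] by blast
    then have "(k, dyadic_index J k x) \<in> S" by (auto simp: S_def)
    then show "x \<in> (\<Union>s\<in>S. index_cube J s)" by (intro UN_I[of "(k, dyadic_index J k x)"]) auto
  qed (use 3 in blast)
  show "disjoint_family_on (index_cube J) S"
    unfolding disjoint_family_on_def
  proof (intro ballI impI equals0I)
    fix s t x assume st: "s \<in> S" "t \<in> S" "s \<noteq> t" and x: "x \<in> index_cube J s \<inter> index_cube J t"
    have "fst s = fst t" using 3[OF st(1), of x] 3[OF st(2), of x] x by (metis IntE linorder_neqE)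
    then show False using st x by (auto simp: index_cube_def prod_eq_iff)
  qed
qed

lemma nn_integral_UN_countable:
  assumes "countable S" "disjoint_family_on C S" and [measurable]: "\<And>s. s \<in> S \<Longrightarrow> C s \<in> sets M" "F \<in> borel_measurable M"
  shows "(\<integral>\<^sup>+x. indicator (\<Union>s\<in>S. C s) x * F x \<partial>M) = (\<integral>\<^sup>+s. \<integral>\<^sup>+x. indicator (C s) x * F x \<partial>M \<partial>count_space S)"
proof -
  have U: "(\<Union>s\<in>S. C s) \<in> sets M" using assms by (intro sets.countable_UN') auto
  have "emeasure (density M F) (\<Union>s\<in>S. C s) = (\<integral>\<^sup>+s. emeasure (density M F) (C s) \<partial>count_space S)"
    using assms by (intro emeasure_UN_countable) auto
  moreover have "(\<integral>\<^sup>+s. emeasure (density M F) (C s) \<partial>count_space S) = (\<integral>\<^sup>+s. \<integral>\<^sup>+x. indicator (C s) x * F x \<partial>M \<partial>count_space S)"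
    by (intro nn_integral_cong) (auto simp: emeasure_density mult.commute)
  ultimately show ?thesis using U by (simp add: emeasure_density mult.commute)
qed

lemma nn_integral_cubes_mono:
  assumes "disjoint_family_on (index_cube J) S" and [measurable]: "F \<in> borel_measurable borel" "G \<in> borel_measurable borel"
    and le: "\<And>s. s \<in> S \<Longrightarrow> (\<integral>\<^sup>+x. indicator (index_cube J s) x * F x \<partial>vol_on J) \<le> (\<integral>\<^sup>+x. indicator (index_cube J s) x * G x \<partial>vol_on J)"
  shows "(\<integral>\<^sup>+x. indicator (\<Union>s\<in>S. index_cube J s) x * F x \<partial>vol_on J) \<le> (\<integral>\<^sup>+x. indicator (\<Union>s\<in>S. index_cube J s) x * G x \<partial>vol_on J)"
proof -
  have "countable S" by simp
  note UN = nn_integral_UN_countable[OF this assms(1), of "vol_on J"]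
  show ?thesis
    by (subst (1 2) UN) (auto intro!: nn_integral_mono le simp del: split_paired_All)
qed

text \<open>Countable subadditivity: the sets \<open>V s\<close> may overlap, but the cubes against
  which they are measured are disjoint, so their volumes add up to that of the union.\<close>

lemma emeasure_mu_tri_UN:
  assumes "disjoint_family_on (index_cube J) S" "\<And>s. s \<in> S \<Longrightarrow> \<exists>x. s = (fst s, dyadic_index J (fst s) x)"
    and V: "\<And>s. s \<in> S \<Longrightarrow> V s \<in> sets borel" "\<And>s. s \<in> S \<Longrightarrow> emeasure (vol_on J) (V s) \<le> c * cube_vol J (fst s)"
  shows "emeasure (vol_on J) (\<Union>s\<in>S. V s) \<le> c * emeasure (vol_on J) (\<Union>s\<in>S. index_cube J s)"
proof -
  note [measurable] = V(1)
  have [measurable]: "(\<Union>s\<in>S. V s) \<in> sets borel" by (intro sets.countable_UN') auto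
  have "emeasure (vol_on J) (\<Union>s\<in>S. V s) = (\<integral>\<^sup>+x. indicator (\<Union>s\<in>S. V s) x \<partial>vol_on J)" by simp
  also have "\<dots> \<le> (\<integral>\<^sup>+x. \<integral>\<^sup>+s. indicator (V s) x \<partial>count_space S \<partial>vol_on J)"
  proof (intro nn_integral_mono)
    fix x
    show "indicator (\<Union>s\<in>S. V s) x \<le> (\<integral>\<^sup>+s. indicator (V s) x \<partial>count_space S)"
    proof (cases "x \<in> (\<Union>s\<in>S. V s)")
      case True
      then obtain s where s: "s \<in> S" "x \<in> V s" by auto
      have "indicator (\<Union>s\<in>S. V s) x = (1::ennreal)" using True by simp
      also have "\<dots> = (\<integral>\<^sup>+t. indicator {s} t \<partial>count_space S)" using s by simp
      also have "\<dots> \<le> (\<integral>\<^sup>+s. indicator (V s) x \<partial>count_space S)"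
        using s by (intro nn_integral_mono) (auto simp: indicator_def)
      finally show ?thesis .
    qed simp
  qed
  also have "\<dots> = (\<integral>\<^sup>+s. emeasure (vol_on J) (V s) \<partial>count_space S)"
    by (subst nn_integral_count_space_nn_integral) (auto intro!: nn_integral_cong)
  also have "\<dots> \<le> (\<integral>\<^sup>+s. c * emeasure (vol_on J) (index_cube J s) \<partial>count_space S)"
    using V(2) assms(2) by (intro nn_integral_mono) (metis emeasure_dy space_count_space)
  also have "\<dots> = c * emeasure (vol_on J) (\<Union>s\<in>S. index_cube J s)"
    using assms(1) by (subst emeasure_UN_countable) (auto simp: nn_integral_cmult)
  finally show ?thesis .
qed

text \<open>Superlevel set of the dyadic maximal function in the coordinates of \<open>J\<close>.
  Averages are compared with \<open>t\<close> after multiplication by the volume, which avoids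
  division in \<open>ennreal\<close>.\<close>

definition dyadic_above :: "'n set \<Rightarrow> (real ^ 'n \<Rightarrow> ennreal) \<Rightarrow> real \<Rightarrow> (real ^ 'n) set" where
  "dyadic_above J F t = {x. \<exists>k. (\<integral>\<^sup>+y. indicator (dyadic_cube J k x) y * F y \<partial>vol_on J) > ennreal t * cube_vol J k}"

text \<open>The Calderon-Zygmund stopping cubes at height \<open>t\<close>: the maximal dyadic cubes
  whose average exceeds \<open>t\<close>. The bound on all larger cubes records the
  maximality.\<close>

definition stop_family :: "'n set \<Rightarrow> (real ^ 'n \<Rightarrow> ennreal) \<Rightarrow> real \<Rightarrow> (int \<times> ('n \<Rightarrow> int)) set \<Rightarrow> bool" where
  "stop_family J F t S \<longleftrightarrow> disjoint_family_on (index_cube J) S \<and> (\<Union>s\<in>S. index_cube J s) = dyadic_above J F t \<and>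
    (\<forall>s\<in>S. (\<integral>\<^sup>+y. indicator (index_cube J s) y * F y \<partial>vol_on J) > ennreal t * cube_vol J (fst s)) \<and>
    (\<forall>s\<in>S. \<forall>x\<in>index_cube J s. \<forall>k>fst s. (\<integral>\<^sup>+y. indicator (dyadic_cube J k x) y * F y \<partial>vol_on J) \<le> ennreal t * cube_vol J k) \<and>
    (\<forall>s\<in>S. \<exists>x. s = (fst s, dyadic_index J (fst s) x))"

lemma stop_familyD:
  assumes "stop_family J F t S"
  shows "disjoint_family_on (index_cube J) S" "(\<Union>s\<in>S. index_cube J s) = dyadic_above J F t"
    "\<And>s. s \<in> S \<Longrightarrow> (\<integral>\<^sup>+y. indicator (index_cube J s) y * F y \<partial>vol_on J) > ennreal t * cube_vol J (fst s)"
    "\<And>s x k. s \<in> S \<Longrightarrow> x \<in> index_cube J s \<Longrightarrow> fst s < k \<Longrightarrow> (\<integral>\<^sup>+y. indicator (dyadic_cube J k x) y * F y \<partial>vol_on J) \<le> ennreal t * cube_vol J k"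
    "\<And>s. s \<in> S \<Longrightarrow> \<exists>x. s = (fst s, dyadic_index J (fst s) x)"
  using assms unfolding stop_family_def by blast+

text \<open>Maximal cubes exist because the integral of \<open>F\<close> is finite while the volume
  of the cubes grows without bound; the latter uses that \<open>J\<close> is nonempty.\<close>

lemma dyadic_above_stopping:
  fixes F :: "real ^ 'n \<Rightarrow> ennreal"
  assumes J: "J \<noteq> {}" and t: "0 < t" and fin: "(\<integral>\<^sup>+y. F y \<partial>vol_on J) < top"
  shows "\<exists>S. stop_family J F t S"
proof -
  let ?P = "\<lambda>k x. (\<integral>\<^sup>+y. indicator (dyadic_cube J k x) y * F y \<partial>vol_on J) > ennreal t * cube_vol J k"
  define P where "P = ?P"
  have "\<exists>b. \<forall>k>b. \<not> ?P k x" for x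
  proof -
    obtain c where c: "(\<integral>\<^sup>+y. F y \<partial>vol_on J) = ennreal c" "0 \<le> c" using fin by (cases "\<integral>\<^sup>+y. F y \<partial>vol_on J") auto
    obtain b :: nat where b: "c / t < 2 ^ b" using real_arch_pow[of 2 "c / t"] by auto
    have "\<not> ?P k x" if k: "k > int b" for k
    proof -
      have "0 < card J" using J by (simp add: card_gt_0_iff)
      have "(2::real) ^ b \<le> side k" using k by (simp flip: powr_realpow)
      also have "\<dots> \<le> side k ^ card J"
        using \<open>0 < card J\<close> k by (intro self_le_power) (auto simp: ge_one_powr_ge_zero)
      finally have "c \<le> t * side k ^ card J" using b t by (simp add: field_simps) (smt (verit) mult_left_mono)
      then have "ennreal c \<le> ennreal t * cube_vol J k" using t by (simp add: cube_vol_def flip: ennreal_mult)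
      moreover have "(\<integral>\<^sup>+y. indicator (dyadic_cube J k x) y * F y \<partial>vol_on J) \<le> (\<integral>\<^sup>+y. F y \<partial>vol_on J)"
        by (intro nn_integral_mono) (auto simp: indicator_def)
      ultimately show ?thesis using c by simp
    qed
    then show ?thesis by blast
  qed
  then have bdd: "\<exists>b. \<forall>k>b. \<not> P k x" for x unfolding P_def .
  have inv: "P k y" if "dyadic_index J k x = dyadic_index J k y" "P k x" for k x y
    using that(2) unfolding P_def that(1) .
  have "\<exists>S. disjoint_family_on (index_cube J) S \<and> (\<Union>s\<in>S. index_cube J s) = {x. \<exists>k. P k x} \<and>
    (\<forall>s\<in>S. \<forall>x\<in>index_cube J s. P (fst s) x \<and> (\<forall>k>fst s. \<not> P k x)) \<and>
    (\<forall>s\<in>S. \<exists>x. s = (fst s, dyadic_index J (fst s) x))"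
    by (rule stopping_cubes[of J P]) (erule inv, assumption, rule bdd)
  then obtain S where S: "disjoint_family_on (index_cube J) S" "(\<Union>s\<in>S. index_cube J s) = {x. \<exists>k. P k x}"
    "\<forall>s\<in>S. \<forall>x\<in>index_cube J s. P (fst s) x \<and> (\<forall>k>fst s. \<not> P k x)"
    "\<forall>s\<in>S. \<exists>x. s = (fst s, dyadic_index J (fst s) x)"
    by (elim exE conjE)
  have "ennreal t * cube_vol J (fst s) < (\<integral>\<^sup>+y. indicator (index_cube J s) y * F y \<partial>vol_on J)" if s: "s \<in> S" for s
  proof -
    obtain x where x: "s = (fst s, dyadic_index J (fst s) x)" using S(4) s by blast
    then have "x \<in> index_cube J s" by (simp add: index_cube_def prod_eq_iff)
    then have "P (fst s) x" using S(3) s by blast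
    then have "?P (fst s) x" unfolding P_def .
    then show ?thesis unfolding x[symmetric] .
  qed
  moreover have "(\<integral>\<^sup>+y. indicator (dyadic_cube J k x) y * F y \<partial>vol_on J) \<le> ennreal t * cube_vol J k"
    if "s \<in> S" "x \<in> index_cube J s" "fst s < k" for s x k using S(3) that unfolding P_def not_less by blast
  moreover have "(\<Union>s\<in>S. index_cube J s) = dyadic_above J F t" unfolding S(2) P_def dyadic_above_def ..
  ultimately show ?thesis unfolding stop_family_def using S(1,4) by blast
qed

lemma dyadic_above_measurable [measurable]:
  assumes "J \<noteq> {}" "0 < t" "(\<integral>\<^sup>+y. F y \<partial>vol_on J) < top"
  shows "dyadic_above J F t \<in> sets borel"
proof -
  obtain S where "stop_family J F t S" using dyadic_above_stopping[OF assms] by blast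
  note S = stop_familyD(2)[OF this]
  have "(\<Union>s\<in>S. index_cube J s) \<in> sets borel" by (intro sets.countable_UN') auto
  then show ?thesis unfolding S .
qed

lemma indicator_mult_const: "(\<integral>\<^sup>+x. indicator A x * c \<partial>vol_on J) = c * emeasure (vol_on J) A" if "A \<in> sets borel"
  using that by (subst mult.commute) (simp add: nn_integral_cmult)

text \<open>On a stopping cube the average lies between \<open>t\<close> and
  \<open>2 ^ card J * t\<close>: it exceeds \<open>t\<close> by selection, and the parent cube,
  whose volume is larger by the factor \<open>2 ^ card J\<close>, has average at most
  \<open>t\<close>. Summation over the disjoint cubes gives both bounds.\<close>

lemma dyadic_above_weak:
  assumes J: "J \<noteq> {}" and t: "0 < t" and fin: "(\<integral>\<^sup>+y. F y \<partial>vol_on J) < top" and [measurable]: "F \<in> borel_measurable borel"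
  shows "ennreal t * emeasure (vol_on J) (dyadic_above J F t) \<le> (\<integral>\<^sup>+y. indicator (dyadic_above J F t) y * F y \<partial>vol_on J)"
    and "(\<integral>\<^sup>+y. indicator (dyadic_above J F t) y * F y \<partial>vol_on J) \<le> 2 ^ card J * ennreal t * emeasure (vol_on J) (dyadic_above J F t)"
proof -
  obtain S where "stop_family J F t S" using dyadic_above_stopping[OF J t fin] by blast
  note S = stop_familyD[OF this]
  have [measurable]: "dyadic_above J F t \<in> sets borel" using J t fin by (rule dyadic_above_measurable)
  have cube_vol: "emeasure (vol_on J) (index_cube J s) = cube_vol J (fst s)" if "s \<in> S" for s
    using S(5)[OF that] emeasure_dy by metis
  have "(\<integral>\<^sup>+y. indicator (dyadic_above J F t) y * ennreal t \<partial>vol_on J) \<le> (\<integral>\<^sup>+y. indicator (dyadic_above J F t) y * F y \<partial>vol_on J)"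
    unfolding S(2)[symmetric]
    by (intro nn_integral_cubes_mono S) (auto simp: indicator_mult_const cube_vol dest!: S(3) less_imp_le)
  then show "ennreal t * emeasure (vol_on J) (dyadic_above J F t) \<le> (\<integral>\<^sup>+y. indicator (dyadic_above J F t) y * F y \<partial>vol_on J)"
    by (simp add: indicator_mult_const)
  have "(\<integral>\<^sup>+y. indicator (dyadic_above J F t) y * F y \<partial>vol_on J) \<le> (\<integral>\<^sup>+y. indicator (dyadic_above J F t) y * (2 ^ card J * ennreal t) \<partial>vol_on J)"
    unfolding S(2)[symmetric]
  proof (intro nn_integral_cubes_mono S)
    fix s assume s: "s \<in> S"
    obtain x where x: "s = (fst s, dyadic_index J (fst s) x)" using S(5)[OF s] by blast
    then have xs: "x \<in> index_cube J s" by (simp add: index_cube_def prod_eq_iff)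
    have "(\<integral>\<^sup>+y. indicator (index_cube J s) y * F y \<partial>vol_on J) \<le> (\<integral>\<^sup>+y. indicator (dyadic_cube J (fst s + 1) x) y * F y \<partial>vol_on J)"
      using dyadic_cube_mono[of "fst s" "fst s + 1" J x] x[symmetric]
      by (intro nn_integral_mono mult_right_mono) (auto simp: indicator_def)
    also have "\<dots> \<le> ennreal t * cube_vol J (fst s + 1)" using S(4)[OF s xs] by simp
    also have "\<dots> = (2 ^ card J * ennreal t) * cube_vol J (fst s)" using cube_vol_add[of J "fst s" 1] by (simp add: ac_simps)
    finally show "(\<integral>\<^sup>+y. indicator (index_cube J s) y * F y \<partial>vol_on J) \<le> (\<integral>\<^sup>+y. indicator (index_cube J s) y * (2 ^ card J * ennreal t) \<partial>vol_on J)"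
      by (simp add: indicator_mult_const cube_vol s)
  qed auto
  then show "(\<integral>\<^sup>+y. indicator (dyadic_above J F t) y * F y \<partial>vol_on J) \<le> 2 ^ card J * ennreal t * emeasure (vol_on J) (dyadic_above J F t)"
    by (simp add: indicator_mult_const)
qed

lemma dyadic_above_finite:
  assumes J: "J \<noteq> {}" and t: "0 < t" and fin: "(\<integral>\<^sup>+y. F y \<partial>vol_on J) < top" and [measurable]: "F \<in> borel_measurable borel"
  shows "emeasure (vol_on J) (dyadic_above J F t) < top" "ennreal t * emeasure (vol_on J) (dyadic_above J F t) \<le> (\<integral>\<^sup>+y. F y \<partial>vol_on J)"
proof -
  have "(\<integral>\<^sup>+y. indicator (dyadic_above J F t) y * F y \<partial>vol_on J) \<le> (\<integral>\<^sup>+y. F y \<partial>vol_on J)"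
    by (intro nn_integral_mono) (auto simp: indicator_def)
  then show *: "ennreal t * emeasure (vol_on J) (dyadic_above J F t) \<le> (\<integral>\<^sup>+y. F y \<partial>vol_on J)"
    using dyadic_above_weak(1)[OF J t fin] by simp
  then have "ennreal t * emeasure (vol_on J) (dyadic_above J F t) < top" using fin by simp
  then show "emeasure (vol_on J) (dyadic_above J F t) < top" using t by (auto simp: ennreal_mult_less_top)
qed

lemma dyadic_above_mono: "t \<le> u \<Longrightarrow> dyadic_above J F u \<subseteq> dyadic_above J F t"
proof -
  assume "t \<le> u"
  then have "ennreal t * cube_vol J k \<le> ennreal u * cube_vol J k" for k by (intro mult_right_mono ennreal_leI) auto
  then show ?thesis unfolding dyadic_above_def by (auto intro: le_less_trans)
qed

text \<open>Values of \<open>F\<close> up to t/2 contribute at most t/2 to any average, so an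
  average above t forces the part of \<open>F\<close> above t/2 to have an average above t/2.
  Applying the weak-type bound to that part alone makes the later integral over the levels
  converge.\<close>

lemma dyadic_above_truncate:
  assumes J: "J \<noteq> {}" and t: "0 < t" and fin: "(\<integral>\<^sup>+y. F y \<partial>vol_on J) < top" and [measurable]: "F \<in> borel_measurable borel"
  shows "ennreal t * emeasure (vol_on J) (dyadic_above J F t) \<le> 2 * (\<integral>\<^sup>+y. indicator {y. F y > ennreal (t / 2)} y * F y \<partial>vol_on J)"
proof -
  let ?G = "\<lambda>y. indicator {y. F y > ennreal (t / 2)} y * F y"
  have G: "(\<integral>\<^sup>+y. ?G y \<partial>vol_on J) < top"
    by (rule le_less_trans[OF nn_integral_mono fin]) (auto simp: indicator_def)
  have "dyadic_above J F t \<subseteq> dyadic_above J ?G (t / 2)"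
  proof
    fix x assume "x \<in> dyadic_above J F t"
    then obtain k where k: "ennreal t * cube_vol J k < (\<integral>\<^sup>+y. indicator (dyadic_cube J k x) y * F y \<partial>vol_on J)" by (auto simp: dyadic_above_def)
    have "(\<integral>\<^sup>+y. indicator (dyadic_cube J k x) y * F y \<partial>vol_on J)
      \<le> (\<integral>\<^sup>+y. indicator (dyadic_cube J k x) y * ?G y + indicator (dyadic_cube J k x) y * ennreal (t / 2) \<partial>vol_on J)"
      by (intro nn_integral_mono) (auto simp: indicator_def not_less)
    also have "\<dots> = (\<integral>\<^sup>+y. indicator (dyadic_cube J k x) y * ?G y \<partial>vol_on J) + ennreal (t / 2) * cube_vol J k"
      by (subst nn_integral_add) (auto simp: indicator_mult_const emeasure_dy)
    finally have "ennreal t * cube_vol J k < (\<integral>\<^sup>+y. indicator (dyadic_cube J k x) y * ?G y \<partial>vol_on J) + ennreal (t / 2) * cube_vol J k"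
      using k by simp
    moreover have "ennreal t * cube_vol J k = ennreal (t / 2) * cube_vol J k + ennreal (t / 2) * cube_vol J k"
      using t by (simp flip: distrib_right ennreal_plus)
    ultimately have "ennreal (t / 2) * cube_vol J k + ennreal (t / 2) * cube_vol J k
      < (\<integral>\<^sup>+y. indicator (dyadic_cube J k x) y * ?G y \<partial>vol_on J) + ennreal (t / 2) * cube_vol J k" by (simp only:)
    then have "ennreal (t / 2) * cube_vol J k < (\<integral>\<^sup>+y. indicator (dyadic_cube J k x) y * ?G y \<partial>vol_on J)"
      by (rule contrapos_pp) (simp only: not_less add_right_mono)
    then show "x \<in> dyadic_above J ?G (t / 2)" unfolding dyadic_above_def by blast
  qed
  then have le: "emeasure (vol_on J) (dyadic_above J F t) \<le> emeasure (vol_on J) (dyadic_above J ?G (t / 2))"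
    using J t G by (intro emeasure_mono) (auto intro: dyadic_above_measurable)
  have "ennreal t * emeasure (vol_on J) (dyadic_above J F t) \<le> 2 * (ennreal (t / 2) * emeasure (vol_on J) (dyadic_above J ?G (t / 2)))"
  proof -
    have "ennreal t = 2 * ennreal (t / 2)" using t by (simp flip: ennreal_mult'' ennreal_numeral)
    then show ?thesis using mult_left_mono[OF le, of "2 * ennreal (t / 2)"] by (simp only: mult.assoc zero_le)
  qed
  also have "\<dots> \<le> 2 * (\<integral>\<^sup>+y. ?G y \<partial>vol_on J)"
    using J t G by (intro mult_left_mono dyadic_above_finite(2)) auto
  finally show ?thesis .
qed

text \<open>Neighbourhoods are not dyadic cubes, so their averages are not bounded by the stopping
  rule itself. Outside the neighbourhoods of all stopping cubes, however, none of the
  \<open>3 ^ card J\<close> cubes that make up \<open>neighbours J k x\<close> has an average above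
  \<open>t\<close>: it would lie in a stopping cube at least as large, and \<open>x\<close> would be
  adjacent to that one.\<close>

lemma neighbours_Om:
  assumes J: "J \<noteq> {}" and t: "0 < t" and fin: "(\<integral>\<^sup>+y. F y \<partial>vol_on J) < top" and [measurable]: "F \<in> borel_measurable borel"
  obtains V where "V \<in> sets borel" "emeasure (vol_on J) V \<le> 3 ^ card J * emeasure (vol_on J) (dyadic_above J F t)"
    "\<And>x k. x \<notin> V \<Longrightarrow> (\<integral>\<^sup>+y. indicator (neighbours J k x) y * F y \<partial>vol_on J) \<le> 3 ^ card J * ennreal t * cube_vol J k"
proof -
  obtain S where "stop_family J F t S" using dyadic_above_stopping[OF J t fin] by blast
  note S = stop_familyD[OF this]
  define T where "T s = {y. \<forall>i\<in>J. \<bar>dyadic_index J (fst s) y i - snd s i\<bar> \<le> 1}" for s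
  have T: "T s = neighbours J (fst s) x" if "s = (fst s, dyadic_index J (fst s) x)" for s x
    using that by (auto simp: T_def neighbours_def prod_eq_iff)
  show ?thesis
  proof
    have Tm: "T s \<in> sets borel" if "s \<in> S" for s using S(5)[OF that] T[of s] by auto
    then show "(\<Union>s\<in>S. T s) \<in> sets borel" by (intro sets.countable_UN') auto
    show "emeasure (vol_on J) (\<Union>s\<in>S. T s) \<le> 3 ^ card J * emeasure (vol_on J) (dyadic_above J F t)"
      unfolding S(2)[symmetric]
    proof (intro emeasure_mu_tri_UN S Tm)
      fix s assume "s \<in> S"
      then obtain x where "s = (fst s, dyadic_index J (fst s) x)" using S(5) by blast
      from T[OF this] show "emeasure (vol_on J) (T s) \<le> 3 ^ card J * cube_vol J (fst s)"
        by (simp only: emeasure_tri order_refl)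
    qed
    fix x k assume x: "x \<notin> (\<Union>s\<in>S. T s)"
    have cube: "(\<integral>\<^sup>+y. indicator (dyadic_cube J k w) y * F y \<partial>vol_on J) \<le> ennreal t * cube_vol J k" if w: "w \<in> neighbours J k x" for w
    proof (rule ccontr)
      assume "\<not> ?thesis"
      then have k: "(\<integral>\<^sup>+y. indicator (dyadic_cube J k w) y * F y \<partial>vol_on J) > ennreal t * cube_vol J k" by simp
      then have "w \<in> dyadic_above J F t" by (auto simp: dyadic_above_def)
      then obtain s where s: "s \<in> S" "w \<in> index_cube J s" unfolding S(2)[symmetric] by (rule UN_E)
      have "k \<le> fst s"
      proof (rule leI, rule notI)
        assume "fst s < k"
        from S(4)[OF s this] k show False by (rule leD[THEN notE])
      qed
      then have "x \<in> neighbours J (fst s) w" using w neighbours_mono[of k "fst s" J w] neighbours_sym[of w J k x] by auto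
      then have "x \<in> T s" using s(2) by (auto simp: T_def neighbours_def index_cube_def)
      then show False using x s by blast
    qed
    \<comment> \<open>Offsets of the \<open>3 ^ card J\<close> adjacent cubes. Each of these cubes
      is represented below by its corner \<open>w\<close>, a point to which the fact
      \<open>cube\<close> applies.\<close>
    define E where "E = (\<Pi>\<^sub>E i\<in>J. {-1, 0, 1::int})"
    define z where "z e = (\<lambda>i. if i \<in> J then dyadic_index J k x i + e i else 0)" for e :: "'a \<Rightarrow> int"
    have E: "finite E" "card E = 3 ^ card J" by (auto simp: E_def card_PiE finite_PiE numeral_3_eq_3)
    have cover: "indicator (neighbours J k x) y * F y \<le> (\<Sum>e\<in>E. indicator (index_cube J (k, z e)) y * F y)" for y
    proof (cases "y \<in> neighbours J k x")
      case True
      define e where "e = restrict (\<lambda>i. dyadic_index J k y i - dyadic_index J k x i) J"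
      have "e \<in> E" unfolding E_def e_def
      proof (rule restrict_PiE_iff[THEN iffD2], rule ballI)
        fix i assume "i \<in> J"
        then have "\<bar>dyadic_index J k y i - dyadic_index J k x i\<bar> \<le> 1" using True by (auto simp: neighbours_def)
        then show "dyadic_index J k y i - dyadic_index J k x i \<in> {-1, 0, 1}" by auto
      qed
      moreover have "y \<in> index_cube J (k, z e)" by (auto simp: index_cube_def z_def e_def dyadic_index_def)
      ultimately show ?thesis using True E(1)
        by (intro order_trans[OF _ member_le_sum[of e]]) auto
    qed simp
    have "(\<integral>\<^sup>+y. indicator (neighbours J k x) y * F y \<partial>vol_on J) \<le> (\<integral>\<^sup>+y. (\<Sum>e\<in>E. indicator (index_cube J (k, z e)) y * F y) \<partial>vol_on J)"
      by (intro nn_integral_mono cover)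
    also have "\<dots> = (\<Sum>e\<in>E. \<integral>\<^sup>+y. indicator (index_cube J (k, z e)) y * F y \<partial>vol_on J)"
      by (intro nn_integral_sum) auto
    also have "\<dots> \<le> (\<Sum>e\<in>E. ennreal t * cube_vol J k)"
    proof (intro sum_mono)
      fix e assume e: "e \<in> E"
      define w :: "real ^ 'a" where "w = (\<chi> i. side k * z e i)"
      have "dyadic_index J k w = z e" by (auto simp: dyadic_index_def w_def z_def fun_eq_iff)
      moreover have "w \<in> neighbours J k x"
        using e by (auto simp: neighbours_def \<open>dyadic_index J k w = z e\<close> z_def E_def PiE_def Pi_def)
      ultimately show "(\<integral>\<^sup>+y. indicator (index_cube J (k, z e)) y * F y \<partial>vol_on J) \<le> ennreal t * cube_vol J k"
        using cube[of w] by simp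
    qed
    also have "\<dots> = 3 ^ card J * ennreal t * cube_vol J k" using E by (simp add: mult.assoc)
    finally show "(\<integral>\<^sup>+y. indicator (neighbours J k x) y * F y \<partial>vol_on J) \<le> 3 ^ card J * ennreal t * cube_vol J k" .
  qed
qed

section \<open>Differentiation along dyadic cubes\<close>

text \<open>An open set is the disjoint union of the maximal dyadic cubes of side at most 1 that it
  contains, and the bound on the averages adds up over these.\<close>

lemma emeasure_le_open_cover:
  fixes H :: "real ^ 'n \<Rightarrow> ennreal"
  assumes [measurable]: "H \<in> borel_measurable borel" and t: "0 < t"
    and H: "\<And>k x. (\<integral>\<^sup>+y. indicator (dyadic_cube UNIV k x) y * H y \<partial>lborel) \<le> ennreal t * cube_vol (UNIV :: 'n set) k"
    and U: "open U"
  shows "(\<integral>\<^sup>+y. indicator U y * H y \<partial>lborel) \<le> ennreal t * emeasure lborel U"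
proof -
  \<comment> \<open>The cap \<open>k \<le> 0\<close> makes maximal cubes exist even if
    \<open>U\<close> contains arbitrarily large cubes.\<close>
  define P where "P k x \<longleftrightarrow> k \<le> 0 \<and> dyadic_cube UNIV k x \<subseteq> U" for k x
  have inv: "P k y" if "dyadic_index UNIV k x = dyadic_index UNIV k y" "P k x" for k x y
    using that(2) unfolding P_def that(1) .
  have bdd: "\<exists>b. \<forall>k>b. \<not> P k x" for x by (rule exI[of _ 0]) (auto simp: P_def)
  have "\<exists>S. disjoint_family_on (index_cube UNIV) S \<and> (\<Union>s\<in>S. index_cube UNIV s) = {x. \<exists>k. P k x} \<and>
    (\<forall>s\<in>S. \<forall>x\<in>index_cube UNIV s. P (fst s) x \<and> (\<forall>k>fst s. \<not> P k x)) \<and>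
    (\<forall>s\<in>S. \<exists>x. s = (fst s, dyadic_index UNIV (fst s) x))"
    by (rule stopping_cubes[of UNIV P]) (erule inv, assumption, rule bdd)
  then obtain S where S: "disjoint_family_on (index_cube UNIV) S" "(\<Union>s\<in>S. index_cube UNIV s) = {x. \<exists>k. P k x}"
    "\<forall>s\<in>S. \<forall>x\<in>index_cube UNIV s. P (fst s) x \<and> (\<forall>k>fst s. \<not> P k x)"
    "\<forall>s\<in>S. \<exists>x. s = (fst s, dyadic_index UNIV (fst s) x)"
    by (elim exE conjE)
  have "{x. \<exists>k. P k x} = U"
  proof (intro equalityI subsetI)
    fix x assume "x \<in> U"
    then obtain e where e: "0 < e" "ball x e \<subseteq> U" using U open_contains_ball by blast
    obtain m :: nat where m: "real CARD('n) / e < 2 ^ m" using real_arch_pow[of 2] by auto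
    have side: "side (- int m) = 1 / 2 ^ m" by (simp add: powr_minus powr_realpow divide_inverse)
    have "dyadic_cube UNIV (- int m) x \<subseteq> ball x e"
    proof
      fix y assume y: "y \<in> dyadic_cube UNIV (- int m) x"
      have "norm (x - y) \<le> (\<Sum>i\<in>UNIV. \<bar>(x - y) $ i\<bar>)" by (rule norm_le_l1_cart)
      also have "\<dots> \<le> (\<Sum>i\<in>(UNIV :: 'n set). side (- int m))"
        using dyadic_cube_dist[OF self_dy y] by (intro sum_mono) auto
      also have "\<dots> = real CARD('n) * (1 / 2 ^ m)" unfolding side by simp
      also have "\<dots> < e" using m e by (simp add: field_simps)
      finally show "y \<in> ball x e" by (simp add: dist_norm)
    qed
    then have "P (- int m) x" using e by (auto simp: P_def)
    then show "x \<in> {x. \<exists>k. P k x}" by blast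
  qed (auto simp: P_def)
  note S(2)[unfolded this]
  have [measurable]: "U \<in> sets borel" using U by simp
  have "(\<integral>\<^sup>+y. indicator (\<Union>s\<in>S. index_cube UNIV s) y * H y \<partial>vol_on UNIV) \<le> (\<integral>\<^sup>+y. indicator (\<Union>s\<in>S. index_cube UNIV s) y * ennreal t \<partial>vol_on UNIV)"
  proof (intro nn_integral_cubes_mono S)
    fix s assume "s \<in> S"
    then obtain x where x: "s = (fst s, dyadic_index UNIV (fst s) x)" using S(4) by blast
    have "(\<integral>\<^sup>+y. indicator (dyadic_cube UNIV (fst s) x) y * H y \<partial>vol_on UNIV) \<le> (\<integral>\<^sup>+y. indicator (dyadic_cube UNIV (fst s) x) y * ennreal t \<partial>vol_on UNIV)"
      using H[of "fst s" x] by (subst indicator_mult_const) (auto simp: emeasure_dy[of UNIV, unfolded vol_on_UNIV])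
    then show "(\<integral>\<^sup>+y. indicator (index_cube UNIV s) y * H y \<partial>vol_on UNIV) \<le> (\<integral>\<^sup>+y. indicator (index_cube UNIV s) y * ennreal t \<partial>vol_on UNIV)"
      unfolding x[symmetric] .
  qed auto
  then show ?thesis unfolding \<open>(\<Union>s\<in>S. index_cube UNIV s) = U\<close> 
    using indicator_mult_const[where A = U and c = "ennreal t" and J = UNIV] by simp
qed

definition depends_on :: "'n set \<Rightarrow> (real ^ 'n \<Rightarrow> 'b) \<Rightarrow> bool" where
  "depends_on J F \<longleftrightarrow> (\<forall>x y. (\<forall>i\<in>J. x $ i = y $ i) \<longrightarrow> F x = F y)"

lemma jdepD: "depends_on J F \<Longrightarrow> (\<And>i. i \<in> J \<Longrightarrow> x $ i = y $ i) \<Longrightarrow> F x = F y"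
  by (auto simp: depends_on_def)

lemma depends_on_mn: "- set js \<subseteq> J \<Longrightarrow> depends_on J (iter_norm q js F)"
  unfolding depends_on_def by (intro allI impI iter_norm_indep) auto

lemma dyadic_above_jdep: "depends_on J (\<lambda>x. x \<in> dyadic_above J F t)"
  unfolding depends_on_def
proof (intro allI impI)
  fix x y :: "real ^ 'a" assume "\<forall>i\<in>J. x $ i = y $ i"
  then have "dyadic_index J k x = dyadic_index J k y" for k by (auto simp: dyadic_index_def)
  then show "(x \<in> dyadic_above J F t) = (y \<in> dyadic_above J F t)" by (simp add: dyadic_above_def)
qed

lemma cube_vol_split:
  fixes J :: "'n::finite set"
  shows "cube_vol (- J) k * cube_vol J k = cube_vol (UNIV :: 'n set) k"
proof -
  have "card (- J) + card J = CARD('n)"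
    using card_Un_disjoint[of "- J" J] by (simp add: Compl_partition2)
  then show ?thesis by (simp add: cube_vol_def flip: ennreal_mult power_add)
qed

text \<open>The coordinates outside \<open>J\<close> contribute only a volume factor. This moves
  averages to the full space, where outer regularity of Lebesgue measure is available.\<close>

lemma integral_dy_UNIV:
  fixes F :: "real ^ 'n \<Rightarrow> ennreal"
  assumes [measurable]: "F \<in> borel_measurable borel" and F: "depends_on J F"
  shows "(\<integral>\<^sup>+y. indicator (dyadic_cube UNIV k x) y * F y \<partial>lborel)
    = cube_vol (- J) k * (\<integral>\<^sup>+y. indicator (dyadic_cube J k x) y * F y \<partial>vol_on J)"
proof -
  have "(\<integral>\<^sup>+y. indicator (dyadic_cube UNIV k x) y * F y \<partial>lborel)
    = (\<integral>\<^sup>+a. \<integral>\<^sup>+b. indicator (dyadic_cube UNIV k x) (merge_coords (- J) a b) * F (merge_coords (- J) a b) \<partial>vol_on J \<partial>vol_on (- J))"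
    using vol_on_split[of "\<lambda>y. indicator (dyadic_cube UNIV k x) y * F y" UNIV "- J"] by (simp add: Compl_eq_Diff_UNIV[symmetric])
  also have "\<dots> = (\<integral>\<^sup>+a. \<integral>\<^sup>+b. indicator (dyadic_cube (- J) k x) a * (indicator (dyadic_cube J k x) b * F b) \<partial>vol_on J \<partial>vol_on (- J))"
  proof (intro nn_integral_cong)
    fix a b
    have "F (merge_coords (- J) a b) = F b" by (rule jdepD[OF F]) auto
    moreover have "merge_coords (- J) a b \<in> dyadic_cube UNIV k x \<longleftrightarrow> a \<in> dyadic_cube (- J) k x \<and> b \<in> dyadic_cube J k x"
      unfolding mem_dy unfolding dyadic_index_def fun_eq_iff by (auto split: if_splits)
    ultimately show "indicator (dyadic_cube UNIV k x) (merge_coords (- J) a b) * F (merge_coords (- J) a b)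
      = indicator (dyadic_cube (- J) k x) a * (indicator (dyadic_cube J k x) b * F b)"
      by (simp add: indicator_def)
  qed
  also have "\<dots> = (\<integral>\<^sup>+a. indicator (dyadic_cube (- J) k x) a * (\<integral>\<^sup>+b. indicator (dyadic_cube J k x) b * F b \<partial>vol_on J) \<partial>vol_on (- J))"
    by (intro nn_integral_cong nn_integral_cmult) auto
  also have "\<dots> = cube_vol (- J) k * (\<integral>\<^sup>+b. indicator (dyadic_cube J k x) b * F b \<partial>vol_on J)"
    by (subst indicator_mult_const) (auto simp: emeasure_dy mult.commute)
  finally show ?thesis .
qed

lemma ennreal_add_le_self: "a + b \<le> b \<Longrightarrow> b < top \<Longrightarrow> a = (0 :: ennreal)"
  by (cases a; cases b) (auto simp: top_unique ennreal_le_iff2 simp flip: ennreal_plus)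

text \<open>The one-sided form of Lebesgue's differentiation theorem. Let \<open>E\<close> be the
  set where \<open>F\<close> exceeds \<open>t\<close> although no average does. Approximating
  \<open>E\<close> from outside by open sets bounds the integral of \<open>F\<close> over
  \<open>E\<close> by \<open>t\<close> times the measure of \<open>E\<close>; since \<open>F\<close>
  exceeds \<open>t\<close> there, \<open>E\<close> must be null.\<close>

lemma dyadic_above_differentiation:
  fixes F :: "real ^ 'n \<Rightarrow> ennreal"
  assumes J: "J \<noteq> {}" and t: "0 < t" and fin: "(\<integral>\<^sup>+y. F y \<partial>vol_on J) < top" and [measurable]: "F \<in> borel_measurable borel"
    and dep: "depends_on J F"
  shows "AE x in vol_on J. x \<notin> dyadic_above J F t \<longrightarrow> F x \<le> ennreal t"
proof -
  have [measurable]: "dyadic_above J F t \<in> sets borel" by (rule dyadic_above_measurable[OF J t fin])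
  \<comment> \<open>Cutting \<open>F\<close> off on the superlevel set bounds every dyadic average:
    a cube inside the set contributes 0, and any other cube contains a point at which no average
    exceeds \<open>t\<close>.\<close>
  define H where "H x = indicator (- dyadic_above J F t) x * F x" for x
  have [measurable]: "H \<in> borel_measurable borel" unfolding H_def[abs_def] by measurable
  have Hdep: "depends_on J H" using dep dyadic_above_jdep[of J F t] by (auto simp: depends_on_def H_def indicator_def)
  have H: "(\<integral>\<^sup>+y. indicator (dyadic_cube UNIV k x) y * H y \<partial>lborel) \<le> ennreal t * cube_vol (UNIV :: 'n set) k" for k x
  proof (cases "dyadic_cube J k x \<subseteq> dyadic_above J F t")
    case True
    then have "(\<integral>\<^sup>+y. indicator (dyadic_cube J k x) y * H y \<partial>vol_on J) = (\<integral>\<^sup>+y. 0 \<partial>vol_on J)"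
      by (intro nn_integral_cong) (auto simp: H_def indicator_def)
    then show ?thesis unfolding integral_dy_UNIV[OF \<open>H \<in> _\<close> Hdep] by simp
  next
    case False
    then obtain w where w: "w \<in> dyadic_cube J k x" "w \<notin> dyadic_above J F t" by blast
  note w = w(1)[unfolded mem_dy] w(2)
    have "(\<integral>\<^sup>+y. indicator (dyadic_cube J k x) y * H y \<partial>vol_on J) \<le> (\<integral>\<^sup>+y. indicator (dyadic_cube J k w) y * F y \<partial>vol_on J)"
      unfolding w(1) by (intro nn_integral_mono) (auto simp: H_def indicator_def)
    also have "\<dots> \<le> ennreal t * cube_vol J k" using w(2) by (auto simp: dyadic_above_def not_less)
    finally have "cube_vol (- J) k * (\<integral>\<^sup>+y. indicator (dyadic_cube J k x) y * H y \<partial>vol_on J) \<le> cube_vol (- J) k * (ennreal t * cube_vol J k)"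
      by (rule mult_left_mono) simp
    also have "\<dots> = ennreal t * cube_vol (UNIV :: 'n set) k" unfolding cube_vol_split[of J, symmetric] by (simp add: ac_simps)
    finally show ?thesis unfolding integral_dy_UNIV[OF \<open>H \<in> _\<close> Hdep] .
  qed
  \<comment> \<open>Intersecting with \<open>ucube J\<close> gives \<open>E\<close> finite Lebesgue
    measure, so that \<open>t\<close> times this measure can be cancelled below.\<close>
  define E where "E = {x. x \<notin> dyadic_above J F t \<and> ennreal t < F x} \<inter> ucube J"
  have [measurable]: "E \<in> sets borel" unfolding E_def by measurable
  have "ennreal t * emeasure lborel E = (\<integral>\<^sup>+y. indicator E y * ennreal t \<partial>lborel)"
    using indicator_mult_const[where A = E and c = "ennreal t" and J = UNIV] by simp
  also have "\<dots> \<le> (\<integral>\<^sup>+y. indicator (ucube J) y * F y \<partial>lborel)"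
    by (intro nn_integral_mono) (auto simp: E_def indicator_def)
  also have "\<dots> < top" using fin by (simp add: nn_integral_mu)
  finally have Efin: "emeasure lborel E < top" using t by (auto simp: ennreal_mult_less_top)
  have "(\<integral>\<^sup>+y. indicator E y * H y \<partial>lborel) \<le> ennreal t * emeasure lborel E"
  proof (rule ennreal_le_epsilon)
    fix e :: real assume e: "0 < e"
    obtain U where U: "open U" "E \<subseteq> U" "emeasure lborel (U - E) < ennreal (e / t)"
      using outer_regular_lborel[of E "e / t"] e t by auto
    have "(\<integral>\<^sup>+y. indicator E y * H y \<partial>lborel) \<le> (\<integral>\<^sup>+y. indicator U y * H y \<partial>lborel)"
      using U(2) by (intro nn_integral_mono) (auto simp: indicator_def)
    also have "\<dots> \<le> ennreal t * emeasure lborel U"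
      by (rule emeasure_le_open_cover[OF _ t H U(1)]) simp
    also have "emeasure lborel U = emeasure lborel E + emeasure lborel (U - E)"
      using U(1,2) by (subst plus_emeasure) (auto intro: arg_cong[where f = "emeasure lborel"])
    also have "ennreal t * \<dots> \<le> ennreal t * (emeasure lborel E + ennreal (e / t))"
      using U(3) by (intro mult_left_mono add_left_mono) auto
    also have "\<dots> = ennreal t * emeasure lborel E + ennreal e"
      using t e by (simp add: distrib_left flip: ennreal_mult)
    finally show "(\<integral>\<^sup>+y. indicator E y * H y \<partial>lborel) \<le> ennreal t * emeasure lborel E + ennreal e" .
  qed
  moreover have "(\<integral>\<^sup>+y. indicator E y * H y \<partial>lborel)
    = (\<integral>\<^sup>+y. indicator E y * (F y - ennreal t) + indicator E y * ennreal t \<partial>lborel)"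
    by (intro nn_integral_cong) (auto simp: E_def H_def indicator_def diff_add_self_ennreal)
  moreover have "\<dots> = (\<integral>\<^sup>+y. indicator E y * (F y - ennreal t) \<partial>lborel) + ennreal t * emeasure lborel E"
    using indicator_mult_const[where A = E and c = "ennreal t" and J = UNIV] by (subst nn_integral_add) auto
  ultimately have "(\<integral>\<^sup>+y. indicator E y * (F y - ennreal t) \<partial>lborel) + ennreal t * emeasure lborel E
      \<le> 0 + ennreal t * emeasure lborel E" by simp
  moreover have "ennreal t * emeasure lborel E < top" using Efin by (simp add: ennreal_mult_less_top)
  ultimately have "(\<integral>\<^sup>+y. indicator E y * (F y - ennreal t) \<partial>lborel) = 0"
    by (intro ennreal_add_le_self) auto
  then have "AE y in lborel. indicator E y * (F y - ennreal t) = 0"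
    by (subst (asm) nn_integral_0_iff_AE) auto
  then have "AE y in lborel. y \<notin> E"
    by (rule eventually_mono) (auto simp: E_def indicator_def dest: ennreal_minus_eq_0 split: if_splits)
  then show ?thesis unfolding vol_on_def
    by (subst AE_density) (auto elim!: eventually_mono simp: E_def indicator_def not_le)
qed

section \<open>Layer cake formulas\<close>

lemma indicator_times_if: "(\<lambda>x. indicator S x * f x) = (\<lambda>x. if x \<in> S then f x else (0 :: real))"
  by (auto simp: indicator_def)

lemma nn_integral_powr_0:
  assumes "0 < s"
  shows "(\<integral>\<^sup>+t. indicator {t. 0 < t \<and> ennreal t < a} t * ennreal (t powr (s - 1)) \<partial>lborel) = ennreal (1 / s) * a powe s"
proof (cases a)
  case (real c)
  have I: "((\<lambda>x. indicator {0..c} x * x powr (s - 1)) has_integral (c powr s / s)) UNIV"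
    unfolding indicator_times_if has_integral_restrict_UNIV using has_integral_powr_from_0[of "s - 1" c] assms real by simp
  have "(\<integral>\<^sup>+t. indicator {t. 0 < t \<and> ennreal t < a} t * ennreal (t powr (s - 1)) \<partial>lborel)
    = (\<integral>\<^sup>+t. ennreal (indicator {0..c} t * t powr (s - 1)) \<partial>lborel)"
    using AE_lborel_singleton[of c] real
    by (intro nn_integral_cong_AE) (auto elim!: eventually_mono simp: indicator_def ennreal_less_iff)
  also have "\<dots> = ennreal (c powr s / s)"
    by (rule nn_integral_has_integral_lborel[OF _ _ I]) auto
  finally show ?thesis using real assms by (simp add: epow_ennreal flip: ennreal_mult)
next
  case top
  have "ennreal (1 / s * real n powr s) \<le> (\<integral>\<^sup>+t. indicator {t. 0 < t \<and> ennreal t < a} t * ennreal (t powr (s - 1)) \<partial>lborel)" for n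
  proof -
    have I: "((\<lambda>x. indicator {0..real n} x * x powr (s - 1)) has_integral (real n powr s / s)) UNIV"
      unfolding indicator_times_if has_integral_restrict_UNIV using has_integral_powr_from_0[of "s - 1" "real n"] assms by simp
    have "ennreal (real n powr s / s) = (\<integral>\<^sup>+t. ennreal (indicator {0..real n} t * t powr (s - 1)) \<partial>lborel)"
      by (rule nn_integral_has_integral_lborel[OF _ _ I, symmetric]) auto
    also have "\<dots> \<le> (\<integral>\<^sup>+t. indicator {t. 0 < t \<and> ennreal t < a} t * ennreal (t powr (s - 1)) \<partial>lborel)"
      using top by (intro nn_integral_mono) (auto simp: indicator_def)
    finally show ?thesis by simp
  qed
  moreover have "(SUP n. ennreal (1 / s * real n powr s)) = top"
  proof (rule ennreal_SUP_eq_top)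
    fix n :: nat
    obtain m :: nat where m: "(s * n) powr (1 / s) \<le> real m" using real_arch_simple by blast
    then have "((s * n) powr (1 / s)) powr s \<le> real m powr s" using assms by (intro powr_mono2) auto
    then have "real n \<le> 1 / s * real m powr s" using assms by (simp add: powr_powr field_simps)
    then have "ennreal (real n) \<le> ennreal (1 / s * real m powr s)" by (rule ennreal_leI)
    then show "\<exists>i\<in>UNIV. of_nat n \<le> ennreal (1 / s * real i powr s)"
      unfolding ennreal_of_nat_eq_real_of_nat by (intro bexI[of _ m]) simp_all
  qed
  ultimately have "top \<le> (\<integral>\<^sup>+t. indicator {t. 0 < t \<and> ennreal t < a} t * ennreal (t powr (s - 1)) \<partial>lborel)"
    by (metis (no_types, lifting) SUP_least)
  then show ?thesis using top assms by (simp add: ennreal_mult_top top_unique)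
qed

text \<open>The product form includes \<open>a = 0\<close>, where the integral diverges but is
  multiplied by 0.\<close>

lemma nn_integral_powr_inf:
  assumes "0 < s"
  shows "(\<integral>\<^sup>+t. indicator {t. 0 < t \<and> a \<le> ennreal t} t * ennreal (t powr (- s - 1)) \<partial>lborel) * a powe s \<le> ennreal (1 / s)"
proof (cases "a = 0 \<or> a = top")
  case True
  then show ?thesis by (auto simp: top_unique)
next
  case False
  then obtain c where c: "a = ennreal c" "0 < c" by (cases a) auto
  have I: "((\<lambda>x. indicator {c..} x * x powr (- s - 1)) has_integral (c powr (- s) / s)) UNIV"
    unfolding indicator_times_if has_integral_restrict_UNIV using has_integral_powr_to_inf[of "- s - 1" c] assms c by simp
  have "(\<integral>\<^sup>+t. indicator {t. 0 < t \<and> a \<le> ennreal t} t * ennreal (t powr (- s - 1)) \<partial>lborel)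
    = (\<integral>\<^sup>+t. ennreal (indicator {c..} t * t powr (- s - 1)) \<partial>lborel)"
    using c by (intro nn_integral_cong) (auto simp: indicator_def ennreal_le_iff2)
  also have "\<dots> = ennreal (c powr (- s) / s)"
    by (rule nn_integral_has_integral_lborel[OF _ _ I]) auto
  finally show ?thesis using c assms
    by (simp add: epow_ennreal powr_minus flip: ennreal_mult)
qed

lemma layer_cake:
  assumes M: "sigma_finite_measure M" and [measurable]: "W \<in> borel_measurable M" and s: "0 < s"
  shows "(\<integral>\<^sup>+x. W x powe s \<partial>M) = ennreal s * (\<integral>\<^sup>+t. indicator {0<..} t * (ennreal (t powr (s - 1)) * emeasure M {x\<in>space M. ennreal t < W x}) \<partial>lborel)"
proof -
  interpret sigma_finite_measure M by fact
  interpret P: pair_sigma_finite M lborel by (simp add: pair_sigma_finite_def M lborel.sigma_finite_measure_axioms)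
  have "(\<integral>\<^sup>+t. indicator {0<..} t * (ennreal (t powr (s - 1)) * emeasure M {x\<in>space M. ennreal t < W x}) \<partial>lborel)
    = (\<integral>\<^sup>+t. \<integral>\<^sup>+x. indicator {t. 0 < t \<and> ennreal t < W x} t * ennreal (t powr (s - 1)) \<partial>M \<partial>lborel)"
  proof (intro nn_integral_cong)
    fix t :: real
    have "(\<integral>\<^sup>+x. indicator {t. 0 < t \<and> ennreal t < W x} t * ennreal (t powr (s - 1)) \<partial>M)
      = (\<integral>\<^sup>+x. (indicator {0<..} t * ennreal (t powr (s - 1))) * indicator {x\<in>space M. ennreal t < W x} x \<partial>M)"
      by (intro nn_integral_cong) (auto simp: indicator_def)
    also have "\<dots> = indicator {0<..} t * (ennreal (t powr (s - 1)) * emeasure M {x\<in>space M. ennreal t < W x})"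
      by (subst nn_integral_cmult_indicator) (auto simp: mult.assoc)
    finally show "indicator {0<..} t * (ennreal (t powr (s - 1)) * emeasure M {x\<in>space M. ennreal t < W x})
      = (\<integral>\<^sup>+x. indicator {t. 0 < t \<and> ennreal t < W x} t * ennreal (t powr (s - 1)) \<partial>M)" ..
  qed
  also have "\<dots> = (\<integral>\<^sup>+x. \<integral>\<^sup>+t. indicator {t. 0 < t \<and> ennreal t < W x} t * ennreal (t powr (s - 1)) \<partial>lborel \<partial>M)"
    by (rule P.Fubini') (simp add: indicator_def[abs_def] of_bool_def)
  also have "\<dots> = ennreal (1 / s) * (\<integral>\<^sup>+x. W x powe s \<partial>M)"
    using s by (simp add: nn_integral_powr_0 nn_integral_cmult)
  finally show ?thesis using s by (simp add: mult.assoc[symmetric] flip: ennreal_mult)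
qed

lemma ennreal_half_less_iff: "0 < t \<Longrightarrow> ennreal (t / 2) < a \<longleftrightarrow> ennreal t < 2 * a"
  by (cases a) (auto simp: ennreal_less_iff ennreal_mult_top simp flip: ennreal_mult'' ennreal_numeral)

text \<open>The strong-type maximal inequality in layer-cake form. After truncation the integral of
  t^(r-2) over 0 < t < 2 F is (2 F)^(r-1) / (r-1); with the remaining factor 2 F this gives the
  constant 2^r / (r-1).\<close>

lemma dyadic_above_layer:
  assumes J: "J \<noteq> {}" and r: "1 < r" and fin: "(\<integral>\<^sup>+y. F y \<partial>vol_on J) < top" and [measurable]: "F \<in> borel_measurable borel"
  shows "(\<integral>\<^sup>+t. indicator {0<..} t * (ennreal (t powr (r - 1)) * emeasure (vol_on J) (dyadic_above J F t)) \<partial>lborel)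
    \<le> ennreal (2 powr r / (r - 1)) * (\<integral>\<^sup>+x. F x powe r \<partial>vol_on J)"
proof -
  interpret M: sigma_finite_measure "vol_on J" by (rule sigma_finite_mu)
  interpret P: pair_sigma_finite "vol_on J" lborel by (simp add: pair_sigma_finite_def sigma_finite_mu lborel.sigma_finite_measure_axioms)
  have "(\<integral>\<^sup>+t. indicator {0<..} t * (ennreal (t powr (r - 1)) * emeasure (vol_on J) (dyadic_above J F t)) \<partial>lborel)
    \<le> (\<integral>\<^sup>+t. \<integral>\<^sup>+x. 2 * F x * (indicator {t. 0 < t \<and> ennreal t < 2 * F x} t * ennreal (t powr (r - 1 - 1))) \<partial>vol_on J \<partial>lborel)"
  proof (intro nn_integral_mono)
    fix t :: real
    show "indicator {0<..} t * (ennreal (t powr (r - 1)) * emeasure (vol_on J) (dyadic_above J F t))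
      \<le> (\<integral>\<^sup>+x. 2 * F x * (indicator {t. 0 < t \<and> ennreal t < 2 * F x} t * ennreal (t powr (r - 1 - 1))) \<partial>vol_on J)"
    proof (cases "0 < t")
      case True
      have "ennreal (t powr (r - 1)) = ennreal (t powr (r - 1 - 1)) * ennreal t"
        using True powr_add[of t "r - 1 - 1" 1] by (simp flip: ennreal_mult)
      then have "ennreal (t powr (r - 1)) * emeasure (vol_on J) (dyadic_above J F t)
        = ennreal (t powr (r - 1 - 1)) * (ennreal t * emeasure (vol_on J) (dyadic_above J F t))" by (simp add: mult.assoc)
      also have "\<dots> \<le> ennreal (t powr (r - 1 - 1)) * (2 * (\<integral>\<^sup>+y. indicator {y. F y > ennreal (t / 2)} y * F y \<partial>vol_on J))"
        by (intro mult_left_mono dyadic_above_truncate[OF J True fin]) auto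
      also have "\<dots> = (\<integral>\<^sup>+x. ennreal (t powr (r - 1 - 1)) * (2 * (indicator {y. F y > ennreal (t / 2)} x * F x)) \<partial>vol_on J)"
        by (simp add: nn_integral_cmult)
      also have "\<dots> = (\<integral>\<^sup>+x. 2 * F x * (indicator {t. 0 < t \<and> ennreal t < 2 * F x} t * ennreal (t powr (r - 1 - 1))) \<partial>vol_on J)"
        using True ennreal_half_less_iff[OF True] by (intro nn_integral_cong) (auto simp: indicator_def ac_simps)
      finally show ?thesis using True by simp
    qed simp
  qed
  also have "\<dots> = (\<integral>\<^sup>+x. \<integral>\<^sup>+t. 2 * F x * (indicator {t. 0 < t \<and> ennreal t < 2 * F x} t * ennreal (t powr (r - 1 - 1))) \<partial>lborel \<partial>vol_on J)"
    by (rule P.Fubini') (simp add: indicator_def[abs_def] of_bool_def)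
  also have "\<dots> = (\<integral>\<^sup>+x. 2 * F x * (ennreal (1 / (r - 1)) * (2 * F x) powe (r - 1)) \<partial>vol_on J)"
    using r by (intro nn_integral_cong) (subst nn_integral_cmult, auto simp: nn_integral_powr_0[of "r - 1", simplified])
  also have "\<dots> = (\<integral>\<^sup>+x. ennreal (2 powr r / (r - 1)) * F x powe r \<partial>vol_on J)"
  proof (intro nn_integral_cong)
    fix x
    have "2 * F x * (ennreal (1 / (r - 1)) * (2 * F x) powe (r - 1)) = ennreal (1 / (r - 1)) * ((2 * F x) powe (1 + (r - 1)))"
      unfolding epow_add by (simp add: ac_simps)
    also have "\<dots> = ennreal (2 powr r / (r - 1)) * F x powe r"
      using r epow_ennreal[of 2 r] by (simp add: epow_mult mult.assoc[symmetric] flip: ennreal_mult)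
    finally show "2 * F x * (ennreal (1 / (r - 1)) * (2 * F x) powe (r - 1)) = ennreal (2 powr r / (r - 1)) * F x powe r" .
  qed
  also have "\<dots> = ennreal (2 powr r / (r - 1)) * (\<integral>\<^sup>+x. F x powe r \<partial>vol_on J)"
    by (rule nn_integral_cmult) simp
  finally show ?thesis .
qed

lemma ennreal_mult_less_cancel:
  assumes "0 < c" shows "ennreal c * a < ennreal c * b \<longleftrightarrow> a < b"
proof -
  have eq: "ennreal (1 / c) * (ennreal c * x) = x" for x
    using assms by (simp add: mult.assoc[symmetric] flip: ennreal_mult)
  have "ennreal c * b \<le> ennreal c * a \<longleftrightarrow> b \<le> a"
    using mult_left_mono[of b a "ennreal c"] mult_left_mono[of "ennreal c * b" "ennreal c * a" "ennreal (1 / c)"]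
    unfolding eq by auto
  then show ?thesis by (simp flip: not_le)
qed

lemma dyadic_above_scale: "0 < c \<Longrightarrow> dyadic_above J F (c * t) = dyadic_above J (\<lambda>x. ennreal (1 / c) * F x) t" if [measurable]: "F \<in> borel_measurable borel"
proof -
  assume c: "0 < c"
  have "(ennreal (c * t) * cube_vol J k < (\<integral>\<^sup>+y. indicator (dyadic_cube J k x) y * F y \<partial>vol_on J))
    \<longleftrightarrow> (ennreal t * cube_vol J k < (\<integral>\<^sup>+y. indicator (dyadic_cube J k x) y * (ennreal (1 / c) * F y) \<partial>vol_on J))" (is "_ < ?A \<longleftrightarrow> _ < ?B") for k x
  proof -
    have B: "?B = ennreal (1 / c) * ?A"
      by (subst nn_integral_cmult[symmetric]) (auto intro!: nn_integral_cong simp: ac_simps)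
    have A: "?A = ennreal c * ?B" using c unfolding B by (simp add: mult.assoc[symmetric] flip: ennreal_mult)
    have eq: "ennreal (c * t) * cube_vol J k = ennreal c * (ennreal t * cube_vol J k)"
      using c by (simp add: ennreal_mult' mult.assoc)
    show ?thesis unfolding A eq using c by (rule ennreal_mult_less_cancel)
  qed
  then show ?thesis by (simp add: dyadic_above_def)
qed

section \<open>Schur estimates for kernels\<close>

lemma nn_integral_lborel_shift:
  fixes f :: "'a::euclidean_space \<Rightarrow> ennreal"
  assumes "f \<in> borel_measurable borel"
  shows "(\<integral>\<^sup>+x. f (c + x) \<partial>lborel) = (\<integral>\<^sup>+x. f x \<partial>lborel)"
  using nn_integral_distr[of "(+) c" lborel borel f] assms by (simp add: lborel_distr_plus)

lemma coord_norm_translate: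
  assumes [measurable]: "g \<in> borel_measurable borel" and j: "j \<in> I"
  shows "coord_norm r j (\<lambda>x. g (u + merge_coords I x 0)) x = coord_norm r j g (u + merge_coords I x 0)"
proof -
  have "u + merge_coords I (upd_coord x j t) 0 = upd_coord (u + merge_coords I x 0) j (u $ j + t)" for t
    using j by (auto simp: vec_eq_iff)
  then show ?thesis unfolding coord_norm_def
    using nn_integral_lborel_shift[of "\<lambda>t. g (upd_coord (u + merge_coords I x 0) j t) powe r" "u $ j"] by simp
qed

text \<open>In each inner coordinate \<open>u\<close> acts as a translation, which preserves
  Lebesgue measure, while the outer coordinates are those of \<open>u\<close> throughout.\<close>

lemma iter_norm_translate:
  assumes "g \<in> borel_measurable borel" "set js \<subseteq> I"
  shows "iter_norm q js (\<lambda>x. g (u + merge_coords I x 0)) x = iter_norm q js g (u + merge_coords I x 0)"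
  using assms
proof (induction js arbitrary: g)
  case (Cons j js)
  have "coord_norm (q $ j) j (\<lambda>x. g (u + merge_coords I x 0)) = (\<lambda>x. coord_norm (q $ j) j g (u + merge_coords I x 0))"
    using Cons.prems by (intro ext coord_norm_translate) auto
  moreover have "iter_norm q js (\<lambda>x. coord_norm (q $ j) j g (u + merge_coords I x 0)) x = iter_norm q js (coord_norm (q $ j) j g) (u + merge_coords I x 0)"
    using Cons.prems by (intro Cons.IH coord_norm_measurable) auto
  ultimately show ?case by (simp only: iter_norm.simps)
qed simp

lemma emeasure_mu_box:
  assumes "0 \<le> r"
  shows "emeasure (vol_on J) {y. \<forall>i\<in>J. \<bar>x $ i - y $ i\<bar> \<le> r} = ennreal ((2 * r) ^ card J)"
proof -
  have m: "{y :: real^'a. \<forall>i\<in>J. \<bar>x $ i - y $ i\<bar> \<le> r} \<in> sets borel" by measurable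
  have "emeasure (vol_on J) {y. \<forall>i\<in>J. \<bar>x $ i - y $ i\<bar> \<le> r}
    = ennreal (\<Prod>i\<in>J. (\<chi> i. x $ i + r) $ i - (\<chi> i. x $ i - r) $ i)"
    using assms by (intro emeasure_mu_between m) (fastforce simp: abs_le_iff)+
  then show ?thesis by (simp add: algebra_simps)
qed

lemma near_measurable [measurable]:
  "{y :: real ^ 'n. \<forall>i\<in>J. \<bar>x $ i - y $ i\<bar> \<le> r} \<in> sets borel"
  "{y :: real ^ 'n. \<forall>i. \<bar>x $ i - y $ i\<bar> \<le> r} \<in> sets borel"
  by measurable

text \<open>Substituting y = u + (inner part of x) turns the dependence on the inner coordinates of
  \<open>x\<close> into a translation of \<open>g\<close>. Minkowski's inequality takes the norm
  under the u-integral, translation invariance removes the shift, and the inner part of the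
  u-integral is merely the volume of a box.\<close>

lemma Schur_box:
  fixes g :: "real ^ 'n \<Rightarrow> ennreal"
  assumes q: "\<forall>j. 1 \<le> q $ j" and [measurable]: "g \<in> borel_measurable borel" and r: "0 \<le> r"
  shows "iter_norm q js (\<lambda>x. \<integral>\<^sup>+y. indicator {y. \<forall>i. \<bar>x $ i - y $ i\<bar> \<le> r} y * g y \<partial>lborel) x
    \<le> ennreal ((2 * r) ^ card (set js)) * (\<integral>\<^sup>+y. indicator {y. \<forall>i\<in>- set js. \<bar>x $ i - y $ i\<bar> \<le> r} y * iter_norm q js g y \<partial>vol_on (- set js))"
proof -
  define I where "I = set js"
  define a where "a u = (indicator {u. \<forall>i\<in>I. \<bar>0 $ i - u $ i\<bar> \<le> r} u :: ennreal)" for u :: "real ^ 'n"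
  define b where "b u x = (if \<forall>i. i \<notin> I \<longrightarrow> \<bar>x $ i - u $ i\<bar> \<le> r then 1 else 0 :: ennreal)" for u x :: "real ^ 'n"
  have [measurable]: "a \<in> borel_measurable borel" unfolding a_def[abs_def] by measurable
  have [measurable]: "(\<lambda>p. b (fst p) (snd p)) \<in> borel_measurable (borel \<Otimes>\<^sub>M borel)" unfolding b_def by measurable
  have [measurable]: "(\<lambda>u. b u x) \<in> borel_measurable borel" for x unfolding b_def by measurable
  have [measurable]: "iter_norm q js g \<in> borel_measurable borel" by measurable
  have "(\<integral>\<^sup>+y. indicator {y. \<forall>i. \<bar>x $ i - y $ i\<bar> \<le> r} y * g y \<partial>lborel)
    = (\<integral>\<^sup>+u. a u * b u x * g (u + merge_coords I x 0) \<partial>lborel)" for x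
    unfolding nn_integral_lborel_shift[of "\<lambda>y. indicator {y. \<forall>i. \<bar>x $ i - y $ i\<bar> \<le> r} y * g y" "merge_coords I x 0", symmetric, simplified]
    by (intro nn_integral_cong) (auto simp: a_def b_def indicator_def add.commute split: if_splits)
  then have "iter_norm q js (\<lambda>x. \<integral>\<^sup>+y. indicator {y. \<forall>i. \<bar>x $ i - y $ i\<bar> \<le> r} y * g y \<partial>lborel) x
    = iter_norm q js (\<lambda>x. \<integral>\<^sup>+u. a u * b u x * g (u + merge_coords I x 0) \<partial>lborel) x" by simp
  also have "\<dots> \<le> (\<integral>\<^sup>+u. iter_norm q js (\<lambda>x. a u * b u x * g (u + merge_coords I x 0)) x \<partial>lborel)"
    by (intro iter_norm_Minkowski[OF q lborel.sigma_finite_measure_axioms]) (simp add: split_beta')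
  also have "\<dots> = (\<integral>\<^sup>+u. a u * b u x * iter_norm q js g u \<partial>lborel)"
  proof (intro nn_integral_cong)
    fix u
    have "iter_norm q js (\<lambda>x. (a u * b u x) * g (u + merge_coords I x 0)) x = (a u * b u x) * iter_norm q js (\<lambda>x. g (u + merge_coords I x 0)) x"
      by (intro iter_norm_cmult_fibre q) (auto simp: b_def I_def)
    also have "iter_norm q js (\<lambda>x. g (u + merge_coords I x 0)) x = iter_norm q js g (u + merge_coords I x 0)"
      by (rule iter_norm_translate) (auto simp: I_def)
    also have "\<dots> = iter_norm q js g u" by (rule iter_norm_indep) (auto simp: I_def)
    finally show "iter_norm q js (\<lambda>x. a u * b u x * g (u + merge_coords I x 0)) x = a u * b u x * iter_norm q js g u" .
  qed
  also have "\<dots> = (\<integral>\<^sup>+p. \<integral>\<^sup>+y. a (merge_coords I p y) * b (merge_coords I p y) x * iter_norm q js g (merge_coords I p y) \<partial>vol_on (- I) \<partial>vol_on I)"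
    using vol_on_split[of "\<lambda>u. a u * b u x * iter_norm q js g u" UNIV I] by (simp add: Compl_eq_Diff_UNIV)
  also have "\<dots> = (\<integral>\<^sup>+p. \<integral>\<^sup>+y. a p * (b y x * iter_norm q js g y) \<partial>vol_on (- I) \<partial>vol_on I)"
  proof (intro nn_integral_cong)
    fix p y
    have "a (merge_coords I p y) = a p" "b (merge_coords I p y) x = b y x" by (auto simp: a_def b_def indicator_def)
    moreover have "iter_norm q js g (merge_coords I p y) = iter_norm q js g y" by (rule iter_norm_indep) (auto simp: I_def)
    ultimately show "a (merge_coords I p y) * b (merge_coords I p y) x * iter_norm q js g (merge_coords I p y) = a p * (b y x * iter_norm q js g y)"
      by (simp add: mult.assoc)
  qed
  also have "\<dots> = (\<integral>\<^sup>+p. a p \<partial>vol_on I) * (\<integral>\<^sup>+y. b y x * iter_norm q js g y \<partial>vol_on (- I))"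
    by (simp add: nn_integral_cmult nn_integral_multc)
  also have "(\<integral>\<^sup>+p. a p \<partial>vol_on I) = ennreal ((2 * r) ^ card I)"
    unfolding a_def using emeasure_mu_box[OF r, of I 0] by (subst nn_integral_indicator) auto
  finally have *: "iter_norm q js (\<lambda>x. \<integral>\<^sup>+y. indicator {y. \<forall>i. \<bar>x $ i - y $ i\<bar> \<le> r} y * g y \<partial>lborel) x
    \<le> ennreal ((2 * r) ^ card I) * (\<integral>\<^sup>+y. b y x * iter_norm q js g y \<partial>vol_on (- I))" .
  have "b y x = indicator {y. \<forall>i\<in>- I. \<bar>x $ i - y $ i\<bar> \<le> r} y" for y
    by (auto simp: b_def indicator_def)
  with * show ?thesis by (simp only: I_def)
qed

text \<open>
  A dyadic majorant of \<open>\<bar>x - y\<bar>\<^bsup>-n-\<epsilon>\<^esup>\<close> for points at distance at least \<open>l\<close>, and the kernel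
  it induces on the coordinates of \<open>J\<close>.
\<close>

definition tail_kernel :: "real \<Rightarrow> real \<Rightarrow> real ^ 'n \<Rightarrow> real ^ 'n \<Rightarrow> ennreal" where
  "tail_kernel \<epsilon> l x y = (\<Sum>k. ennreal ((2 ^ k * l) powr (- real CARD('n) - \<epsilon>)) * indicator {y. \<forall>i. \<bar>x $ i - y $ i\<bar> \<le> 2 ^ Suc k * l} y)"

definition tail_kernel_on :: "'n set \<Rightarrow> real \<Rightarrow> real \<Rightarrow> real ^ 'n \<Rightarrow> real ^ 'n \<Rightarrow> ennreal" where
  "tail_kernel_on J \<epsilon> l x y = (\<Sum>k. ennreal ((2 ^ k * l) powr (- real CARD('n) - \<epsilon>)) * (ennreal ((2 * (2 ^ Suc k * l)) ^ card (- J))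
    * indicator {y. \<forall>i\<in>J. \<bar>x $ i - y $ i\<bar> \<le> 2 ^ Suc k * l} y))"

lemma tail_kernel_measurable [measurable (raw)]:
  assumes [measurable]: "f \<in> borel_measurable M" "g \<in> borel_measurable M"
  shows "(\<lambda>w. tail_kernel \<epsilon> l (f w) (g w)) \<in> borel_measurable M"
proof -
  have [measurable]: "Measurable.pred M (\<lambda>w. \<forall>i. \<bar>f w $ i - g w $ i\<bar> \<le> c)" for c by measurable
  show ?thesis unfolding tail_kernel_def indicator_def mem_Collect_eq of_bool_def by measurable
qed

lemma tail_kernel_on_measurable [measurable (raw)]:
  assumes [measurable]: "f \<in> borel_measurable M" "g \<in> borel_measurable M"
  shows "(\<lambda>w. tail_kernel_on J \<epsilon> l (f w) (g w)) \<in> borel_measurable M"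
proof -
  have [measurable]: "Measurable.pred M (\<lambda>w. \<forall>i\<in>J. \<bar>f w $ i - g w $ i\<bar> \<le> c)" for c by measurable
  show ?thesis unfolding tail_kernel_on_def indicator_def mem_Collect_eq of_bool_def by measurable
qed

lemma tail_kernel_sym: "tail_kernel \<epsilon> l x y = tail_kernel \<epsilon> l y x"
  by (simp add: tail_kernel_def indicator_def abs_minus_commute)

text \<open>\<open>Schur_box\<close> is applied to each dyadic box of the majorant; the volume of
  the inner box becomes the extra factor in \<open>tail_kernel_on\<close>.\<close>

lemma Schur_th:
  fixes g :: "real ^ 'n \<Rightarrow> ennreal"
  assumes q: "\<forall>j. 1 \<le> q $ j" and [measurable]: "g \<in> borel_measurable borel" and l: "0 < l"
  shows "iter_norm q js (\<lambda>x. \<integral>\<^sup>+y. tail_kernel \<epsilon> l x y * g y \<partial>lborel) x \<le> (\<integral>\<^sup>+y. tail_kernel_on (- set js) \<epsilon> l x y * iter_norm q js g y \<partial>vol_on (- set js))"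
proof -
  let ?c = "\<lambda>k. ennreal ((2 ^ k * l) powr (- real CARD('n) - \<epsilon>))"
  let ?B = "\<lambda>k x. \<integral>\<^sup>+y. indicator {y. \<forall>i. \<bar>x $ i - y $ i\<bar> \<le> 2 ^ Suc k * l} y * g y \<partial>lborel"
  have [measurable]: "(\<lambda>x. ?B k x) \<in> borel_measurable borel" for k
  proof -
    have [measurable]: "Measurable.pred (borel \<Otimes>\<^sub>M borel) (\<lambda>p. \<forall>i. \<bar>fst p $ i - snd p $ i\<bar> \<le> 2 ^ Suc k * l)" by measurable
    show ?thesis unfolding indicator_def mem_Collect_eq of_bool_def by measurable
  qed
  have "(\<integral>\<^sup>+y. tail_kernel \<epsilon> l x y * g y \<partial>lborel) = (\<Sum>k. ?c k * ?B k x)" for x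
  proof -
    have "(\<integral>\<^sup>+y. tail_kernel \<epsilon> l x y * g y \<partial>lborel) = (\<integral>\<^sup>+y. (\<Sum>k. ?c k * (indicator {y. \<forall>i. \<bar>x $ i - y $ i\<bar> \<le> 2 ^ Suc k * l} y * g y)) \<partial>lborel)"
      unfolding tail_kernel_def by (simp add: ennreal_suminf_multc[symmetric] mult.assoc)
    also have "\<dots> = (\<Sum>k. ?c k * ?B k x)"
      by (subst nn_integral_suminf) (auto simp: nn_integral_cmult)
    finally show ?thesis .
  qed
  then have "iter_norm q js (\<lambda>x. \<integral>\<^sup>+y. tail_kernel \<epsilon> l x y * g y \<partial>lborel) x = iter_norm q js (\<lambda>x. \<Sum>k. ?c k * ?B k x) x" by simp
  also have "\<dots> \<le> (\<Sum>k. iter_norm q js (\<lambda>x. ?c k * ?B k x) x)" by (rule iter_norm_suminf[OF q]) measurable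
  also have "\<dots> = (\<Sum>k. ?c k * iter_norm q js (?B k) x)"
    by (intro suminf_cong iter_norm_cmult[OF q]) measurable
  also have "\<dots> \<le> (\<Sum>k. ?c k * (ennreal ((2 * (2 ^ Suc k * l)) ^ card (set js)) * (\<integral>\<^sup>+y. indicator {y. \<forall>i\<in>- set js. \<bar>x $ i - y $ i\<bar> \<le> 2 ^ Suc k * l} y * iter_norm q js g y \<partial>vol_on (- set js))))"
    using l by (intro suminf_le mult_left_mono Schur_box q) auto
  also have "\<dots> = (\<integral>\<^sup>+y. tail_kernel_on (- set js) \<epsilon> l x y * iter_norm q js g y \<partial>vol_on (- set js))"
  proof -
    have [measurable]: "iter_norm q js g \<in> borel_measurable borel" by measurable
    show ?thesis unfolding tail_kernel_on_def ennreal_suminf_multc[symmetric]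
      by (subst nn_integral_suminf) (auto simp: nn_integral_cmult mult.assoc intro!: suminf_cong)
  qed
  finally show ?thesis .
qed

text \<open>The box is selected by the largest coordinate difference \<open>R\<close>, which lies
  between 2^k l and 2^(k+1) l for the least admissible \<open>k\<close>. The Euclidean norm is at
  least \<open>R\<close>, so the negative power is bounded by its value at 2^k l.\<close>

lemma tail_kernel_lower:
  fixes x y :: "real ^ 'n"
  assumes l: "0 < l" and \<epsilon>: "0 < \<epsilon>" and far: "l \<le> \<bar>x $ i - y $ i\<bar>"
  shows "ennreal (1 / norm (x - y) powr (real CARD('n) + \<epsilon>)) \<le> tail_kernel \<epsilon> l x y"
proof -
  define R where "R = Max (range (\<lambda>i. \<bar>x $ i - y $ i\<bar>))"
  have R: "\<bar>x $ i - y $ i\<bar> \<le> R" for i unfolding R_def by (rule Max_ge) auto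
  have "R \<in> range (\<lambda>i. \<bar>x $ i - y $ i\<bar>)" unfolding R_def by (rule Max_in) auto
  then have Rn: "R \<le> norm (x - y)" using component_le_norm_cart[of "x - y"] by auto
  have lR: "l \<le> R" using far R[of i] by simp
  obtain m :: nat where "R / l < 2 ^ m" using real_arch_pow[of 2] by auto
  then have "R < 2 ^ Suc m * l" using l lR by (simp add: field_simps)
  define k where "k = (LEAST k. R < 2 ^ Suc k * l)"
  have k1: "R < 2 ^ Suc k * l" unfolding k_def by (rule LeastI) fact
  have k2: "2 ^ k * l \<le> R"
  proof (cases k)
    case (Suc k')
    then show ?thesis using not_less_Least[of k' "\<lambda>k. R < 2 ^ Suc k * l"] unfolding k_def by simp
  qed (use lR in simp)
  have "1 / norm (x - y) powr (real CARD('n) + \<epsilon>) = norm (x - y) powr (- real CARD('n) - \<epsilon>)"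
    unfolding diff_conv_add_uminus minus_add_distrib[symmetric] powr_minus_divide ..
  also have "\<dots> \<le> (2 ^ k * l) powr (- real CARD('n) - \<epsilon>)"
    using l \<epsilon> k2 Rn by (intro powr_mono2') auto
  finally have "ennreal (1 / norm (x - y) powr (real CARD('n) + \<epsilon>))
    \<le> ennreal ((2 ^ k * l) powr (- real CARD('n) - \<epsilon>)) * indicator {y. \<forall>i. \<bar>x $ i - y $ i\<bar> \<le> 2 ^ Suc k * l} y"
    using order_trans[OF R less_imp_le[OF k1]] by (simp add: ennreal_leI)
  also have "\<dots> \<le> tail_kernel \<epsilon> l x y"
  proof -
    have "f k \<le> (\<Sum>k. f k)" for f :: "nat \<Rightarrow> ennreal"
      using sum_le_suminf[OF summableI, of "{k}" f] by simp
    then show ?thesis unfolding tail_kernel_def .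
  qed
  finally show ?thesis .
qed

text \<open>The factor 4 is the ratio of the edge \<open>2 * (2 ^ Suc k * l)\<close> of the k-th box
  to \<open>2 ^ k * l\<close>; the denominator sums the geometric series with ratio 2^(-\<epsilon>).
  The argument of type \<open>itself\<close> carries the dimension.\<close>

definition tail_const :: "'n itself \<Rightarrow> real \<Rightarrow> real" where
  "tail_const _ \<epsilon> = 4 ^ CARD('n) / (1 - 2 powr (- \<epsilon>))"

lemma tail_const_pos: "0 < \<epsilon> \<Longrightarrow> 0 < tail_const TYPE('n::finite) \<epsilon>"
  by (simp add: tail_const_def powr_less_one)

lemma tail_kernel_on_series:
  fixes J :: "'n::finite set"
  assumes l: "0 < l" and \<epsilon>: "0 < \<epsilon>"
  shows "(\<Sum>k. ennreal ((2 ^ k * l) powr (- real CARD('n) - \<epsilon>)) * (ennreal ((2 * (2 ^ Suc k * l)) ^ card (- J))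
    * ennreal ((2 * (2 ^ Suc k * l)) ^ card J))) = ennreal (tail_const TYPE('n) \<epsilon> * l powr (- \<epsilon>))"
proof -
  have card: "card (- J) + card J = CARD('n)"
    using card_Un_disjoint[of "- J" J] by (simp add: Compl_partition2)
  have "(2 ^ k * l) powr (- real CARD('n) - \<epsilon>) * ((2 * (2 ^ Suc k * l)) ^ card (- J) * (2 * (2 ^ Suc k * l)) ^ card J)
    = 4 ^ CARD('n) * l powr (- \<epsilon>) * (2 powr (- \<epsilon>)) ^ k" for k
  proof -
    have "(2 * (2 ^ Suc k * l)) ^ card (- J) * (2 * (2 ^ Suc k * l)) ^ card J = (4 * (2 ^ k * l)) ^ CARD('n)"
      unfolding power_add[symmetric] card by simp
    also have "\<dots> = 4 ^ CARD('n) * (2 ^ k * l) powr real CARD('n)"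
      using l by (simp add: power_mult_distrib powr_realpow)
    finally have "(2 ^ k * l) powr (- real CARD('n) - \<epsilon>) * ((2 * (2 ^ Suc k * l)) ^ card (- J) * (2 * (2 ^ Suc k * l)) ^ card J)
      = 4 ^ CARD('n) * ((2 ^ k * l) powr (- real CARD('n) - \<epsilon>) * (2 ^ k * l) powr real CARD('n))" by simp
    also have "(2 ^ k * l) powr (- real CARD('n) - \<epsilon>) * (2 ^ k * l) powr real CARD('n) = (2 ^ k * l) powr (- \<epsilon>)"
      by (simp flip: powr_add)
    also have "\<dots> = l powr (- \<epsilon>) * (2 powr (- \<epsilon>)) ^ k"
      using l by (simp add: powr_mult powr_powr mult.commute flip: powr_realpow)
    finally show ?thesis by simp
  qed
  then have eq: "ennreal ((2 ^ k * l) powr (- real CARD('n) - \<epsilon>)) * (ennreal ((2 * (2 ^ Suc k * l)) ^ card (- J)) * ennreal ((2 * (2 ^ Suc k * l)) ^ card J))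
    = ennreal (4 ^ CARD('n) * l powr (- \<epsilon>) * (2 powr (- \<epsilon>)) ^ k)" for k
    using l by (simp flip: ennreal_mult)
  have "2 powr (- \<epsilon>) < 1" using \<epsilon> by (simp add: powr_less_one)
  then have "(\<lambda>k. 4 ^ CARD('n) * l powr (- \<epsilon>) * (2 powr (- \<epsilon>)) ^ k) sums (4 ^ CARD('n) * l powr (- \<epsilon>) * (1 / (1 - 2 powr (- \<epsilon>))))"
    by (intro sums_mult geometric_sums) simp
  then have "(\<Sum>k. ennreal (4 ^ CARD('n) * l powr (- \<epsilon>) * (2 powr (- \<epsilon>)) ^ k)) = ennreal (4 ^ CARD('n) * l powr (- \<epsilon>) * (1 / (1 - 2 powr (- \<epsilon>))))"
    by (intro suminf_ennreal_eq) auto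
  then show ?thesis unfolding eq by (simp add: tail_const_def)
qed

lemma tail_kernel_on_integral:
  fixes y :: "real ^ 'n"
  assumes "0 < l" "0 < \<epsilon>"
  shows "(\<integral>\<^sup>+x. tail_kernel_on J \<epsilon> l x y \<partial>vol_on J) = ennreal (tail_const TYPE('n) \<epsilon> * l powr (- \<epsilon>))"
proof -
  have "(\<integral>\<^sup>+x. tail_kernel_on J \<epsilon> l x y \<partial>vol_on J) = (\<integral>\<^sup>+x. (\<Sum>k. ennreal ((2 ^ k * l) powr (- real CARD('n) - \<epsilon>)) * (ennreal ((2 * (2 ^ Suc k * l)) ^ card (- J))
    * indicator {x. \<forall>i\<in>J. \<bar>y $ i - x $ i\<bar> \<le> 2 ^ Suc k * l} x)) \<partial>vol_on J)"
    by (intro nn_integral_cong) (simp add: tail_kernel_on_def indicator_def abs_minus_commute)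
  also have "\<dots> = (\<Sum>k. ennreal ((2 ^ k * l) powr (- real CARD('n) - \<epsilon>)) * (ennreal ((2 * (2 ^ Suc k * l)) ^ card (- J))
    * ennreal ((2 * (2 ^ Suc k * l)) ^ card J)))"
    using assms by (subst nn_integral_suminf) (auto simp: nn_integral_cmult emeasure_mu_box)
  finally show ?thesis using tail_kernel_on_series[OF assms] by simp
qed

text \<open>The k-th box around \<open>x\<close> lies in the neighbourhood of generation \<kappa> +
  k + 1, so each term of the integral is at most \<open>A\<close> times the corresponding term of
  the total mass of the kernel.\<close>

lemma tail_kernel_on_tri:
  fixes x :: "real ^ 'n"
  assumes \<epsilon>: "0 < \<epsilon>" and [measurable]: "F \<in> borel_measurable borel"
    and le: "\<And>k. \<kappa> \<le> k \<Longrightarrow> (\<integral>\<^sup>+y. indicator (neighbours J k x) y * F y \<partial>vol_on J) \<le> A * cube_vol J k"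
  shows "(\<integral>\<^sup>+y. tail_kernel_on J \<epsilon> (side \<kappa>) x y * F y \<partial>vol_on J) \<le> A * ennreal (tail_const TYPE('n) \<epsilon> * side \<kappa> powr (- \<epsilon>))"
proof -
  let ?l = "side \<kappa>"
  let ?c = "\<lambda>k. ennreal ((2 ^ k * ?l) powr (- real CARD('n) - \<epsilon>))"
  let ?d = "\<lambda>k. ennreal ((2 * (2 ^ Suc k * ?l)) ^ card (- J))"
  have "(\<integral>\<^sup>+y. tail_kernel_on J \<epsilon> ?l x y * F y \<partial>vol_on J) = (\<Sum>k. ?c k * (?d k * (\<integral>\<^sup>+y. indicator {y. \<forall>i\<in>J. \<bar>x $ i - y $ i\<bar> \<le> 2 ^ Suc k * ?l} y * F y \<partial>vol_on J)))"
    unfolding tail_kernel_on_def ennreal_suminf_multc[symmetric]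
    by (subst nn_integral_suminf) (auto simp: nn_integral_cmult mult.assoc intro!: suminf_cong)
  also have "\<dots> \<le> (\<Sum>k. A * (?c k * (?d k * ennreal ((2 * (2 ^ Suc k * ?l)) ^ card J))))"
  proof (intro suminf_le)
    fix k
    have side: "2 ^ Suc k * ?l = side (\<kappa> + int (Suc k))" by (simp add: powr_add powr_realpow[symmetric])
    have "(\<integral>\<^sup>+y. indicator {y. \<forall>i\<in>J. \<bar>x $ i - y $ i\<bar> \<le> 2 ^ Suc k * ?l} y * F y \<partial>vol_on J)
      \<le> (\<integral>\<^sup>+y. indicator (neighbours J (\<kappa> + int (Suc k)) x) y * F y \<partial>vol_on J)"
      unfolding side by (intro nn_integral_mono mult_right_mono) (auto simp: indicator_def abs_minus_commute intro!: neighbours_near)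
    also have "\<dots> \<le> A * cube_vol J (\<kappa> + int (Suc k))" by (rule le) simp
    also have "\<dots> \<le> A * ennreal ((2 * (2 ^ Suc k * ?l)) ^ card J)"
      unfolding side cube_vol_def by (intro mult_left_mono ennreal_leI power_mono) auto
    finally show "?c k * (?d k * (\<integral>\<^sup>+y. indicator {y. \<forall>i\<in>J. \<bar>x $ i - y $ i\<bar> \<le> 2 ^ Suc k * ?l} y * F y \<partial>vol_on J))
      \<le> A * (?c k * (?d k * ennreal ((2 * (2 ^ Suc k * ?l)) ^ card J)))"
      by (subst mult.left_commute[of A], subst mult.left_commute[of A]) (intro mult_left_mono, auto)
  qed auto
  also have "\<dots> = A * ennreal (tail_const TYPE('n) \<epsilon> * ?l powr (- \<epsilon>))"
    unfolding ennreal_suminf_cmult using tail_kernel_on_series[of ?l \<epsilon> J] \<epsilon> by simp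
  finally show ?thesis .
qed

section \<open>Bounded functions of bounded support\<close>

text \<open>The bounds hold everywhere and the functions are Borel, so that pieces cut from such a
  function stay in the class and its iterated norms can be computed without exceptional
  sets.\<close>

definition bdd_supp :: "((real, 'n::finite) vec \<Rightarrow> complex) set" where
  "bdd_supp = {f \<in> borel_measurable borel. \<exists>B R. \<forall>x. norm (f x) \<le> B \<and> (f x \<noteq> 0 \<longrightarrow> (\<forall>i. \<bar>x $ i\<bar> \<le> R))}"

abbreviation cnorm :: "('a \<Rightarrow> complex) \<Rightarrow> 'a \<Rightarrow> ennreal" where
  "cnorm f x \<equiv> ennreal (norm (f x))"

lemma bdd_supp_I:
  assumes "f \<in> borel_measurable borel" "\<And>x. norm (f x) \<le> B" "\<And>x i. f x \<noteq> 0 \<Longrightarrow> \<bar>x $ i\<bar> \<le> R"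
  shows "f \<in> bdd_supp"
  using assms unfolding bdd_supp_def by blast

lemma bdd_supp_ex:
  assumes "f \<in> bdd_supp"
  shows "\<exists>B R. 0 < B \<and> 0 < R \<and> (\<forall>x. norm (f x) \<le> B) \<and> (\<forall>x i. f x \<noteq> 0 \<longrightarrow> \<bar>x $ i\<bar> \<le> R)"
proof -
  obtain B R where "\<forall>x. norm (f x) \<le> B \<and> (f x \<noteq> 0 \<longrightarrow> (\<forall>i. \<bar>x $ i\<bar> \<le> R))"
    using assms unfolding bdd_supp_def by blast
  then show ?thesis by (intro exI[of _ "max B 1"] exI[of _ "max R 1"]) (auto simp: le_max_iff_disj)
qed

lemma bdd_supp_measurable [measurable_dest]: "f \<in> bdd_supp \<Longrightarrow> f \<in> borel_measurable borel"
  by (simp add: bdd_supp_def)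

lemma BB_0: "(\<lambda>x. 0) \<in> bdd_supp"
  by (rule bdd_supp_I[of _ 0 0]) auto

lemma bdd_supp_add: assumes f: "f \<in> bdd_supp" and g: "g \<in> bdd_supp" shows "(\<lambda>x. f x + g x) \<in> bdd_supp"
proof -
  note [measurable] = bdd_supp_measurable[OF f] bdd_supp_measurable[OF g]
  obtain B R where "0 < B" "0 < R" and *: "\<forall>x. norm (f x) \<le> B" "\<forall>x i. f x \<noteq> 0 \<longrightarrow> \<bar>x $ i\<bar> \<le> R"
    using bdd_supp_ex[OF f] by blast
  note fb = this(1,2) *[rule_format]
  obtain B' R' where "0 < B'" "0 < R'" and *: "\<forall>x. norm (g x) \<le> B'" "\<forall>x i. g x \<noteq> 0 \<longrightarrow> \<bar>x $ i\<bar> \<le> R'"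
    using bdd_supp_ex[OF g] by blast
  note gb = this(1,2) *[rule_format]
  show ?thesis
  proof (rule bdd_supp_I[of _ "B + B'" "max R R'"])
    show "norm (f x + g x) \<le> B + B'" for x using fb(3)[of x] gb(3)[of x] by norm
    fix x i assume "f x + g x \<noteq> 0"
    then have "f x \<noteq> 0 \<or> g x \<noteq> 0" by auto
    then show "\<bar>x $ i\<bar> \<le> max R R'" using fb(4)[of x i] gb(4)[of x i] by auto
  qed measurable
qed

lemma bdd_supp_le:
  assumes [measurable]: "g \<in> borel_measurable borel" and f: "f \<in> bdd_supp" and le: "\<And>x. norm (g x) \<le> norm (f x)"
  shows "g \<in> bdd_supp"
proof -
  obtain B R where "0 < B" "0 < R" and *: "\<forall>x. norm (f x) \<le> B" "\<forall>x i. f x \<noteq> 0 \<longrightarrow> \<bar>x $ i\<bar> \<le> R"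
    using bdd_supp_ex[OF f] by blast
  note fb = this(1,2) *[rule_format]
  show ?thesis
  proof (rule bdd_supp_I[of _ B R])
    show "norm (g x) \<le> B" for x using le[of x] fb(3)[of x] by simp
    fix x i assume "g x \<noteq> 0"
    then have "f x \<noteq> 0" using le[of x] by auto
    then show "\<bar>x $ i\<bar> \<le> R" by (rule fb(4))
  qed simp
qed

lemma bdd_supp_uminus: "f \<in> bdd_supp \<Longrightarrow> (\<lambda>x. - f x) \<in> bdd_supp"
  by (rule bdd_supp_le[of _ f]) (auto dest: bdd_supp_measurable)

lemma bdd_supp_indicator: "f \<in> bdd_supp \<Longrightarrow> S \<in> sets borel \<Longrightarrow> (\<lambda>x. indicator S x *\<^sub>R f x) \<in> bdd_supp"
  by (rule bdd_supp_le[of _ f]) (auto dest: bdd_supp_measurable simp: indicator_def)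

lemma bdd_supp_sum: "(\<And>s. s \<in> S \<Longrightarrow> f s \<in> bdd_supp) \<Longrightarrow> (\<lambda>x. \<Sum>s\<in>S. f s x) \<in> bdd_supp"
  by (induction S rule: infinite_finite_induct) (auto intro: BB_0 bdd_supp_add)

lemma epow_of_bool [simp]: "of_bool P powe s = of_bool P"
  by (cases P) auto

lemma epow_indicator [simp]: "indicator A x powe s = indicator A x"
  by (simp add: indicator_def)

lemma coord_norm_indicator:
  assumes "1 \<le> q" "j \<in> A" "0 \<le> R"
  shows "coord_norm q j (indicator {x. \<forall>i\<in>A. \<bar>x $ i\<bar> \<le> R}) x
    = ennreal ((2 * R) powr (1 / q)) * indicator {x. \<forall>i\<in>A - {j}. \<bar>x $ i\<bar> \<le> R} x"
proof -
  have *: "indicator {x. \<forall>i\<in>A. \<bar>x $ i\<bar> \<le> R} (upd_coord x j t) powe q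
    = indicator {x. \<forall>i\<in>A - {j}. \<bar>x $ i\<bar> \<le> R} x * indicator {- R..R} t" for t
    using \<open>j \<in> A\<close> by (auto simp: indicator_def)
  have "emeasure lborel {- R..R} = ennreal (2 * R)" using \<open>0 \<le> R\<close> by simp
  then show ?thesis unfolding coord_norm_def *
    by (simp add: nn_integral_cmult_indicator epow_mult) (auto simp: indicator_def epow_ennreal \<open>0 \<le> R\<close>)
qed

lemma iter_norm_indicator_finite:
  assumes q: "\<forall>j. 1 \<le> q $ j" and "distinct js" "set js \<subseteq> A" "0 \<le> R"
  shows "\<exists>c::real. 0 \<le> c \<and> (\<forall>x. iter_norm q js (indicator {x. \<forall>i\<in>A. \<bar>x $ i\<bar> \<le> R}) x
    = ennreal c * indicator {x. \<forall>i\<in>A - set js. \<bar>x $ i\<bar> \<le> R} x)"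
  using assms(2-)
proof (induction js arbitrary: A)
  case Nil
  show ?case by (rule exI[of _ 1]) simp
next
  case (Cons j js)
  have j: "1 \<le> q $ j" using q by blast
  obtain c :: real where c: "0 \<le> c" "\<forall>x. iter_norm q js (indicator {x. \<forall>i\<in>A - {j}. \<bar>x $ i\<bar> \<le> R}) x
    = ennreal c * indicator {x. \<forall>i\<in>A - {j} - set js. \<bar>x $ i\<bar> \<le> R} x"
    using Cons.IH[of "A - {j}"] Cons.prems by auto
  have [measurable]: "(indicator {x :: real^'a. \<forall>i\<in>A - {j}. \<bar>x $ i\<bar> \<le> R} :: _ \<Rightarrow> ennreal) \<in> borel_measurable borel"
    by measurable
  have eq: "A - {j} - set js = A - set (j # js)" by auto
  have "coord_norm (q $ j) j (indicator {x. \<forall>i\<in>A. \<bar>x $ i\<bar> \<le> R})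
    = (\<lambda>x. ennreal ((2 * R) powr (1 / (q $ j))) * indicator {x. \<forall>i\<in>A - {j}. \<bar>x $ i\<bar> \<le> R} x)"
    using j Cons.prems by (intro ext coord_norm_indicator) auto
  then have "iter_norm q (j # js) (indicator {x. \<forall>i\<in>A. \<bar>x $ i\<bar> \<le> R}) x
    = ennreal ((2 * R) powr (1 / (q $ j))) * iter_norm q js (indicator {x. \<forall>i\<in>A - {j}. \<bar>x $ i\<bar> \<le> R}) x" for x
    using iter_norm_cmult[OF q, of "indicator {x. \<forall>i\<in>A - {j}. \<bar>x $ i\<bar> \<le> R}" js] by simp
  then have "iter_norm q (j # js) (indicator {x. \<forall>i\<in>A. \<bar>x $ i\<bar> \<le> R}) x
    = ennreal ((2 * R) powr (1 / (q $ j)) * c) * indicator {x. \<forall>i\<in>A - set (j # js). \<bar>x $ i\<bar> \<le> R} x" for x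
    using c(1) unfolding c(2)[rule_format] eq by (simp add: ennreal_mult mult.assoc)
  then show ?case using c(1) by (intro exI[of _ "(2 * R) powr (1 / (q $ j)) * c"]) auto
qed

lemma iter_norm_BB:
  assumes q: "\<forall>j. 1 \<le> q $ j" and js: "distinct js" and f: "f \<in> bdd_supp"
  shows "\<exists>c R :: real. 0 \<le> c \<and> 0 \<le> R \<and> (\<forall>x. iter_norm q js (cnorm f) x \<le> ennreal c * indicator {x. \<forall>i\<in>- set js. \<bar>0 $ i - x $ i\<bar> \<le> R} x)"
proof -
  obtain B R where "0 < B" "0 < R" and *: "\<forall>x. norm (f x) \<le> B" "\<forall>x i. f x \<noteq> 0 \<longrightarrow> \<bar>x $ i\<bar> \<le> R"
    using bdd_supp_ex[OF f] by blast
  note fb = this(1,2) *[rule_format]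
  obtain c :: real where c: "0 \<le> c" "\<forall>x. iter_norm q js (indicator {x. \<forall>i\<in>UNIV. \<bar>x $ i\<bar> \<le> R}) x
    = ennreal c * indicator {x. \<forall>i\<in>UNIV - set js. \<bar>x $ i\<bar> \<le> R} x"
    using iter_norm_indicator_finite[OF q js subset_UNIV, of R] fb by auto
  have m: "(indicator {x :: real^'a. \<forall>i\<in>UNIV. \<bar>x $ i\<bar> \<le> R} :: _ \<Rightarrow> ennreal) \<in> borel_measurable borel"
    by measurable
  have "iter_norm q js (cnorm f) x \<le> ennreal (B * c) * indicator {x. \<forall>i\<in>- set js. \<bar>0 $ i - x $ i\<bar> \<le> R} x" for x
  proof -
    have "iter_norm q js (cnorm f) x \<le> iter_norm q js (\<lambda>x. ennreal B * indicator {x. \<forall>i\<in>UNIV. \<bar>x $ i\<bar> \<le> R} x) x"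
    proof (intro iter_norm_mono[OF q])
      fix y
      show "cnorm f y \<le> ennreal B * indicator {x. \<forall>i\<in>UNIV. \<bar>x $ i\<bar> \<le> R} y"
      proof (cases "f y = 0")
        case False
        then have "\<forall>i\<in>UNIV. \<bar>y $ i\<bar> \<le> R" using fb(4) by blast
        then show ?thesis using fb(3)[of y] by (simp add: ennreal_leI)
      qed simp
    qed
    also have "\<dots> = ennreal B * (ennreal c * indicator {x. \<forall>i\<in>UNIV - set js. \<bar>x $ i\<bar> \<le> R} x)"
      unfolding iter_norm_cmult[OF q m] c(2)[rule_format] ..
    finally show ?thesis using c(1) fb(1) by (simp add: ennreal_mult mult.assoc Compl_eq_Diff_UNIV)
  qed
  moreover have "0 \<le> B * c" "0 \<le> R" using c(1) fb(1,2) by auto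
  ultimately show ?thesis by blast
qed

text \<open>The a priori finiteness behind the stopping cubes and the absorption argument: the inner
  norm is dominated by a multiple of the indicator of a bounded box in the outer
  coordinates.\<close>

lemma iter_norm_BB_integral:
  assumes q: "\<forall>j. 1 \<le> q $ j" and js: "distinct js" and f: "f \<in> bdd_supp" and s: "0 < s"
  shows "(\<integral>\<^sup>+x. iter_norm q js (cnorm f) x powe s \<partial>vol_on (- set js)) < top"
proof -
  obtain c R :: real where c: "0 \<le> c" "0 \<le> R" "\<forall>x. iter_norm q js (cnorm f) x \<le> ennreal c * indicator {x. \<forall>i\<in>- set js. \<bar>0 $ i - x $ i\<bar> \<le> R} x"
    using iter_norm_BB[OF q js f] by blast
  note c = c(1,2) c(3)[rule_format]
  have "(\<integral>\<^sup>+x. iter_norm q js (cnorm f) x powe s \<partial>vol_on (- set js)) \<le> (\<integral>\<^sup>+x. ennreal (c powr s) * indicator {x. \<forall>i\<in>- set js. \<bar>0 $ i - x $ i\<bar> \<le> R} x \<partial>vol_on (- set js))"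
  proof (intro nn_integral_mono)
    fix x
    show "iter_norm q js (cnorm f) x powe s \<le> ennreal (c powr s) * indicator {x. \<forall>i\<in>- set js. \<bar>0 $ i - x $ i\<bar> \<le> R} x"
      using epow_mono[OF c(3)[of x], of s] s c(1) by (simp add: epow_mult epow_ennreal)
  qed
  also have "\<dots> = ennreal (c powr s) * ennreal ((2 * R) ^ card (- set js))"
    using c by (subst nn_integral_cmult_indicator) (auto simp: emeasure_mu_box[of R _ 0, simplified])
  also have "\<dots> < top" by (simp add: ennreal_mult_less_top)
  finally show ?thesis .
qed

lemma iter_norm_BB_integral1:
  assumes "\<forall>j. 1 \<le> q $ j" "distinct js" "f \<in> bdd_supp"
  shows "(\<integral>\<^sup>+x. iter_norm q js (cnorm f) x \<partial>vol_on (- set js)) < top"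
  using iter_norm_BB_integral[OF assms, of 1] by simp

section \<open>Iterated norms over fixed outer coordinates\<close>

lemma coord_norm_mrg: "j \<in> I \<Longrightarrow> coord_norm r j (\<lambda>x. g (merge_coords I x w)) x = coord_norm r j g (merge_coords I x w)"
proof -
  assume "j \<in> I"
  then have "merge_coords I (upd_coord x j t) w = upd_coord (merge_coords I x w) j t" for t
    by (auto simp: vec_eq_iff)
  then show ?thesis by (simp add: coord_norm_def)
qed

lemma iter_norm_mrg:
  assumes "set js \<subseteq> I"
  shows "iter_norm q js (\<lambda>x. g (merge_coords I x w)) x = iter_norm q js g (merge_coords I x w)"
  using assms
proof (induction js arbitrary: g)
  case (Cons j js)
  have "coord_norm (q $ j) j (\<lambda>x. g (merge_coords I x w)) = (\<lambda>x. coord_norm (q $ j) j g (merge_coords I x w))"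
    using Cons.prems by (intro ext coord_norm_mrg) auto
  moreover have "iter_norm q js (\<lambda>x. coord_norm (q $ j) j g (merge_coords I x w)) x = iter_norm q js (coord_norm (q $ j) j g) (merge_coords I x w)"
    using Cons.prems by (intro Cons.IH) auto
  ultimately show ?case by (simp only: iter_norm.simps)
qed simp

lemma iter_norm_mrg': "iter_norm q js (\<lambda>x. g (merge_coords (set js) x w)) x = iter_norm q js g w"
  using iter_norm_mrg[of js "set js" q g w x] iter_norm_indep[of js "merge_coords (set js) x w" w q g] by simp

lemma iter_norm_indicator_mult:
  assumes "\<forall>j. 1 \<le> q $ j" "F \<in> borel_measurable borel" "depends_on (- set js) (\<lambda>x. x \<in> S)"
  shows "iter_norm q js (\<lambda>x. indicator S x * F x) x = indicator S x * iter_norm q js F x"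
proof (rule iter_norm_cmult_fibre[OF assms(1,2)])
  fix x y :: "real ^ 'a" assume "\<And>i. i \<notin> set js \<Longrightarrow> x $ i = y $ i"
  then have "(x \<in> S) = (y \<in> S)" by (intro jdepD[OF assms(3)]) auto
  then show "(indicator S x :: ennreal) = indicator S y" by (simp add: indicator_def)
qed

lemma dyadic_index_jdep: "(\<And>i. i \<in> J \<Longrightarrow> x $ i = y $ i) \<Longrightarrow> dyadic_index J k x = dyadic_index J k y"
  by (auto simp: dyadic_index_def)

lemma depends_on_cb: "depends_on J (\<lambda>x. x \<in> index_cube J s)"
  unfolding depends_on_def
proof (intro allI impI)
  fix x y :: "real ^ 'a" assume "\<forall>i\<in>J. x $ i = y $ i"
  then have "dyadic_index J (fst s) x = dyadic_index J (fst s) y" by (intro dyadic_index_jdep) auto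
  then show "(x \<in> index_cube J s) = (y \<in> index_cube J s)" by (simp add: index_cube_def)
qed

lemma depends_on_tri: "depends_on J (\<lambda>x. x \<in> neighbours J k z)"
  unfolding depends_on_def by (auto simp: neighbours_def dyadic_index_def)

text \<open>The exchange concerns outer coordinates only, whereas \<open>vol_on (- I)\<close>
  restricts the inner coordinates of the second point, so the product measure is preserved. The
  lemma serves to move an average from a function onto the kernel.\<close>

lemma pair_swap_mu:
  fixes I :: "'n::finite set"
  defines "P \<equiv> lborel \<Otimes>\<^sub>M vol_on (- I)"
  shows "distr P P (\<lambda>p. (merge_coords I (fst p) (snd p), merge_coords I (snd p) (fst p))) = P"
proof (rule measure_eqI)
  interpret M: sigma_finite_measure "vol_on (- I)" by (rule sigma_finite_mu)
  let ?\<Psi> = "\<lambda>p. (merge_coords I (fst p) (snd p), merge_coords I (snd p) (fst p)) :: (real ^ 'n) \<times> (real ^ 'n)"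
  have sP: "sets P = sets (borel \<Otimes>\<^sub>M borel)" unfolding P_def by (intro sets_pair_measure_cong) auto
  have spP: "space P = UNIV" unfolding P_def by (simp add: space_pair_measure)
  have \<Psi>: "?\<Psi> \<in> measurable P P"
    unfolding measurable_cong_sets[OF sP sP] by measurable
  have nn: "emeasure P X = (\<integral>\<^sup>+x. \<integral>\<^sup>+y. indicator X (x, y) * indicator (ucube (- I)) y \<partial>lborel \<partial>lborel)"
    if [measurable]: "X \<in> sets (borel \<Otimes>\<^sub>M borel)" for X
  proof -
    have [measurable]: "X \<in> sets (lborel \<Otimes>\<^sub>M vol_on (- I))" using that sP unfolding P_def by simp
    have "emeasure P X = (\<integral>\<^sup>+x. \<integral>\<^sup>+y. indicator X (x, y) \<partial>vol_on (- I) \<partial>lborel)"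
      unfolding P_def by (rule M.emeasure_pair_measure) simp
    also have "\<dots> = (\<integral>\<^sup>+x. \<integral>\<^sup>+y. indicator X (x, y) * indicator (ucube (- I)) y \<partial>lborel \<partial>lborel)"
      by (intro nn_integral_cong) (subst nn_integral_mu, auto simp: mult.commute)
    finally show ?thesis .
  qed
  show "sets (distr P P ?\<Psi>) = sets P" by simp
  fix X assume "X \<in> sets (distr P P ?\<Psi>)"
  then have XP: "X \<in> sets P" and [measurable]: "X \<in> sets (borel \<Otimes>\<^sub>M borel)" by (auto simp: sP)
  have Xm: "?\<Psi> -` X \<in> sets (borel \<Otimes>\<^sub>M borel)"
    using measurable_sets[OF \<Psi> XP] by (simp add: spP sP)
  have "emeasure (distr P P ?\<Psi>) X = emeasure P (?\<Psi> -` X)"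
    using \<Psi> XP by (subst emeasure_distr) (auto simp: spP)
  also have "\<dots> = (\<integral>\<^sup>+x. \<integral>\<^sup>+y. indicator (?\<Psi> -` X) (x, y) * indicator (ucube (- I)) y \<partial>lborel \<partial>lborel)"
    by (rule nn[OF Xm])
  also have "\<dots> = (\<integral>\<^sup>+x. \<integral>\<^sup>+y. indicator X (merge_coords I x y, merge_coords I y x) * indicator (ucube (- I)) (merge_coords I y x) \<partial>lborel \<partial>lborel)"
    by (intro nn_integral_cong) (auto simp: indicator_def ucube_def)
  also have "\<dots> = (\<integral>\<^sup>+x. \<integral>\<^sup>+y. indicator X (x, y) * indicator (ucube (- I)) y \<partial>lborel \<partial>lborel)"
    using nn_integral_swap[of "\<lambda>(x, y). indicator X (x, y) * indicator (ucube (- I)) y" I] by simp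
  also have "\<dots> = emeasure P X" by (rule nn[symmetric]) simp
  finally show "emeasure (distr P P ?\<Psi>) X = emeasure P X" .
qed

section \<open>Averages over cubes in the outer coordinates\<close>

text \<open>The average of the vector-valued function of the outer coordinates, taken pointwise: the
  inner coordinates stay those of \<open>y\<close> while the outer ones run over the cube.\<close>

definition cube_avg :: "'n set \<Rightarrow> (real ^ 'n \<Rightarrow> complex) \<Rightarrow> int \<times> ('n \<Rightarrow> int) \<Rightarrow> real ^ 'n \<Rightarrow> complex" where
  "cube_avg I g s y = (LINT w|vol_on (- I). indicator (index_cube (- I) s) w *\<^sub>R g (merge_coords I y w)) /\<^sub>R (side (fst s) ^ card (- I))"

lemma cube_avg_measurable [measurable]:
  assumes [measurable]: "g \<in> borel_measurable borel"
  shows "cube_avg I g s \<in> borel_measurable borel"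
proof -
  interpret M: sigma_finite_measure "vol_on (- I)" by (rule sigma_finite_mu)
  show ?thesis unfolding cube_avg_def[abs_def] by measurable
qed

text \<open>Holds for non-integrable functions as well, whose Bochner integral is 0 by
  convention.\<close>

lemma norm_lint_le: "ennreal (norm (LINT x|M. f x)) \<le> (\<integral>\<^sup>+x. ennreal (norm (f x)) \<partial>M)"
  for f :: "'a \<Rightarrow> 'b::{banach, second_countable_topology}"
  by (cases "integrable M f") (auto simp: integral_norm_bound_ennreal not_integrable_integral_eq)

lemma cube_avg_norm:
  assumes [measurable]: "g \<in> borel_measurable borel" and s: "s = (fst s, dyadic_index (- I) (fst s) x0)"
  shows "cube_vol (- I) (fst s) * cnorm (cube_avg I g s) y \<le> (\<integral>\<^sup>+w. indicator (index_cube (- I) s) w * cnorm g (merge_coords I y w) \<partial>vol_on (- I))"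
proof -
  have pos: "0 < side (fst s) ^ card (- I)" by simp
  have "cube_vol (- I) (fst s) * cnorm (cube_avg I g s) y = ennreal (norm (LINT w|vol_on (- I). indicator (index_cube (- I) s) w *\<^sub>R g (merge_coords I y w)))"
    unfolding cube_avg_def cube_vol_def using pos by (simp add: field_simps flip: ennreal_mult)
  also have "\<dots> \<le> (\<integral>\<^sup>+w. cnorm (\<lambda>w. indicator (index_cube (- I) s) w *\<^sub>R g (merge_coords I y w)) w \<partial>vol_on (- I))" by (rule norm_lint_le)
  also have "\<dots> = (\<integral>\<^sup>+w. indicator (index_cube (- I) s) w * cnorm g (merge_coords I y w) \<partial>vol_on (- I))"
    by (intro nn_integral_cong) (auto simp: indicator_def)
  finally show ?thesis .
qed

lemma cube_avg_bound:
  assumes [measurable]: "g \<in> borel_measurable borel" and s: "s = (fst s, dyadic_index (- I) (fst s) x0)"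
    and g: "\<And>x. norm (g x) \<le> B" "0 \<le> B"
  shows "norm (cube_avg I g s y) \<le> B"
proof -
  have e: "emeasure (vol_on (- I)) (index_cube (- I) s) = cube_vol (- I) (fst s)" by (subst s) (rule emeasure_dy)
  have "cube_vol (- I) (fst s) * cnorm (cube_avg I g s) y \<le> (\<integral>\<^sup>+w. indicator (index_cube (- I) s) w * cnorm g (merge_coords I y w) \<partial>vol_on (- I))"
    by (rule cube_avg_norm[OF _ s]) simp
  also have "\<dots> \<le> (\<integral>\<^sup>+w. indicator (index_cube (- I) s) w * ennreal B \<partial>vol_on (- I))"
    using g by (intro nn_integral_mono mult_left_mono ennreal_leI) auto
  also have "\<dots> = ennreal B * cube_vol (- I) (fst s)" by (simp add: indicator_mult_const e)
  finally have "ennreal (side (fst s) ^ card (- I) * norm (cube_avg I g s y)) \<le> ennreal (side (fst s) ^ card (- I) * B)"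
    using g(2) unfolding cube_vol_def by (simp add: mult.commute flip: ennreal_mult)
  then have "side (fst s) ^ card (- I) * norm (cube_avg I g s y) \<le> side (fst s) ^ card (- I) * B"
    using g(2) by (subst (asm) ennreal_le_iff) auto
  then show ?thesis by simp
qed

text \<open>Minkowski's inequality: the inner norm of an average is at most the average of the inner
  norms. It bounds the good part of the Calderon-Zygmund decomposition.\<close>

lemma iter_norm_av:
  assumes q: "\<forall>j. 1 \<le> q $ j" and [measurable]: "g \<in> borel_measurable borel"
    and s: "s = (fst s, dyadic_index (- set js) (fst s) x0)"
  shows "cube_vol (- set js) (fst s) * iter_norm q js (cnorm (cube_avg (set js) g s)) x
    \<le> (\<integral>\<^sup>+w. indicator (index_cube (- set js) s) w * iter_norm q js (cnorm g) w \<partial>vol_on (- set js))"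
proof -
  let ?I = "set js"
  have "cube_vol (- ?I) (fst s) * iter_norm q js (cnorm (cube_avg ?I g s)) x = iter_norm q js (\<lambda>y. cube_vol (- ?I) (fst s) * cnorm (cube_avg ?I g s) y) x"
    by (rule iter_norm_cmult[OF q, symmetric]) simp
  also have "\<dots> \<le> iter_norm q js (\<lambda>y. \<integral>\<^sup>+w. indicator (index_cube (- ?I) s) w * cnorm g (merge_coords ?I y w) \<partial>vol_on (- ?I)) x"
    by (intro iter_norm_mono[OF q] cube_avg_norm[OF _ s]) simp
  also have "\<dots> \<le> (\<integral>\<^sup>+w. iter_norm q js (\<lambda>y. indicator (index_cube (- ?I) s) w * cnorm g (merge_coords ?I y w)) x \<partial>vol_on (- ?I))"
    by (intro iter_norm_Minkowski[OF q sigma_finite_mu]) measurable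
  also have "\<dots> = (\<integral>\<^sup>+w. indicator (index_cube (- ?I) s) w * iter_norm q js (cnorm g) w \<partial>vol_on (- ?I))"
    by (intro nn_integral_cong) (subst iter_norm_cmult[OF q], simp, subst iter_norm_mrg'[of q js "cnorm g"], simp)
  finally show ?thesis .
qed

text \<open>Subtracting the average removes the mean over the outer cube for each choice of the
  inner coordinates; \<open>bad_part_kernel\<close> exploits this cancellation.\<close>

definition bad_part :: "'n set \<Rightarrow> (real ^ 'n \<Rightarrow> complex) \<Rightarrow> int \<times> ('n \<Rightarrow> int) \<Rightarrow> real ^ 'n \<Rightarrow> complex" where
  "bad_part I g s y = indicator (index_cube (- I) s) y *\<^sub>R (g y - cube_avg I g s y)"

lemma bad_part_BB:
  assumes g: "g \<in> bdd_supp" and s: "s = (fst s, dyadic_index (- I) (fst s) x0)"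
  shows "bad_part I g s \<in> bdd_supp"
proof -
  obtain B R where "0 < B" "0 < R" and *: "\<forall>x. norm (g x) \<le> B" "\<forall>x i. g x \<noteq> 0 \<longrightarrow> \<bar>x $ i\<bar> \<le> R"
    using bdd_supp_ex[OF g] by blast
  note fb = this(1,2) *[rule_format]
  note [measurable] = bdd_supp_measurable[OF g]
  define M where "M = Max (range (\<lambda>i. \<bar>x0 $ i\<bar>))"
  have M: "\<bar>x0 $ i\<bar> \<le> M" for i unfolding M_def by (rule Max_ge) auto
  show ?thesis
  proof (rule bdd_supp_I[of _ "2 * B" "max R (M + side (fst s))"])
    show "bad_part I g s \<in> borel_measurable borel" unfolding bad_part_def[abs_def] by measurable
    fix y
    have "norm (cube_avg I g s y) \<le> B" using fb by (intro cube_avg_bound[OF _ s]) auto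
    then have "norm (g y - cube_avg I g s y) \<le> 2 * B" using fb(3)[of y] by norm
    then show "norm (bad_part I g s y) \<le> 2 * B" using fb(1) by (auto simp: bad_part_def indicator_def)
    fix i assume "bad_part I g s y \<noteq> 0"
    then have y: "y \<in> dyadic_cube (- I) (fst s) x0" and ne: "g y - cube_avg I g s y \<noteq> 0"
      unfolding s[symmetric] by (auto simp: bad_part_def indicator_def split: if_splits)
    show "\<bar>y $ i\<bar> \<le> max R (M + side (fst s))"
    proof (cases "i \<in> I")
      case True
      show ?thesis
      proof (rule ccontr)
        assume "\<not> ?thesis"
        \<comment> \<open>With an inner coordinate beyond \<open>R\<close>, all points that enter
          the average lie outside the support too, so the average vanishes together with
          \<open>g\<close>.\<close>
        then have "R < \<bar>y $ i\<bar>" by simp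
        then have "g y = 0" "g (merge_coords I y w) = 0" for w using fb(4)[of y i] fb(4)[of "merge_coords I y w" i] True by force+
        then show False using ne by (simp add: cube_avg_def)
      qed
    next
      case False
      then have "\<bar>y $ i - x0 $ i\<bar> \<le> side (fst s)" using dyadic_cube_dist[OF y self_dy, of i] by simp
      then show ?thesis using M[of i] by linarith
    qed
  qed
qed

section \<open>Calderon-Zygmund operators on bounded functions of bounded support\<close>

lemma mem_cbox_abs:
  fixes y :: "real ^ 'n"
  shows "y \<in> cbox (\<chi> i. - R) (\<chi> i. R) \<longleftrightarrow> (\<forall>i. \<bar>y $ i\<bar> \<le> R)"
  unfolding mem_box_cart by (auto simp: abs_le_iff minus_le_iff)

locale cz_kernel =
  fixes k :: "real ^ 'n::finite \<Rightarrow> real ^ 'n \<Rightarrow> complex"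
    and A \<epsilon> :: real
  assumes A: "0 < A" and \<epsilon>: "0 < \<epsilon>"
    and k_size: "\<And>x y. x \<noteq> y \<Longrightarrow> norm (k x y) \<le> A * norm (x - y) powr (- real CARD('n))"
    and k_left: "\<And>x y z. x \<noteq> y \<Longrightarrow> 2 * norm (x - z) \<le> norm (x - y) \<Longrightarrow>
      norm (k x y - k z y) \<le> A * (norm (x - z) powr \<epsilon> / norm (x - y) powr (real CARD('n) + \<epsilon>))"
    and k_right: "\<And>x y z. x \<noteq> y \<Longrightarrow> 2 * norm (x - z) \<le> norm (x - y) \<Longrightarrow>
      norm (k y x - k y z) \<le> A * (norm (x - z) powr \<epsilon> / norm (x - y) powr (real CARD('n) + \<epsilon>))"
begin

text \<open>Smoothness in the second variable gives continuity off the diagonal, and with it the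
  Borel measurability of \<open>k x\<close> on which the kernel integrals rely.\<close>

lemma k_continuous: "continuous_on (- {x}) (k x)"
  unfolding continuous_on_def
proof
  fix y0 assume "y0 \<in> - {x}"
  then have ne: "y0 \<noteq> x" by simp
  have "((\<lambda>y. k x y - k x y0) \<longlongrightarrow> 0) (at y0)"
  proof (rule Lim_null_comparison)
    have "eventually (\<lambda>y. dist y y0 < norm (y0 - x) / 2) (at y0)"
      unfolding eventually_at using ne by (intro exI[of _ "norm (y0 - x) / 2"]) auto
    then show "eventually (\<lambda>y. norm (k x y - k x y0) \<le> A * (norm (y0 - y) powr \<epsilon> / norm (y0 - x) powr (real CARD('n) + \<epsilon>))) (at y0)"
    proof (rule eventually_mono)
      fix y assume "dist y y0 < norm (y0 - x) / 2"
      then have "2 * norm (y0 - y) \<le> norm (y0 - x)" by (simp add: dist_norm norm_minus_commute)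
      from k_right[OF ne this] show "norm (k x y - k x y0) \<le> A * (norm (y0 - y) powr \<epsilon> / norm (y0 - x) powr (real CARD('n) + \<epsilon>))"
        by (simp add: norm_minus_commute)
    qed
    have n0: "((\<lambda>y. norm (y0 - y)) \<longlongrightarrow> norm (y0 - y0)) (at y0)" by (intro tendsto_intros)
    have "((\<lambda>y. norm (y0 - y) powr \<epsilon>) \<longlongrightarrow> norm (y0 - y0) powr \<epsilon>) (at y0)"
      using \<epsilon> by (intro tendsto_powr'[OF n0 tendsto_const]) auto
    then have "((\<lambda>y. norm (y0 - y) powr \<epsilon>) \<longlongrightarrow> 0) (at y0)" using \<epsilon> by simp
    then show "((\<lambda>y. A * (norm (y0 - y) powr \<epsilon> / norm (y0 - x) powr (real CARD('n) + \<epsilon>))) \<longlongrightarrow> 0) (at y0)"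
      by (intro tendsto_mult_right_zero tendsto_divide_zero)
  qed
  then have "(k x \<longlongrightarrow> k x y0) (at y0)" by (simp add: LIM_zero_iff)
  then show "(k x \<longlongrightarrow> k x y0) (at y0 within - {x})" by (rule tendsto_within_subset) simp
qed

lemma k_measurable: "(\<lambda>y. indicator (- {x}) y *\<^sub>R k x y) \<in> borel_measurable borel"
  by (rule borel_measurable_continuous_on_indicator[OF _ k_continuous]) simp

lemma k_far: "0 < d \<Longrightarrow> d \<le> norm (x - y) \<Longrightarrow> norm (k x y) \<le> A * d powr (- real CARD('n))"
proof -
  assume d: "0 < d" "d \<le> norm (x - y)"
  then have "norm (k x y) \<le> A * norm (x - y) powr (- real CARD('n))" by (intro k_size) auto
  also have "\<dots> \<le> A * d powr (- real CARD('n))"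
    using A d by (intro mult_left_mono powr_mono2') auto
  finally show ?thesis .
qed

text \<open>The value of the kernel on the diagonal is arbitrary; \<open>f x = 0\<close> removes it
  from the product.\<close>

lemma k_times_measurable:
  assumes [measurable]: "f \<in> borel_measurable borel" and "f x = 0"
  shows "(\<lambda>y. k x y * f y) \<in> borel_measurable borel"
proof -
  note [measurable] = k_measurable[of x]
  have "(\<lambda>y. k x y * f y) = (\<lambda>y. (indicator (- {x}) y *\<^sub>R k x y) * f y)"
    using assms(2) by (auto simp: indicator_def)
  also have "\<dots> \<in> borel_measurable borel" by measurable
  finally show ?thesis .
qed

lemma k_integrable:
  assumes f: "f \<in> bdd_supp" and d: "0 < d" and far: "\<And>y. f y \<noteq> 0 \<Longrightarrow> d \<le> norm (x - y)"
  shows "integrable lborel (\<lambda>y. k x y * f y)"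
proof -
  obtain B R where "0 < B" "0 < R" and *: "\<forall>x. norm (f x) \<le> B" "\<forall>x i. f x \<noteq> 0 \<longrightarrow> \<bar>x $ i\<bar> \<le> R"
    using bdd_supp_ex[OF f] by blast
  note fb = this(1,2) *[rule_format]
  have fx: "f x = 0" using far[of x] d by auto
  show ?thesis
  proof (rule integrableI_bounded_set[where A = "cbox (\<chi> i. - R) (\<chi> i. R)" and B = "(A * d powr (- real CARD('n))) * B"])
    show "(\<lambda>y. k x y * f y) \<in> borel_measurable lborel"
      using k_times_measurable[of f x] bdd_supp_measurable[OF f] fx by simp
    show "AE y\<in>cbox (\<chi> i. - R) (\<chi> i. R) in lborel. norm (k x y * f y) \<le> (A * d powr (- real CARD('n))) * B"
    proof (intro AE_I2 impI)
      fix y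
      show "norm (k x y * f y) \<le> (A * d powr (- real CARD('n))) * B"
      proof (cases "f y = 0")
        case False
        then show ?thesis unfolding norm_mult using fb(3)[of y] k_far[OF d far[of y]] A
          by (intro mult_mono) auto
      qed (use A fb(1) in auto)
    qed
    show "AE y in lborel. y \<notin> cbox (\<chi> i. - R) (\<chi> i. R) \<longrightarrow> k x y * f y = 0"
    proof (intro AE_I2 impI)
      fix y :: "real ^ 'n" assume y: "y \<notin> cbox (\<chi> i. - R) (\<chi> i. R)"
      obtain i where "\<not> \<bar>y $ i\<bar> \<le> R" using y unfolding mem_cbox_abs by blast
      then have "f y = 0" using fb(4)[of y i] by auto
      then show "k x y * f y = 0" by simp
    qed
  qed (use emeasure_lborel_cbox_finite in auto)
qed

text \<open>Distances are given by coordinates while smoothness refers to the Euclidean norm. The l1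
  bound gives |y - y'| \<le> n l, so a separation of 2 n l in one coordinate yields the factor 2 in
  the smoothness condition. This is the origin of the enlargement exponent \<open>a\<close> with 2 n
  \<le> 2^a.\<close>

lemma k_diff_th:
  assumes J: "i \<in> J" and l: "0 < l" and y: "\<And>i. \<bar>y $ i - y' $ i\<bar> \<le> l"
    and far: "2 * real CARD('n) * l \<le> \<bar>x $ i - y $ i\<bar>"
  shows "ennreal (norm (k x y - k x y')) \<le> ennreal (A * (real CARD('n) * l) powr \<epsilon>) * tail_kernel \<epsilon> l x y"
    and "ennreal (norm (k y x - k y' x)) \<le> ennreal (A * (real CARD('n) * l) powr \<epsilon>) * tail_kernel \<epsilon> l x y"
proof -
  have "norm (y - y') \<le> (\<Sum>i\<in>UNIV. \<bar>(y - y') $ i\<bar>)" by (rule norm_le_l1_cart)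
  also have "\<dots> \<le> (\<Sum>i\<in>(UNIV :: 'n set). l)" using y by (intro sum_mono) auto
  finally have d: "norm (y - y') \<le> real CARD('n) * l" by simp
  have x: "2 * real CARD('n) * l \<le> norm (y - x)"
    using far component_le_norm_cart[of "x - y" i] by (simp add: norm_minus_commute)
  have n1: "1 \<le> real CARD('n)" using zero_less_card_finite[where 'a = 'n] by linarith
  then have pos: "0 < 2 * real CARD('n) * l" using l by simp
  then have ne: "y \<noteq> x" using x by auto
  have 2: "2 * norm (y - y') \<le> norm (y - x)" using d x by linarith
  have "1 * l \<le> (2 * real CARD('n)) * l" by (intro mult_right_mono) (use n1 l in linarith)+
  then have "l \<le> 2 * real CARD('n) * l" by simp
  then have tail_kernel: "ennreal (1 / norm (x - y) powr (real CARD('n) + \<epsilon>)) \<le> tail_kernel \<epsilon> l x y"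
    using far by (intro tail_kernel_lower[OF l \<epsilon>, of x i y]) linarith
  have est: "A * (norm (y - y') powr \<epsilon> / norm (y - x) powr (real CARD('n) + \<epsilon>))
    \<le> A * (real CARD('n) * l) powr \<epsilon> * (1 / norm (x - y) powr (real CARD('n) + \<epsilon>))"
  proof -
    have "norm (y - y') powr \<epsilon> \<le> (real CARD('n) * l) powr \<epsilon>" using d \<epsilon> by (intro powr_mono2) auto
    then show ?thesis using A unfolding norm_minus_commute[of y x]
      by (simp add: divide_right_mono mult_left_mono)
  qed
  have fin: "ennreal c \<le> ennreal (A * (real CARD('n) * l) powr \<epsilon>) * tail_kernel \<epsilon> l x y"
    if "c \<le> A * (norm (y - y') powr \<epsilon> / norm (y - x) powr (real CARD('n) + \<epsilon>))" for c
  proof -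
    have "ennreal c \<le> ennreal (A * (real CARD('n) * l) powr \<epsilon> * (1 / norm (x - y) powr (real CARD('n) + \<epsilon>)))"
      using that est by (intro ennreal_leI) linarith
    also have "\<dots> = ennreal (A * (real CARD('n) * l) powr \<epsilon>) * ennreal (1 / norm (x - y) powr (real CARD('n) + \<epsilon>))"
      using A by (intro ennreal_mult) auto
    also have "\<dots> \<le> ennreal (A * (real CARD('n) * l) powr \<epsilon>) * tail_kernel \<epsilon> l x y"
      by (intro mult_left_mono tail_kernel) simp
    finally show ?thesis .
  qed
  show "ennreal (norm (k x y - k x y')) \<le> ennreal (A * (real CARD('n) * l) powr \<epsilon>) * tail_kernel \<epsilon> l x y"
    by (rule fin[OF k_right[OF ne 2]])
  show "ennreal (norm (k y x - k y' x)) \<le> ennreal (A * (real CARD('n) * l) powr \<epsilon>) * tail_kernel \<epsilon> l x y"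
    by (rule fin[OF k_left[OF ne 2]])
qed

text \<open>Both k(x,y) g(y) and k(x,y) times the average of \<open>g\<close> are written as
  integrals over pairs (y, w). Exchanging the outer coordinates of y and w in the second one moves
  the average from \<open>g\<close> to the kernel. What remains is a difference of \<open>k\<close>
  at two points with equal inner coordinates whose outer coordinates lie in the same cube.\<close>

lemma bad_part_kernel:
  fixes I :: "'n set"
  assumes g: "g \<in> bdd_supp" and a: "2 * real CARD('n) \<le> 2 ^ a"
    and s: "s = (fst s, dyadic_index (- I) (fst s) x0)" and x: "x \<notin> neighbours (- I) (fst s + int a) x0"
  shows "ennreal (norm (LINT y|lborel. k x y * bad_part I g s y))
    \<le> ennreal (A * (real CARD('n) * side (fst s)) powr \<epsilon>) * (\<integral>\<^sup>+y. tail_kernel \<epsilon> (side (fst s)) x y * (indicator (index_cube (- I) s) y * cnorm g y) \<partial>lborel)"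
proof -
  define J where "J = - I"
  define l where "l = side (fst s)"
  define Q where "Q = index_cube J s"
  define v where "v = l ^ card J"
  define c where "c = ennreal (A * (real CARD('n) * l) powr \<epsilon>)"
  have l: "0 < l" and v: "0 < v" by (auto simp: l_def v_def)
  have Qd: "Q = dyadic_cube J (fst s) x0" unfolding Q_def J_def by (subst s) simp
  have [measurable]: "Q \<in> sets borel" unfolding Q_def by simp
  note [measurable] = bdd_supp_measurable[OF g]
  obtain B R where "0 < B" "0 < R" and *: "\<forall>x. norm (g x) \<le> B" "\<forall>x i. g x \<noteq> 0 \<longrightarrow> \<bar>x $ i\<bar> \<le> R"
    using bdd_supp_ex[OF g] by blast
  note gb = this(1,2) *[rule_format]
  have l2: "2 * real CARD('n) * l \<le> side (fst s + int a)"
    using a l mult_right_mono[OF a, of l] by (simp add: l_def powr_add powr_realpow mult.commute)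
  have far: "\<exists>i\<in>J. 2 * real CARD('n) * l \<le> \<bar>x $ i - y $ i\<bar>" if "y \<in> Q" for y
  proof -
    have "y \<in> dyadic_cube J (fst s + int a) x0" using that dyadic_cube_mono[of "fst s" "fst s + int a" J x0] unfolding Qd by auto
    then obtain i where "i \<in> J" "side (fst s + int a) < \<bar>x $ i - y $ i\<bar>"
      using not_tri_far[of x J "fst s + int a" x0 y] x unfolding J_def by blast
    then show ?thesis using l2 by (intro bexI[of _ i]) auto
  qed
  define d where "d = 2 * real CARD('n) * l"
  have n1: "1 \<le> real CARD('n)" using zero_less_card_finite[where 'a = 'n] by linarith
  have d: "0 < d" using l n1 by (simp add: d_def)
  have fard: "d \<le> norm (x - y)" if "y \<in> Q" for y
    using far[OF that] component_le_norm_cart[of "x - y"] unfolding d_def by (auto intro: order_trans)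
  have xQ: "x \<notin> Q" using fard[of x] d by auto
  define K where "K y = indicator Q y *\<^sub>R k x y" for y
  have [measurable]: "K \<in> borel_measurable borel"
  proof -
    note [measurable] = k_measurable[of x]
    have "K = (\<lambda>y. indicator Q y *\<^sub>R (indicator (- {x}) y *\<^sub>R k x y))"
      using xQ by (auto simp: K_def indicator_def)
    also have "\<dots> \<in> borel_measurable borel" by measurable
    finally show ?thesis .
  qed
  define M where "M = A * d powr (- real CARD('n))"
  have M: "norm (K y) \<le> M" "0 \<le> M" for y
    using k_far[OF d fard[of y]] A by (auto simp: K_def M_def indicator_def)
  interpret m: sigma_finite_measure "vol_on J" by (rule sigma_finite_mu)
  interpret P: pair_sigma_finite lborel "vol_on J"
    by (simp add: pair_sigma_finite_def sigma_finite_mu lborel.sigma_finite_measure_axioms)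
  let ?P = "lborel \<Otimes>\<^sub>M vol_on J"
  have sP: "sets ?P = sets (borel \<Otimes>\<^sub>M borel)" by (intro sets_pair_measure_cong) auto
  \<comment> \<open>\<open>Q\<close> is a cylinder and unbounded in the inner coordinates; the bound
    \<open>R\<close> from the support of \<open>g\<close> makes the domain of integration finite in
    measure.\<close>
  define E where "E = {y \<in> Q. \<forall>i. i \<in> I \<longrightarrow> \<bar>y $ i\<bar> \<le> R}"
  have [measurable]: "E \<in> sets borel" unfolding E_def by measurable
  have Qfin: "emeasure (vol_on J) Q = ennreal v" unfolding Qd emeasure_dy cube_vol_def v_def l_def ..
  have Efin: "emeasure lborel E < top"
  proof -
    define R' where "R' = R + Max (range (\<lambda>i. \<bar>x0 $ i\<bar>)) + l"
    have "E \<subseteq> cbox (\<chi> i. - R') (\<chi> i. R')"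
    proof
      fix y assume y: "y \<in> E"
      have "\<bar>y $ i\<bar> \<le> R'" for i
      proof -
        have m: "\<bar>x0 $ i\<bar> \<le> Max (range (\<lambda>i. \<bar>x0 $ i\<bar>))" by (rule Max_ge) auto
        show ?thesis
        proof (cases "i \<in> I")
          case True
          then have "\<bar>y $ i\<bar> \<le> R" using y unfolding E_def by blast
          then show ?thesis using m l unfolding R'_def by linarith
        next
          case False
          then have "\<bar>y $ i - x0 $ i\<bar> \<le> l"
            using y dyadic_cube_dist[of y J "fst s" x0 x0 i] by (auto simp: E_def Qd J_def l_def)
          then show ?thesis using m gb(2) unfolding R'_def by linarith
        qed
      qed
      then show "y \<in> cbox (\<chi> i. - R') (\<chi> i. R')" unfolding mem_cbox_abs by blast
    qed
    then have "emeasure lborel E \<le> emeasure lborel (cbox (\<chi> i. - R') (\<chi> i. R') :: (real ^ 'n) set)" by (intro emeasure_mono) auto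
    then show ?thesis using emeasure_lborel_cbox_finite le_less_trans by (metis infinity_ennreal_def)
  qed
  have EQ: "emeasure ?P (E \<times> Q) < top"
    using Efin Qfin by (subst m.emeasure_pair_measure_Times) (auto simp: ennreal_mult_less_top)
  have integ: "integrable ?P (\<lambda>p. (indicator Q (snd p) / v) *\<^sub>R (K (fst p) * h p))"
    if [measurable]: "h \<in> borel_measurable (borel \<Otimes>\<^sub>M borel)" and hB: "\<And>p. norm (h p) \<le> B"
      and h0: "\<And>p i. h p \<noteq> 0 \<Longrightarrow> i \<in> I \<Longrightarrow> \<bar>fst p $ i\<bar> \<le> R" for h
  proof (rule integrableI_bounded_set[where A = "E \<times> Q" and B = "1 / v * (M * B)"])
    show "(\<lambda>p. (indicator Q (snd p) / v) *\<^sub>R (K (fst p) * h p)) \<in> borel_measurable ?P"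
      unfolding measurable_cong_sets[OF sP refl] by measurable
    show "E \<times> Q \<in> sets ?P" by simp
    show "AE p\<in>E \<times> Q in ?P. norm ((indicator Q (snd p) / v) *\<^sub>R (K (fst p) * h p)) \<le> 1 / v * (M * B)"
    proof (intro AE_I2 impI)
      fix p
      have "norm (K (fst p) * h p) \<le> M * B" unfolding norm_mult using M hB gb by (intro mult_mono) auto
      then show "norm ((indicator Q (snd p) / v) *\<^sub>R (K (fst p) * h p)) \<le> 1 / v * (M * B)"
        using v M(2) gb(1) by (auto simp: indicator_def divide_right_mono)
    qed
    show "AE p in ?P. p \<notin> E \<times> Q \<longrightarrow> (indicator Q (snd p) / v) *\<^sub>R (K (fst p) * h p) = 0"
    proof (intro AE_I2 impI, rule ccontr)
      fix p assume p: "p \<notin> E \<times> Q" and ne: "(indicator Q (snd p) / v) *\<^sub>R (K (fst p) * h p) \<noteq> 0"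
      then have "h p \<noteq> 0" by auto
      have "snd p \<in> Q" "fst p \<in> Q" using ne by (auto simp: K_def indicator_def split: if_splits)
      moreover have "fst p \<in> E" using \<open>fst p \<in> Q\<close> h0[OF \<open>h p \<noteq> 0\<close>] by (auto simp: E_def)
      ultimately show False using p by (cases p) auto
    qed
  qed (use EQ in auto)
  \<comment> \<open>The factor \<open>indicator Q (snd p) / v\<close> turns the integral over w into
    an average over the cube.\<close>
  define F1 where "F1 p = (indicator Q (snd p) / v) *\<^sub>R (K (fst p) * g (fst p))" for p
  define F2 where "F2 p = (indicator Q (snd p) / v) *\<^sub>R (K (fst p) * g (merge_coords I (fst p) (snd p)))" for p
  define \<Psi> where "\<Psi> p = (merge_coords I (fst p) (snd p), merge_coords I (snd p) (fst p))" for p :: "(real ^ 'n) \<times> (real ^ 'n)"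
  have i1: "integrable ?P F1" unfolding F1_def by (rule integ) (use gb in auto)
  have i2: "integrable ?P F2" unfolding F2_def
  proof (rule integ)
    show "\<bar>fst p $ i\<bar> \<le> R" if "g (merge_coords I (fst p) (snd p)) \<noteq> 0" "i \<in> I" for p i
      using gb(4)[OF that(1), of i] that(2) by simp
  qed (use gb in auto)
  have \<Psi>m: "\<Psi> \<in> measurable ?P ?P" unfolding \<Psi>_def measurable_cong_sets[OF sP sP] by measurable
  have \<Psi>P: "distr ?P ?P \<Psi> = ?P" unfolding \<Psi>_def[abs_def] J_def by (rule pair_swap_mu)
  have F2m: "F2 \<in> borel_measurable ?P" using i2 by simp
  have i3: "integrable ?P (\<lambda>p. F2 (\<Psi> p))"
    using integrable_distr_eq[OF \<Psi>m F2m] i2 unfolding \<Psi>P by simp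
  have Qv: "measure (vol_on J) Q = v" using v by (simp add: measure_def Qfin)
  have L1: "(LINT p|?P. F1 p) = (LINT y|lborel. K y * g y)"
  proof -
    have "(LINT p|?P. F1 p) = (LINT y|lborel. LINT w|vol_on J. F1 (y, w))"
      using P.integral_fst'[OF i1] by simp
    also have "\<dots> = (LINT y|lborel. K y * g y)"
      unfolding F1_def fst_conv snd_conv
      by (intro Bochner_Integration.integral_cong refl) (subst integral_scaleR_left, use v in \<open>auto simp: Qv Qfin intro!: integrable_real_indicator\<close>)
    finally show ?thesis .
  qed
  have L2: "(LINT p|?P. F2 p) = (LINT y|lborel. K y * cube_avg I g s y)"
  proof -
    have "(LINT p|?P. F2 p) = (LINT y|lborel. LINT w|vol_on J. F2 (y, w))"
      using P.integral_fst'[OF i2] by simp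
    also have "\<dots> = (LINT y|lborel. K y * cube_avg I g s y)"
    proof (intro Bochner_Integration.integral_cong refl)
      fix y
      have "(LINT w|vol_on J. F2 (y, w)) = (LINT w|vol_on J. (K y / of_real v) * (indicator Q w *\<^sub>R g (merge_coords I y w)))"
        unfolding F2_def by (intro Bochner_Integration.integral_cong refl) (auto simp: indicator_def scaleR_conv_of_real field_simps)
      also have "\<dots> = (K y / of_real v) * (LINT w|vol_on J. (indicator Q w *\<^sub>R g (merge_coords I y w)))"
        by (rule integral_mult_right_zero)
      also have "\<dots> = K y * cube_avg I g s y"
        by (simp add: cube_avg_def Q_def J_def v_def l_def scaleR_conv_of_real field_simps)
      finally show "(LINT w|vol_on J. F2 (y, w)) = K y * cube_avg I g s y" .
    qed
    finally show ?thesis .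
  qed
  have Kint: "integrable lborel (\<lambda>y. K y * g y)" "integrable lborel (\<lambda>y. K y * cube_avg I g s y)"
  proof -
    show "integrable lborel (\<lambda>y. K y * g y)"
    proof -
      have "integrable lborel (\<lambda>y. k x y * (indicator Q y *\<^sub>R g y))"
        using fard by (intro k_integrable[OF _ d] bdd_supp_indicator g) (auto simp: indicator_def split: if_splits)
      moreover have "(\<lambda>y. k x y * (indicator Q y *\<^sub>R g y)) = (\<lambda>y. K y * g y)" by (auto simp: K_def)
      ultimately show ?thesis by simp
    qed
    have "integrable lborel (\<lambda>y. k x y * bad_part I g s y)"
      using fard by (intro k_integrable[OF _ d] bad_part_BB[OF g s]) (auto simp: bad_part_def Q_def J_def indicator_def split: if_splits)
    moreover have "(\<lambda>y. k x y * bad_part I g s y) = (\<lambda>y. K y * g y - K y * cube_avg I g s y)"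
      by (auto simp: K_def bad_part_def Q_def J_def indicator_def algebra_simps)
    ultimately have "integrable lborel (\<lambda>y. K y * g y - K y * cube_avg I g s y)" by simp
    from Bochner_Integration.integrable_diff[OF \<open>integrable lborel (\<lambda>y. K y * g y)\<close> this]
    show "integrable lborel (\<lambda>y. K y * cube_avg I g s y)" by simp
  qed
  have "(LINT y|lborel. k x y * bad_part I g s y) = (LINT y|lborel. K y * g y - K y * cube_avg I g s y)"
    by (intro Bochner_Integration.integral_cong refl) (auto simp: K_def bad_part_def Q_def J_def indicator_def algebra_simps)
  also have "\<dots> = (LINT p|?P. F1 p) - (LINT p|?P. F2 p)" unfolding L1 L2 by (intro Bochner_Integration.integral_diff Kint)
  \<comment> \<open>The exchange of outer coordinates. After it \<open>g\<close> is evaluated at y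
    in both integrals, and only the arguments of the kernel differ.\<close>
  also have "(LINT p|?P. F2 p) = (LINT p|?P. F2 (\<Psi> p))"
    using integral_distr[OF \<Psi>m F2m] unfolding \<Psi>P .
  also have "(LINT p|?P. F1 p) - (LINT p|?P. F2 (\<Psi> p)) = (LINT p|?P. F1 p - F2 (\<Psi> p))"
    by (intro Bochner_Integration.integral_diff[symmetric] i1 i3)
  finally have "ennreal (norm (LINT y|lborel. k x y * bad_part I g s y)) \<le> (\<integral>\<^sup>+p. ennreal (norm (F1 p - F2 (\<Psi> p))) \<partial>?P)"
    using norm_lint_le[of ?P "\<lambda>p. F1 p - F2 (\<Psi> p)"] by simp
  also have "\<dots> \<le> (\<integral>\<^sup>+p. (c * (tail_kernel \<epsilon> l x (fst p) * (indicator Q (fst p) * cnorm g (fst p)))) * (indicator Q (snd p) * ennreal (1 / v)) \<partial>?P)"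
  proof (intro nn_integral_mono)
    fix p :: "(real ^ 'n) \<times> (real ^ 'n)"
    obtain y w where p: "p = (y, w)" by (cases p)
    have yw: "merge_coords I y w \<in> Q \<longleftrightarrow> w \<in> Q" "merge_coords I w y \<in> Q \<longleftrightarrow> y \<in> Q"
      using jdepD[OF depends_on_cb[of J s], of "merge_coords I y w" w] jdepD[OF depends_on_cb[of J s], of "merge_coords I w y" y]
      by (auto simp: Q_def J_def)
    have mm: "merge_coords I (merge_coords I y w) (merge_coords I w y) = y" by (simp add: vec_eq_iff)
    show "ennreal (norm (F1 p - F2 (\<Psi> p)))
      \<le> (c * (tail_kernel \<epsilon> l x (fst p) * (indicator Q (fst p) * cnorm g (fst p)))) * (indicator Q (snd p) * ennreal (1 / v))"
    proof (cases "y \<in> Q \<and> w \<in> Q")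
      case True
      have "F1 p - F2 (\<Psi> p) = (1 / v) *\<^sub>R ((k x y - k x (merge_coords I y w)) * g y)"
        using True yw mm by (simp add: F1_def F2_def \<Psi>_def p K_def algebra_simps)
      then have "ennreal (norm (F1 p - F2 (\<Psi> p))) = ennreal (norm (k x y - k x (merge_coords I y w))) * cnorm g y * ennreal (1 / v)"
        using v by (simp add: norm_mult mult.commute flip: ennreal_mult)
      also have "\<dots> \<le> (c * tail_kernel \<epsilon> l x y) * cnorm g y * ennreal (1 / v)"
      proof (intro mult_right_mono)
        obtain i where i: "i \<in> J" "2 * real CARD('n) * l \<le> \<bar>x $ i - y $ i\<bar>" using far True by blast
        have "\<bar>y $ j - merge_coords I y w $ j\<bar> \<le> l" for j
          using dyadic_cube_dist[of y J "fst s" x0 w j] True l unfolding Qd by (auto simp: J_def l_def)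
        from k_diff_th(1)[OF i(1) l this i(2)]
        show "ennreal (norm (k x y - k x (merge_coords I y w))) \<le> c * tail_kernel \<epsilon> l x y" unfolding c_def .
      qed auto
      finally show ?thesis using True by (simp add: p mult.assoc)
    next
      case False
      then have "F1 p - F2 (\<Psi> p) = 0" using yw by (auto simp: F1_def F2_def \<Psi>_def p K_def)
      then show ?thesis by simp
    qed
  qed
  also have "\<dots> = (\<integral>\<^sup>+y. \<integral>\<^sup>+w. (c * (tail_kernel \<epsilon> l x y * (indicator Q y * cnorm g y))) * (indicator Q w * ennreal (1 / v)) \<partial>vol_on J \<partial>lborel)"
    by (subst m.nn_integral_fst[symmetric]) (simp_all add: measurable_cong_sets[OF sP refl])
  also have "\<dots> = (\<integral>\<^sup>+y. c * (tail_kernel \<epsilon> l x y * (indicator Q y * cnorm g y)) \<partial>lborel)"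
  proof (intro nn_integral_cong)
    fix y
    have "(\<integral>\<^sup>+w. indicator Q w * ennreal (1 / v) \<partial>vol_on J) = 1"
      using v by (simp add: indicator_mult_const Qfin flip: ennreal_mult)
    then show "(\<integral>\<^sup>+w. (c * (tail_kernel \<epsilon> l x y * (indicator Q y * cnorm g y))) * (indicator Q w * ennreal (1 / v)) \<partial>vol_on J)
      = c * (tail_kernel \<epsilon> l x y * (indicator Q y * cnorm g y))"
      by (subst nn_integral_cmult) auto
  qed
  also have "\<dots> = c * (\<integral>\<^sup>+y. tail_kernel \<epsilon> l x y * (indicator Q y * cnorm g y) \<partial>lborel)"
    by (rule nn_integral_cmult) measurable
  finally show ?thesis by (simp add: c_def l_def Q_def J_def)
qed

end

text \<open>The off-support formula is stated for open sets on which \<open>f\<close> vanishes, so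
  that complements of closed cubes and open neighbourhoods can be inserted directly.\<close>

locale cz = cz_kernel k A \<epsilon> for k :: "real ^ 'n::finite \<Rightarrow> real ^ 'n \<Rightarrow> complex" and A \<epsilon> :: real +
  fixes T :: "(real ^ 'n \<Rightarrow> complex) \<Rightarrow> real ^ 'n \<Rightarrow> complex"
  assumes T_measurable: "\<And>f. f \<in> bdd_supp \<Longrightarrow> T f \<in> borel_measurable borel"
    and T_add: "\<And>f g. f \<in> bdd_supp \<Longrightarrow> g \<in> bdd_supp \<Longrightarrow> AE x in lborel. T (\<lambda>y. f y + g y) x = T f x + T g x"
    and T_off: "\<And>f U. f \<in> bdd_supp \<Longrightarrow> open U \<Longrightarrow> (\<And>y. y \<in> U \<Longrightarrow> f y = 0) \<Longrightarrow>
      AE x in lborel. x \<in> U \<longrightarrow> T f x = (LINT y|lborel. k x y * f y)"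

section \<open>Lowering the outer exponent\<close>

text \<open>A stopping cube is given by its index; the union over all points with this index avoids
  choosing one, and all of them yield the same neighbourhood.\<close>

definition enlarged :: "'n set \<Rightarrow> nat \<Rightarrow> int \<times> ('n \<Rightarrow> int) \<Rightarrow> (real ^ 'n) set" where
  "enlarged J a s = (\<Union>x\<in>{x. s = (fst s, dyadic_index J (fst s) x)}. neighbours J (fst s + int a) x)"

lemma enlarged_eq:
  assumes "s = (fst s, dyadic_index J (fst s) x)"
  shows "enlarged J a s = neighbours J (fst s + int a) x"
proof -
  have "neighbours J (fst s + int a) y = neighbours J (fst s + int a) x" if "s = (fst s, dyadic_index J (fst s) y)" for y
  proof (rule neighbours_cong, rule dyadic_index_mono)
    show "dyadic_index J (fst s) y = dyadic_index J (fst s) x" using that assms by (metis snd_conv)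
  qed simp
  then show ?thesis unfolding enlarged_def using assms by blast
qed

text \<open>The operator is used through finite additivity, so only finitely many stopping cubes can
  enter the bad part. Dominated convergence makes the integral over the discarded ones as small as
  desired.\<close>

lemma finite_part:
  fixes C :: "'s::countable \<Rightarrow> 'a set"
  assumes C: "\<And>s. C s \<in> sets M" and [measurable]: "H \<in> borel_measurable M" "U \<in> sets M"
    and U: "(\<Union>s\<in>S. C s) = U" and fin: "(\<integral>\<^sup>+x. indicator U x * H x \<partial>M) < top" and d: "0 < d"
  shows "\<exists>S0\<subseteq>S. finite S0 \<and> (\<integral>\<^sup>+x. indicator (U - (\<Union>s\<in>S0. C s)) x * H x \<partial>M) < d"
proof -
  note [measurable] = C
  define S0 where "S0 N = {s \<in> S. to_nat s < N}" for N
  have fS0: "finite (S0 N)" for N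
  proof (rule finite_imageD)
    have "to_nat ` S0 N \<subseteq> {..<N}" by (auto simp: S0_def)
    then show "finite (to_nat ` S0 N)" by (rule finite_subset) simp
  qed (auto simp: inj_on_def)
  have [measurable]: "(\<Union>s\<in>S0 N. C s) \<in> sets M" for N using fS0 by (intro sets.finite_UN) auto
  have "(\<lambda>N. \<integral>\<^sup>+x. indicator (U - (\<Union>s\<in>S0 N. C s)) x * H x \<partial>M) \<longlonglongrightarrow> (\<integral>\<^sup>+x. 0 \<partial>M)"
  proof (rule nn_integral_dominated_convergence[where w = "\<lambda>x. indicator U x * H x"])
    show "AE x in M. indicator (U - (\<Union>s\<in>S0 N. C s)) x * H x \<le> indicator U x * H x" for N
      by (intro AE_I2 mult_right_mono) (auto simp: indicator_def)
    show "AE x in M. (\<lambda>N. indicator (U - (\<Union>s\<in>S0 N. C s)) x * H x) \<longlonglongrightarrow> 0"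
    proof (intro AE_I2)
      fix x
      have "eventually (\<lambda>N. indicator (U - (\<Union>s\<in>S0 N. C s)) x * H x = 0) sequentially"
      proof (cases "x \<in> U")
        case True
        then obtain s where s: "s \<in> S" "x \<in> C s" using U by blast
        show ?thesis
        proof (rule eventually_mono[OF eventually_gt_at_top[of "to_nat s"]])
          fix N assume "to_nat s < N"
          then have "x \<in> (\<Union>s\<in>S0 N. C s)" using s by (auto simp: S0_def)
          then show "indicator (U - (\<Union>s\<in>S0 N. C s)) x * H x = 0" by (simp add: indicator_def)
        qed
      qed simp
      then show "(\<lambda>N. indicator (U - (\<Union>s\<in>S0 N. C s)) x * H x) \<longlonglongrightarrow> 0" by (rule tendsto_eventually)
    qed
  qed (use fin in auto)
  then have "eventually (\<lambda>N. (\<integral>\<^sup>+x. indicator (U - (\<Union>s\<in>S0 N. C s)) x * H x \<partial>M) < d) sequentially"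
    using d by (intro order_tendstoD(2)[where a = d]) auto
  then obtain N where "(\<integral>\<^sup>+x. indicator (U - (\<Union>s\<in>S0 N. C s)) x * H x \<partial>M) < d"
    by (auto simp: eventually_sequentially)
  then show ?thesis using fS0[of N] by (intro exI[of _ "S0 N"]) (auto simp: S0_def)
qed

lemma stop_family_cube:
  assumes S: "stop_family J F t S" and s: "s \<in> S" and t: "0 < t"
  shows "(\<integral>\<^sup>+y. indicator (index_cube J s) y * F y \<partial>vol_on J) \<le> 2 ^ card J * ennreal t * cube_vol J (fst s)"
proof -
  obtain x where x: "s = (fst s, dyadic_index J (fst s) x)" using stop_familyD(5)[OF S s] by blast
  then have xs: "x \<in> index_cube J s" by (simp add: index_cube_def prod_eq_iff)
  have "(\<integral>\<^sup>+y. indicator (index_cube J s) y * F y \<partial>vol_on J) \<le> (\<integral>\<^sup>+y. indicator (dyadic_cube J (fst s + 1) x) y * F y \<partial>vol_on J)"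
    using dyadic_cube_mono[of "fst s" "fst s + 1" J x] x[symmetric]
    by (intro nn_integral_mono mult_right_mono) (auto simp: indicator_def)
  also have "\<dots> \<le> ennreal t * cube_vol J (fst s + 1)" using stop_familyD(4)[OF S s xs] by simp
  also have "\<dots> = 2 ^ card J * ennreal t * cube_vol J (fst s)" using cube_vol_add[of J "fst s" 1] by (simp add: ac_simps)
  finally show ?thesis .
qed

context cz
begin

text \<open>Off the enlarged cubes the kernel formula is valid for the whole finite sum at once, and
  each summand is then estimated by its own cancellation.\<close>

lemma T_bad:
  fixes I :: "'n set"
  assumes g: "g \<in> bdd_supp" and a: "2 * real CARD('n) \<le> 2 ^ a" and fin: "finite S0"
    and S0: "\<And>s. s \<in> S0 \<Longrightarrow> \<exists>x0. s = (fst s, dyadic_index (- I) (fst s) x0)"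
  shows "AE x in lborel. x \<notin> (\<Union>s\<in>S0. enlarged (- I) a s) \<longrightarrow> cnorm (T (\<lambda>y. \<Sum>s\<in>S0. bad_part I g s y)) x
    \<le> (\<Sum>s\<in>S0. ennreal (A * (real CARD('n) * side (fst s)) powr \<epsilon>) * (\<integral>\<^sup>+y. tail_kernel \<epsilon> (side (fst s)) x y * (indicator (index_cube (- I) s) y * cnorm g y) \<partial>lborel))"
proof -
  define J where "J = - I"
  \<comment> \<open>Dyadic cubes are half-open, but the off-support formula requires an open set on
    which the sum vanishes, hence the complement of the closed cubes. These still lie in the
    enlarged cubes.\<close>
  define cl where "cl s = (\<Inter>i\<in>J. {y :: real ^ 'n. side (fst s) * real_of_int (snd s i) \<le> y $ i} \<inter> {y. y $ i \<le> side (fst s) * (real_of_int (snd s i) + 1)})" for s :: "int \<times> ('n \<Rightarrow> int)"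
  have closed: "closed (cl s)" for s
    unfolding cl_def by (intro closed_INT ballI closed_Int closed_Collect_le continuous_intros)
  define U where "U = - (\<Union>s\<in>S0. cl s)"
  have U: "open U" unfolding U_def using fin closed by (intro open_Compl closed_UN) auto
  have index_cube_cl: "index_cube J s \<subseteq> cl s" if s: "s \<in> S0" for s
  proof
    fix y assume y: "y \<in> index_cube J s"
    obtain x0 where x0: "s = (fst s, dyadic_index J (fst s) x0)" using S0[OF s] unfolding J_def by blast
    then have z: "snd s = dyadic_index J (fst s) x0" by (metis snd_conv)
    have "y \<in> dyadic_cube J (fst s) x0" using y unfolding x0[symmetric] .
    from this[unfolded mem_dy_floor] show "y \<in> cl s" unfolding z[symmetric] cl_def by (auto intro: less_imp_le)
  qed
  have cl_enl: "cl s \<subseteq> enlarged J a s" if s: "s \<in> S0" for s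
  proof
    fix y assume y: "y \<in> cl s"
    obtain x0 where x0: "s = (fst s, dyadic_index J (fst s) x0)" using S0[OF s] unfolding J_def by blast
    then have z: "snd s = dyadic_index J (fst s) x0" by (metis snd_conv)
    define c :: "real ^ 'n" where "c = (\<chi> i. side (fst s) * real_of_int (snd s i))"
    have "c \<in> dyadic_cube J (fst s) x0" unfolding mem_dy_floor by (auto simp: c_def z)
    then have "c \<in> dyadic_cube J (fst s + int a) x0" using dyadic_cube_mono[of "fst s" "fst s + int a" J x0] by auto
    moreover have "\<bar>y $ i - c $ i\<bar> \<le> side (fst s + int a)" if "i \<in> J" for i
    proof -
      have "\<bar>y $ i - c $ i\<bar> \<le> side (fst s)" using y that by (auto simp: cl_def c_def algebra_simps)
      also have "\<dots> \<le> side (fst s + int a)" by simp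
      finally show ?thesis .
    qed
    ultimately have "y \<in> neighbours J (fst s + int a) x0"
      using not_tri_far[of y J "fst s + int a" x0 c] by (meson not_le)
    then show "y \<in> enlarged J a s" unfolding enlarged_eq[OF x0] .
  qed
  have bad_part: "bad_part I g s \<in> bdd_supp" if "s \<in> S0" for s using S0[OF that] bad_part_BB[OF g] by blast
  have B: "(\<lambda>y. \<Sum>s\<in>S0. bad_part I g s y) \<in> bdd_supp" by (intro bdd_supp_sum bad_part)
  have "AE x in lborel. x \<in> U \<longrightarrow> T (\<lambda>y. \<Sum>s\<in>S0. bad_part I g s y) x = (LINT y|lborel. k x y * (\<Sum>s\<in>S0. bad_part I g s y))"
  proof (rule T_off[OF B U])
    fix y assume "y \<in> U"
    then have "bad_part I g s y = 0" if "s \<in> S0" for s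
      using index_cube_cl[OF that] that by (auto simp: bad_part_def U_def J_def indicator_def)
    then show "(\<Sum>s\<in>S0. bad_part I g s y) = 0" by simp
  qed
  then show ?thesis
  proof (rule eventually_mono, intro impI)
    fix x assume T: "x \<in> U \<longrightarrow> T (\<lambda>y. \<Sum>s\<in>S0. bad_part I g s y) x = (LINT y|lborel. k x y * (\<Sum>s\<in>S0. bad_part I g s y))"
      and x: "x \<notin> (\<Union>s\<in>S0. enlarged (- I) a s)"
    have xU: "x \<in> U" using x cl_enl unfolding U_def J_def by blast
    obtain e where e: "0 < e" "ball x e \<subseteq> U" using xU U open_contains_ball by blast
    have far: "e \<le> norm (x - y)" if "bad_part I g s y \<noteq> 0" "s \<in> S0" for s y
    proof -
      have "y \<in> index_cube J s" using that(1) by (auto simp: bad_part_def J_def indicator_def split: if_splits)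
      then have "y \<notin> U" using index_cube_cl[OF that(2)] that(2) by (auto simp: U_def)
      then show ?thesis using e(2) by (auto simp: subset_iff dist_norm not_less[symmetric])
    qed
    have "T (\<lambda>y. \<Sum>s\<in>S0. bad_part I g s y) x = (LINT y|lborel. (\<Sum>s\<in>S0. k x y * bad_part I g s y))"
      using T xU by (simp add: sum_distrib_left)
    also have "\<dots> = (\<Sum>s\<in>S0. LINT y|lborel. k x y * bad_part I g s y)"
      by (intro Bochner_Integration.integral_sum k_integrable[OF bad_part e(1)] far)
    finally have "cnorm (T (\<lambda>y. \<Sum>s\<in>S0. bad_part I g s y)) x \<le> ennreal (\<Sum>s\<in>S0. norm (LINT y|lborel. k x y * bad_part I g s y))"
      by (simp add: ennreal_leI norm_sum)
    also have "\<dots> = (\<Sum>s\<in>S0. ennreal (norm (LINT y|lborel. k x y * bad_part I g s y)))"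
      by (rule sum_ennreal[symmetric]) simp
    also have "\<dots> \<le> (\<Sum>s\<in>S0. ennreal (A * (real CARD('n) * side (fst s)) powr \<epsilon>) * (\<integral>\<^sup>+y. tail_kernel \<epsilon> (side (fst s)) x y * (indicator (index_cube (- I) s) y * cnorm g y) \<partial>lborel))"
    proof (rule sum_mono)
      fix s assume s: "s \<in> S0"
      obtain x0 where x0: "s = (fst s, dyadic_index (- I) (fst s) x0)" using S0[OF s] by blast
      have "x \<notin> neighbours (- I) (fst s + int a) x0" using x s enlarged_eq[OF x0, of a] by blast
      from bad_part_kernel[OF g a x0 this]
      show "ennreal (norm (LINT y|lborel. k x y * bad_part I g s y)) \<le> ennreal (A * (real CARD('n) * side (fst s)) powr \<epsilon>) * (\<integral>\<^sup>+y. tail_kernel \<epsilon> (side (fst s)) x y * (indicator (index_cube (- I) s) y * cnorm g y) \<partial>lborel)" .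
    qed
    finally show "cnorm (T (\<lambda>y. \<Sum>s\<in>S0. bad_part I g s y)) x \<le> \<dots>" .
  qed
qed

text \<open>The smoothness factor A (n l)^\<epsilon> times the total mass of the tail kernel, which
  is proportional to l^(-\<epsilon>). The scale cancels, so one constant serves all cubes.\<close>

definition kernel_const :: real where "kernel_const = A * real CARD('n) powr \<epsilon> * tail_const TYPE('n) \<epsilon>"

lemma kernel_const_pos: "0 \<le> kernel_const"
  using A tail_const_pos[OF \<epsilon>, where 'n = 'n] by (simp add: kernel_const_def)

text \<open>The Schur estimate carries the pointwise bound to the inner norm. Integrating the outer
  kernel in x first, by Fubini's theorem, costs \<open>kernel_const\<close> independently of the
  cube.\<close>

lemma T_bad_integral:
  fixes js :: "'n list" and q :: "real ^ 'n"
  defines "J \<equiv> - set js"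
  assumes q: "\<forall>j. 1 \<le> q $ j" and js: "distinct js"
    and g: "g \<in> bdd_supp" and a: "2 * real CARD('n) \<le> 2 ^ a" and fin: "finite S0"
    and S0: "\<And>s. s \<in> S0 \<Longrightarrow> \<exists>x0. s = (fst s, dyadic_index J (fst s) x0)"
  shows "(\<integral>\<^sup>+x. indicator (- (\<Union>s\<in>S0. enlarged J a s)) x * iter_norm q js (cnorm (T (\<lambda>y. \<Sum>s\<in>S0. bad_part (set js) g s y))) x \<partial>vol_on J)
    \<le> ennreal kernel_const * (\<Sum>s\<in>S0. \<integral>\<^sup>+y. indicator (index_cube J s) y * iter_norm q js (cnorm g) y \<partial>vol_on J)"
proof -
  define E where "E = (\<Union>s\<in>S0. enlarged J a s)"
  define B where "B = (\<lambda>y. \<Sum>s\<in>S0. bad_part (set js) g s y)"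
  have bad_part: "bad_part (set js) g s \<in> bdd_supp" if "s \<in> S0" for s using S0[OF that] bad_part_BB[OF g] unfolding J_def by blast
  have B: "B \<in> bdd_supp" unfolding B_def by (intro bdd_supp_sum bad_part)
  note [measurable] = bdd_supp_measurable[OF g] T_measurable[OF B]
  have enlm: "enlarged J a s \<in> sets borel" "depends_on J (\<lambda>x. x \<in> enlarged J a s)" if s: "s \<in> S0" for s
  proof -
    obtain x0 where x0: "s = (fst s, dyadic_index J (fst s) x0)" using S0[OF s] by blast
    show "enlarged J a s \<in> sets borel" unfolding enlarged_eq[OF x0] by simp
    show "depends_on J (\<lambda>x. x \<in> enlarged J a s)" unfolding enlarged_eq[OF x0] by (rule depends_on_tri)
  qed
  have [measurable]: "E \<in> sets borel" unfolding E_def using fin enlm by (intro sets.finite_UN) auto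
  have Ej: "depends_on (- set js) (\<lambda>x. x \<in> - E)"
    using enlm(2) unfolding E_def depends_on_def J_def by (simp only: Compl_iff UN_iff) blast
  let ?c = "\<lambda>s. ennreal (A * (real CARD('n) * side (fst s)) powr \<epsilon>)"
  let ?D = "\<lambda>s x. \<integral>\<^sup>+y. tail_kernel \<epsilon> (side (fst s)) x y * (indicator (index_cube J s) y * cnorm g y) \<partial>lborel"
  have [measurable]: "?D s \<in> borel_measurable borel" for s by measurable
  have gm: "(\<lambda>y. indicator (index_cube J s) y * cnorm g y) \<in> borel_measurable borel" for s by measurable
  have mg [measurable]: "iter_norm q js (cnorm g) \<in> borel_measurable borel" by measurable
  have mB [measurable]: "iter_norm q js (cnorm (T B)) \<in> borel_measurable borel" by measurable
  have ae: "AE x in vol_on UNIV. indicator (- E) x * cnorm (T B) x \<le> (\<Sum>s\<in>S0. ?c s * ?D s x)"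
    unfolding vol_on_UNIV using T_bad[OF g a fin S0[unfolded J_def]] unfolding B_def[symmetric] E_def[symmetric] J_def[symmetric]
    by (rule eventually_mono) (auto simp: indicator_def E_def)
  have "AE x in vol_on J. indicator (- E) x * iter_norm q js (cnorm (T B)) x \<le> (\<Sum>s\<in>S0. ?c s * (\<integral>\<^sup>+y. tail_kernel_on J \<epsilon> (side (fst s)) x y * (indicator (index_cube J s) y * iter_norm q js (cnorm g) y) \<partial>vol_on J))"
    using iter_norm_AE_mono[OF q js subset_UNIV ae] unfolding J_def[symmetric] Compl_eq_Diff_UNIV[symmetric]
  proof (rule eventually_mono)
    fix x assume le: "iter_norm q js (\<lambda>x. indicator (- E) x * cnorm (T B) x) x \<le> iter_norm q js (\<lambda>x. \<Sum>s\<in>S0. ?c s * ?D s x) x"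
    have "indicator (- E) x * iter_norm q js (cnorm (T B)) x = iter_norm q js (\<lambda>x. indicator (- E) x * cnorm (T B) x) x"
      by (rule iter_norm_indicator_mult[OF q _ Ej, symmetric]) simp
    also note le
    also have "iter_norm q js (\<lambda>x. \<Sum>s\<in>S0. ?c s * ?D s x) x \<le> (\<Sum>s\<in>S0. iter_norm q js (\<lambda>x. ?c s * ?D s x) x)"
      by (intro iter_norm_sum[OF q _ fin]) measurable
    also have "\<dots> = (\<Sum>s\<in>S0. ?c s * iter_norm q js (?D s) x)" by (intro sum.cong refl iter_norm_cmult[OF q]) measurable
    also have "\<dots> \<le> (\<Sum>s\<in>S0. ?c s * (\<integral>\<^sup>+y. tail_kernel_on J \<epsilon> (side (fst s)) x y * (indicator (index_cube J s) y * iter_norm q js (cnorm g) y) \<partial>vol_on J))"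
    proof (intro sum_mono mult_left_mono)
      fix s
      have "iter_norm q js (?D s) x \<le> (\<integral>\<^sup>+y. tail_kernel_on J \<epsilon> (side (fst s)) x y * iter_norm q js (\<lambda>y. indicator (index_cube J s) y * cnorm g y) y \<partial>vol_on J)"
        unfolding J_def by (rule Schur_th[OF q gm[unfolded J_def]]) simp
      also have "\<dots> = (\<integral>\<^sup>+y. tail_kernel_on J \<epsilon> (side (fst s)) x y * (indicator (index_cube J s) y * iter_norm q js (cnorm g) y) \<partial>vol_on J)"
        unfolding J_def by (intro nn_integral_cong arg_cong2[where f = times] refl iter_norm_indicator_mult[OF q _ depends_on_cb]) simp
      finally show "iter_norm q js (?D s) x \<le> (\<integral>\<^sup>+y. tail_kernel_on J \<epsilon> (side (fst s)) x y * (indicator (index_cube J s) y * iter_norm q js (cnorm g) y) \<partial>vol_on J)" .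
    qed auto
    finally show "indicator (- E) x * iter_norm q js (cnorm (T B)) x \<le> (\<Sum>s\<in>S0. ?c s * (\<integral>\<^sup>+y. tail_kernel_on J \<epsilon> (side (fst s)) x y * (indicator (index_cube J s) y * iter_norm q js (cnorm g) y) \<partial>vol_on J))" .
  qed
  then have "(\<integral>\<^sup>+x. indicator (- E) x * iter_norm q js (cnorm (T B)) x \<partial>vol_on J)
    \<le> (\<integral>\<^sup>+x. (\<Sum>s\<in>S0. ?c s * (\<integral>\<^sup>+y. tail_kernel_on J \<epsilon> (side (fst s)) x y * (indicator (index_cube J s) y * iter_norm q js (cnorm g) y) \<partial>vol_on J)) \<partial>vol_on J)"
    by (rule nn_integral_mono_AE)
  also have "\<dots> = (\<Sum>s\<in>S0. ennreal kernel_const * (\<integral>\<^sup>+y. indicator (index_cube J s) y * iter_norm q js (cnorm g) y \<partial>vol_on J))"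
  proof -
    interpret m: sigma_finite_measure "vol_on J" by (rule sigma_finite_mu)
    interpret P: pair_sigma_finite "vol_on J" "vol_on J" by (simp add: pair_sigma_finite_def sigma_finite_mu)
    have meas: "(\<lambda>x. \<integral>\<^sup>+y. tail_kernel_on J \<epsilon> l x y * (indicator (index_cube J s) y * iter_norm q js (cnorm g) y) \<partial>vol_on J) \<in> borel_measurable (vol_on J)" for s l
      by measurable
    have "(\<integral>\<^sup>+x. (\<Sum>s\<in>S0. ?c s * (\<integral>\<^sup>+y. tail_kernel_on J \<epsilon> (side (fst s)) x y * (indicator (index_cube J s) y * iter_norm q js (cnorm g) y) \<partial>vol_on J)) \<partial>vol_on J)
      = (\<Sum>s\<in>S0. ?c s * (\<integral>\<^sup>+x. \<integral>\<^sup>+y. tail_kernel_on J \<epsilon> (side (fst s)) x y * (indicator (index_cube J s) y * iter_norm q js (cnorm g) y) \<partial>vol_on J \<partial>vol_on J))"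
      using meas by (subst nn_integral_sum) (auto simp: nn_integral_cmult)
    also have "\<dots> = (\<Sum>s\<in>S0. ?c s * (\<integral>\<^sup>+y. \<integral>\<^sup>+x. tail_kernel_on J \<epsilon> (side (fst s)) x y * (indicator (index_cube J s) y * iter_norm q js (cnorm g) y) \<partial>vol_on J \<partial>vol_on J))"
      by (intro sum.cong refl arg_cong2[where f = times] P.Fubini') measurable
    also have "\<dots> = (\<Sum>s\<in>S0. ennreal kernel_const * (\<integral>\<^sup>+y. indicator (index_cube J s) y * iter_norm q js (cnorm g) y \<partial>vol_on J))"
    proof (intro sum.cong refl)
      fix s assume "s \<in> S0"
      have "(\<integral>\<^sup>+y. \<integral>\<^sup>+x. tail_kernel_on J \<epsilon> (side (fst s)) x y * (indicator (index_cube J s) y * iter_norm q js (cnorm g) y) \<partial>vol_on J \<partial>vol_on J)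
        = (\<integral>\<^sup>+y. ennreal (tail_const TYPE('n) \<epsilon> * side (fst s) powr (- \<epsilon>)) * (indicator (index_cube J s) y * iter_norm q js (cnorm g) y) \<partial>vol_on J)"
      proof (intro nn_integral_cong)
        fix y
        have "(\<integral>\<^sup>+x. tail_kernel_on J \<epsilon> (side (fst s)) x y * (indicator (index_cube J s) y * iter_norm q js (cnorm g) y) \<partial>vol_on J)
          = (\<integral>\<^sup>+x. tail_kernel_on J \<epsilon> (side (fst s)) x y \<partial>vol_on J) * (indicator (index_cube J s) y * iter_norm q js (cnorm g) y)"
          by (intro nn_integral_multc) measurable
        then show "(\<integral>\<^sup>+x. tail_kernel_on J \<epsilon> (side (fst s)) x y * (indicator (index_cube J s) y * iter_norm q js (cnorm g) y) \<partial>vol_on J)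
          = ennreal (tail_const TYPE('n) \<epsilon> * side (fst s) powr (- \<epsilon>)) * (indicator (index_cube J s) y * iter_norm q js (cnorm g) y)"
          unfolding tail_kernel_on_integral[OF powr_gt_zero[THEN iffD2] \<epsilon>, OF zero_neq_numeral[symmetric]] .
      qed
      also have "\<dots> = ennreal (tail_const TYPE('n) \<epsilon> * side (fst s) powr (- \<epsilon>)) * (\<integral>\<^sup>+y. indicator (index_cube J s) y * iter_norm q js (cnorm g) y \<partial>vol_on J)"
        by (rule nn_integral_cmult) measurable
      finally have eq: "(\<integral>\<^sup>+y. \<integral>\<^sup>+x. tail_kernel_on J \<epsilon> (side (fst s)) x y * (indicator (index_cube J s) y * iter_norm q js (cnorm g) y) \<partial>vol_on J \<partial>vol_on J) = \<dots>" .
      have "?c s * ennreal (tail_const TYPE('n) \<epsilon> * side (fst s) powr (- \<epsilon>)) = ennreal kernel_const"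
      proof -
        have "side (fst s) powr \<epsilon> * side (fst s) powr (- \<epsilon>) = 1" by (simp flip: powr_add)
        then have "A * (real CARD('n) * side (fst s)) powr \<epsilon> * (tail_const TYPE('n) \<epsilon> * side (fst s) powr (- \<epsilon>)) = kernel_const"
          by (simp add: kernel_const_def powr_mult)
        then show ?thesis using A tail_const_pos[OF \<epsilon>, where 'n = 'n] by (simp flip: ennreal_mult)
      qed
      then show "?c s * (\<integral>\<^sup>+y. \<integral>\<^sup>+x. tail_kernel_on J \<epsilon> (side (fst s)) x y * (indicator (index_cube J s) y * iter_norm q js (cnorm g) y) \<partial>vol_on J \<partial>vol_on J)
        = ennreal kernel_const * (\<integral>\<^sup>+y. indicator (index_cube J s) y * iter_norm q js (cnorm g) y \<partial>vol_on J)"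
        unfolding eq by (simp add: mult.assoc[symmetric])
    qed
    finally show ?thesis .
  qed
  finally show ?thesis by (simp add: E_def B_def sum_distrib_left)
qed

end

section \<open>Measurability in the level and Chebyshev's inequality\<close>

lemma antimono_borel_measurable:
  fixes f :: "real \<Rightarrow> ennreal"
  assumes f: "\<And>t u. t \<le> u \<Longrightarrow> f u \<le> f t"
  shows "f \<in> borel_measurable borel"
proof (rule borel_measurableI_greater)
  fix y
  define S where "S = {t. y < f t}"
  have down: "t \<in> S" if "u \<in> S" "t \<le> u" for t u using that f[of t u] by (auto simp: S_def)
  have "S \<in> sets borel"
  proof (cases "S \<noteq> {} \<and> bdd_above S")
    case True
    have lt: "{..<Sup S} \<subseteq> S"
    proof
      fix x assume "x \<in> {..<Sup S}"
      then obtain u where "u \<in> S" "x < u" using True less_cSupD[of S x] by auto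
      then show "x \<in> S" using down[of u x] by simp
    qed
    have le: "S \<subseteq> {..Sup S}" using True by (auto intro: cSup_upper)
    define b where "b = Sup S"
    have "S = {..<b} \<or> S = {..b}"
    proof (cases "b \<in> S")
      case True
      then have "{..b} \<subseteq> S" using down by auto
      then show ?thesis using le unfolding b_def by blast
    next
      case False
      have "S \<subseteq> {..<b}"
      proof
        fix x assume "x \<in> S"
        then have "x \<le> b" "x \<noteq> b" using le False unfolding b_def by auto
        then show "x \<in> {..<b}" by simp
      qed
      then show ?thesis using lt unfolding b_def by blast
    qed
    then show ?thesis by auto
  next
    case False
    then consider "S = {}" | "\<not> bdd_above S" by blast
    then show ?thesis
    proof cases
      case 2
      have "t \<in> S" for t
      proof -
        obtain u where "u \<in> S" "\<not> u \<le> t" using 2 unfolding bdd_above_def by blast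
        then show ?thesis using down[of u t] by simp
      qed
      then have "S = UNIV" by blast
      then show ?thesis by simp
    qed simp
  qed
  then show "{t \<in> space borel. y < f t} \<in> sets borel" by (simp add: S_def)
qed

text \<open>The superlevel sets shrink as the level grows, so their measure is an antitone function
  of it and hence Borel.\<close>

lemma dyadic_above_level_measurable:
  assumes "J \<noteq> {}" "(\<integral>\<^sup>+y. F y \<partial>vol_on J) < top" "F \<in> borel_measurable borel"
  shows "(\<lambda>t. indicator {0<..} t * (ennreal (t powr r) * emeasure (vol_on J) (dyadic_above J F t))) \<in> borel_measurable borel"
proof -
  \<comment> \<open>The value \<open>top\<close> for \<open>t \<le> 0\<close> keeps the function
    antitone on the whole line.\<close>
  define f where "f t = (if 0 < t then emeasure (vol_on J) (dyadic_above J F t) else top)" for t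
  have "f u \<le> f t" if "t \<le> u" for t u
  proof (cases "0 < t")
    case True
    then have "dyadic_above J F t \<in> sets (vol_on J)" using dyadic_above_measurable[OF assms(1) True assms(2)] by simp
    then show ?thesis using that True emeasure_mono[OF dyadic_above_mono[OF that, of J F]] by (simp add: f_def)
  qed (simp add: f_def)
  then have [measurable]: "f \<in> borel_measurable borel" by (rule antimono_borel_measurable)
  have "(\<lambda>t. indicator {0<..} t * (ennreal (t powr r) * emeasure (vol_on J) (dyadic_above J F t))) = (\<lambda>t. indicator {0<..} t * (ennreal (t powr r) * f t))"
    by (auto simp: f_def indicator_def)
  also have "\<dots> \<in> borel_measurable borel" by measurable
  finally show ?thesis .
qed

lemma epow_of_mult_real: "0 \<le> l \<Longrightarrow> ennreal (l powr (- s)) * (ennreal l * c) powe s = (if l = 0 then 0 else c powe s)"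
  by (cases "l = 0") (auto simp: epow_mult epow_ennreal mult.assoc[symmetric] powr_minus simp flip: ennreal_mult)

lemma emeasure_Markov_epow:
  assumes [measurable]: "F \<in> borel_measurable M" and l: "0 < l" and s: "0 < s"
  shows "emeasure M {x \<in> space M. ennreal l < F x} \<le> ennreal (l powr (- s)) * (\<integral>\<^sup>+x. F x powe s \<partial>M)"
proof -
  have "emeasure M {x \<in> space M. ennreal l < F x} = (\<integral>\<^sup>+x. indicator {x \<in> space M. ennreal l < F x} x \<partial>M)"
    by simp
  also have "\<dots> \<le> (\<integral>\<^sup>+x. ennreal (l powr (- s)) * F x powe s \<partial>M)"
  proof (intro nn_integral_mono)
    fix x assume "x \<in> space M"
    show "indicator {x \<in> space M. ennreal l < F x} x \<le> ennreal (l powr (- s)) * F x powe s"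
    proof (cases "ennreal l < F x")
      case True
      have "1 = ennreal (l powr (- s)) * ennreal l powe s"
        using l by (simp add: epow_ennreal powr_minus flip: ennreal_mult)
      also have "\<dots> \<le> ennreal (l powr (- s)) * F x powe s"
        using True s by (intro mult_left_mono epow_mono) auto
      finally show ?thesis by (auto simp: indicator_def)
    qed auto
  qed
  also have "\<dots> = ennreal (l powr (- s)) * (\<integral>\<^sup>+x. F x powe s \<partial>M)" by (rule nn_integral_cmult) simp
  finally show ?thesis .
qed

context cz
begin

text \<open>Boundedness on L^s of the outer coordinates for functions with values in the mixed norm
  space of the coordinates \<open>js\<close>, tested on \<open>bdd_supp\<close> and expressed by
  integrals of s-th powers.\<close>

definition bdd_outer :: "real ^ 'n \<Rightarrow> 'n list \<Rightarrow> real \<Rightarrow> bool" where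
  "bdd_outer q js s \<longleftrightarrow> (\<exists>C. 0 \<le> C \<and> (\<forall>g\<in>bdd_supp. (\<integral>\<^sup>+x. iter_norm q js (cnorm (T g)) x powe s \<partial>vol_on (- set js))
    \<le> ennreal C * (\<integral>\<^sup>+x. iter_norm q js (cnorm g) x powe s \<partial>vol_on (- set js))))"

text \<open>Calderon-Zygmund decomposition of \<open>g\<close> at height \<open>l\<close> along the
  stopping cubes of its inner norm \<open>F\<close>. The good part \<open>G\<close> is treated by
  the L^s bound and accounts for the first summand of \<open>K\<close>; the bad part
  \<open>B\<close> is treated by the L1 bound off the enlarged cubes and, with the measure of these
  cubes, accounts for the second.\<close>

lemma lower_exponent_level:
  fixes js :: "'n list" and q :: "real ^ 'n"
  defines "J \<equiv> - set js"
  assumes q: "\<forall>j. 1 \<le> q $ j" and js: "distinct js" and J: "J \<noteq> {}" and s: "0 < s" and C: "0 \<le> C"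
    and bdd: "\<And>g. g \<in> bdd_supp \<Longrightarrow> (\<integral>\<^sup>+x. iter_norm q js (cnorm (T g)) x powe s \<partial>vol_on J) \<le> ennreal C * (\<integral>\<^sup>+x. iter_norm q js (cnorm g) x powe s \<partial>vol_on J)"
    and g: "g \<in> bdd_supp" and a: "2 * real CARD('n) \<le> 2 ^ a" and l: "0 < l"
  defines "K \<equiv> ennreal C * (1 + (2 ^ card J) powe s) + (3 ^ card J * 2 ^ (a * card J) + ennreal kernel_const * 2 ^ card J)"
  shows "emeasure (vol_on J) {x. ennreal (2 * l) < iter_norm q js (cnorm (T g)) x}
    \<le> K * (ennreal (l powr (- s)) * (\<integral>\<^sup>+x. indicator {x. iter_norm q js (cnorm g) x \<le> ennreal l} x * iter_norm q js (cnorm g) x powe s \<partial>vol_on J)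
      + emeasure (vol_on J) (dyadic_above J (iter_norm q js (cnorm g)) l))"
proof -
  define F where "F = iter_norm q js (cnorm g)"
  note gm [measurable] = bdd_supp_measurable[OF g]
  have Fm [measurable]: "F \<in> borel_measurable borel" unfolding F_def by measurable
  have Ffin: "(\<integral>\<^sup>+x. F x \<partial>vol_on J) < top" unfolding F_def J_def by (rule iter_norm_BB_integral1[OF q js g])
  have Fsfin: "(\<integral>\<^sup>+x. F x powe s \<partial>vol_on J) < top" unfolding F_def J_def by (rule iter_norm_BB_integral[OF q js g s])
  have Fdep: "depends_on J F" unfolding F_def J_def by (rule depends_on_mn) simp
  define Om' where "Om' = dyadic_above J F l"
  have Omm [measurable]: "Om' \<in> sets borel" unfolding Om'_def by (rule dyadic_above_measurable[OF J l Ffin])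
  obtain S where S: "stop_family J F l S" using dyadic_above_stopping[OF J l Ffin] by blast
  note SD = stop_familyD[OF S]
  have mOmfin: "emeasure (vol_on J) Om' < top" unfolding Om'_def by (rule dyadic_above_finite(1)[OF J l Ffin]) simp
  have OmF: "(\<integral>\<^sup>+x. indicator Om' x * F x powe s \<partial>vol_on J) < top"
    by (rule le_less_trans[OF nn_integral_mono Fsfin]) (auto simp: indicator_def)
  \<comment> \<open>On the discarded cubes \<open>G\<close> still equals \<open>g\<close>. The bound
    asked for there, l^s times the measure of the superlevel set, is of the same order as the
    contribution of the cubes on which \<open>g\<close> is averaged.\<close>
  have "\<exists>S0\<subseteq>S. finite S0 \<and> (\<integral>\<^sup>+x. indicator (Om' - (\<Union>s\<in>S0. index_cube J s)) x * F x powe s \<partial>vol_on J) \<le> ennreal (l powr s) * emeasure (vol_on J) Om'"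
  proof (cases "emeasure (vol_on J) Om' = 0")
    case True
    have "AE x in vol_on J. x \<notin> Om'" using True by (intro AE_not_in) (auto simp: null_sets_def)
    then have "AE x in vol_on J. indicator Om' x * F x powe s = 0" by (rule eventually_mono) simp
    then have "(\<integral>\<^sup>+x. indicator Om' x * F x powe s \<partial>vol_on J) = 0" by (subst nn_integral_0_iff_AE) auto
    then show ?thesis by (intro exI[of _ "{}"]) simp
  next
    case False
    then have "0 < ennreal (l powr s) * emeasure (vol_on J) Om'" using l by (simp add: ennreal_zero_less_mult_iff zero_less_iff_neq_zero)
    from finite_part[of "index_cube J" "vol_on J" "\<lambda>x. F x powe s" Om' S, OF _ _ _ SD(2)[folded Om'_def] OmF this]
    show ?thesis by (auto intro: less_imp_le)
  qed
  then obtain S0 where S0: "S0 \<subseteq> S" "finite S0"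
    and rest: "(\<integral>\<^sup>+x. indicator (Om' - (\<Union>s\<in>S0. index_cube J s)) x * F x powe s \<partial>vol_on J) \<le> ennreal (l powr s) * emeasure (vol_on J) Om'" by blast
  have S0x: "\<exists>x0. s = (fst s, dyadic_index J (fst s) x0)" if "s \<in> S0" for s using SD(5)[of s] S0(1) that by blast
  define U where "U = (\<Union>s\<in>S0. index_cube J s)"
  have [measurable]: "U \<in> sets borel" unfolding U_def using S0(2) by (intro sets.finite_UN) auto
  have UOm: "U \<subseteq> Om'" using S0(1) SD(2) unfolding U_def Om'_def by blast
  define B where "B = (\<lambda>y. \<Sum>s\<in>S0. bad_part (set js) g s y)"
  have bad_part: "bad_part (set js) g s \<in> bdd_supp" if "s \<in> S0" for s using S0x[OF that] bad_part_BB[OF g] unfolding J_def by blast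
  have B: "B \<in> bdd_supp" unfolding B_def by (intro bdd_supp_sum bad_part)
  define G where "G = (\<lambda>y. g y + - B y)"
  have G: "G \<in> bdd_supp" unfolding G_def by (intro bdd_supp_add bdd_supp_uminus g B)
  note [measurable] = bdd_supp_measurable[OF B] bdd_supp_measurable[OF G] T_measurable[OF B] T_measurable[OF G] T_measurable[OF g]
  have NG [measurable]: "iter_norm q js (cnorm (T G)) \<in> borel_measurable borel" and NB [measurable]: "iter_norm q js (cnorm (T B)) \<in> borel_measurable borel"
    and Ng [measurable]: "iter_norm q js (cnorm (T g)) \<in> borel_measurable borel" by measurable
  have Bs: "B y = bad_part (set js) g s y" if s: "s \<in> S0" "y \<in> index_cube J s" for s y
  proof -
    have "bad_part (set js) g s' y = 0" if "s' \<in> S0 - {s}" for s'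
    proof -
      have "y \<notin> index_cube J s'" using disjoint_family_onD[OF SD(1), of s s'] that s S0(1) by blast
      then show ?thesis by (simp add: bad_part_def J_def)
    qed
    then have "(\<Sum>s'\<in>S0 - {s}. bad_part (set js) g s' y) = 0" by (rule sum.neutral[OF ballI])
    then show ?thesis unfolding B_def using S0(2) s(1) by (simp add: sum.remove)
  qed
  have B0: "B y = 0" if "y \<notin> U" for y
    unfolding B_def using that by (intro sum.neutral) (auto simp: bad_part_def U_def J_def)
  \<comment> \<open>On a selected cube \<open>G\<close> is the average of \<open>g\<close>. Its
    inner norm is at most the average of \<open>F\<close>, which is bounded because the parent cube
    was not selected.\<close>
  have GU: "iter_norm q js (cnorm G) x \<le> 2 ^ card J * ennreal l" if x: "x \<in> U" for x
  proof -
    obtain s where s0: "s \<in> S0" "x \<in> index_cube J s" using x unfolding U_def by blast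
    obtain x0 where x0: "s = (fst s, dyadic_index J (fst s) x0)" using S0x[OF s0(1)] by blast
    have "iter_norm q js (cnorm G) x = iter_norm q js (cnorm (cube_avg (set js) g s)) x"
    proof (rule iter_norm_cong_fibre[OF q])
      fix y assume "\<And>i. i \<notin> set js \<Longrightarrow> y $ i = x $ i"
      then have "y \<in> index_cube J s" using s0(2) jdepD[OF depends_on_cb[of J s], of y x] by (auto simp: J_def)
      then show "cnorm G y = cnorm (cube_avg (set js) g s) y"
        unfolding G_def Bs[OF s0(1) \<open>y \<in> index_cube J s\<close>] by (simp add: bad_part_def J_def)
    qed
    moreover have "cube_vol J (fst s) * iter_norm q js (cnorm (cube_avg (set js) g s)) x \<le> cube_vol J (fst s) * (2 ^ card J * ennreal l)"
    proof -
      have "cube_vol J (fst s) * iter_norm q js (cnorm (cube_avg (set js) g s)) x \<le> (\<integral>\<^sup>+w. indicator (index_cube J s) w * F w \<partial>vol_on J)"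
        unfolding F_def J_def by (rule iter_norm_av[OF q gm x0[unfolded J_def]])
      also have "\<dots> \<le> 2 ^ card J * ennreal l * cube_vol J (fst s)"
        using S0(1) s0(1) by (intro stop_family_cube[OF S _ l]) auto
      finally show ?thesis by (simp add: ac_simps)
    qed
    ultimately show ?thesis unfolding cube_vol_def by (simp add: not_less[symmetric] ennreal_mult_less_cancel)
  qed
  have GnU: "iter_norm q js (cnorm G) x = F x" if x: "x \<notin> U" for x
    unfolding F_def
  proof (rule iter_norm_cong_fibre[OF q])
    fix y assume y: "\<And>i. i \<notin> set js \<Longrightarrow> y $ i = x $ i"
    have "y \<notin> index_cube J s" if "s \<in> S0" for s
      using x that y jdepD[OF depends_on_cb[of J s], of y x] by (auto simp: J_def U_def)
    then have "y \<notin> U" by (auto simp: U_def)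
    then show "cnorm G y = cnorm g y" unfolding G_def using B0 by simp
  qed
  let ?I = "\<integral>\<^sup>+x. indicator {x. F x \<le> ennreal l} x * F x powe s \<partial>vol_on J"
  let ?m = "emeasure (vol_on J) Om'"
  have good: "(\<integral>\<^sup>+x. iter_norm q js (cnorm G) x powe s \<partial>vol_on J) \<le> ?I + ennreal (l powr s) * ?m + (2 ^ card J * ennreal l) powe s * ?m"
  proof -
    \<comment> \<open>The three terms belong to the discarded cubes, to the averaged ones, and to
      the complement of the superlevel set, where \<open>F \<le> l\<close> almost everywhere by
      differentiation.\<close>
    have "AE x in vol_on J. iter_norm q js (cnorm G) x powe s \<le> indicator {x. F x \<le> ennreal l} x * F x powe s
      + indicator (Om' - U) x * F x powe s + indicator Om' x * (2 ^ card J * ennreal l) powe s"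
      using dyadic_above_differentiation[OF J l Ffin Fm Fdep]
    proof (rule eventually_mono)
      fix x assume x: "x \<notin> dyadic_above J F l \<longrightarrow> F x \<le> ennreal l"
      consider "x \<in> U" | "x \<notin> U" "x \<in> Om'" | "x \<notin> U" "x \<notin> Om'" by blast
      then show "iter_norm q js (cnorm G) x powe s \<le> indicator {x. F x \<le> ennreal l} x * F x powe s
        + indicator (Om' - U) x * F x powe s + indicator Om' x * (2 ^ card J * ennreal l) powe s"
      proof cases
        case 1
        then have "iter_norm q js (cnorm G) x powe s \<le> (2 ^ card J * ennreal l) powe s"
          using s by (intro epow_mono GU) auto
        also have "\<dots> = indicator Om' x * (2 ^ card J * ennreal l) powe s" using 1 UOm by (auto simp: indicator_def)
        finally show ?thesis by (rule order_trans) simp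
      next
        case 2 then show ?thesis by (simp add: GnU add_increasing add_increasing2)
      next
        case 3 then show ?thesis using x by (simp add: GnU Om'_def)
      qed
    qed
    then have "(\<integral>\<^sup>+x. iter_norm q js (cnorm G) x powe s \<partial>vol_on J) \<le> (\<integral>\<^sup>+x. indicator {x. F x \<le> ennreal l} x * F x powe s
        + indicator (Om' - U) x * F x powe s + indicator Om' x * (2 ^ card J * ennreal l) powe s \<partial>vol_on J)"
      by (rule nn_integral_mono_AE)
    also have "\<dots> = ?I + (\<integral>\<^sup>+x. indicator (Om' - U) x * F x powe s \<partial>vol_on J) + (2 ^ card J * ennreal l) powe s * ?m"
      by (simp add: nn_integral_add indicator_mult_const)
    also have "\<dots> \<le> ?I + ennreal (l powr s) * ?m + (2 ^ card J * ennreal l) powe s * ?m"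
      using rest unfolding U_def[symmetric] by (intro add_mono) auto
    finally show ?thesis .
  qed
  have part1: "emeasure (vol_on J) {x. ennreal l < iter_norm q js (cnorm (T G)) x} \<le> ennreal C * (ennreal (l powr (- s)) * ?I + (1 + (2 ^ card J) powe s) * ?m)"
  proof -
    have "emeasure (vol_on J) {x. ennreal l < iter_norm q js (cnorm (T G)) x} \<le> ennreal (l powr (- s)) * (\<integral>\<^sup>+x. iter_norm q js (cnorm (T G)) x powe s \<partial>vol_on J)"
      using emeasure_Markov_epow[of "iter_norm q js (cnorm (T G))" "vol_on J" l s] l s by simp
    also have "\<dots> \<le> ennreal (l powr (- s)) * (ennreal C * (?I + ennreal (l powr s) * ?m + (2 ^ card J * ennreal l) powe s * ?m))"
      by (intro mult_left_mono order_trans[OF bdd[OF G]] good) auto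
    also have "\<dots> = ennreal C * (ennreal (l powr (- s)) * ?I + (ennreal (l powr (- s)) * ennreal (l powr s)) * ?m
       + (ennreal (l powr (- s)) * (2 ^ card J * ennreal l) powe s) * ?m)"
      by (simp add: distrib_left ac_simps)
    also have "ennreal (l powr (- s)) * ennreal (l powr s) = 1"
      using l by (simp flip: ennreal_mult powr_add)
    also have "ennreal (l powr (- s)) * (2 ^ card J * ennreal l) powe s = (2 ^ card J) powe s"
      using epow_of_mult_real[of l s "2 ^ card J"] l by (simp add: mult.commute)
    finally show ?thesis by (simp add: distrib_right add.assoc)
  qed
  define E where "E = (\<Union>s\<in>S0. enlarged J a s)"
  have enlm: "enlarged J a s \<in> sets borel" "emeasure (vol_on J) (enlarged J a s) \<le> (3 ^ card J * 2 ^ (a * card J)) * cube_vol J (fst s)" if s: "s \<in> S0" for s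
  proof -
    obtain x0 where x0: "s = (fst s, dyadic_index J (fst s) x0)" using S0x[OF s] by blast
    show "enlarged J a s \<in> sets borel" unfolding enlarged_eq[OF x0] by simp
    show "emeasure (vol_on J) (enlarged J a s) \<le> (3 ^ card J * 2 ^ (a * card J)) * cube_vol J (fst s)"
      unfolding enlarged_eq[OF x0] emeasure_tri cube_vol_add by (simp add: mult.assoc)
  qed
  have [measurable]: "E \<in> sets borel" unfolding E_def using S0(2) enlm by (intro sets.finite_UN) auto
  have disj: "disjoint_family_on (index_cube J) S0" using SD(1) S0(1) by (rule disjoint_family_on_mono[rotated])
  have mE: "emeasure (vol_on J) E \<le> (3 ^ card J * 2 ^ (a * card J)) * ?m"
  proof -
    have "emeasure (vol_on J) E \<le> (3 ^ card J * 2 ^ (a * card J)) * emeasure (vol_on J) U"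
      unfolding E_def U_def by (rule emeasure_mu_tri_UN[OF disj S0x enlm])
    also have "\<dots> \<le> (3 ^ card J * 2 ^ (a * card J)) * ?m" by (intro mult_left_mono emeasure_mono UOm) auto
    finally show ?thesis .
  qed
  \<comment> \<open>The enlarged cubes enter by their measure. Off them Chebyshev's inequality with
    exponent 1 is used, and its factor 1/l cancels the \<open>l\<close> in the averages over the
    stopping cubes.\<close>
  have part2: "emeasure (vol_on J) {x. ennreal l < iter_norm q js (cnorm (T B)) x} \<le> (3 ^ card J * 2 ^ (a * card J) + ennreal kernel_const * 2 ^ card J) * ?m"
  proof -
    have "emeasure (vol_on J) {x. ennreal l < iter_norm q js (cnorm (T B)) x}
      \<le> emeasure (vol_on J) (E \<union> {x. ennreal l < indicator (- E) x * iter_norm q js (cnorm (T B)) x})"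
      by (intro emeasure_mono) (auto simp: indicator_def)
    also have "\<dots> \<le> emeasure (vol_on J) E + emeasure (vol_on J) {x. ennreal l < indicator (- E) x * iter_norm q js (cnorm (T B)) x}"
      by (intro emeasure_subadditive) auto
    also have "emeasure (vol_on J) {x. ennreal l < indicator (- E) x * iter_norm q js (cnorm (T B)) x}
      \<le> ennreal (l powr (- 1)) * (\<integral>\<^sup>+x. indicator (- E) x * iter_norm q js (cnorm (T B)) x \<partial>vol_on J)"
      using emeasure_Markov_epow[of "\<lambda>x. indicator (- E) x * iter_norm q js (cnorm (T B)) x" "vol_on J" l 1] l by simp
    also have "(\<integral>\<^sup>+x. indicator (- E) x * iter_norm q js (cnorm (T B)) x \<partial>vol_on J) \<le> ennreal kernel_const * (\<Sum>s\<in>S0. \<integral>\<^sup>+y. indicator (index_cube J s) y * F y \<partial>vol_on J)"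
      unfolding E_def B_def F_def J_def by (rule T_bad_integral[OF q js g a S0(2) S0x[unfolded J_def]])
    also have "(\<Sum>s\<in>S0. \<integral>\<^sup>+y. indicator (index_cube J s) y * F y \<partial>vol_on J) = (\<integral>\<^sup>+y. indicator U y * F y \<partial>vol_on J)"
      unfolding U_def using nn_integral_UN_countable[OF _ disj, of "vol_on J" F] S0(2)
      by (simp add: nn_integral_count_space_finite countable_finite)
    also have "\<dots> \<le> (\<integral>\<^sup>+y. indicator Om' y * F y \<partial>vol_on J)"
      using UOm by (intro nn_integral_mono mult_right_mono) (auto simp: indicator_def)
    also have "\<dots> \<le> 2 ^ card J * ennreal l * ?m"
      unfolding Om'_def by (rule dyadic_above_weak(2)[OF J l Ffin Fm])
    also note mE
    finally have "emeasure (vol_on J) {x. ennreal l < iter_norm q js (cnorm (T B)) x}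
      \<le> 3 ^ card J * 2 ^ (a * card J) * ?m + ennreal (l powr - 1) * (ennreal kernel_const * (2 ^ card J * ennreal l * ?m))"
      by (simp add: add_mono mult_left_mono)
    also have "ennreal (l powr - 1) * (ennreal kernel_const * (2 ^ card J * ennreal l * ?m)) = (ennreal (l powr - 1) * ennreal l) * (ennreal kernel_const * 2 ^ card J * ?m)"
      by (simp add: ac_simps)
    also have "ennreal (l powr - 1) * ennreal l = 1" using l by (simp add: powr_minus flip: ennreal_mult)
    finally show ?thesis by (simp add: distrib_right)
  qed
  have "(\<lambda>y. G y + B y) = g" by (auto simp: G_def)
  then have "AE x in lborel. T g x = T G x + T B x" using T_add[OF G B] by simp
  then have "AE x in vol_on UNIV. cnorm (T g) x \<le> cnorm (T G) x + cnorm (T B) x" unfolding vol_on_UNIV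
    by (rule eventually_mono) (simp add: norm_triangle_ineq ennreal_leI flip: ennreal_plus)
  from iter_norm_AE_mono[OF q js subset_UNIV this]
  have "AE x in vol_on J. iter_norm q js (cnorm (T g)) x \<le> iter_norm q js (cnorm (T G)) x + iter_norm q js (cnorm (T B)) x"
    unfolding J_def Compl_eq_Diff_UNIV by (rule eventually_mono) (rule order_trans, assumption, rule iter_norm_add[OF q], measurable)
  then have "AE x in vol_on J. x \<in> {x. ennreal (2 * l) < iter_norm q js (cnorm (T g)) x} \<longrightarrow>
      x \<in> {x. ennreal l < iter_norm q js (cnorm (T G)) x} \<union> {x. ennreal l < iter_norm q js (cnorm (T B)) x}"
  proof (rule eventually_mono, intro impI)
    fix x assume le: "iter_norm q js (cnorm (T g)) x \<le> iter_norm q js (cnorm (T G)) x + iter_norm q js (cnorm (T B)) x"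
      and x: "x \<in> {x. ennreal (2 * l) < iter_norm q js (cnorm (T g)) x}"
    show "x \<in> {x. ennreal l < iter_norm q js (cnorm (T G)) x} \<union> {x. ennreal l < iter_norm q js (cnorm (T B)) x}"
    proof (rule ccontr)
      assume "\<not> ?thesis"
      then have "iter_norm q js (cnorm (T G)) x + iter_norm q js (cnorm (T B)) x \<le> ennreal l + ennreal l" by (intro add_mono) auto
      also have "\<dots> = ennreal (2 * l)" using l by (simp flip: ennreal_plus)
      finally show False using le x by (auto dest: order_trans simp: not_le[symmetric])
    qed
  qed
  then have "emeasure (vol_on J) {x. ennreal (2 * l) < iter_norm q js (cnorm (T g)) x}
    \<le> emeasure (vol_on J) ({x. ennreal l < iter_norm q js (cnorm (T G)) x} \<union> {x. ennreal l < iter_norm q js (cnorm (T B)) x})"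
    by (intro emeasure_mono_AE) auto
  also have "\<dots> \<le> emeasure (vol_on J) {x. ennreal l < iter_norm q js (cnorm (T G)) x} + emeasure (vol_on J) {x. ennreal l < iter_norm q js (cnorm (T B)) x}"
    by (intro emeasure_subadditive) auto
  also have "\<dots> \<le> ennreal C * (ennreal (l powr (- s)) * ?I + (1 + (2 ^ card J) powe s) * ?m)
    + (3 ^ card J * 2 ^ (a * card J) + ennreal kernel_const * 2 ^ card J) * ?m"
    by (intro add_mono part1 part2)
  also have "\<dots> = ennreal C * (ennreal (l powr (- s)) * ?I) + K * ?m"
    unfolding K_def by (simp add: distrib_left distrib_right ac_simps)
  also have "\<dots> \<le> K * (ennreal (l powr (- s)) * ?I) + K * ?m"
  proof (intro add_right_mono mult_right_mono)
    have "ennreal C * 1 \<le> ennreal C * (1 + (2 ^ card J) powe s)" by (intro mult_left_mono) auto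
    then show "ennreal C \<le> K" unfolding K_def by (simp add: add_increasing2)
  qed auto
  finally show ?thesis unfolding F_def[symmetric] Om'_def[symmetric] by (simp add: distrib_left)
qed

text \<open>Integration of the level estimate against t^(r-1), as in Marcinkiewicz interpolation.
  The part with F \<le> t converges at infinity because r < s and yields 1/(s-r); the superlevel
  sets are controlled by the maximal inequality, which requires 1 < r.\<close>

theorem bdd_outer_lower_exponent:
  assumes q: "\<forall>j. 1 \<le> q $ j" and js: "distinct js" and J: "- set js \<noteq> {}" and r: "1 < r" "r < s" and bdd: "bdd_outer q js s"
  shows "bdd_outer q js r"
proof -
  define J where "J = - set js"
  obtain C where C: "0 \<le> C" and bd: "\<And>g. g \<in> bdd_supp \<Longrightarrow> (\<integral>\<^sup>+x. iter_norm q js (cnorm (T g)) x powe s \<partial>vol_on J) \<le> ennreal C * (\<integral>\<^sup>+x. iter_norm q js (cnorm g) x powe s \<partial>vol_on J)"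
    using bdd unfolding bdd_outer_def J_def by blast
  obtain a :: nat where "2 * real CARD('n) < 2 ^ a" using real_arch_pow[of 2] by auto
  then have a: "2 * real CARD('n) \<le> 2 ^ a" by simp
  define K where "K = ennreal C * (1 + (2 ^ card J) powe s) + (3 ^ card J * 2 ^ (a * card J) + ennreal kernel_const * 2 ^ card J)"
  have Kfin: "K < top" unfolding K_def by (simp add: ennreal_mult_less_top power_less_top_ennreal)
  \<comment> \<open>2^r compensates for the doubled level in \<open>lower_exponent_level\<close>,
    and r comes from the layer-cake formula.\<close>
  define c where "c = ennreal (2 powr r) * (ennreal r * (K * (ennreal (1 / (s - r)) + ennreal (2 powr r / (r - 1)))))"
  have main: "(\<integral>\<^sup>+x. iter_norm q js (cnorm (T g)) x powe r \<partial>vol_on J) \<le> c * (\<integral>\<^sup>+x. iter_norm q js (cnorm g) x powe r \<partial>vol_on J)" if g: "g \<in> bdd_supp" for g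
  proof -
    define F where "F = iter_norm q js (cnorm g)"
    define W where "W = iter_norm q js (cnorm (T g))"
    note [measurable] = bdd_supp_measurable[OF g] T_measurable[OF g]
    have Fm [measurable]: "F \<in> borel_measurable borel" unfolding F_def by measurable
    have Wm [measurable]: "W \<in> borel_measurable borel" unfolding W_def by measurable
    have Ffin: "(\<integral>\<^sup>+x. F x \<partial>vol_on J) < top" unfolding F_def J_def by (rule iter_norm_BB_integral1[OF q js g])
    have Jne: "J \<noteq> {}" using J unfolding J_def .
    interpret m: sigma_finite_measure "vol_on J" by (rule sigma_finite_mu)
    interpret P: pair_sigma_finite "vol_on J" lborel by (simp add: pair_sigma_finite_def sigma_finite_mu lborel.sigma_finite_measure_axioms)
    let ?I = "\<lambda>t. \<integral>\<^sup>+x. indicator {x. F x \<le> ennreal t} x * F x powe s \<partial>vol_on J"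
    have Im [measurable]: "?I \<in> borel_measurable borel"
      unfolding indicator_def mem_Collect_eq of_bool_def by measurable
    have half: "ennreal t < ennreal (1 / 2) * w \<longleftrightarrow> ennreal (2 * t) < w" if "0 < t" for t w
    proof -
      have "ennreal t = ennreal (1 / 2) * ennreal (2 * t)" using ennreal_mult'[of "1 / 2" "2 * t"] by simp
      then show ?thesis using ennreal_mult_less_cancel[of "1 / 2" "ennreal (2 * t)" w] by simp
    qed
    have "(\<integral>\<^sup>+x. W x powe r \<partial>vol_on J) = (\<integral>\<^sup>+x. ennreal (2 powr r) * (ennreal (1 / 2) * W x) powe r \<partial>vol_on J)"
    proof (intro nn_integral_cong)
      fix x
      have "ennreal (2 powr r) * (ennreal (1 / 2) * W x) powe r = (ennreal (2 powr r) * ennreal ((1 / 2) powr r)) * W x powe r"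
        unfolding epow_mult by (subst epow_ennreal) (simp_all only: mult.assoc zero_le_divide_1_iff zero_le_numeral)
      also have "ennreal (2 powr r) * ennreal ((1 / 2) powr r) = 1" by (simp add: powr_divide flip: ennreal_mult)
      finally show "W x powe r = ennreal (2 powr r) * (ennreal (1 / 2) * W x) powe r" by simp
    qed
    also have "\<dots> = ennreal (2 powr r) * (\<integral>\<^sup>+x. (ennreal (1 / 2) * W x) powe r \<partial>vol_on J)" by (rule nn_integral_cmult) measurable
    also have "(\<integral>\<^sup>+x. (ennreal (1 / 2) * W x) powe r \<partial>vol_on J) = ennreal r * (\<integral>\<^sup>+t. indicator {0<..} t * (ennreal (t powr (r - 1)) * emeasure (vol_on J) {x. ennreal t < ennreal (1 / 2) * W x}) \<partial>lborel)"
      using layer_cake[OF sigma_finite_mu, of "\<lambda>x. ennreal (1 / 2) * W x" J r] r by simp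
    finally have eq1: "(\<integral>\<^sup>+x. W x powe r \<partial>vol_on J) = ennreal (2 powr r) * (ennreal r * (\<integral>\<^sup>+t. indicator {0<..} t * (ennreal (t powr (r - 1)) * emeasure (vol_on J) {x. ennreal t < ennreal (1 / 2) * W x}) \<partial>lborel))" .
    have "(\<integral>\<^sup>+t. indicator {0<..} t * (ennreal (t powr (r - 1)) * emeasure (vol_on J) {x. ennreal t < ennreal (1 / 2) * W x}) \<partial>lborel)
      \<le> (\<integral>\<^sup>+t. K * (indicator {0<..} t * (ennreal (t powr (r - 1)) * (ennreal (t powr (- s)) * ?I t))) + K * (indicator {0<..} t * (ennreal (t powr (r - 1)) * emeasure (vol_on J) (dyadic_above J F t))) \<partial>lborel)"
    proof (intro nn_integral_mono)
      fix t :: real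
      show "indicator {0<..} t * (ennreal (t powr (r - 1)) * emeasure (vol_on J) {x. ennreal t < ennreal (1 / 2) * W x})
        \<le> K * (indicator {0<..} t * (ennreal (t powr (r - 1)) * (ennreal (t powr (- s)) * ?I t))) + K * (indicator {0<..} t * (ennreal (t powr (r - 1)) * emeasure (vol_on J) (dyadic_above J F t)))"
      proof (cases "0 < t")
        case True
        have "emeasure (vol_on J) {x. ennreal (2 * t) < W x} \<le> K * (ennreal (t powr (- s)) * ?I t + emeasure (vol_on J) (dyadic_above J F t))"
          unfolding W_def F_def K_def J_def using r
          by (intro lower_exponent_level[OF q js J _ C bd[unfolded J_def] g a True]) auto
        then have le: "ennreal (t powr (r - 1)) * emeasure (vol_on J) {x. ennreal (2 * t) < W x} \<le> ennreal (t powr (r - 1)) * (K * (ennreal (t powr (- s)) * ?I t + emeasure (vol_on J) (dyadic_above J F t)))"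
          by (rule mult_left_mono) simp
        have eq: "a * (K * (X + Y)) = K * (a * X) + K * (a * Y)" for a X Y :: ennreal
          by (simp add: distrib_left mult.left_commute)
        have W: "{x. ennreal t < ennreal (1 / 2) * W x} = {x. ennreal (2 * t) < W x}" using half[OF True] by blast
        have ind: "indicator {0<..} t = (1::ennreal)" using True by simp
        show ?thesis unfolding W ind mult_1 using le unfolding eq .
      qed simp
    qed
    also have "\<dots> \<le> K * (ennreal (1 / (s - r)) * (\<integral>\<^sup>+x. F x powe r \<partial>vol_on J)) + K * (ennreal (2 powr r / (r - 1)) * (\<integral>\<^sup>+x. F x powe r \<partial>vol_on J))"
    proof -
      have Omint: "(\<lambda>t. indicator {0<..} t * (ennreal (t powr (r - 1)) * emeasure (vol_on J) (dyadic_above J F t))) \<in> borel_measurable borel"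
        by (rule dyadic_above_level_measurable[OF Jne Ffin Fm])
      have 1: "(\<integral>\<^sup>+t. indicator {0<..} t * (ennreal (t powr (r - 1)) * (ennreal (t powr (- s)) * ?I t)) \<partial>lborel)
        \<le> ennreal (1 / (s - r)) * (\<integral>\<^sup>+x. F x powe r \<partial>vol_on J)"
      proof -
        have "(\<integral>\<^sup>+t. indicator {0<..} t * (ennreal (t powr (r - 1)) * (ennreal (t powr (- s)) * ?I t)) \<partial>lborel)
          = (\<integral>\<^sup>+t. \<integral>\<^sup>+x. (indicator {t. 0 < t \<and> F x \<le> ennreal t} t * ennreal (t powr (- (s - r) - 1))) * F x powe s \<partial>vol_on J \<partial>lborel)"
        proof (intro nn_integral_cong)
          fix t :: real
          have e: "ennreal (t powr (r - 1)) * ennreal (t powr (- s)) = ennreal (t powr (- (s - r) - 1))"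
            by (simp add: algebra_simps flip: ennreal_mult powr_add)
          have "indicator {0<..} t * (ennreal (t powr (r - 1)) * (ennreal (t powr (- s)) * ?I t))
            = (indicator {0<..} t * ennreal (t powr (- (s - r) - 1))) * ?I t" unfolding e[symmetric] by (simp add: ac_simps)
          also have "\<dots> = (\<integral>\<^sup>+x. (indicator {0<..} t * ennreal (t powr (- (s - r) - 1))) * (indicator {x. F x \<le> ennreal t} x * F x powe s) \<partial>vol_on J)"
            by (rule nn_integral_cmult[symmetric]) measurable
          also have "\<dots> = (\<integral>\<^sup>+x. (indicator {t. 0 < t \<and> F x \<le> ennreal t} t * ennreal (t powr (- (s - r) - 1))) * F x powe s \<partial>vol_on J)"
            by (intro nn_integral_cong) (auto simp: indicator_def)
          finally show "indicator {0<..} t * (ennreal (t powr (r - 1)) * (ennreal (t powr (- s)) * ?I t))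
            = (\<integral>\<^sup>+x. (indicator {t. 0 < t \<and> F x \<le> ennreal t} t * ennreal (t powr (- (s - r) - 1))) * F x powe s \<partial>vol_on J)" .
        qed
        also have "\<dots> = (\<integral>\<^sup>+x. \<integral>\<^sup>+t. (indicator {t. 0 < t \<and> F x \<le> ennreal t} t * ennreal (t powr (- (s - r) - 1))) * F x powe s \<partial>lborel \<partial>vol_on J)"
          by (rule P.Fubini') (simp add: indicator_def[abs_def] of_bool_def)
        also have "\<dots> = (\<integral>\<^sup>+x. (\<integral>\<^sup>+t. indicator {t. 0 < t \<and> F x \<le> ennreal t} t * ennreal (t powr (- (s - r) - 1)) \<partial>lborel) * F x powe s \<partial>vol_on J)"
          by (intro nn_integral_cong nn_integral_multc) measurable
        also have "\<dots> \<le> (\<integral>\<^sup>+x. ennreal (1 / (s - r)) * F x powe r \<partial>vol_on J)"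
        proof (intro nn_integral_mono)
          fix x
          have "F x powe s = F x powe (s - r) * F x powe r" by (simp flip: epow_add)
          then show "(\<integral>\<^sup>+t. indicator {t. 0 < t \<and> F x \<le> ennreal t} t * ennreal (t powr (- (s - r) - 1)) \<partial>lborel) * F x powe s \<le> ennreal (1 / (s - r)) * F x powe r"
            using mult_right_mono[OF nn_integral_powr_inf[of "s - r" "F x"], of "F x powe r"] r by (simp add: mult.assoc)
        qed
        also have "\<dots> = ennreal (1 / (s - r)) * (\<integral>\<^sup>+x. F x powe r \<partial>vol_on J)" by (rule nn_integral_cmult) measurable
        finally show ?thesis .
      qed
      have 2: "(\<integral>\<^sup>+t. indicator {0<..} t * (ennreal (t powr (r - 1)) * emeasure (vol_on J) (dyadic_above J F t)) \<partial>lborel) \<le> ennreal (2 powr r / (r - 1)) * (\<integral>\<^sup>+x. F x powe r \<partial>vol_on J)"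
        by (rule dyadic_above_layer[OF Jne r(1) Ffin Fm])
      show ?thesis
        by (subst nn_integral_add) (use Omint in \<open>auto simp: nn_integral_cmult intro!: add_mono mult_left_mono 1 2\<close>)
    qed
    finally have "(\<integral>\<^sup>+x. W x powe r \<partial>vol_on J) \<le> ennreal (2 powr r) * (ennreal r * (K * (ennreal (1 / (s - r)) * (\<integral>\<^sup>+x. F x powe r \<partial>vol_on J)) + K * (ennreal (2 powr r / (r - 1)) * (\<integral>\<^sup>+x. F x powe r \<partial>vol_on J))))"
      unfolding eq1 by (intro mult_left_mono) simp_all
    then show ?thesis unfolding c_def F_def W_def by (simp add: distrib_left distrib_right ac_simps)
  qed
  have "c < top" unfolding c_def using Kfin by (simp add: ennreal_mult_less_top)
  then obtain c' where "c = ennreal c'" "0 \<le> c'" by (cases c) auto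
  then show ?thesis unfolding bdd_outer_def J_def[symmetric] using main by blast
qed

end

section \<open>Raising the outer exponent\<close>

context cz
begin

text \<open>The value of \<open>T g\<close> at x is compared with that at the point w with the inner
  coordinates of x and the outer ones of z. Only outer coordinates move, and within one cube, so
  smoothness of \<open>k\<close> in the first variable controls the difference; the inner norm is
  then taken over the common inner coordinates. The quantifier over z stands outside because a
  single good z is picked later.\<close>

lemma T_far:
  fixes js :: "'n list" and q :: "real ^ 'n"
  defines "J \<equiv> - set js"
  assumes q: "\<forall>j. 1 \<le> q $ j" and js: "distinct js"
    and g: "g \<in> bdd_supp" and a: "2 * real CARD('n) \<le> 2 ^ a"
    and vanish: "\<And>y. y \<in> neighbours J (\<kappa> + int a) x0 \<Longrightarrow> g y = 0"
  shows "AE z in vol_on J. z \<in> dyadic_cube J \<kappa> x0 \<longrightarrow> (AE x in vol_on J. x \<in> dyadic_cube J \<kappa> x0 \<longrightarrow>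
    iter_norm q js (cnorm (T g)) x \<le> iter_norm q js (cnorm (T g)) z
      + ennreal (A * (real CARD('n) * side \<kappa>) powr \<epsilon>) * (\<integral>\<^sup>+y. tail_kernel_on J \<epsilon> (side \<kappa>) x y * iter_norm q js (cnorm g) y \<partial>vol_on J))"
proof -
  define I where "I = set js"
  define l where "l = side \<kappa>"
  define c where "c = ennreal (A * (real CARD('n) * l) powr \<epsilon>)"
  define f where "f = dyadic_index J (\<kappa> + int a) x0"
  define L where "L = side (\<kappa> + int a)"
  have L: "0 < L" and l: "0 < l" by (auto simp: L_def l_def)
  note [measurable] = bdd_supp_measurable[OF g] T_measurable[OF g]
  have n1: "1 \<le> real CARD('n)" using zero_less_card_finite[where 'a = 'n] by linarith
  have l2: "2 * real CARD('n) * l \<le> L"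
    using a l mult_right_mono[OF a, of l] by (simp add: l_def L_def powr_add powr_realpow mult.commute)
  define U where "U = (\<Inter>i\<in>J. {y :: real ^ 'n. L * (real_of_int (f i) - 1) < y $ i} \<inter> {y. y $ i < L * (real_of_int (f i) + 2)})"
  have U: "open U"
    unfolding U_def by (intro open_INT ballI open_Int open_Collect_less continuous_intros) simp
  have UP: "U \<subseteq> neighbours J (\<kappa> + int a) x0"
    unfolding U_def mem_tri_floor subset_iff f_def L_def by (auto intro: less_imp_le)
  have dd: "dyadic_cube J \<kappa> x0 \<subseteq> dyadic_cube J (\<kappa> + int a) x0" by (rule dyadic_cube_mono) simp
  have QU: "dyadic_cube J \<kappa> x0 \<subseteq> U"
  proof
    fix y assume "y \<in> dyadic_cube J \<kappa> x0"
    then have "y \<in> dyadic_cube J (\<kappa> + int a) x0" using dd by blast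
    from this[unfolded mem_dy_floor, folded f_def L_def]
    have y: "L * real_of_int (f i) \<le> y $ i" "y $ i < L * (real_of_int (f i) + 1)" if "i \<in> J" for i using that by auto
    have "L * (real_of_int (f i) - 1) < y $ i" "y $ i < L * (real_of_int (f i) + 2)" if "i \<in> J" for i
      using y[OF that] L by (auto simp: algebra_simps)
    then show "y \<in> U" unfolding U_def by blast
  qed
  have "AE x in lborel. x \<in> U \<longrightarrow> T g x = (LINT y|lborel. k x y * g y)"
    using UP vanish by (intro T_off[OF g U]) auto
  \<comment> \<open>A Borel null set is fixed so that Fubini's theorem gives null sections over
    almost every \<open>z\<close>.\<close>
  then obtain N where N: "{x \<in> space lborel. \<not> (x \<in> U \<longrightarrow> T g x = (LINT y|lborel. k x y * g y))} \<subseteq> N"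
    "emeasure lborel N = 0" "N \<in> sets lborel" by (rule AE_E)
  have [measurable]: "N \<in> sets borel" using N(3) by simp
  have off: "T g x = (LINT y|lborel. k x y * g y)" if "x \<in> U" "x \<notin> N" for x using that N(1) by auto
  interpret mI: sigma_finite_measure "vol_on I" by (rule sigma_finite_mu)
  interpret mJ: sigma_finite_measure "vol_on J" by (rule sigma_finite_mu)
  interpret P: pair_sigma_finite "vol_on I" "vol_on J" by (simp add: pair_sigma_finite_def sigma_finite_mu)
  have "(\<integral>\<^sup>+z. \<integral>\<^sup>+x. indicator N (merge_coords I x z) \<partial>vol_on I \<partial>vol_on J) = (\<integral>\<^sup>+x. \<integral>\<^sup>+z. indicator N (merge_coords I x z) \<partial>vol_on J \<partial>vol_on I)"
    by (rule P.Fubini') measurable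
  also have "\<dots> = (\<integral>\<^sup>+x. indicator N x \<partial>vol_on UNIV)"
    using vol_on_split[of "indicator N" UNIV I] by (simp add: J_def I_def Compl_eq_Diff_UNIV)
  also have "\<dots> = 0" using N(2) by simp
  finally have "AE z in vol_on J. (\<integral>\<^sup>+x. indicator N (merge_coords I x z) \<partial>vol_on I) = 0"
    by (subst (asm) nn_integral_0_iff_AE) auto
  then show ?thesis
  proof (rule eventually_mono, intro impI)
    fix z assume z: "(\<integral>\<^sup>+x. indicator N (merge_coords I x z) \<partial>vol_on I) = (0 :: ennreal)" and zQ: "z \<in> dyadic_cube J \<kappa> x0"
    have "(\<integral>\<^sup>+x. indicator N (merge_coords I x z) \<partial>vol_on UNIV) = (\<integral>\<^sup>+x. \<integral>\<^sup>+y. indicator N (merge_coords I (merge_coords I x y) z) \<partial>vol_on J \<partial>vol_on I)"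
      using vol_on_split[of "\<lambda>x. indicator N (merge_coords I x z)" UNIV I] by (simp add: J_def I_def Compl_eq_Diff_UNIV)
    \<comment> \<open>The measure of the outer space may be infinite, but it is multiplied by an
      integrand whose integral is 0, and 0 times \<open>top\<close> is 0.\<close>
    also have "\<dots> = (\<integral>\<^sup>+x. indicator N (merge_coords I x z) * emeasure (vol_on J) UNIV \<partial>vol_on I)"
    proof (intro nn_integral_cong)
      fix x
      have "merge_coords I (merge_coords I x y) z = merge_coords I x z" for y by (simp add: vec_eq_iff)
      then show "(\<integral>\<^sup>+y. indicator N (merge_coords I (merge_coords I x y) z) \<partial>vol_on J) = indicator N (merge_coords I x z) * emeasure (vol_on J) UNIV" by simp
    qed
    also have "\<dots> = 0" by (subst nn_integral_multc) (auto simp: z)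
    finally have "AE x in lborel. indicator N (merge_coords I x z) = (0 :: ennreal)"
      unfolding vol_on_UNIV by (subst (asm) nn_integral_0_iff_AE) auto
    moreover have "AE x in lborel. x \<notin> N" using N by (intro AE_not_in) (auto simp: null_sets_def)
    ultimately have ae: "AE x in vol_on UNIV. indicator (dyadic_cube J \<kappa> x0) x * cnorm (T g) x \<le> cnorm (T g) (merge_coords I x z) + c * (\<integral>\<^sup>+y. tail_kernel \<epsilon> l x y * cnorm g y \<partial>lborel)"
      unfolding vol_on_UNIV
    proof eventually_elim
      case (elim x)
      show ?case
      proof (cases "x \<in> dyadic_cube J \<kappa> x0")
        case True
        define w where "w = merge_coords I x z"
        have wN: "w \<notin> N" using elim(1) by (auto simp: w_def indicator_def split: if_splits)
        have wQ: "w \<in> dyadic_cube J \<kappa> x0" using zQ jdepD[OF depends_on_cb[of J "(\<kappa>, dyadic_index J \<kappa> x0)"], of w z] by (auto simp: w_def I_def J_def)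
        have far: "\<exists>i\<in>J. 2 * real CARD('n) * l \<le> \<bar>y $ i - v $ i\<bar>" if y: "g y \<noteq> 0" and v: "v \<in> dyadic_cube J \<kappa> x0" for y v
        proof -
          have "y \<notin> neighbours J (\<kappa> + int a) x0" using vanish y by blast
          moreover have "v \<in> dyadic_cube J (\<kappa> + int a) x0" using v dd by blast
          ultimately obtain i where "i \<in> J" "L < \<bar>y $ i - v $ i\<bar>" using not_tri_far unfolding L_def by blast
          then show ?thesis using l2 by (intro bexI[of _ i]) auto
        qed
        have int: "integrable lborel (\<lambda>y. k v y * g y)" if v: "v \<in> dyadic_cube J \<kappa> x0" for v
        proof (rule k_integrable[OF g])
          show "0 < 2 * real CARD('n) * l" using l n1 by simp
          fix y assume "g y \<noteq> 0"
          from far[OF this v] obtain i where "2 * real CARD('n) * l \<le> \<bar>y $ i - v $ i\<bar>" by blast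
          also have "\<dots> \<le> norm (v - y)" using component_le_norm_cart[of "v - y" i] by (simp add: abs_minus_commute)
          finally show "2 * real CARD('n) * l \<le> norm (v - y)" .
        qed
        have "T g x - T g w = (LINT y|lborel. k x y * g y) - (LINT y|lborel. k w y * g y)"
          using off[OF subsetD[OF QU True] elim(2)] off[OF subsetD[OF QU wQ] wN] by simp
        also have "\<dots> = (LINT y|lborel. k x y * g y - k w y * g y)"
          by (rule Bochner_Integration.integral_diff[OF int[OF True] int[OF wQ], symmetric])
        finally have "ennreal (norm (T g x - T g w)) \<le> (\<integral>\<^sup>+y. ennreal (norm (k x y * g y - k w y * g y)) \<partial>lborel)"
          using norm_lint_le[of lborel "\<lambda>y. k x y * g y - k w y * g y"] by simp
        also have "\<dots> \<le> (\<integral>\<^sup>+y. c * (tail_kernel \<epsilon> l x y * cnorm g y) \<partial>lborel)"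
        proof (intro nn_integral_mono)
          fix y
          show "ennreal (norm (k x y * g y - k w y * g y)) \<le> c * (tail_kernel \<epsilon> l x y * cnorm g y)"
          proof (cases "g y = 0")
            case False
            obtain i where i: "i \<in> J" "2 * real CARD('n) * l \<le> \<bar>y $ i - x $ i\<bar>" using far[OF False True] by blast
            have "\<bar>x $ j - w $ j\<bar> \<le> l" for j
              using dyadic_cube_dist[OF True zQ, of j] l by (auto simp: w_def I_def J_def l_def)
            from k_diff_th(2)[OF i(1) l this i(2)]
            have "ennreal (norm (k x y - k w y)) \<le> c * tail_kernel \<epsilon> l x y" unfolding c_def tail_kernel_sym[of \<epsilon> l x] .
            then have "ennreal (norm (k x y - k w y)) * cnorm g y \<le> (c * tail_kernel \<epsilon> l x y) * cnorm g y" by (rule mult_right_mono) simp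
            moreover have "ennreal (norm (k x y * g y - k w y * g y)) = ennreal (norm (k x y - k w y)) * cnorm g y"
              by (simp add: norm_mult flip: left_diff_distrib ennreal_mult)
            ultimately show ?thesis by (simp add: mult.assoc)
          qed simp
        qed
        also have "\<dots> = c * (\<integral>\<^sup>+y. tail_kernel \<epsilon> l x y * cnorm g y \<partial>lborel)" by (rule nn_integral_cmult) measurable
        finally have d: "ennreal (norm (T g x - T g w)) \<le> c * (\<integral>\<^sup>+y. tail_kernel \<epsilon> l x y * cnorm g y \<partial>lborel)" .
        have "norm (T g x) \<le> norm (T g w) + norm (T g x - T g w)" by norm
        then have "cnorm (T g) x \<le> cnorm (T g) w + ennreal (norm (T g x - T g w))" by (simp add: ennreal_leI flip: ennreal_plus)
        also have "\<dots> \<le> cnorm (T g) w + c * (\<integral>\<^sup>+y. tail_kernel \<epsilon> l x y * cnorm g y \<partial>lborel)" by (intro add_left_mono d)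
        finally show ?thesis using True by (simp add: w_def)
      qed simp
    qed
    have thmeas: "(\<lambda>x. \<integral>\<^sup>+y. tail_kernel \<epsilon> l x y * cnorm g y \<partial>lborel) \<in> borel_measurable borel" by measurable
    have ind: "depends_on (- set js) (\<lambda>x. x \<in> dyadic_cube J \<kappa> x0)" unfolding J_def by (rule depends_on_cb)
    show "AE x in vol_on J. x \<in> dyadic_cube J \<kappa> x0 \<longrightarrow> iter_norm q js (cnorm (T g)) x \<le> iter_norm q js (cnorm (T g)) z
      + ennreal (A * (real CARD('n) * side \<kappa>) powr \<epsilon>) * (\<integral>\<^sup>+y. tail_kernel_on J \<epsilon> (side \<kappa>) x y * iter_norm q js (cnorm g) y \<partial>vol_on J)"
      using iter_norm_AE_mono[OF q js subset_UNIV ae] unfolding J_def[symmetric] Compl_eq_Diff_UNIV[symmetric]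
    proof (rule eventually_mono, intro impI)
      fix x assume xQ: "x \<in> dyadic_cube J \<kappa> x0" and le: "iter_norm q js (\<lambda>x. indicator (dyadic_cube J \<kappa> x0) x * cnorm (T g) x) x
        \<le> iter_norm q js (\<lambda>x. cnorm (T g) (merge_coords I x z) + c * (\<integral>\<^sup>+y. tail_kernel \<epsilon> l x y * cnorm g y \<partial>lborel)) x"
      have "iter_norm q js (cnorm (T g)) x = iter_norm q js (\<lambda>x. indicator (dyadic_cube J \<kappa> x0) x * cnorm (T g) x) x"
        using iter_norm_indicator_mult[OF q _ ind, of "cnorm (T g)" x] xQ by simp
      note this[THEN eq_refl]
      also note le
      also have "iter_norm q js (\<lambda>x. cnorm (T g) (merge_coords I x z) + c * (\<integral>\<^sup>+y. tail_kernel \<epsilon> l x y * cnorm g y \<partial>lborel)) x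
        \<le> iter_norm q js (\<lambda>x. cnorm (T g) (merge_coords I x z)) x + iter_norm q js (\<lambda>x. c * (\<integral>\<^sup>+y. tail_kernel \<epsilon> l x y * cnorm g y \<partial>lborel)) x"
        by (rule iter_norm_add[OF q]) (use thmeas in \<open>measurable\<close>)
      also have "\<dots> \<le> iter_norm q js (cnorm (T g)) z + c * (\<integral>\<^sup>+y. tail_kernel_on J \<epsilon> l x y * iter_norm q js (cnorm g) y \<partial>vol_on J)"
      proof (intro add_mono)
        show "iter_norm q js (\<lambda>x. cnorm (T g) (merge_coords I x z)) x \<le> iter_norm q js (cnorm (T g)) z"
          unfolding I_def using iter_norm_mrg'[of q js "cnorm (T g)" z x] by simp
        have "iter_norm q js (\<lambda>x. c * (\<integral>\<^sup>+y. tail_kernel \<epsilon> l x y * cnorm g y \<partial>lborel)) x = c * iter_norm q js (\<lambda>x. \<integral>\<^sup>+y. tail_kernel \<epsilon> l x y * cnorm g y \<partial>lborel) x"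
          by (rule iter_norm_cmult[OF q thmeas])
        also have "\<dots> \<le> c * (\<integral>\<^sup>+y. tail_kernel_on J \<epsilon> l x y * iter_norm q js (cnorm g) y \<partial>vol_on J)"
          unfolding J_def by (intro mult_left_mono Schur_th[OF q _ l]) auto
        finally show "iter_norm q js (\<lambda>x. c * (\<integral>\<^sup>+y. tail_kernel \<epsilon> l x y * cnorm g y \<partial>lborel)) x \<le> c * (\<integral>\<^sup>+y. tail_kernel_on J \<epsilon> l x y * iter_norm q js (cnorm g) y \<partial>vol_on J)" .
      qed
      finally show "iter_norm q js (cnorm (T g)) x \<le> iter_norm q js (cnorm (T g)) z
        + ennreal (A * (real CARD('n) * side \<kappa>) powr \<epsilon>) * (\<integral>\<^sup>+y. tail_kernel_on J \<epsilon> (side \<kappa>) x y * iter_norm q js (cnorm g) y \<partial>vol_on J)"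
        unfolding c_def l_def .
    qed
  qed
qed

text \<open>A substitute for Hoelder's inequality on a cube: if the average of w^s is at most d^s,
  integration of this bound shows that the average of w is at most 2 d.\<close>

lemma ennreal_le_power_split:
  assumes "0 < d" "1 \<le> s" shows "w \<le> ennreal d + ennreal (d powr (1 - s)) * w powe s"
proof (cases w)
  case (real x)
  show ?thesis
  proof (cases "x \<le> d")
    case True
    then have "w \<le> ennreal d" using real by (simp add: ennreal_leI)
    then show ?thesis by (rule order_trans) simp
  next
    case False
    then have x: "d \<le> x" "0 < x" using assms by auto
    have "x = x powr (1 - s) * x powr s" using x by (simp flip: powr_add)
    also have "\<dots> \<le> d powr (1 - s) * x powr s" using assms x by (intro mult_right_mono powr_mono2') auto
    finally have "ennreal x \<le> ennreal (d powr (1 - s)) * ennreal x powe s" using x by (simp add: epow_ennreal ennreal_leI flip: ennreal_mult)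
    then show ?thesis using real by (simp add: add_increasing)
  qed
next
  case top then show ?thesis using assms by (simp add: ennreal_mult_top)
qed

text \<open>The local good-\<lambda> estimate. On the parent cube the far part \<open>g2\<close>
  contributes almost a constant, which a single good point z controls. Thus \<open>W\<close> exceeds
  3 t^(1/s) only through the near part \<open>g1\<close>, whose image is small by the L^s bound and
  the smallness \<gamma> of the averages of \<open>F\<close>. \<open>D\<close> collects
  \<open>C\<close> and the volume ratio of the neighbourhood \<open>Pt\<close> to the cube; the
  added 1 makes it positive.\<close>

lemma raise_exponent_cube:
  fixes js :: "'n list" and q :: "real ^ 'n"
  defines "J \<equiv> - set js"
  assumes q: "\<forall>j. 1 \<le> q $ j" and js: "distinct js" and J: "J \<noteq> {}" and s: "1 \<le> s" and C: "0 \<le> C"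
    and bdd: "\<And>g. g \<in> bdd_supp \<Longrightarrow> (\<integral>\<^sup>+x. iter_norm q js (cnorm (T g)) x powe s \<partial>vol_on J) \<le> ennreal C * (\<integral>\<^sup>+x. iter_norm q js (cnorm g) x powe s \<partial>vol_on J)"
    and g: "g \<in> bdd_supp" and a: "2 * real CARD('n) \<le> 2 ^ a" and t: "0 < t" and \<gamma>: "0 < \<gamma>"
  defines "D \<equiv> C * 3 ^ card J * 2 ^ ((1 + a) * card J) + 1"
  assumes \<gamma>D: "\<gamma> * ((2 * D) powr (1 / s) + 2 * 3 ^ card J * kernel_const) \<le> 1"
    and hW: "\<And>k. \<kappa> < k \<Longrightarrow> (\<integral>\<^sup>+x. indicator (dyadic_cube J k x0) x * iter_norm q js (cnorm (T g)) x powe s \<partial>vol_on J) \<le> ennreal t * cube_vol J k"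
    and hF: "\<And>k. (\<integral>\<^sup>+x. indicator (neighbours J k x0) x * iter_norm q js (cnorm g) x powe s \<partial>vol_on J) \<le> 3 ^ card J * ennreal (\<gamma> powr s * t) * cube_vol J k"
  shows "emeasure (vol_on J) (dyadic_cube J \<kappa> x0 \<inter> dyadic_above J (\<lambda>x. iter_norm q js (cnorm (T g)) x powe s) ((6 powr s + 1) * t))
    \<le> ennreal (2 powr s * D * \<gamma> powr s) * cube_vol J \<kappa>"
proof -
  let ?m = "card J"
  have D: "0 < D" unfolding D_def using C by (intro add_nonneg_pos) auto
  have s0: "0 < s" using s by simp
  \<comment> \<open>The hypothesis on the averages of the inner norm of \<open>T g\<close> holds
    only above \<kappa>, so the argument runs on the parent cube.\<close>
  define \<kappa>1 where "\<kappa>1 = \<kappa> + 1"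
  define Q where "Q = dyadic_cube J \<kappa>1 x0"
  define Pt where "Pt = neighbours J (\<kappa>1 + int a) x0"
  define g1 where "g1 = (\<lambda>x. indicator Pt x *\<^sub>R g x)"
  define g2 where "g2 = (\<lambda>x. indicator (- Pt) x *\<^sub>R g x)"
  have [measurable]: "Pt \<in> sets borel" "Q \<in> sets borel" unfolding Pt_def Q_def by auto
  have g1: "g1 \<in> bdd_supp" and g2: "g2 \<in> bdd_supp" unfolding g1_def g2_def by (auto intro!: bdd_supp_indicator g)
  note [measurable] = bdd_supp_measurable[OF g] bdd_supp_measurable[OF g1] bdd_supp_measurable[OF g2] T_measurable[OF g] T_measurable[OF g1] T_measurable[OF g2]
  define F where "F = iter_norm q js (cnorm g)"
  define W where "W = iter_norm q js (cnorm (T g))"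
  define N1 where "N1 = iter_norm q js (cnorm (T g1))"
  define V where "V = iter_norm q js (cnorm (T g2))"
  have [measurable]: "F \<in> borel_measurable borel" "W \<in> borel_measurable borel" "N1 \<in> borel_measurable borel" "V \<in> borel_measurable borel"
    unfolding F_def W_def N1_def V_def by measurable
  have nfg1: "cnorm g1 = (\<lambda>x. indicator Pt x * cnorm g x)" by (auto simp: g1_def indicator_def)
  have mg1: "iter_norm q js (cnorm g1) x = indicator Pt x * F x" for x
    unfolding nfg1 F_def by (rule iter_norm_indicator_mult[OF q]) (auto simp: Pt_def J_def depends_on_tri)
  have N1s: "(\<integral>\<^sup>+x. N1 x powe s \<partial>vol_on J) \<le> ennreal (D * \<gamma> powr s * t) * cube_vol J \<kappa>"
  proof -
    have "(\<integral>\<^sup>+x. N1 x powe s \<partial>vol_on J) \<le> ennreal C * (\<integral>\<^sup>+x. iter_norm q js (cnorm g1) x powe s \<partial>vol_on J)"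
      unfolding N1_def by (rule bdd[OF g1])
    also have "(\<integral>\<^sup>+x. iter_norm q js (cnorm g1) x powe s \<partial>vol_on J) = (\<integral>\<^sup>+x. indicator Pt x * F x powe s \<partial>vol_on J)"
      unfolding mg1 by (simp add: epow_mult)
    also have "ennreal C * \<dots> \<le> ennreal C * (3 ^ ?m * ennreal (\<gamma> powr s * t) * cube_vol J (\<kappa>1 + int a))"
      unfolding Pt_def F_def by (intro mult_left_mono hF) simp
    also have "cube_vol J (\<kappa>1 + int a) = 2 ^ ((1 + a) * ?m) * cube_vol J \<kappa>"
      using cube_vol_add[of J \<kappa> "1 + a"] unfolding \<kappa>1_def by (simp add: add.assoc)
    also have "ennreal C * (3 ^ ?m * ennreal (\<gamma> powr s * t) * (2 ^ ((1 + a) * ?m) * cube_vol J \<kappa>))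
      = ennreal (C * 3 ^ ?m * 2 ^ ((1 + a) * ?m) * (\<gamma> powr s * t)) * cube_vol J \<kappa>"
      using C t by (simp add: ennreal_mult ennreal_power ac_simps flip: ennreal_numeral)
    also have "\<dots> \<le> ennreal (D * \<gamma> powr s * t) * cube_vol J \<kappa>"
      using t C unfolding D_def by (intro mult_right_mono ennreal_leI) (auto simp: algebra_simps)
    finally show ?thesis .
  qed
  have T12: "AE x in lborel. T g x = T g1 x + T g2 x"
  proof -
    have "(\<lambda>y. g1 y + g2 y) = g" by (auto simp: g1_def g2_def indicator_def)
    then show ?thesis using T_add[OF g1 g2] by simp
  qed
  have WNV: "AE x in vol_on J. W x \<le> N1 x + V x"
  proof -
    have "AE x in vol_on UNIV. cnorm (T g) x \<le> cnorm (T g1) x + cnorm (T g2) x" unfolding vol_on_UNIV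
      using T12 by (rule eventually_mono) (simp add: norm_triangle_ineq ennreal_leI flip: ennreal_plus)
    from iter_norm_AE_mono[OF q js subset_UNIV this] show ?thesis
      unfolding J_def Compl_eq_Diff_UNIV W_def N1_def V_def
      by (rule eventually_mono) (rule order_trans, assumption, rule iter_norm_add[OF q], measurable)
  qed
  have VWN: "AE x in vol_on J. V x \<le> W x + N1 x"
  proof -
    have "AE x in vol_on UNIV. cnorm (T g2) x \<le> cnorm (T g) x + cnorm (T g1) x" unfolding vol_on_UNIV
      using T12
    proof (rule eventually_mono)
      fix x assume "T g x = T g1 x + T g2 x"
      then have "norm (T g2 x) \<le> norm (T g x) + norm (T g1 x)" using norm_triangle_ineq4[of "T g x" "T g1 x"] by simp
      then show "cnorm (T g2) x \<le> cnorm (T g) x + cnorm (T g1) x" by (simp add: ennreal_leI flip: ennreal_plus)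
    qed
    from iter_norm_AE_mono[OF q js subset_UNIV this] show ?thesis
      unfolding J_def Compl_eq_Diff_UNIV W_def N1_def V_def
      by (rule eventually_mono) (rule order_trans, assumption, rule iter_norm_add[OF q], measurable)
  qed
  \<comment> \<open>Heights for the norms themselves instead of their s-th powers: \<open>lm\<close>
    for \<open>W\<close>, and \<open>d\<close>, smaller by the factor \<gamma>, for
    \<open>F\<close>.\<close>
  define lm where "lm = t powr (1 / s)"
  define d where "d = \<gamma> * lm"
  have lm: "0 < lm" "lm powr s = t" using t s0 by (auto simp: lm_def powr_powr)
  have d: "0 < d" using \<gamma> lm by (simp add: d_def)
  have ds: "d powr s = \<gamma> powr s * t" using \<gamma> lm by (simp add: d_def powr_mult)
  have hF1: "(\<integral>\<^sup>+x. indicator (neighbours J k x0) x * F x \<partial>vol_on J) \<le> ennreal (2 * 3 ^ ?m * d) * cube_vol J k" for k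
  proof -
    have "(\<integral>\<^sup>+x. indicator (neighbours J k x0) x * F x \<partial>vol_on J)
      \<le> (\<integral>\<^sup>+x. indicator (neighbours J k x0) x * ennreal d + ennreal (d powr (1 - s)) * (indicator (neighbours J k x0) x * F x powe s) \<partial>vol_on J)"
      using ennreal_le_power_split[OF d s] by (intro nn_integral_mono) (auto simp: indicator_def)
    also have "\<dots> = ennreal d * (3 ^ ?m * cube_vol J k) + ennreal (d powr (1 - s)) * (\<integral>\<^sup>+x. indicator (neighbours J k x0) x * F x powe s \<partial>vol_on J)"
      by (simp add: nn_integral_add nn_integral_cmult indicator_mult_const emeasure_tri)
    also have "\<dots> \<le> ennreal d * (3 ^ ?m * cube_vol J k) + ennreal (d powr (1 - s)) * (3 ^ ?m * ennreal (\<gamma> powr s * t) * cube_vol J k)"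
      unfolding F_def by (intro add_left_mono mult_left_mono hF) simp
    also have "ennreal (d powr (1 - s)) * (3 ^ ?m * ennreal (\<gamma> powr s * t) * cube_vol J k) = (ennreal (d powr (1 - s)) * ennreal (d powr s)) * (3 ^ ?m * cube_vol J k)"
      unfolding ds by (simp add: ac_simps)
    also have "ennreal (d powr (1 - s)) * ennreal (d powr s) = ennreal d" using d by (simp flip: ennreal_mult powr_add)
    finally have "(\<integral>\<^sup>+x. indicator (neighbours J k x0) x * F x \<partial>vol_on J) \<le> 2 * (ennreal d * (3 ^ ?m * cube_vol J k))"
      by (simp only: mult_2)
    also have "\<dots> = ennreal (2 * 3 ^ ?m * d) * cube_vol J k"
      using d by (simp add: ennreal_mult ennreal_power ac_simps flip: ennreal_numeral)
    finally show ?thesis .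
  qed
  define D' where "D' = D * \<gamma> powr s"
  have D': "0 < D'" using D \<gamma> by (simp add: D'_def)
  let ?far = "\<lambda>z. AE x in vol_on J. x \<in> Q \<longrightarrow> V x \<le> V z + ennreal (A * (real CARD('n) * side \<kappa>1) powr \<epsilon>) * (\<integral>\<^sup>+y. tail_kernel_on J \<epsilon> (side \<kappa>1) x y * iter_norm q js (cnorm g2) y \<partial>vol_on J)"
  have Tfar: "AE z in vol_on J. z \<in> Q \<longrightarrow> ?far z"
  proof -
    have "g2 y = 0" if "y \<in> neighbours (- set js) (\<kappa>1 + int a) x0" for y
      using that by (simp add: g2_def Pt_def J_def)
    from T_far[OF q js g2 a this] show ?thesis unfolding Q_def V_def J_def .
  qed
  have volQ: "emeasure (vol_on J) Q = cube_vol J \<kappa>1" unfolding Q_def by (rule emeasure_dy)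
  \<comment> \<open>The good point is found by averaging. With weight D' on the power of
    \<open>W\<close>, the two integrals are at most D' t times the volume of the parent and D' t
    times that of the cube; the parent is strictly larger, so the sum is below 2 D' t times its
    volume.\<close>
  have "\<exists>z. z \<in> Q \<and> ?far z \<and> V z \<le> W z + N1 z \<and> ennreal D' * W z powe s + N1 z powe s \<le> ennreal (2 * D' * t)"
  proof (rule ccontr)
    assume no: "\<not> ?thesis"
    have "AE z in vol_on J. indicator Q z * ennreal (2 * D' * t) \<le> indicator Q z * (ennreal D' * W z powe s + N1 z powe s)"
      using Tfar VWN
    proof eventually_elim
      case (elim z)
      then show ?case using no by (cases "z \<in> Q") (auto simp: not_le less_imp_le)
    qed
    then have "(\<integral>\<^sup>+z. indicator Q z * ennreal (2 * D' * t) \<partial>vol_on J) \<le> (\<integral>\<^sup>+z. indicator Q z * (ennreal D' * W z powe s + N1 z powe s) \<partial>vol_on J)"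
      by (rule nn_integral_mono_AE)
    also have "\<dots> \<le> (\<integral>\<^sup>+z. ennreal D' * (indicator Q z * W z powe s) + N1 z powe s \<partial>vol_on J)"
      by (intro nn_integral_mono) (auto simp: indicator_def)
    also have "\<dots> = ennreal D' * (\<integral>\<^sup>+z. indicator Q z * W z powe s \<partial>vol_on J) + (\<integral>\<^sup>+z. N1 z powe s \<partial>vol_on J)"
      by (simp add: nn_integral_add nn_integral_cmult)
    also have "\<dots> \<le> ennreal D' * (ennreal t * cube_vol J \<kappa>1) + ennreal (D * \<gamma> powr s * t) * cube_vol J \<kappa>"
      unfolding Q_def W_def by (intro add_mono mult_left_mono hW N1s) (auto simp: \<kappa>1_def)
    finally have le: "ennreal (2 * D' * t) * cube_vol J \<kappa>1 \<le> ennreal D' * (ennreal t * cube_vol J \<kappa>1) + ennreal (D' * t) * cube_vol J \<kappa>"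
      by (simp add: indicator_mult_const volQ D'_def)
    have "?m > 0" using J by (simp add: card_gt_0_iff)
    then have "side \<kappa> ^ ?m < side \<kappa>1 ^ ?m" unfolding \<kappa>1_def by (intro power_strict_mono) auto
    then have lt: "D' * t * side \<kappa> ^ ?m < D' * t * side \<kappa>1 ^ ?m" using D' t by simp
    have "2 * D' * t * side \<kappa>1 ^ ?m \<le> D' * (t * side \<kappa>1 ^ ?m) + D' * t * side \<kappa> ^ ?m"
      using le D' t unfolding cube_vol_def by (simp flip: ennreal_mult ennreal_plus)
    then show False using lt by (simp add: algebra_simps)
  qed
  then obtain z where zQ: "z \<in> Q" and zfar: "?far z" and zV: "V z \<le> W z + N1 z"
    and zZ: "ennreal D' * W z powe s + N1 z powe s \<le> ennreal (2 * D' * t)" by blast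
  have Wz: "W z \<le> ennreal (2 * lm)"
  proof -
    have "ennreal D' * W z powe s \<le> ennreal D' * W z powe s + N1 z powe s" by simp
    also note zZ
    also have "ennreal (2 * D' * t) = ennreal D' * ennreal (2 * t)" using D' t by (simp add: mult.commute mult.left_commute flip: ennreal_mult)
    finally have "W z powe s \<le> ennreal (2 * t)" using D' by (simp add: not_less[symmetric] ennreal_mult_less_cancel)
    also have "\<dots> \<le> ennreal ((2 * lm) powr s)"
    proof (intro ennreal_leI)
      have "2 powr 1 \<le> 2 powr s" using s by (intro powr_mono) auto
      then show "2 * t \<le> (2 * lm) powr s" using lm t by (simp add: powr_mult)
    qed
    also have "\<dots> = ennreal (2 * lm) powe s" using lm by (simp add: epow_ennreal)
    finally show ?thesis using s0 by (simp add: epow_le_iff)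
  qed
  have Nz: "N1 z \<le> ennreal ((2 * D) powr (1 / s) * d)"
  proof -
    have "N1 z powe s \<le> ennreal D' * W z powe s + N1 z powe s" by simp
    also note zZ
    also have "ennreal (2 * D' * t) = ennreal ((2 * D) powr (1 / s) * d) powe s"
      using D d s0 ds by (simp add: epow_ennreal powr_mult powr_powr D'_def mult.assoc)
    finally show ?thesis using s0 by (simp add: epow_le_iff)
  qed
  have near: "AE x in vol_on J. x \<in> Q \<longrightarrow> W x \<le> N1 x + ennreal (3 * lm)"
    using WNV zfar
  proof eventually_elim
    case (elim x)
    show ?case
    proof
      assume x: "x \<in> Q"
      have neighbours: "neighbours J k x = neighbours J k x0" if "\<kappa>1 \<le> k" for k
        using x that unfolding Q_def mem_dy by (intro neighbours_cong dyadic_index_mono[OF _ that])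
      have F2F: "iter_norm q js (cnorm g2) y \<le> F y" for y
        unfolding F_def by (rule iter_norm_mono[OF q]) (auto simp: g2_def indicator_def)
      have "(\<integral>\<^sup>+y. tail_kernel_on J \<epsilon> (side \<kappa>1) x y * iter_norm q js (cnorm g2) y \<partial>vol_on J) \<le> (\<integral>\<^sup>+y. tail_kernel_on J \<epsilon> (side \<kappa>1) x y * F y \<partial>vol_on J)"
        by (intro nn_integral_mono mult_left_mono F2F) auto
      also have "\<dots> \<le> ennreal (2 * 3 ^ ?m * d) * ennreal (tail_const TYPE('n) \<epsilon> * side \<kappa>1 powr (- \<epsilon>))"
        by (rule tail_kernel_on_tri[OF \<epsilon>]) (simp_all only: neighbours hF1 \<open>F \<in> borel_measurable borel\<close>)
      finally have "ennreal (A * (real CARD('n) * side \<kappa>1) powr \<epsilon>) * (\<integral>\<^sup>+y. tail_kernel_on J \<epsilon> (side \<kappa>1) x y * iter_norm q js (cnorm g2) y \<partial>vol_on J)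
        \<le> ennreal (A * (real CARD('n) * side \<kappa>1) powr \<epsilon>) * (ennreal (2 * 3 ^ ?m * d) * ennreal (tail_const TYPE('n) \<epsilon> * side \<kappa>1 powr (- \<epsilon>)))"
        by (rule mult_left_mono) simp
      also have "\<dots> = ennreal (2 * 3 ^ ?m * kernel_const * d)"
      proof -
        have "side \<kappa>1 powr \<epsilon> * side \<kappa>1 powr (- \<epsilon>) = 1" by (simp flip: powr_add)
        then have "A * (real CARD('n) * side \<kappa>1) powr \<epsilon> * (2 * 3 ^ ?m * d * (tail_const TYPE('n) \<epsilon> * side \<kappa>1 powr (- \<epsilon>))) = 2 * 3 ^ ?m * kernel_const * d"
          by (simp add: kernel_const_def powr_mult)
        note e = this[symmetric]
        show ?thesis unfolding e using A d tail_const_pos[OF \<epsilon>, where 'n = 'n] by (simp add: ennreal_mult)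
      qed
      finally have tail: "ennreal (A * (real CARD('n) * side \<kappa>1) powr \<epsilon>) * (\<integral>\<^sup>+y. tail_kernel_on J \<epsilon> (side \<kappa>1) x y * iter_norm q js (cnorm g2) y \<partial>vol_on J) \<le> ennreal (2 * 3 ^ ?m * kernel_const * d)" .
      have "V x \<le> V z + ennreal (2 * 3 ^ ?m * kernel_const * d)"
        using elim(2) x tail by (meson add_left_mono order_trans)
      also have "\<dots> \<le> (ennreal (2 * lm) + ennreal ((2 * D) powr (1 / s) * d)) + ennreal (2 * 3 ^ ?m * kernel_const * d)"
        by (intro add_right_mono order_trans[OF zV] add_mono Wz Nz)
      also have "\<dots> = ennreal (2 * lm + (2 * D) powr (1 / s) * d + 2 * 3 ^ ?m * kernel_const * d)"
        using lm D d kernel_const_pos by (simp flip: ennreal_plus)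
      \<comment> \<open>By the choice of \<gamma>, the near part at z and the variation of the far
        part together cost at most one further \<open>lm\<close>.\<close>
      also have "\<dots> \<le> ennreal (3 * lm)"
      proof (intro ennreal_leI)
        have "(2 * D) powr (1 / s) * d + 2 * 3 ^ ?m * kernel_const * d = (\<gamma> * ((2 * D) powr (1 / s) + 2 * 3 ^ ?m * kernel_const)) * lm"
          by (simp add: d_def algebra_simps)
        also have "\<dots> \<le> 1 * lm" using lm by (intro mult_right_mono \<gamma>D) auto
        finally show "2 * lm + (2 * D) powr (1 / s) * d + 2 * 3 ^ ?m * kernel_const * d \<le> 3 * lm" by simp
      qed
      finally have "N1 x + V x \<le> N1 x + ennreal (3 * lm)" by (rule add_left_mono)
      then show "W x \<le> N1 x + ennreal (3 * lm)" using elim(1) by (rule order_trans[rotated])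
    qed
  qed
  \<comment> \<open>The constant 6^s is 2^s 3^s: the first factor is from the quasi-triangle
    inequality for s-th powers, the second from the bound 3 \<open>lm\<close>.\<close>
  have nears: "AE x in vol_on J. x \<in> Q \<longrightarrow> W x powe s \<le> ennreal (2 powr s) * N1 x powe s + ennreal (6 powr s * t)"
    using near
  proof (rule eventually_mono, intro impI)
    fix x assume "x \<in> Q \<longrightarrow> W x \<le> N1 x + ennreal (3 * lm)" "x \<in> Q"
    then have "W x powe s \<le> (N1 x + ennreal (3 * lm)) powe s" using s0 by (intro epow_mono) auto
    also have "\<dots> \<le> ennreal (2 powr s) * (N1 x powe s + ennreal (3 * lm) powe s)" by (rule epow_add_le[OF s0])
    also have "ennreal (3 * lm) powe s = ennreal (3 powr s * t)" using lm by (simp add: epow_ennreal powr_mult)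
    also have "ennreal (2 powr s) * (N1 x powe s + ennreal (3 powr s * t)) = ennreal (2 powr s) * N1 x powe s + ennreal (6 powr s * t)"
    proof -
      have "2 powr s * (3 powr s * t) = 6 powr s * t" using powr_mult[of 2 3 s] by simp
      then show ?thesis using t by (simp add: distrib_left flip: ennreal_mult)
    qed
    finally show "W x powe s \<le> ennreal (2 powr s) * N1 x powe s + ennreal (6 powr s * t)" .
  qed
  define H1 where "H1 x = ennreal (2 powr s) * N1 x powe s" for x
  have [measurable]: "H1 \<in> borel_measurable borel" unfolding H1_def[abs_def] by measurable
  have H1le: "(\<integral>\<^sup>+x. H1 x \<partial>vol_on J) \<le> ennreal (2 powr s) * (ennreal (D' * t) * cube_vol J \<kappa>)"
    unfolding H1_def by (subst nn_integral_cmult) (use N1s in \<open>auto intro!: mult_left_mono simp: D'_def\<close>)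
  then have H1fin: "(\<integral>\<^sup>+x. H1 x \<partial>vol_on J) < top"
    by (rule le_less_trans) (simp add: ennreal_mult_less_top)
  \<comment> \<open>Cubes above \<kappa> cannot reach the level by hypothesis. A smaller cube lies
    in the parent, where the constant part accounts for 6^s t of the average, so the near part must
    supply the remaining t.\<close>
  have sub: "dyadic_cube J \<kappa> x0 \<inter> dyadic_above J (\<lambda>x. W x powe s) ((6 powr s + 1) * t) \<subseteq> dyadic_above J H1 t"
  proof
    fix x assume x: "x \<in> dyadic_cube J \<kappa> x0 \<inter> dyadic_above J (\<lambda>x. W x powe s) ((6 powr s + 1) * t)"
    then obtain k where k: "ennreal ((6 powr s + 1) * t) * cube_vol J k < (\<integral>\<^sup>+y. indicator (dyadic_cube J k x) y * W y powe s \<partial>vol_on J)"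
      by (auto simp: dyadic_above_def)
    have flx: "dyadic_index J \<kappa> x = dyadic_index J \<kappa> x0" using x by (simp add: mem_dy)
    have k\<kappa>: "k \<le> \<kappa>"
    proof (rule ccontr)
      assume "\<not> k \<le> \<kappa>"
      then have "\<kappa> < k" by simp
      have "(\<integral>\<^sup>+y. indicator (dyadic_cube J k x) y * W y powe s \<partial>vol_on J) \<le> ennreal t * cube_vol J k"
        using hW[OF \<open>\<kappa> < k\<close>] unfolding W_def dyadic_index_mono[OF flx less_imp_le[OF \<open>\<kappa> < k\<close>]] .
      also have "\<dots> \<le> ennreal ((6 powr s + 1) * t) * cube_vol J k"
        using t by (intro mult_right_mono ennreal_leI) (auto simp: algebra_simps)
      finally show False using k by simp
    qed
    have dQ: "dyadic_cube J k x \<subseteq> Q"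
    proof -
      have "dyadic_index J \<kappa>1 x = dyadic_index J \<kappa>1 x0" using flx by (rule dyadic_index_mono) (simp add: \<kappa>1_def)
      then show ?thesis using dyadic_cube_mono[of k \<kappa>1 J x] k\<kappa> unfolding Q_def \<kappa>1_def by simp
    qed
    have "(\<integral>\<^sup>+y. indicator (dyadic_cube J k x) y * W y powe s \<partial>vol_on J) \<le> (\<integral>\<^sup>+y. indicator (dyadic_cube J k x) y * H1 y + indicator (dyadic_cube J k x) y * ennreal (6 powr s * t) \<partial>vol_on J)"
    proof (rule nn_integral_mono_AE)
      show "AE y in vol_on J. indicator (dyadic_cube J k x) y * W y powe s \<le> indicator (dyadic_cube J k x) y * H1 y + indicator (dyadic_cube J k x) y * ennreal (6 powr s * t)"
        using nears
      proof (rule eventually_mono)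
        fix y assume "y \<in> Q \<longrightarrow> W y powe s \<le> ennreal (2 powr s) * N1 y powe s + ennreal (6 powr s * t)"
        then show "indicator (dyadic_cube J k x) y * W y powe s \<le> indicator (dyadic_cube J k x) y * H1 y + indicator (dyadic_cube J k x) y * ennreal (6 powr s * t)"
          using dQ by (cases "y \<in> dyadic_cube J k x") (auto simp: H1_def)
      qed
    qed
    also have "\<dots> = (\<integral>\<^sup>+y. indicator (dyadic_cube J k x) y * H1 y \<partial>vol_on J) + ennreal (6 powr s * t) * cube_vol J k"
      by (simp add: nn_integral_add indicator_mult_const emeasure_dy)
    finally have "ennreal ((6 powr s + 1) * t) * cube_vol J k < (\<integral>\<^sup>+y. indicator (dyadic_cube J k x) y * H1 y \<partial>vol_on J) + ennreal (6 powr s * t) * cube_vol J k"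
      using k by (rule less_le_trans[rotated])
    moreover have "ennreal ((6 powr s + 1) * t) * cube_vol J k = ennreal t * cube_vol J k + ennreal (6 powr s * t) * cube_vol J k"
    proof -
      have e: "(6 powr s + 1) * t = t + 6 powr s * t" by (simp add: algebra_simps)
      show ?thesis unfolding e using t by (simp add: distrib_right)
    qed
    ultimately have "ennreal t * cube_vol J k + ennreal (6 powr s * t) * cube_vol J k < (\<integral>\<^sup>+y. indicator (dyadic_cube J k x) y * H1 y \<partial>vol_on J) + ennreal (6 powr s * t) * cube_vol J k"
      by (simp only:)
    then have "ennreal t * cube_vol J k < (\<integral>\<^sup>+y. indicator (dyadic_cube J k x) y * H1 y \<partial>vol_on J)"
      by (rule contrapos_pp) (simp only: not_less add_right_mono)
    then show "x \<in> dyadic_above J H1 t" unfolding dyadic_above_def by blast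
  qed
  have OmH1: "dyadic_above J H1 t \<in> sets borel" by (rule dyadic_above_measurable[OF J t H1fin])
  have "ennreal t * emeasure (vol_on J) (dyadic_cube J \<kappa> x0 \<inter> dyadic_above J (\<lambda>x. W x powe s) ((6 powr s + 1) * t)) \<le> ennreal t * emeasure (vol_on J) (dyadic_above J H1 t)"
    using OmH1 by (intro mult_left_mono emeasure_mono sub) auto
  also have "\<dots> \<le> (\<integral>\<^sup>+x. H1 x \<partial>vol_on J)" by (rule dyadic_above_finite(2)[OF J t H1fin]) simp
  also note H1le
  also have "ennreal (2 powr s) * (ennreal (D' * t) * cube_vol J \<kappa>) = ennreal t * (ennreal (2 powr s * D * \<gamma> powr s) * cube_vol J \<kappa>)"
    using D t by (simp add: D'_def ennreal_mult ac_simps)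
  finally show ?thesis unfolding W_def using t by (simp add: not_less[symmetric] ennreal_mult_less_cancel)
qed

text \<open>The local estimate is summed over the stopping cubes of the s-th power of the inner norm
  of \<open>T g\<close>. Such a cube either lies in the exceptional set \<open>V\<close>, which pays
  for it, or contains a point x0 outside \<open>V\<close>, at which the averages belonging to
  \<open>g\<close> are small over all neighbourhoods.\<close>

lemma raise_exponent_level:
  fixes js :: "'n list" and q :: "real ^ 'n"
  defines "J \<equiv> - set js"
  assumes q: "\<forall>j. 1 \<le> q $ j" and js: "distinct js" and J: "J \<noteq> {}" and s: "1 \<le> s" and C: "0 \<le> C"
    and bdd: "\<And>g. g \<in> bdd_supp \<Longrightarrow> (\<integral>\<^sup>+x. iter_norm q js (cnorm (T g)) x powe s \<partial>vol_on J) \<le> ennreal C * (\<integral>\<^sup>+x. iter_norm q js (cnorm g) x powe s \<partial>vol_on J)"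
    and g: "g \<in> bdd_supp" and a: "2 * real CARD('n) \<le> 2 ^ a" and t: "0 < t" and \<gamma>: "0 < \<gamma>"
  defines "D \<equiv> C * 3 ^ card J * 2 ^ ((1 + a) * card J) + 1"
  assumes \<gamma>D: "\<gamma> * ((2 * D) powr (1 / s) + 2 * 3 ^ card J * kernel_const) \<le> 1"
    and F: "(\<integral>\<^sup>+x. iter_norm q js (cnorm g) x powe s \<partial>vol_on J) < top" and W: "(\<integral>\<^sup>+x. iter_norm q js (cnorm (T g)) x powe s \<partial>vol_on J) < top"
  shows "emeasure (vol_on J) (dyadic_above J (\<lambda>x. iter_norm q js (cnorm (T g)) x powe s) ((6 powr s + 1) * t))
    \<le> 3 ^ card J * emeasure (vol_on J) (dyadic_above J (\<lambda>x. iter_norm q js (cnorm g) x powe s) (\<gamma> powr s * t))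
      + ennreal (2 powr s * D * \<gamma> powr s) * emeasure (vol_on J) (dyadic_above J (\<lambda>x. iter_norm q js (cnorm (T g)) x powe s) t)"
proof -
  define H where "H x = iter_norm q js (cnorm (T g)) x powe s" for x
  define G where "G x = iter_norm q js (cnorm g) x powe s" for x
  note [measurable] = bdd_supp_measurable[OF g] T_measurable[OF g]
  have [measurable]: "H \<in> borel_measurable borel" "G \<in> borel_measurable borel"
    unfolding H_def[abs_def] G_def[abs_def] by measurable
  let ?K = "6 powr s + 1" and ?\<delta> = "ennreal (2 powr s * D * \<gamma> powr s)"
  have \<gamma>t: "0 < \<gamma> powr s * t" using \<gamma> t by simp
  have Kt: "0 < ?K * t" "t \<le> ?K * t" using t by (auto simp: algebra_simps intro: add_pos_pos)
  obtain V where [measurable]: "V \<in> sets borel" and V: "emeasure (vol_on J) V \<le> 3 ^ card J * emeasure (vol_on J) (dyadic_above J G (\<gamma> powr s * t))"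
    "\<And>x k. x \<notin> V \<Longrightarrow> (\<integral>\<^sup>+y. indicator (neighbours J k x) y * G y \<partial>vol_on J) \<le> 3 ^ card J * ennreal (\<gamma> powr s * t) * cube_vol J k"
    using neighbours_Om[OF J \<gamma>t, of G] F unfolding G_def[symmetric] by auto
  have Hfin: "(\<integral>\<^sup>+x. H x \<partial>vol_on J) < top" using W by (simp add: H_def)
  obtain S where "stop_family J H t S" using dyadic_above_stopping[OF J t Hfin] by blast
  note S = stop_familyD[OF this]
  let ?O = "dyadic_above J H (?K * t)"
  have dyadic_above [measurable]: "?O \<in> sets borel" "dyadic_above J H t \<in> sets borel"
    by (fact dyadic_above_measurable[OF J Kt(1) Hfin] dyadic_above_measurable[OF J t Hfin])+
  have cube: "(\<integral>\<^sup>+x. indicator (index_cube J c) x * indicator ?O x \<partial>vol_on J)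
    \<le> (\<integral>\<^sup>+x. indicator (index_cube J c) x * (indicator V x + ?\<delta>) \<partial>vol_on J)" if c: "c \<in> S" for c
  proof -
    obtain x1 where x1: "c = (fst c, dyadic_index J (fst c) x1)" using S(5)[OF c] by blast
    define \<kappa> where "\<kappa> = fst c"
    have cbc: "index_cube J c = dyadic_cube J \<kappa> x1" unfolding \<kappa>_def by (subst x1) simp
    show ?thesis
    proof (cases "index_cube J c \<subseteq> V")
      case True
      then show ?thesis by (intro nn_integral_mono) (auto simp: indicator_def)
    next
      case False
      then obtain x0 where x0: "x0 \<in> index_cube J c" "x0 \<notin> V" by blast
      have cb0: "index_cube J c = dyadic_cube J \<kappa> x0" using x0(1) unfolding cbc mem_dy by (intro dyadic_cube_cong) simp
      have hW: "(\<integral>\<^sup>+x. indicator (dyadic_cube J k x0) x * iter_norm q js (cnorm (T g)) x powe s \<partial>vol_on J) \<le> ennreal t * cube_vol J k" if "\<kappa> < k" for k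
        using S(4)[OF c x0(1)] that unfolding \<kappa>_def H_def by blast
      have "(\<integral>\<^sup>+x. indicator (index_cube J c) x * indicator ?O x \<partial>vol_on J) = emeasure (vol_on J) (dyadic_cube J \<kappa> x0 \<inter> ?O)"
        unfolding cb0 by (subst indicator_inter_arith[symmetric]) simp
      also have "\<dots> \<le> ?\<delta> * cube_vol J \<kappa>"
        unfolding H_def J_def D_def
        by (rule raise_exponent_cube[OF q js _ s C _ g a t \<gamma>])
          (use J bdd \<gamma>D hW V(2)[OF x0(2)] in \<open>simp_all add: J_def D_def G_def\<close>)
      also have "\<dots> = (\<integral>\<^sup>+x. indicator (index_cube J c) x * ?\<delta> \<partial>vol_on J)"
        unfolding cb0 by (simp add: indicator_mult_const emeasure_dy)
      also have "\<dots> \<le> (\<integral>\<^sup>+x. indicator (index_cube J c) x * (indicator V x + ?\<delta>) \<partial>vol_on J)"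
        by (intro nn_integral_mono mult_left_mono) auto
      finally show ?thesis .
    qed
  qed
  have "emeasure (vol_on J) ?O = (\<integral>\<^sup>+x. indicator (dyadic_above J H t) x * indicator ?O x \<partial>vol_on J)"
    using dyadic_above_mono[OF Kt(2), of J H] by (subst indicator_inter_arith[symmetric]) (simp add: Int_absorb1)
  also have "\<dots> \<le> (\<integral>\<^sup>+x. indicator (dyadic_above J H t) x * (indicator V x + ?\<delta>) \<partial>vol_on J)"
    unfolding S(2)[symmetric] by (rule nn_integral_cubes_mono[OF S(1)]) (use cube in auto)
  also have "\<dots> \<le> (\<integral>\<^sup>+x. indicator V x + ?\<delta> * indicator (dyadic_above J H t) x \<partial>vol_on J)"
    by (intro nn_integral_mono) (auto simp: indicator_def)
  also have "\<dots> = emeasure (vol_on J) V + ?\<delta> * emeasure (vol_on J) (dyadic_above J H t)"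
    by (simp add: nn_integral_add nn_integral_cmult)
  also have "\<dots> \<le> 3 ^ card J * emeasure (vol_on J) (dyadic_above J G (\<gamma> powr s * t)) + ?\<delta> * emeasure (vol_on J) (dyadic_above J H t)"
    by (intro add_right_mono V(1))
  finally show ?thesis unfolding H_def G_def .
qed

end

section \<open>Integration of the good-\<lambda> inequality over the levels\<close>

lemma ennreal_absorb_half:
  assumes "x \<le> y + ennreal (1 / 2) * x" "x < top" shows "x \<le> 2 * y"
proof (cases y)
  case (real b)
  obtain a where a: "x = ennreal a" "0 \<le> a" using assms(2) by (cases x) auto
  have "ennreal (b + 1 / 2 * a) = ennreal b + ennreal (1 / 2) * ennreal a"
    using a(2) real(1) by (simp only: ennreal_plus ennreal_mult divide_nonneg_nonneg mult_nonneg_nonneg zero_le_one zero_le_numeral)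
  then have "ennreal a \<le> ennreal (b + 1 / 2 * a)" using assms(1) a(1) real(2) by (simp only:)
  then have "a \<le> b + 1 / 2 * a" using a(2) real(1) by (subst (asm) ennreal_le_iff) auto
  then have "a \<le> 2 * b" by simp
  then have "ennreal a \<le> ennreal (2 * b)" by (rule ennreal_leI)
  then show ?thesis using a real by (simp add: ennreal_mult)
qed (simp add: ennreal_mult_top)

text \<open>Substituting K t for t multiplies the integral by K, so the coefficient 1/(2 K) leaves
  one half to be absorbed. The cut-off at A keeps this half finite, and since K \<ge> 1 the integral
  up to A is dominated by the one up to K A.\<close>

lemma nn_integral_scale_absorb:
  fixes h \<psi> :: "real \<Rightarrow> ennreal"
  assumes [measurable]: "h \<in> borel_measurable borel" "\<psi> \<in> borel_measurable borel"
    and K: "1 \<le> K" and le: "\<And>t. h (K * t) \<le> \<psi> t + ennreal (1 / (2 * K)) * h t"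
    and fin: "\<And>A. (\<integral>\<^sup>+t. indicator {..<A} t * h t \<partial>lborel) < top"
  shows "(\<integral>\<^sup>+t. h t \<partial>lborel) \<le> ennreal (2 * K) * (\<integral>\<^sup>+t. \<psi> t \<partial>lborel)"
proof -
  define \<Phi> where "\<Phi> A = (\<integral>\<^sup>+t. indicator {..<A} t * h t \<partial>lborel)" for A :: real
  have bound: "\<Phi> A \<le> ennreal (2 * K) * (\<integral>\<^sup>+t. \<psi> t \<partial>lborel)" if A: "0 < A" for A
  proof -
    have AK: "A \<le> K * A" using A K by simp
    have mono: "\<Phi> A \<le> \<Phi> (K * A)" unfolding \<Phi>_def
      by (intro nn_integral_mono) (auto simp: indicator_def dest: less_le_trans[OF _ AK])
    have "\<Phi> (K * A) = ennreal K * (\<integral>\<^sup>+t. indicator {..<K * A} (K * t) * h (K * t) \<partial>lborel)"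
      unfolding \<Phi>_def using K by (subst nn_integral_real_affine[of _ K 0]) auto
    also have "\<dots> \<le> ennreal K * (\<integral>\<^sup>+t. \<psi> t + ennreal (1 / (2 * K)) * (indicator {..<A} t * h t) \<partial>lborel)"
      using K le by (intro mult_left_mono nn_integral_mono) (auto simp: indicator_def)
    also have "\<dots> = ennreal K * (\<integral>\<^sup>+t. \<psi> t \<partial>lborel) + (ennreal K * ennreal (1 / (2 * K))) * \<Phi> A"
      unfolding \<Phi>_def by (simp add: nn_integral_add nn_integral_cmult distrib_left mult.assoc)
    also have "ennreal K * ennreal (1 / (2 * K)) = ennreal (1 / 2)" using K by (simp flip: ennreal_mult)
    also have "ennreal K * (\<integral>\<^sup>+t. \<psi> t \<partial>lborel) + ennreal (1 / 2) * \<Phi> A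
      \<le> ennreal K * (\<integral>\<^sup>+t. \<psi> t \<partial>lborel) + ennreal (1 / 2) * \<Phi> (K * A)"
      by (intro add_left_mono mult_left_mono mono) simp
    finally have "\<Phi> (K * A) \<le> 2 * (ennreal K * (\<integral>\<^sup>+t. \<psi> t \<partial>lborel))"
      by (rule ennreal_absorb_half) (simp add: \<Phi>_def fin)
    then show ?thesis using mono K by (simp add: ennreal_mult mult.assoc)
  qed
  have "(\<integral>\<^sup>+t. h t \<partial>lborel) = (\<integral>\<^sup>+t. (SUP n. indicator {..<real (Suc n)} t * h t) \<partial>lborel)"
  proof (intro nn_integral_cong antisym SUP_least)
    fix t
    obtain n where "t < real n" using reals_Archimedean2 by blast
    then have "t < real (Suc n)" by simp
    then show "h t \<le> (SUP n. indicator {..<real (Suc n)} t * h t)"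
      by (intro SUP_upper2[of n]) auto
  qed (auto simp: indicator_def)
  also have "\<dots> = (SUP n. \<Phi> (real (Suc n)))"
    unfolding \<Phi>_def by (rule nn_integral_monotone_convergence_SUP) (auto simp: incseq_def le_fun_def indicator_def)
  also have "\<dots> \<le> ennreal (2 * K) * (\<integral>\<^sup>+t. \<psi> t \<partial>lborel)"
    by (intro SUP_least bound) simp
  finally show ?thesis .
qed

context cz
begin

text \<open>The level estimate concerns s-th powers, so it is integrated with exponent \<rho> = r/s.
  The term with the superlevel sets of \<open>T g\<close> is absorbed, and the term with those of
  \<open>g\<close> is bounded by the maximal inequality, available because \<rho> > 1.\<close>

theorem bdd_outer_raise_exponent:
  fixes js :: "'n list" and q :: "real ^ 'n"
  assumes s: "1 < s" "s < r" and Jne: "- set js \<noteq> {}" and js: "distinct js" and q: "\<forall>j. 1 \<le> q $ j"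
    and B: "bdd_outer q js s"
  shows "bdd_outer q js r"
proof -
  define J where "J = - set js"
  let ?m = "card J"
  have J: "J \<noteq> {}" using Jne by (simp add: J_def)
  obtain C where C: "0 \<le> C" and bdd: "\<And>g. g \<in> bdd_supp \<Longrightarrow> (\<integral>\<^sup>+x. iter_norm q js (cnorm (T g)) x powe s \<partial>vol_on J) \<le> ennreal C * (\<integral>\<^sup>+x. iter_norm q js (cnorm g) x powe s \<partial>vol_on J)"
    using B unfolding bdd_outer_def J_def by blast
  obtain a where "2 * real CARD('n) < 2 ^ a" using real_arch_pow[of 2 "2 * real CARD('n)"] by auto
  then have a: "2 * real CARD('n) \<le> 2 ^ a" by simp
  define D where "D = C * 3 ^ ?m * 2 ^ ((1 + a) * ?m) + 1"
  define b where "b = (2 * D) powr (1 / s) + 2 * 3 ^ ?m * kernel_const"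
  define \<rho> where "\<rho> = r / s"
  define K where "K = 6 powr s + (1::real)"
  have \<rho>: "1 < \<rho>" using s by (simp add: \<rho>_def)
  have D: "0 < D" unfolding D_def using C by (intro add_nonneg_pos) auto
  have b: "0 < b" unfolding b_def using D kernel_const_pos by (intro add_pos_nonneg) auto
  have K: "1 \<le> K" by (simp add: K_def)
  \<comment> \<open>Chosen so that K^(\<rho>-1) 2^s D e = 1/(2 K), the coefficient that
    \<open>nn_integral_scale_absorb\<close> can absorb.\<close>
  define e where "e = 1 / (2 * K powr \<rho> * (2 powr s * D))"
  have e: "0 < e" using K D by (simp add: e_def)
  \<comment> \<open>The first bound serves the local estimate, the second the absorption.\<close>
  define \<gamma> where "\<gamma> = min (1 / b) (e powr (1 / s))"
  have \<gamma>: "0 < \<gamma>" "\<gamma> * b \<le> 1" using b e by (auto simp: \<gamma>_def field_simps min_def)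
  have "\<gamma> powr s \<le> (e powr (1 / s)) powr s" using s \<gamma>(1) by (intro powr_mono2) (auto simp: \<gamma>_def)
  then have \<gamma>e: "\<gamma> powr s \<le> e" using s e by (simp add: powr_powr)
  define c where "c = ennreal \<rho> * (ennreal (2 * K) * (ennreal (K powr (\<rho> - 1)) * 3 ^ ?m * (ennreal (2 powr \<rho> / (\<rho> - 1)) * ennreal (1 / \<gamma> powr s) powe \<rho>)))"
  have main: "(\<integral>\<^sup>+x. iter_norm q js (cnorm (T g)) x powe r \<partial>vol_on J) \<le> c * (\<integral>\<^sup>+x. iter_norm q js (cnorm g) x powe r \<partial>vol_on J)" if g: "g \<in> bdd_supp" for g
  proof -
    define H where "H x = iter_norm q js (cnorm (T g)) x powe s" for x
    define G where "G x = iter_norm q js (cnorm g) x powe s" for x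
    note [measurable] = bdd_supp_measurable[OF g] T_measurable[OF g]
    have Hm [measurable]: "H \<in> borel_measurable borel" and Gm [measurable]: "G \<in> borel_measurable borel"
      unfolding H_def[abs_def] G_def[abs_def] by measurable
    have Gfin: "(\<integral>\<^sup>+x. G x \<partial>vol_on J) < top" unfolding G_def J_def using s by (intro iter_norm_BB_integral[OF q js g]) auto
    have Hfin: "(\<integral>\<^sup>+x. H x \<partial>vol_on J) < top"
      using le_less_trans[OF bdd[OF g]] Gfin unfolding G_def[symmetric] H_def[symmetric]
      by (simp add: ennreal_mult_less_top)
    define \<phi> where "\<phi> t = emeasure (vol_on J) (dyadic_above J H t)" for t
    define G' where "G' x = ennreal (1 / \<gamma> powr s) * G x" for x
    have [measurable]: "G' \<in> borel_measurable borel" unfolding G'_def[abs_def] by measurable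
    have G'fin: "(\<integral>\<^sup>+x. G' x \<partial>vol_on J) < top" unfolding G'_def using Gfin by (simp add: nn_integral_cmult ennreal_mult_less_top)
    have level: "\<phi> (K * t) \<le> 3 ^ ?m * emeasure (vol_on J) (dyadic_above J G' t) + ennreal (2 powr s * D * \<gamma> powr s) * \<phi> t" if t: "0 < t" for t
    proof -
      have "dyadic_above J G (\<gamma> powr s * t) = dyadic_above J G' t" unfolding G'_def using \<gamma> by (intro dyadic_above_scale) auto
      moreover have "emeasure (vol_on J) (dyadic_above J H (K * t)) \<le> 3 ^ ?m * emeasure (vol_on J) (dyadic_above J G (\<gamma> powr s * t)) + ennreal (2 powr s * D * \<gamma> powr s) * emeasure (vol_on J) (dyadic_above J H t)"
        unfolding H_def[abs_def] G_def[abs_def] K_def D_def J_def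
        by (rule raise_exponent_level[OF q js Jne less_imp_le[OF s(1)] C bdd[unfolded J_def] g a t \<gamma>(1) \<gamma>(2)[unfolded b_def D_def J_def]
          Gfin[unfolded G_def J_def] Hfin[unfolded H_def J_def]])
      ultimately show ?thesis by (simp only: \<phi>_def)
    qed
    define h where "h t = indicator {0<..} t * (ennreal (t powr (\<rho> - 1)) * \<phi> t)" for t
    define \<psi> where "\<psi> t = indicator {0<..} t * (ennreal (t powr (\<rho> - 1)) * emeasure (vol_on J) (dyadic_above J G' t))" for t
    have hm [measurable]: "h \<in> borel_measurable borel"
      unfolding h_def[abs_def] \<phi>_def by (rule dyadic_above_level_measurable[OF J Hfin Hm])
    have \<psi>m [measurable]: "\<psi> \<in> borel_measurable borel"
      unfolding \<psi>_def[abs_def] by (rule dyadic_above_level_measurable[OF J G'fin]) measurable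
    have "(\<integral>\<^sup>+t. h t \<partial>lborel) \<le> ennreal (2 * K) * (\<integral>\<^sup>+t. ennreal (K powr (\<rho> - 1)) * 3 ^ ?m * \<psi> t \<partial>lborel)"
    proof (rule nn_integral_scale_absorb[OF hm _ K])
      fix t :: real
      show "h (K * t) \<le> ennreal (K powr (\<rho> - 1)) * 3 ^ ?m * \<psi> t + ennreal (1 / (2 * K)) * h t"
      proof (cases "0 < t")
        case True
        have "K * e * (2 powr s * D) * K powr (\<rho> - 1) = 1 / 2"
        proof -
          have "K * K powr (\<rho> - 1) = K powr \<rho>" using K powr_add[of K 1 "\<rho> - 1"] by simp
          then show ?thesis using K D by (simp add: e_def field_simps)
        qed
        then have k: "K powr (\<rho> - 1) * (2 powr s * D * e) = 1 / (2 * K)" using K by (simp add: field_simps)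
        have "K powr (\<rho> - 1) * (2 powr s * D * \<gamma> powr s) \<le> K powr (\<rho> - 1) * (2 powr s * D * e)"
          using \<gamma>e D by (intro mult_left_mono) auto
        then have "ennreal (K powr (\<rho> - 1)) * ennreal (2 powr s * D * \<gamma> powr s) \<le> ennreal (1 / (2 * K))"
          unfolding k using D by (subst ennreal_mult[symmetric]) (auto intro: ennreal_leI)
        note d = mult_right_mono[OF this, of "h t"]
        have "h (K * t) = ennreal (K powr (\<rho> - 1)) * (ennreal (t powr (\<rho> - 1)) * \<phi> (K * t))"
          using K True by (simp add: h_def powr_mult ennreal_mult mult.assoc)
        also have "\<dots> \<le> ennreal (K powr (\<rho> - 1)) * (ennreal (t powr (\<rho> - 1)) * (3 ^ ?m * emeasure (vol_on J) (dyadic_above J G' t) + ennreal (2 powr s * D * \<gamma> powr s) * \<phi> t))"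
          by (intro mult_left_mono level True) auto
        also have "\<dots> = ennreal (K powr (\<rho> - 1)) * 3 ^ ?m * \<psi> t + ennreal (K powr (\<rho> - 1)) * ennreal (2 powr s * D * \<gamma> powr s) * h t"
          using True by (simp add: h_def \<psi>_def distrib_left ac_simps)
        also have "\<dots> \<le> ennreal (K powr (\<rho> - 1)) * 3 ^ ?m * \<psi> t + ennreal (1 / (2 * K)) * h t"
          by (intro add_left_mono d) simp
        finally show ?thesis .
      next
        case False
        then have "\<not> 0 < K * t" using K by (simp add: zero_less_mult_iff)
        then show ?thesis by (simp add: h_def)
      qed
    next
      \<comment> \<open>A priori finiteness: by the weak-type bound \<open>h\<close> is at most
        t^(\<rho>-2) times the integral of \<open>H\<close>. The power is integrable near 0 since
        \<rho> > 1, and the integral of \<open>H\<close> is finite by the L^s bound for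
        \<open>g\<close>.\<close>
      fix A :: real
      have "(\<integral>\<^sup>+t. indicator {..<A} t * h t \<partial>lborel) \<le> (\<integral>\<^sup>+t. (indicator {t. 0 < t \<and> ennreal t < ennreal A} t * ennreal (t powr ((\<rho> - 1) - 1))) * (\<integral>\<^sup>+x. H x \<partial>vol_on J) \<partial>lborel)"
      proof (intro nn_integral_mono)
        fix t :: real
        show "indicator {..<A} t * h t \<le> (indicator {t. 0 < t \<and> ennreal t < ennreal A} t * ennreal (t powr ((\<rho> - 1) - 1))) * (\<integral>\<^sup>+x. H x \<partial>vol_on J)"
        proof (cases "0 < t \<and> t < A")
          case True
          then have t: "0 < t" "ennreal t < ennreal A" by (auto simp: ennreal_less_iff)
          have "ennreal (t powr (\<rho> - 1)) * \<phi> t = ennreal (t powr ((\<rho> - 1) - 1)) * (ennreal t * \<phi> t)"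
            using t powr_add[of t "\<rho> - 1 - 1" 1] by (simp add: mult.assoc[symmetric] flip: ennreal_mult)
          also have "\<dots> \<le> ennreal (t powr ((\<rho> - 1) - 1)) * (\<integral>\<^sup>+x. H x \<partial>vol_on J)"
            unfolding \<phi>_def by (intro mult_left_mono dyadic_above_finite(2)[OF J t(1) Hfin Hm]) simp
          finally show ?thesis using True t by (simp add: h_def)
        qed (auto simp: h_def indicator_def)
      qed
      also have "\<dots> = ennreal (1 / (\<rho> - 1)) * ennreal A powe (\<rho> - 1) * (\<integral>\<^sup>+x. H x \<partial>vol_on J)"
        using \<rho> nn_integral_powr_0[of "\<rho> - 1" "ennreal A"] by (subst nn_integral_multc) simp_all
      also have "\<dots> < top" using Hfin by (simp add: ennreal_mult_less_top ennreal_powr_def)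
      finally show "(\<integral>\<^sup>+t. indicator {..<A} t * h t \<partial>lborel) < top" .
    qed measurable
    also have "(\<integral>\<^sup>+t. ennreal (K powr (\<rho> - 1)) * 3 ^ ?m * \<psi> t \<partial>lborel) = ennreal (K powr (\<rho> - 1)) * 3 ^ ?m * (\<integral>\<^sup>+t. \<psi> t \<partial>lborel)"
      by (rule nn_integral_cmult) measurable
    finally have hle: "(\<integral>\<^sup>+t. h t \<partial>lborel) \<le> ennreal (2 * K) * (ennreal (K powr (\<rho> - 1)) * 3 ^ ?m * (\<integral>\<^sup>+t. \<psi> t \<partial>lborel))" .
    have pow: "(w powe s) powe \<rho> = w powe r" for w
      using s by (simp add: epow_epow \<rho>_def)
    have \<psi>le: "(\<integral>\<^sup>+t. \<psi> t \<partial>lborel) \<le> ennreal (2 powr \<rho> / (\<rho> - 1)) * ennreal (1 / \<gamma> powr s) powe \<rho> * (\<integral>\<^sup>+x. iter_norm q js (cnorm g) x powe r \<partial>vol_on J)"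
    proof -
      have "(\<integral>\<^sup>+t. \<psi> t \<partial>lborel) \<le> ennreal (2 powr \<rho> / (\<rho> - 1)) * (\<integral>\<^sup>+x. G' x powe \<rho> \<partial>vol_on J)"
        unfolding \<psi>_def by (rule dyadic_above_layer[OF J \<rho> G'fin]) measurable
      also have "(\<integral>\<^sup>+x. G' x powe \<rho> \<partial>vol_on J) = (\<integral>\<^sup>+x. ennreal (1 / \<gamma> powr s) powe \<rho> * iter_norm q js (cnorm g) x powe r \<partial>vol_on J)"
        using \<rho> by (simp add: G'_def G_def epow_mult pow)
      also have "\<dots> = ennreal (1 / \<gamma> powr s) powe \<rho> * (\<integral>\<^sup>+x. iter_norm q js (cnorm g) x powe r \<partial>vol_on J)"
        by (rule nn_integral_cmult) measurable
      finally show ?thesis by (simp add: mult.assoc)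
    qed
    \<comment> \<open>By differentiation the level sets of \<open>H\<close> lie, up to null sets, in
      those of its maximal function.\<close>
    have lev: "emeasure (vol_on J) {x \<in> space (vol_on J). ennreal t < H x} \<le> \<phi> t" if t: "0 < t" for t
    proof -
      have "depends_on J H" unfolding depends_on_def H_def
        by (intro allI impI arg_cong[where f = "\<lambda>w. w powe s"] iter_norm_indep) (simp add: J_def)
      then have "AE x in vol_on J. x \<notin> dyadic_above J H t \<longrightarrow> H x \<le> ennreal t" by (rule dyadic_above_differentiation[OF J t Hfin Hm])
      then have "AE x in vol_on J. x \<in> {x \<in> space (vol_on J). ennreal t < H x} \<longrightarrow> x \<in> dyadic_above J H t"
        by (rule eventually_mono) (auto simp: not_less[symmetric])
      then show ?thesis unfolding \<phi>_def
        using dyadic_above_measurable[OF J t Hfin] by (intro emeasure_mono_AE) auto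
    qed
    have "(\<integral>\<^sup>+x. iter_norm q js (cnorm (T g)) x powe r \<partial>vol_on J) = (\<integral>\<^sup>+x. H x powe \<rho> \<partial>vol_on J)"
      unfolding H_def pow ..
    also have "\<dots> = ennreal \<rho> * (\<integral>\<^sup>+t. indicator {0<..} t * (ennreal (t powr (\<rho> - 1)) * emeasure (vol_on J) {x\<in>space (vol_on J). ennreal t < H x}) \<partial>lborel)"
      using \<rho> by (intro layer_cake sigma_finite_mu) auto
    also have "\<dots> \<le> ennreal \<rho> * (\<integral>\<^sup>+t. h t \<partial>lborel)"
    proof (intro mult_left_mono nn_integral_mono)
      fix t :: real
      show "indicator {0<..} t * (ennreal (t powr (\<rho> - 1)) * emeasure (vol_on J) {x\<in>space (vol_on J). ennreal t < H x}) \<le> h t"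
        using lev[of t] by (cases "0 < t") (auto simp: h_def intro: mult_left_mono)
    qed simp
    also have "\<dots> \<le> ennreal \<rho> * (ennreal (2 * K) * (ennreal (K powr (\<rho> - 1)) * 3 ^ ?m * (ennreal (2 powr \<rho> / (\<rho> - 1)) * ennreal (1 / \<gamma> powr s) powe \<rho> * (\<integral>\<^sup>+x. iter_norm q js (cnorm g) x powe r \<partial>vol_on J))))"
      by (intro mult_left_mono order_trans[OF hle] \<psi>le) auto
    finally show ?thesis unfolding c_def by (simp add: ac_simps)
  qed
  have "c < top" unfolding c_def using \<rho> \<gamma>(1)
    by (auto simp: ennreal_mult_less_top epow_ennreal power_less_top_ennreal)
  then obtain c' where "c = ennreal c'" "0 \<le> c'" by (cases c) auto
  then show ?thesis unfolding bdd_outer_def J_def[symmetric] using main by blast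
qed

end

section \<open>Moving coordinates from the outer to the inner norm\<close>

lemma emeasure_mu_empty [simp]: "emeasure (vol_on ({} :: 'n::finite set)) UNIV = 1"
proof -
  have "emeasure (vol_on ({} :: 'n set)) UNIV = emeasure lborel (ucube {} :: (real ^ 'n) set)"
    unfolding vol_on_def by (subst emeasure_density) auto
  then show ?thesis by (simp add: emeasure_ucube)
qed

context cz
begin

text \<open>At the outer exponent \<open>q $ j\<close> both integrals are unchanged when
  \<open>j\<close> becomes an inner coordinate, so the same constant serves.\<close>

lemma bdd_outer_append:
  assumes q: "\<forall>j. 1 \<le> q $ j" and j: "j \<notin> set js" and B: "bdd_outer q js (q $ j)"
  shows "bdd_outer q (js @ [j]) (q $ j)"
proof -
  have S: "- set (js @ [j]) = - set js - {j}" by auto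
  have q0: "0 < q $ j" using q[rule_format, of j] by simp
  have eq: "(\<integral>\<^sup>+x. iter_norm q (js @ [j]) F x powe (q $ j) \<partial>vol_on (- set (js @ [j]))) = (\<integral>\<^sup>+x. iter_norm q js F x powe (q $ j) \<partial>vol_on (- set js))"
    if [measurable]: "F \<in> borel_measurable borel" for F
    unfolding S iter_norm_append iter_norm.simps using j q0 by (intro coord_norm_power_integral) auto
  obtain C where C: "0 \<le> C" and *: "\<forall>g\<in>bdd_supp. (\<integral>\<^sup>+x. iter_norm q js (cnorm (T g)) x powe (q $ j) \<partial>vol_on (- set js))
    \<le> ennreal C * (\<integral>\<^sup>+x. iter_norm q js (cnorm g) x powe (q $ j) \<partial>vol_on (- set js))"
    using B unfolding bdd_outer_def by blast
  show ?thesis unfolding bdd_outer_def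
  proof (intro exI[of _ C] conjI ballI C)
    fix g :: "real ^ 'n \<Rightarrow> complex" assume g: "g \<in> bdd_supp"
    note [measurable] = bdd_supp_measurable[OF g] T_measurable[OF g]
    show "(\<integral>\<^sup>+x. iter_norm q (js @ [j]) (cnorm (T g)) x powe (q $ j) \<partial>vol_on (- set (js @ [j])))
      \<le> ennreal C * (\<integral>\<^sup>+x. iter_norm q (js @ [j]) (cnorm g) x powe (q $ j) \<partial>vol_on (- set (js @ [j])))"
      using *[rule_format, OF g] by (subst (1 2) eq) measurable
  qed
qed

text \<open>Every step passes through the exponent \<open>q $ j\<close>, at which \<open>j\<close>
  can be moved, and then changes to the arbitrary outer exponent \<open>r\<close>. The change of
  exponent requires that some outer coordinate remains.\<close>

lemma bdd_outer_all:
  assumes q: "\<forall>j. 1 < q $ j" and base: "\<And>r. 1 < r \<Longrightarrow> bdd_outer q [] r"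
    and "distinct js" "- set js \<noteq> {}" "1 < r"
  shows "bdd_outer q js r"
  using assms(3-)
proof (induction js arbitrary: r rule: rev_induct)
  case Nil
  then show ?case using base by blast
next
  case (snoc j js)
  have q1: "\<forall>j. 1 \<le> q $ j" using q by (auto intro: less_imp_le)
  have js: "distinct js" "j \<notin> set js" "- set js \<noteq> {}" using snoc.prems by auto
  have B: "bdd_outer q (js @ [j]) (q $ j)"
    by (rule bdd_outer_append[OF q1 js(2) snoc.IH[OF js(1,3)]]) (use q in blast)
  consider "r < q $ j" | "r = q $ j" | "q $ j < r" by linarith
  then show ?case
  proof cases
    case 1
    then show ?thesis using bdd_outer_lower_exponent[OF q1 snoc.prems(1,2,3) 1 B] by blast
  next
    case 2
    then show ?thesis using B by simp
  next
    case 3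
    have "1 < q $ j" using q by blast
    then show ?thesis using bdd_outer_raise_exponent[OF _ 3 snoc.prems(2,1) q1 B] by blast
  qed
qed

text \<open>The last coordinate is moved without a further change of exponent, since no outer
  coordinate is left. The outer integral is then that of a constant against the probability measure
  \<open>vol_on {}\<close>, i.e. a power of the full norm.\<close>

theorem iter_norm_bounded:
  assumes q: "\<forall>j. 1 < q $ j" and base: "\<And>r. 1 < r \<Longrightarrow> bdd_outer q [] r"
    and js: "distinct js" "set js = UNIV"
  shows "\<exists>C. 0 \<le> C \<and> (\<forall>g\<in>bdd_supp. iter_norm q js (cnorm (T g)) 0 \<le> ennreal C * iter_norm q js (cnorm g) 0)"
proof -
  have q1: "\<forall>j. 1 \<le> q $ j" using q by (auto intro: less_imp_le)
  obtain ks j where ksj: "js = ks @ [j]" using js(2) by (cases js rule: rev_cases) auto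
  then have ks: "distinct ks" "j \<notin> set ks" using js(1) by auto
  define r where "r = q $ j"
  have r: "1 < r" "0 < r" using q[rule_format, of j] by (auto simp: r_def)
  have "bdd_outer q js r" unfolding ksj r_def
    using ks q by (intro bdd_outer_append[OF q1] bdd_outer_all[OF q base]) auto
  then obtain C where C: "0 \<le> C" and *: "\<forall>g\<in>bdd_supp. (\<integral>\<^sup>+x. iter_norm q js (cnorm (T g)) x powe r \<partial>vol_on (- set js))
    \<le> ennreal C * (\<integral>\<^sup>+x. iter_norm q js (cnorm g) x powe r \<partial>vol_on (- set js))" unfolding bdd_outer_def by blast
  have eq: "(\<integral>\<^sup>+x. iter_norm q js F x powe r \<partial>vol_on (- set js)) = iter_norm q js F 0 powe r" for F
  proof -
    have "(\<integral>\<^sup>+x. iter_norm q js F x powe r \<partial>vol_on (- set js)) = (\<integral>\<^sup>+x. iter_norm q js F 0 powe r \<partial>vol_on (- set js))"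
      by (intro nn_integral_cong arg_cong[where f = "\<lambda>w. w powe r"] iter_norm_indep) (simp add: js(2))
    also have "\<dots> = iter_norm q js F 0 powe r" by (simp add: js(2) emeasure_mu_empty)
    finally show ?thesis .
  qed
  show ?thesis
  proof (intro exI[of _ "C powr (1 / r)"] conjI ballI)
    fix g :: "real ^ 'n \<Rightarrow> complex" assume "g \<in> bdd_supp"
    then have "iter_norm q js (cnorm (T g)) 0 powe r \<le> ennreal C * iter_norm q js (cnorm g) 0 powe r"
      using * unfolding eq by blast
    also have "\<dots> = (ennreal (C powr (1 / r)) * iter_norm q js (cnorm g) 0) powe r"
      using r C by (simp add: epow_mult epow_ennreal powr_powr)
    finally show "iter_norm q js (cnorm (T g)) 0 \<le> ennreal (C powr (1 / r)) * iter_norm q js (cnorm g) 0"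
      using r by (simp add: epow_le_iff)
  qed simp
qed

end

section \<open>Mixed norms on cubes\<close>

text \<open>With all coordinates integrated out both sides are constants, and an inequality of
  constants that holds almost everywhere for the nontrivial measure \<open>vol_on {}\<close> simply
  holds.\<close>

lemma iter_norm_full_AE_mono:
  fixes q :: "real ^ 'n"
  assumes q: "\<forall>j. 1 \<le> q $ j" and js: "distinct js" "set js = UNIV" and le: "AE x in lborel. F x \<le> G x"
  shows "iter_norm q js F 0 \<le> iter_norm q js G 0"
proof -
  have const: "iter_norm q js H x = iter_norm q js H 0" for H x by (rule iter_norm_indep) (simp add: js(2))
  have "AE x in vol_on UNIV. F x \<le> G x" unfolding vol_on_UNIV by (rule le)
  note ae = iter_norm_AE_mono[OF q js(1) subset_UNIV this]
  have "UNIV - set js = {}" by (simp add: js(2))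
  note ae = ae[unfolded this]
  have "AE x in vol_on ({} :: 'n set). iter_norm q js F 0 \<le> iter_norm q js G 0" using ae
    by (rule eventually_mono) (metis const)
  moreover have "ae_filter (vol_on ({} :: 'n set)) \<noteq> bot" by (simp add: ae_filter_eq_bot_iff)
  ultimately show ?thesis by (simp add: eventually_const_iff)
qed

lemma mixed_norm_AE_mono:
  assumes q: "\<forall>j. 1 \<le> q $ j" and le: "AE x in lborel. norm (f x) \<le> norm (g x)"
  shows "mixed_norm q f \<le> mixed_norm q g"
  unfolding mixed_norm_eq_mn[OF q]
  by (rule iter_norm_full_AE_mono[OF q]) (use le in \<open>auto elim: eventually_mono intro: ennreal_leI\<close>)

lemma mixed_norm_AE_cong:
  assumes "\<forall>j. 1 \<le> q $ j" "AE x in lborel. f x = g x"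
  shows "mixed_norm q f = mixed_norm q g"
  using assms by (intro antisym mixed_norm_AE_mono) (auto elim: eventually_mono)

section \<open>Borel versions and equal exponents\<close>

lemma ex_borel_version:
  fixes f :: "'a::euclidean_space \<Rightarrow> complex"
  assumes f: "f \<in> borel_measurable lebesgue"
  shows "\<exists>g\<in>borel_measurable borel. AE x in lborel. f x = g x"
proof -
  have "(\<lambda>x. Re (f x)) \<in> borel_measurable lebesgue" "(\<lambda>x. Im (f x)) \<in> borel_measurable lebesgue"
    using f by measurable
  then obtain u v where [measurable]: "u \<in> borel_measurable lborel" "v \<in> borel_measurable lborel"
    and uv: "AE x in lborel. Re (f x) = u x" "AE x in lborel. Im (f x) = v x"
    by (auto dest!: completion_ex_borel_measurable_real)
  have "AE x in lborel. f x = Complex (u x) (v x)" using uv by eventually_elim (simp add: complex_eq_iff)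
  moreover have "(\<lambda>x. Complex (u x) (v x)) = (\<lambda>x. of_real (u x) + \<i> * of_real (v x))" by (simp add: complex_eq_iff fun_eq_iff)
  then have "(\<lambda>x. Complex (u x) (v x)) \<in> borel_measurable borel" by simp
  ultimately show ?thesis by (intro bexI[of _ "\<lambda>x. Complex (u x) (v x)"])
qed

text \<open>With equal exponents root and power cancel at every step, so Fubini's theorem collapses
  the iterated norm to an L^r norm.\<close>

lemma iter_norm_vec_power:
  fixes F :: "real ^ 'n \<Rightarrow> ennreal"
  assumes "F \<in> borel_measurable borel" "0 < r" "distinct js" "set js \<subseteq> K"
  shows "(\<integral>\<^sup>+x. iter_norm (vec r) js F x powe r \<partial>vol_on (K - set js)) = (\<integral>\<^sup>+x. F x powe r \<partial>vol_on K)"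
  using assms
proof (induction js arbitrary: F K)
  case (Cons j js)
  note [measurable] = Cons.prems(1)
  have K: "K - set (j # js) = (K - {j}) - set js" by auto
  have "(\<integral>\<^sup>+x. iter_norm (vec r) (j # js) F x powe r \<partial>vol_on (K - set (j # js))) = (\<integral>\<^sup>+x. coord_norm r j F x powe r \<partial>vol_on (K - {j}))"
    unfolding K using Cons.prems by (simp add: Cons.IH subset_Diff_insert)
  also have "\<dots> = (\<integral>\<^sup>+x. F x powe r \<partial>vol_on K)" using Cons.prems by (intro coord_norm_power_integral) auto
  finally show ?case .
qed simp

lemma mixed_norm_vec:
  fixes f :: "('n::{finite,linorder}) cfun"
  assumes r: "1 \<le> r" and f: "f \<in> borel_measurable lebesgue"
  shows "mixed_norm (vec r) f powe r = (\<integral>\<^sup>+x. cnorm f x powe r \<partial>lborel)"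
proof -
  obtain g where [measurable]: "g \<in> borel_measurable borel" and g: "AE x in lborel. f x = g x"
    using ex_borel_version[OF f] by blast
  let ?js = "sorted_list_of_set (UNIV :: 'n set)"
  have v: "\<forall>j::'n. 1 \<le> (vec r :: (real, 'n) vec) $ j" using r by simp
  have "(\<integral>\<^sup>+x. iter_norm (vec r) ?js (cnorm g) x powe r \<partial>vol_on (UNIV - set ?js)) = (\<integral>\<^sup>+x. cnorm g x powe r \<partial>vol_on UNIV)"
    using r by (intro iter_norm_vec_power) auto
  moreover have "(\<integral>\<^sup>+x. iter_norm (vec r) ?js (cnorm g) x powe r \<partial>vol_on (UNIV - set ?js)) = (\<integral>\<^sup>+x. iter_norm (vec r) ?js (cnorm g) 0 powe r \<partial>vol_on ({} :: 'n set))"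
    by (simp del: nn_integral_const) (intro nn_integral_cong arg_cong[where f = "\<lambda>w. w powe r"] iter_norm_indep, simp)
  ultimately have "mixed_norm (vec r) g powe r = (\<integral>\<^sup>+x. cnorm g x powe r \<partial>lborel)"
    unfolding mixed_norm_eq_mn[OF v] by simp
  moreover have "mixed_norm (vec r) f = mixed_norm (vec r) g" by (rule mixed_norm_AE_cong[OF v g])
  moreover have "(\<integral>\<^sup>+x. cnorm f x powe r \<partial>lborel) = (\<integral>\<^sup>+x. cnorm g x powe r \<partial>lborel)"
    using g by (intro nn_integral_cong_AE) auto
  ultimately show ?thesis by simp
qed

section \<open>Comparison of exponents for functions supported in a cube\<close>

lemma coord_norm_compare:
  assumes s: "1 \<le> s" "s \<le> q" and l: "0 < l" and [measurable]: "F \<in> borel_measurable borel"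
    and supp: "\<And>t. F (upd_coord x j t) \<noteq> 0 \<Longrightarrow> \<bar>a - t\<bar> \<le> l / 2"
  shows "coord_norm s j F x \<le> ennreal (l powr (1 / s - 1 / q)) * coord_norm q j F x"
proof (cases "s = q")
  case True
  then show ?thesis using l by simp
next
  case False
  let ?u = "\<lambda>t. F (upd_coord x j t)" and ?I = "{a - l / 2..a + l / 2}"
  have sq: "1 < q / s" "1 < q / (q - s)" "1 / (q / s) + 1 / (q / (q - s)) = 1"
    using s False by (auto simp: field_simps)
  have I: "emeasure lborel ?I = ennreal l" using l by simp
  have "(\<integral>\<^sup>+t. ?u t powe s \<partial>lborel) = (\<integral>\<^sup>+t. ?u t powe s * indicator ?I t \<partial>lborel)"
  proof (intro nn_integral_cong)
    fix t show "?u t powe s = ?u t powe s * indicator ?I t"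
    proof (cases "?u t = 0")
      case False
      from supp[OF this] have "t \<in> ?I" unfolding atLeastAtMost_iff by arith
      then show ?thesis by simp
    qed simp
  qed
  also have "\<dots> \<le> (\<integral>\<^sup>+t. (?u t powe s) powe (q / s) \<partial>lborel) powe (1 / (q / s))
    * (\<integral>\<^sup>+t. indicator ?I t powe (q / (q - s)) \<partial>lborel) powe (1 / (q / (q - s)))"
    by (rule Hoelder_ennreal[OF sq]) measurable
  also have "\<dots> = (\<integral>\<^sup>+t. ?u t powe q \<partial>lborel) powe (s / q) * ennreal (l powr ((q - s) / q))"
    using s l by (simp add: epow_epow epow_ennreal)
  finally have "coord_norm s j F x \<le> ((\<integral>\<^sup>+t. ?u t powe q \<partial>lborel) powe (s / q) * ennreal (l powr ((q - s) / q))) powe (1 / s)"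
    unfolding coord_norm_def using s by (intro epow_mono) auto
  also have "\<dots> = (\<integral>\<^sup>+t. ?u t powe q \<partial>lborel) powe (1 / q) * ennreal (l powr (1 / s - 1 / q))"
  proof -
    have "(q - s) / q * (1 / s) = 1 / s - 1 / q" using s by (simp add: field_simps)
    then show ?thesis using s l by (simp add: epow_mult epow_epow epow_ennreal powr_powr)
  qed
  finally show ?thesis by (simp add: coord_norm_def mult.commute)
qed

lemma coord_norm_support:
  assumes "coord_norm q j F y \<noteq> 0" shows "\<exists>t. F (upd_coord y j t) \<noteq> 0"
proof (rule ccontr)
  assume "\<nexists>t. F (upd_coord y j t) \<noteq> 0"
  then have "coord_norm q j F y = 0" by (simp add: coord_norm_def)
  then show False using assms by simp
qed

text \<open>Hoelder's inequality on an interval of length \<open>l\<close> in each coordinate; the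
  powers of \<open>l\<close> multiply. The support condition survives each integration because a
  nonzero coordinate norm needs a nonzero value on its line.\<close>

lemma iter_norm_compare:
  fixes q :: "real ^ 'n"
  assumes s: "1 \<le> s" "\<forall>j. s \<le> q $ j" and l: "0 < l" and "F \<in> borel_measurable borel" "distinct js"
    and "\<And>y i. F y \<noteq> 0 \<Longrightarrow> i \<in> set js \<Longrightarrow> \<bar>c $ i - y $ i\<bar> \<le> l / 2"
  shows "iter_norm (vec s) js F x \<le> ennreal (l powr (\<Sum>i\<in>set js. 1 / s - 1 / q $ i)) * iter_norm q js F x"
  using assms(4-)
proof (induction js arbitrary: F)
  case Nil
  then show ?case using l by simp
next
  case (Cons j js)
  note [measurable] = Cons.prems(1)
  have v: "\<forall>i. 1 \<le> (vec s :: real ^ 'n) $ i" using s by simp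
  let ?e = "l powr (1 / s - 1 / q $ j)"
  have "iter_norm (vec s) (j # js) F x \<le> iter_norm (vec s) js (\<lambda>y. ennreal ?e * coord_norm (q $ j) j F y) x"
    unfolding iter_norm.simps
  proof (rule iter_norm_mono[OF v])
    fix y
    show "coord_norm (vec s $ j) j F y \<le> ennreal ?e * coord_norm (q $ j) j F y"
      unfolding vec_component
    proof (rule coord_norm_compare[OF s(1) _ l])
      fix t assume "F (upd_coord y j t) \<noteq> 0"
      from Cons.prems(3)[OF this, of j] show "\<bar>c $ j - t\<bar> \<le> l / 2" by simp
    qed (use s in auto)
  qed
  also have "\<dots> = ennreal ?e * iter_norm (vec s) js (coord_norm (q $ j) j F) x" by (rule iter_norm_cmult[OF v]) measurable
  also have "\<dots> \<le> ennreal ?e * (ennreal (l powr (\<Sum>i\<in>set js. 1 / s - 1 / q $ i)) * iter_norm q js (coord_norm (q $ j) j F) x)"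
  proof (intro mult_left_mono Cons.IH)
    fix y i assume y: "coord_norm (q $ j) j F y \<noteq> 0" and i: "i \<in> set js"
    obtain t where "F (upd_coord y j t) \<noteq> 0" using coord_norm_support[OF y] by blast
    moreover have "i \<noteq> j" using i Cons.prems(2) by auto
    ultimately show "\<bar>c $ i - y $ i\<bar> \<le> l / 2" using Cons.prems(3)[of "upd_coord y j t" i] i by simp
  qed (use Cons.prems in auto)
  also have "\<dots> = ennreal (l powr (\<Sum>i\<in>set (j # js). 1 / s - 1 / q $ i)) * iter_norm q (j # js) F x"
    using Cons.prems(2) l by (simp add: mult.assoc[symmetric] powr_add flip: ennreal_mult)
  finally show ?case .
qed

lemma iter_norm_le_cube:
  fixes q :: "real ^ 'n"
  assumes q: "\<forall>j. 1 \<le> q $ j" and l: "0 < l" and "distinct js"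
    and "\<And>y i. F y \<noteq> 0 \<Longrightarrow> i \<in> set js \<Longrightarrow> \<bar>c $ i - y $ i\<bar> \<le> l / 2" "\<And>y. F y \<le> b"
  shows "iter_norm q js F x \<le> ennreal (l powr (\<Sum>i\<in>set js. 1 / q $ i)) * b"
  using assms(3-)
proof (induction js arbitrary: F b)
  case Nil
  then show ?case using l by simp
next
  case (Cons j js)
  let ?e = "l powr (1 / q $ j)" and ?I = "{c $ j - l / 2..c $ j + l / 2}"
  have q0: "0 < q $ j" using q[rule_format, of j] by simp
  have le: "coord_norm (q $ j) j F y \<le> ennreal ?e * b" for y
  proof -
    have "(\<integral>\<^sup>+t. F (upd_coord y j t) powe (q $ j) \<partial>lborel) \<le> (\<integral>\<^sup>+t. b powe (q $ j) * indicator ?I t \<partial>lborel)"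
    proof (intro nn_integral_mono)
      fix t
      show "F (upd_coord y j t) powe (q $ j) \<le> b powe (q $ j) * indicator ?I t"
      proof (cases "F (upd_coord y j t) = 0")
        case False
        from Cons.prems(2)[OF this, of j] have "\<bar>c $ j - t\<bar> \<le> l / 2" by simp
        then have "t \<in> ?I" unfolding atLeastAtMost_iff by arith
        then show ?thesis using q0 Cons.prems(3) by (simp add: epow_le_iff)
      qed simp
    qed
    also have "\<dots> = b powe (q $ j) * ennreal l" using l by (simp add: nn_integral_cmult)
    finally have "coord_norm (q $ j) j F y \<le> (b powe (q $ j) * ennreal l) powe (1 / q $ j)"
      unfolding coord_norm_def using q0 by (intro epow_mono) auto
    then show ?thesis using q0 l by (simp add: epow_mult epow_epow epow_ennreal mult.commute)
  qed
  have "iter_norm q (j # js) F x \<le> ennreal (l powr (\<Sum>i\<in>set js. 1 / q $ i)) * (ennreal ?e * b)"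
    unfolding iter_norm.simps
  proof (rule Cons.IH)
    fix y i assume y: "coord_norm (q $ j) j F y \<noteq> 0" and i: "i \<in> set js"
    obtain t where "F (upd_coord y j t) \<noteq> 0" using coord_norm_support[OF y] by blast
    moreover have "i \<noteq> j" using i Cons.prems(1) by auto
    ultimately show "\<bar>c $ i - y $ i\<bar> \<le> l / 2" using Cons.prems(2)[of "upd_coord y j t" i] i by simp
  qed (use Cons.prems le in auto)
  also have "\<dots> = ennreal (l powr (\<Sum>i\<in>set (j # js). 1 / q $ i)) * b"
    using Cons.prems(1) l by (simp add: powr_add ennreal_mult ac_simps)
  finally show ?case .
qed

section \<open>Morrey norms in terms of the side length\<close>

lemma mem_cube: "y \<in> cube c l \<longleftrightarrow> (\<forall>i. \<bar>c $ i - y $ i\<bar> \<le> l / 2)"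
proof -
  have "(c $ i - l / 2 \<le> y $ i \<and> y $ i \<le> c $ i + l / 2) \<longleftrightarrow> \<bar>c $ i - y $ i\<bar> \<le> l / 2" for i by arith
  then show ?thesis by (simp add: cube_def mem_box_cart)
qed

lemma cube_borel [measurable]: "cube c l \<in> sets borel"
  by (simp add: cube_def)

lemma measure_cube: "0 < l \<Longrightarrow> measure lebesgue (cube (c :: real ^ 'n) l) = l ^ CARD('n)"
proof -
  assume l: "0 < l"
  have "c \<in> cube c l" using l by (simp add: mem_cube)
  then have ne: "cube c l \<noteq> {}" by blast
  show ?thesis using content_cbox_cart[OF ne[unfolded cube_def]] by (simp add: cube_def)
qed

lemma morrey_weight:
  fixes q c :: "real ^ 'n"
  assumes "0 < l" "0 < p"
  shows "measure lebesgue (cube c l) powr (1 / p - 1 / real CARD('n) * (\<Sum>j\<in>UNIV. 1 / q $ j))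
    = l powr (real CARD('n) / p - (\<Sum>j\<in>UNIV. 1 / q $ j))"
proof -
  have e: "real CARD('n) * (1 / p - 1 / real CARD('n) * (\<Sum>j\<in>UNIV. 1 / q $ j)) = real CARD('n) / p - (\<Sum>j\<in>UNIV. 1 / q $ j)"
    by (simp add: right_diff_distrib)
  show ?thesis unfolding measure_cube[OF assms(1)] powr_realpow[OF assms(1), symmetric] powr_powr e ..
qed

lemma mixed_morrey_norm_leI:
  fixes f :: "('n::{finite,linorder}) cfun"
  assumes "0 < p" "\<And>c l. 0 < l \<Longrightarrow>
    ennreal (l powr (real CARD('n) / p - (\<Sum>j\<in>UNIV. 1 / q $ j))) * mixed_norm q (\<lambda>x. indicator (cube c l) x *\<^sub>R f x) \<le> B"
  shows "mixed_morrey_norm p q f \<le> B"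
  unfolding mixed_morrey_norm_def
proof (rule SUP_least)
  fix Q :: "(real, 'n) vec set" assume "Q \<in> cubes"
  then obtain c l where Q: "Q = cube c l" "0 < l" unfolding cubes_def by blast
  show "ennreal (measure lebesgue Q powr (1 / p - 1 / real CARD('n) * (\<Sum>j\<in>UNIV. 1 / q $ j))) * mixed_norm q (\<lambda>x. indicator Q x *\<^sub>R f x) \<le> B"
    unfolding Q(1) morrey_weight[OF Q(2) assms(1)] by (rule assms(2)[OF Q(2)])
qed

lemma mixed_morrey_norm_ge:
  fixes f :: "('n::{finite,linorder}) cfun"
  assumes "0 < p" "0 < l"
  shows "ennreal (l powr (real CARD('n) / p - (\<Sum>j\<in>UNIV. 1 / q $ j))) * mixed_norm q (\<lambda>x. indicator (cube c l) x *\<^sub>R f x)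
    \<le> mixed_morrey_norm p q f"
proof -
  have "cube c l \<in> cubes" using assms by (auto simp: cubes_def)
  from SUP_upper[OF this] show ?thesis unfolding mixed_morrey_norm_def morrey_weight[OF assms(2,1), of c q, symmetric] .
qed

lemma mixed_norm_cube_compare:
  fixes f :: "('n::{finite,linorder}) cfun"
  assumes s: "1 \<le> s" "\<forall>j. s \<le> q $ j" and l: "0 < l" and f: "f \<in> borel_measurable lebesgue"
  shows "mixed_norm (vec s) (\<lambda>x. indicator (cube c l) x *\<^sub>R f x)
    \<le> ennreal (l powr (real CARD('n) / s - (\<Sum>j\<in>UNIV. 1 / q $ j))) * mixed_norm q (\<lambda>x. indicator (cube c l) x *\<^sub>R f x)"
proof -
  obtain g where [measurable]: "g \<in> borel_measurable borel" and g: "AE x in lborel. f x = g x"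
    using ex_borel_version[OF f] by blast
  have ae: "AE x in lborel. indicator (cube c l) x *\<^sub>R f x = indicator (cube c l) x *\<^sub>R g x"
    using g by (rule eventually_mono) simp
  have q: "\<forall>j. 1 \<le> q $ j" and v: "\<forall>j::'n. 1 \<le> (vec s :: (real, 'n) vec) $ j" using s by (auto intro: order_trans)
  have "(\<Sum>i\<in>(UNIV :: 'n set). 1 / s - 1 / q $ i) = real CARD('n) / s - (\<Sum>j\<in>UNIV. 1 / q $ j)"
    by (simp add: sum_subtractf)
  note e = this[symmetric]
  show ?thesis
    unfolding mixed_norm_AE_cong[OF q ae] mixed_norm_AE_cong[OF v ae] unfolding mixed_norm_eq_mn[OF q] mixed_norm_eq_mn[OF v] e
    using iter_norm_compare[OF s l, of "cnorm (\<lambda>x. indicator (cube c l) x *\<^sub>R g x)" "sorted_list_of_set UNIV" c 0]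
    by (simp add: mem_cube indicator_def split: if_splits)
qed

text \<open>For equal parameters the weight has exponent 0. The supremum is at most the full
  integral, and it is attained in the limit because the cubes centred at 0 exhaust the
  space.\<close>

lemma morrey_norm_Lr:
  fixes f :: "('n::{finite,linorder}) cfun"
  assumes r: "1 \<le> r" and f: "f \<in> borel_measurable lebesgue"
  shows "morrey_norm r r f powe r = (\<integral>\<^sup>+x. cnorm f x powe r \<partial>lborel)"
proof (rule antisym)
  have r0: "0 < r" using r by simp
  have e0: "real CARD('n) / r - (\<Sum>j\<in>(UNIV :: 'n set). 1 / (vec r :: (real, 'n) vec) $ j) = 0" by simp
  have meas: "(\<lambda>x. indicator (cube c l) x *\<^sub>R f x) \<in> borel_measurable lebesgue" for c l
    using f by (intro borel_measurable_scaleR borel_measurable_indicator) auto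
  have eq: "mixed_norm (vec r) (\<lambda>x. indicator (cube c l) x *\<^sub>R f x) powe r = (\<integral>\<^sup>+x. indicator (cube c l) x * cnorm f x powe r \<partial>lborel)" for c l
    unfolding mixed_norm_vec[OF r meas] by (intro nn_integral_cong) (auto simp: indicator_def)
  have "morrey_norm r r f \<le> (\<integral>\<^sup>+x. cnorm f x powe r \<partial>lborel) powe (1 / r)"
  proof (rule mixed_morrey_norm_leI[OF r0])
    fix c :: "(real, 'n) vec" and l :: real assume l: "0 < l"
    have "mixed_norm (vec r) (\<lambda>x. indicator (cube c l) x *\<^sub>R f x) powe r \<le> (\<integral>\<^sup>+x. cnorm f x powe r \<partial>lborel)"
      unfolding eq by (intro nn_integral_mono) (auto simp: indicator_def)
    then show "ennreal (l powr (real CARD('n) / r - (\<Sum>j\<in>UNIV. 1 / (vec r :: (real, 'n) vec) $ j))) * mixed_norm (vec r) (\<lambda>x. indicator (cube c l) x *\<^sub>R f x)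
      \<le> (\<integral>\<^sup>+x. cnorm f x powe r \<partial>lborel) powe (1 / r)"
      unfolding e0 using l r0 by (simp add: epow_le_swap)
  qed
  then show "morrey_norm r r f powe r \<le> (\<integral>\<^sup>+x. cnorm f x powe r \<partial>lborel)" using r0 by (simp add: epow_le_swap)
  have "(\<integral>\<^sup>+x. cnorm f x powe r \<partial>lborel) = (\<integral>\<^sup>+x. cnorm f x powe r \<partial>lebesgue)" by (simp add: nn_integral_completion)
  also have "\<dots> = (\<integral>\<^sup>+x. (SUP m. indicator (cube 0 (real (Suc m))) x * cnorm f x powe r) \<partial>lebesgue)"
  proof (intro nn_integral_cong antisym SUP_least)
    fix x :: "(real, 'n) vec"
    obtain m where "2 * norm x < real m" using reals_Archimedean2 by blast
    then have "\<bar>x $ i\<bar> \<le> real (Suc m) / 2" for i using component_le_norm_cart[of x i] by simp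
    then have "x \<in> cube 0 (real (Suc m))" by (simp add: mem_cube)
    then show "cnorm f x powe r \<le> (SUP m. indicator (cube 0 (real (Suc m))) x * cnorm f x powe r)" by (intro SUP_upper2[of m]) auto
  qed (auto simp: indicator_def)
  also have "\<dots> = (SUP m. \<integral>\<^sup>+x. indicator (cube 0 (real (Suc m))) x * cnorm f x powe r \<partial>lebesgue)"
  proof (rule nn_integral_monotone_convergence_SUP)
    show "incseq (\<lambda>m x. indicator (cube 0 (real (Suc m))) x * cnorm f x powe r)"
      unfolding incseq_def le_fun_def
    proof (intro allI impI mult_right_mono)
      fix m k :: nat and x :: "(real, 'n) vec" assume "m \<le> k"
      then have "real (Suc m) / 2 \<le> real (Suc k) / 2" by simp
      then have "cube 0 (real (Suc m)) \<subseteq> (cube 0 (real (Suc k)) :: (real, 'n) vec set)"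
        unfolding subset_iff mem_cube by (meson order_trans)
      then show "indicator (cube 0 (real (Suc m))) x \<le> (indicator (cube 0 (real (Suc k))) x :: ennreal)"
        by (auto simp: indicator_def)
    qed simp
    show "(\<lambda>x. indicator (cube 0 (real (Suc m))) x * cnorm f x powe r) \<in> borel_measurable lebesgue" for m
    proof -
      note [measurable] = f
      have [measurable]: "cube 0 (real (Suc m)) \<in> sets (lebesgue :: (real, 'n) vec measure)" by (simp add: cube_def)
      show ?thesis by measurable
    qed
  qed
  also have "\<dots> \<le> morrey_norm r r f powe r"
  proof (rule SUP_least)
    fix m
    have "mixed_norm (vec r) (\<lambda>x. indicator (cube 0 (real (Suc m))) x *\<^sub>R f x) \<le> morrey_norm r r f"
      using mixed_morrey_norm_ge[OF r0, of "real (Suc m)" "vec r" 0 f] unfolding e0 by simp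
    then show "(\<integral>\<^sup>+x. indicator (cube 0 (real (Suc m))) x * cnorm f x powe r \<partial>lebesgue) \<le> morrey_norm r r f powe r"
      unfolding nn_integral_completion eq[symmetric] using r0 by (intro epow_mono) auto
  qed
  finally show "(\<integral>\<^sup>+x. cnorm f x powe r \<partial>lborel) \<le> morrey_norm r r f powe r" .
qed

lemma morrey_iff_Lr:
  fixes f :: "('n::{finite,linorder}) cfun"
  assumes "1 \<le> r"
  shows "f \<in> morrey r r \<longleftrightarrow> f \<in> borel_measurable lebesgue \<and> (\<integral>\<^sup>+x. cnorm f x powe r \<partial>lborel) < top"
  by (cases "f \<in> borel_measurable lebesgue") (simp_all add: mixed_morrey_def flip: morrey_norm_Lr[OF assms])

text \<open>Passing from the exponents \<open>q\<close> to \<open>s\<close> on a cube of side l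
  costs l^(n/s - \<sigma>), with \<sigma> the sum of the reciprocals of the \<open>q $ j\<close>.
  This is exactly the quotient of the two Morrey weights.\<close>

lemma morrey_norm_le_mixed:
  fixes f :: "('n::{finite,linorder}) cfun"
  assumes s: "1 \<le> s" "\<forall>j. s \<le> q $ j" and p: "0 < p" and f: "f \<in> borel_measurable lebesgue"
  shows "morrey_norm p s f \<le> mixed_morrey_norm p q f"
proof (rule mixed_morrey_norm_leI[OF p])
  fix c :: "(real, 'n) vec" and l :: real assume l: "0 < l"
  let ?n = "real CARD('n)" and ?\<sigma> = "\<Sum>j\<in>UNIV. 1 / q $ j" and ?f = "\<lambda>x. indicator (cube c l) x *\<^sub>R f x"
  have "(\<Sum>j\<in>(UNIV :: 'n set). 1 / (vec s :: (real, 'n) vec) $ j) = ?n / s" by simp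
  then have "ennreal (l powr (?n / p - (\<Sum>j\<in>(UNIV :: 'n set). 1 / (vec s :: (real, 'n) vec) $ j))) * mixed_norm (vec s) ?f
    \<le> ennreal (l powr (?n / p - ?n / s)) * (ennreal (l powr (?n / s - ?\<sigma>)) * mixed_norm q ?f)"
    by (simp only:) (intro mult_left_mono mixed_norm_cube_compare s l f, simp)
  also have "\<dots> = ennreal (l powr (?n / p - ?\<sigma>)) * mixed_norm q ?f"
    using l by (simp add: mult.assoc[symmetric] flip: ennreal_mult powr_add)
  also have "\<dots> \<le> mixed_morrey_norm p q f" by (rule mixed_morrey_norm_ge[OF p l])
  finally show "ennreal (l powr (?n / p - (\<Sum>j\<in>(UNIV :: 'n set). 1 / (vec s :: (real, 'n) vec) $ j))) * mixed_norm (vec s) ?f \<le> mixed_morrey_norm p q f" .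
qed

section \<open>The bound for truncations to cubes\<close>

text \<open>The representation formula has an exceptional null set for each cube. Countably many
  cubes suffice to reach all points of an open set, so one null set can serve them all.\<close>

lemma rational_cube:
  fixes U :: "(real, 'n::finite) vec set"
  assumes U: "open U" and x: "x \<in> U"
  shows "\<exists>(r :: 'n \<Rightarrow> rat) m. x \<in> cube (\<chi> i. real_of_rat (r i)) (1 / real (Suc m)) \<and> cube (\<chi> i. real_of_rat (r i)) (2 * (1 / real (Suc m))) \<subseteq> U"
proof -
  obtain e where e: "0 < e" "ball x e \<subseteq> U" using U x open_contains_ball by blast
  obtain m where "2 * real CARD('n) / e < real m" using reals_Archimedean2 by blast
  then have "2 * real CARD('n) < real m * e" using e by (simp add: field_simps)
  also have "\<dots> \<le> real (Suc m) * e" using e by (intro mult_right_mono) auto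
  finally have m: "2 * real CARD('n) * (1 / real (Suc m)) < e" by (simp add: field_simps)
  define l where "l = 1 / real (Suc m)"
  have l: "0 < l" by (simp add: l_def)
  have "\<exists>r. \<bar>real_of_rat r - x $ i\<bar> \<le> l / 2" for i
  proof -
    obtain w where w: "w \<in> \<rat>" "x $ i - l / 2 < w" "w < x $ i + l / 2" using Rats_dense_in_real[of "x $ i - l / 2" "x $ i + l / 2"] l by auto
    obtain r where r: "w = real_of_rat r" using w(1) by (auto simp: Rats_def)
    have "\<bar>w - x $ i\<bar> \<le> l / 2" using w(2,3) by arith
    then show ?thesis unfolding r by blast
  qed
  then obtain r where r: "\<And>i. \<bar>real_of_rat (r i) - x $ i\<bar> \<le> l / 2" by metis
  have "cube (\<chi> i. real_of_rat (r i)) (2 * l) \<subseteq> ball x e"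
  proof
    fix y assume "y \<in> cube (\<chi> i. real_of_rat (r i)) (2 * l)"
    then have y: "\<bar>real_of_rat (r i) - y $ i\<bar> \<le> l" for i by (simp add: mem_cube)
    have "norm (x - y) \<le> (\<Sum>i\<in>UNIV. \<bar>(x - y) $ i\<bar>)" by (rule norm_le_l1_cart)
    also have "\<dots> \<le> (\<Sum>i\<in>(UNIV :: 'n set). 2 * l)"
    proof (rule sum_mono)
      fix i show "\<bar>(x - y) $ i\<bar> \<le> 2 * l" using r[of i] y[of i] l by (simp only: vector_minus_component)
    qed
    also have "\<dots> < e" using m by (simp add: l_def mult.commute mult.left_commute)
    finally show "y \<in> ball x e" by (simp add: dist_norm)
  qed
  then show ?thesis using r e unfolding l_def by (intro exI[of _ r] exI[of _ m]) (auto simp: mem_cube)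
qed

locale morrey_cz = cz_kernel k A \<epsilon>
  for k :: "(real, 'n::{finite,linorder}) vec \<Rightarrow> (real, 'n) vec \<Rightarrow> complex" and A \<epsilon> :: real +
  fixes T :: "'n cfun \<Rightarrow> 'n cfun"
  assumes ext: "extends_to_morrey k T"
begin

text \<open>
  \<open>T f\<close> is only Lebesgue measurable, whereas iterated integrals and Fubini are used for Borel functions.
\<close>

definition T_borel :: "'n cfun \<Rightarrow> 'n cfun" where
  "T_borel f = (SOME h. h \<in> borel_measurable borel \<and> (AE x in lborel. T f x = h x))"

lemma Lr_bound:
  assumes "1 < r"
  shows "\<exists>C\<ge>0. \<forall>f\<in>morrey r r. T f \<in> borel_measurable lebesgue \<and>
    (\<integral>\<^sup>+x. cnorm (T f) x powe r \<partial>lborel) \<le> ennreal C * (\<integral>\<^sup>+x. cnorm f x powe r \<partial>lborel)"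
proof -
  have r: "1 \<le> r" using assms by simp
  obtain C where C: "0 < C" "\<forall>f\<in>morrey r r. T f \<in> morrey r r \<and> morrey_norm r r (T f) \<le> ennreal C * morrey_norm r r f"
    using ext assms unfolding extends_to_morrey_def bounded_linear_on_morrey_def by blast
  show ?thesis
  proof (intro exI[of _ "C powr r"] conjI ballI)
    fix f :: "'n cfun" assume f: "f \<in> morrey r r"
    then have *: "T f \<in> morrey r r" "morrey_norm r r (T f) \<le> ennreal C * morrey_norm r r f" using C by auto
    show Tf: "T f \<in> borel_measurable lebesgue" using *(1) by (simp add: mixed_morrey_def)
    have fm: "f \<in> borel_measurable lebesgue" using f by (simp add: mixed_morrey_def)
    have "morrey_norm r r (T f) powe r \<le> (ennreal C * morrey_norm r r f) powe r"
      using *(2) r by (intro epow_mono) auto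
    also have "\<dots> = ennreal (C powr r) * morrey_norm r r f powe r" using C by (simp add: epow_mult epow_ennreal)
    finally show "(\<integral>\<^sup>+x. cnorm (T f) x powe r \<partial>lborel) \<le> ennreal (C powr r) * (\<integral>\<^sup>+x. cnorm f x powe r \<partial>lborel)"
      unfolding morrey_norm_Lr[OF r Tf] morrey_norm_Lr[OF r fm] .
  qed simp
qed

lemma Lr_add:
  assumes "1 < r" "f \<in> morrey r r" "g \<in> morrey r r"
  shows "AE x in lborel. T (\<lambda>y. f y + g y) x = T f x + T g x"
proof -
  have "bounded_linear_on_morrey r r T" using ext assms(1) unfolding extends_to_morrey_def by blast
  then have "AE_linear_on (morrey r r) T" unfolding bounded_linear_on_morrey_def by blast
  then have "AE x in lebesgue. T (\<lambda>y. f y + g y) x = T f x + T g x" using assms(2,3) unfolding AE_linear_on_def by blast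
  then show ?thesis unfolding AE_completion_iff .
qed

text \<open>\<open>T\<close> acts on functions, not on classes. That it respects equality almost
  everywhere comes from the norm bound, by which null functions have null images.\<close>

lemma Lr_null:
  assumes r: "1 < r" and f: "f \<in> borel_measurable lebesgue" and 0: "AE x in lborel. f x = 0"
  shows "f \<in> morrey r r" "AE x in lborel. T f x = 0"
proof -
  have r1: "1 \<le> r" using r by simp
  have I: "(\<integral>\<^sup>+x. cnorm f x powe r \<partial>lborel) = 0"
  proof -
    have "(\<integral>\<^sup>+x. cnorm f x powe r \<partial>lborel) = (\<integral>\<^sup>+x. 0 \<partial>(lborel :: (real, 'n) vec measure))" using 0 by (intro nn_integral_cong_AE) auto
    then show ?thesis by simp
  qed
  then show m: "f \<in> morrey r r" using f by (simp add: morrey_iff_Lr[OF r1])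
  obtain C where C: "\<forall>f\<in>morrey r r. T f \<in> borel_measurable lebesgue \<and>
    (\<integral>\<^sup>+x. cnorm (T f) x powe r \<partial>lborel) \<le> ennreal C * (\<integral>\<^sup>+x. cnorm f x powe r \<partial>lborel)"
    using Lr_bound[OF r] by blast
  note [measurable] = conjunct1[OF C[rule_format, OF m]]
  have "(\<integral>\<^sup>+x. cnorm (T f) x powe r \<partial>lborel) \<le> ennreal C * 0" using C[rule_format, OF m] unfolding I by blast
  then have "(\<integral>\<^sup>+x. cnorm (T f) x powe r \<partial>lebesgue) = 0" by (simp add: nn_integral_completion)
  then have "AE x in lebesgue. cnorm (T f) x powe r = 0" by (subst (asm) nn_integral_0_iff_AE) auto
  then show "AE x in lborel. T f x = 0" unfolding AE_completion_iff by (rule eventually_mono) simp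
qed

lemma Lr_cong:
  assumes r: "1 < r" and f: "f \<in> morrey r r" and g: "g \<in> morrey r r" and eq: "AE x in lborel. f x = g x"
  shows "AE x in lborel. T f x = T g x"
proof -
  have [measurable]: "f \<in> borel_measurable lebesgue" "g \<in> borel_measurable lebesgue" using f g by (auto simp: mixed_morrey_def)
  let ?h = "\<lambda>x. f x - g x"
  have h: "?h \<in> borel_measurable lebesgue" by measurable
  have h0: "AE x in lborel. ?h x = 0" using eq by (rule eventually_mono) simp
  have "AE x in lborel. T (\<lambda>y. ?h y + g y) x = T ?h x + T g x" by (rule Lr_add[OF r Lr_null(1)[OF r h h0] g])
  then have "AE x in lborel. T f x = T ?h x + T g x" by simp
  with Lr_null(2)[OF r h h0] show ?thesis by eventually_elim simp
qed

lemma bdd_supp_morrey: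
  fixes f :: "'n cfun"
  assumes "1 \<le> r" "f \<in> bdd_supp" shows "f \<in> morrey r r"
proof -
  have q: "\<forall>j. 1 \<le> (vec 1 :: (real, 'n) vec) $ j" by simp
  have "(\<integral>\<^sup>+x. cnorm f x powe r \<partial>lborel) < top"
    using iter_norm_BB_integral[OF q distinct.simps(1)[THEN iffD2, OF TrueI] assms(2), of r] assms(1) by simp
  moreover have "f \<in> borel_measurable lebesgue" using bdd_supp_measurable[OF assms(2)] by (simp add: measurable_completion)
  ultimately show ?thesis by (simp add: morrey_iff_Lr[OF assms(1)])
qed

lemma T_borel:
  assumes "1 < r" "f \<in> morrey r r"
  shows "T_borel f \<in> borel_measurable borel" "AE x in lborel. T f x = T_borel f x"
proof -
  have "T f \<in> borel_measurable lebesgue" using Lr_bound[OF assms(1)] assms(2) by blast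
  from ex_borel_version[OF this] have "\<exists>h. h \<in> borel_measurable borel \<and> (AE x in lborel. T f x = h x)" by blast
  from someI_ex[OF this] show "T_borel f \<in> borel_measurable borel" "AE x in lborel. T f x = T_borel f x"
    unfolding T_borel_def by blast+
qed

text \<open>Around a point of \<open>U\<close> there is a small cube whose double lies in
  \<open>U\<close>. On it the representation formula reduces to the kernel integral, since the local
  term is \<open>T\<close> of the zero function and vanishes almost everywhere.\<close>

lemma T_borel_off:
  assumes f: "f \<in> bdd_supp" and U: "open U" and 0: "\<And>y. y \<in> U \<Longrightarrow> f y = 0"
  shows "AE x in lborel. x \<in> U \<longrightarrow> T_borel f x = (LINT y|lborel. k x y * f y)"
proof -
  have m: "f \<in> morrey 2 2" using f by (simp add: bdd_supp_morrey)
  have two: "1 < (2 :: real)" by simp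
  note [measurable] = bdd_supp_measurable[OF f]
  have T0: "AE x in lborel. T (\<lambda>y. 0) x = 0" by (rule Lr_null(2)[of 2]) auto
  have "AE x in lborel. \<forall>(r :: 'n \<Rightarrow> rat) m. x \<in> cube (\<chi> i. real_of_rat (r i)) (1 / real (Suc m)) \<longrightarrow>
    T f x = T (\<lambda>y. indicator (cube (\<chi> i. real_of_rat (r i)) (2 * (1 / real (Suc m)))) y *\<^sub>R f y) x
      + (LINT y:(- cube (\<chi> i. real_of_rat (r i)) (2 * (1 / real (Suc m))))|lebesgue. k x y * f y)"
    unfolding AE_all_countable
  proof (intro allI)
    fix r :: "'n \<Rightarrow> rat" and m :: nat
    have two': "1 < (2 :: real) \<and> (2 :: real) \<le> 2" by simp
    have "0 < 1 / real (Suc m)" by simp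
    then have "AE x in lebesgue. x \<in> cube (\<chi> i. real_of_rat (r i)) (1 / real (Suc m)) \<longrightarrow>
    T f x = T (\<lambda>y. indicator (cube (\<chi> i. real_of_rat (r i)) (2 * (1 / real (Suc m)))) y *\<^sub>R f y) x
      + (LINT y:(- cube (\<chi> i. real_of_rat (r i)) (2 * (1 / real (Suc m))))|lebesgue. k x y * f y)"
      by (rule ext[unfolded extends_to_morrey_def, rule_format, OF two', THEN conjunct2, rule_format, OF m])
    then show "AE x in lborel. x \<in> cube (\<chi> i. real_of_rat (r i)) (1 / real (Suc m)) \<longrightarrow>
    T f x = T (\<lambda>y. indicator (cube (\<chi> i. real_of_rat (r i)) (2 * (1 / real (Suc m)))) y *\<^sub>R f y) x
      + (LINT y:(- cube (\<chi> i. real_of_rat (r i)) (2 * (1 / real (Suc m))))|lebesgue. k x y * f y)"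
      unfolding AE_completion_iff .
  qed
  then show ?thesis using T0 T_borel(2)[OF two m]
  proof eventually_elim
    case (elim x)
    show ?case
    proof
      assume x: "x \<in> U"
      obtain r :: "'n \<Rightarrow> rat" and m where rm: "x \<in> cube (\<chi> i. real_of_rat (r i)) (1 / real (Suc m))"
        "cube (\<chi> i. real_of_rat (r i)) (2 * (1 / real (Suc m))) \<subseteq> U" using rational_cube[OF U x] by blast
      let ?Q = "cube (\<chi> i. real_of_rat (r i)) (2 * (1 / real (Suc m)))"
      have z: "(\<lambda>y. indicator ?Q y *\<^sub>R f y) = (\<lambda>y. 0)" using rm(2) 0 by (auto simp: indicator_def fun_eq_iff)
      have i: "(\<lambda>y. indicator (- ?Q) y *\<^sub>R (k x y * f y)) = (\<lambda>y. k x y * f y)" using rm(2) 0 by (auto simp: indicator_def fun_eq_iff)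
      have "T f x = T (\<lambda>y. 0) x + (LINT y|lebesgue. k x y * f y)"
        using elim(1)[rule_format, OF rm(1)] unfolding set_lebesgue_integral_def z i .
      moreover have "(\<lambda>y. k x y * f y) \<in> borel_measurable lborel"
        using k_times_measurable[of f x] 0 x by simp
      ultimately show "T_borel f x = (LINT y|lborel. k x y * f y)" using elim(2,3) by (simp add: integral_completion)
    qed
  qed
qed

sublocale cz k A \<epsilon> T_borel
proof
  fix f :: "'n cfun" assume f: "f \<in> bdd_supp"
  \<comment> \<open>The exponent 2 merely fixes one space that contains all bounded functions of
    bounded support.\<close>
  then have m: "f \<in> morrey 2 2" by (simp add: bdd_supp_morrey)
  show "T_borel f \<in> borel_measurable borel" using T_borel(1)[OF _ m] by simp
  show "AE x in lborel. T_borel (\<lambda>y. f y + g y) x = T_borel f x + T_borel g x" if g: "g \<in> bdd_supp" for g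
  proof -
    have m': "g \<in> morrey 2 2" "(\<lambda>y. f y + g y) \<in> morrey 2 2" using f g by (simp_all add: bdd_supp_morrey bdd_supp_add)
    have 2: "1 < (2::real)" by simp
    from Lr_add[OF 2 m m'(1)] T_borel(2)[OF 2 m] T_borel(2)[OF 2 m'(1)] T_borel(2)[OF 2 m'(2)]
    show ?thesis by eventually_elim simp
  qed
qed (rule T_borel_off)

text \<open>With no inner coordinate the statement \<open>bdd_outer\<close> is boundedness on L^r
  for every r > 1, which starts the induction over the coordinates.\<close>

theorem bdd_supp_bound:
  assumes q: "\<forall>j. 1 < q $ j"
  shows "\<exists>C\<ge>0. \<forall>g\<in>bdd_supp. mixed_norm q (T_borel g) \<le> ennreal C * mixed_norm q g"
proof -
  have "bdd_outer q [] r" if r: "1 < r" for r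
  proof -
    obtain C where C: "0 \<le> C" "\<forall>f\<in>morrey r r. T f \<in> borel_measurable lebesgue \<and>
      (\<integral>\<^sup>+x. cnorm (T f) x powe r \<partial>lborel) \<le> ennreal C * (\<integral>\<^sup>+x. cnorm f x powe r \<partial>lborel)"
      using Lr_bound[OF r] by blast
    show ?thesis unfolding bdd_outer_def
    proof (intro exI[of _ C] conjI ballI C(1))
      fix g :: "'n cfun" assume "g \<in> bdd_supp"
      then have g: "g \<in> morrey r r" using r by (simp add: bdd_supp_morrey)
      have "(\<integral>\<^sup>+x. cnorm (T_borel g) x powe r \<partial>lborel) = (\<integral>\<^sup>+x. cnorm (T g) x powe r \<partial>lborel)"
        using T_borel(2)[OF r g] by (intro nn_integral_cong_AE) auto
      then show "(\<integral>\<^sup>+x. iter_norm q [] (cnorm (T_borel g)) x powe r \<partial>vol_on (- set [])) \<le> ennreal C * (\<integral>\<^sup>+x. iter_norm q [] (cnorm g) x powe r \<partial>vol_on (- set []))"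
        using C(2) g by simp
    qed
  qed
  from iter_norm_bounded[OF q this, of "sorted_list_of_set UNIV"] q show ?thesis
    by (simp add: mixed_norm_eq_mn less_imp_le)
qed

text \<open>Truncations \<open>gn\<close> in height approximate the function in L^s, where
  \<open>T\<close> is bounded. Their images converge in L^s, hence almost everywhere along a
  subsequence, and Fatou's lemma for iterated norms passes to the limit. For the mixed norms only
  the domination of \<open>gn\<close> by \<open>g1\<close> is used.\<close>

lemma cube_bound:
  assumes q: "\<forall>j. 1 < q $ j" and s: "1 < s"
    and C: "\<forall>g\<in>bdd_supp. mixed_norm q (T_borel g) \<le> ennreal C * mixed_norm q g"
    and f: "f \<in> borel_measurable lebesgue" and g: "(\<lambda>x. indicator (cube c l) x *\<^sub>R f x) \<in> morrey s s"
  shows "mixed_norm q (T (\<lambda>x. indicator (cube c l) x *\<^sub>R f x)) \<le> ennreal C * mixed_norm q (\<lambda>x. indicator (cube c l) x *\<^sub>R f x)"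
proof -
  have q1: "\<forall>j. 1 \<le> q $ j" using q by (auto intro: less_imp_le)
  have s1: "1 \<le> s" using s by simp
  obtain h where [measurable]: "h \<in> borel_measurable borel" and h: "AE x in lborel. f x = h x"
    using ex_borel_version[OF f] by blast
  define g1 where "g1 x = indicator (cube c l) x *\<^sub>R h x" for x
  have [measurable]: "g1 \<in> borel_measurable borel" unfolding g1_def[abs_def] by measurable
  have eq: "AE x in lborel. indicator (cube c l) x *\<^sub>R f x = g1 x"
    using h by (rule eventually_mono) (simp add: g1_def)
  have g1: "g1 \<in> morrey s s"
  proof -
    have "(\<integral>\<^sup>+x. cnorm g1 x powe s \<partial>lborel) = (\<integral>\<^sup>+x. cnorm (\<lambda>x. indicator (cube c l) x *\<^sub>R f x) x powe s \<partial>lborel)"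
      by (intro nn_integral_cong_AE eventually_mono[OF eq]) (simp only:)
    moreover have "g1 \<in> borel_measurable lebesgue" by (simp add: measurable_completion)
    ultimately show ?thesis using g by (simp add: morrey_iff_Lr[OF s1])
  qed
  define gn where "gn n x = indicator {x. norm (g1 x) \<le> real n} x *\<^sub>R g1 x" for n :: nat and x
  have gn: "gn n \<in> bdd_supp" for n
  proof (rule bdd_supp_I[of _ "real n" "norm c + \<bar>l\<bar>"])
    show "gn n \<in> borel_measurable borel" unfolding gn_def[abs_def] by measurable
    show "norm (gn n x) \<le> real n" for x by (auto simp: gn_def indicator_def)
    fix x i assume "gn n x \<noteq> 0"
    then have "x \<in> cube c l" by (auto simp: gn_def g1_def indicator_def split: if_splits)
    then have "\<bar>c $ i - x $ i\<bar> \<le> l / 2" by (simp add: mem_cube)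
    then show "\<bar>x $ i\<bar> \<le> norm c + \<bar>l\<bar>" using component_le_norm_cart[of c i] by arith
  qed
  note [measurable] = bdd_supp_measurable[OF gn]
  have gnm: "gn n \<in> morrey s s" for n by (rule bdd_supp_morrey[OF s1 gn])
  define d where "d n x = g1 x - gn n x" for n x
  have [measurable]: "d n \<in> borel_measurable borel" for n unfolding d_def[abs_def] by measurable
  have dle: "cnorm (d n) x \<le> cnorm g1 x" for n x by (auto simp: d_def gn_def indicator_def)
  have fin: "(\<integral>\<^sup>+x. cnorm g1 x powe s \<partial>lborel) < top" using g1 by (simp add: morrey_iff_Lr[OF s1])
  have dfin: "(\<integral>\<^sup>+x. cnorm (d n) x powe s \<partial>lborel) < top" for n
    by (rule le_less_trans[OF nn_integral_mono fin]) (use dle s1 in \<open>auto intro: epow_mono\<close>)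
  have dm: "d n \<in> morrey s s" for n
    using dfin by (simp add: morrey_iff_Lr[OF s1] measurable_completion)
  have lim: "(\<lambda>n. \<integral>\<^sup>+x. cnorm (d n) x powe s \<partial>lborel) \<longlonglongrightarrow> (\<integral>\<^sup>+x. 0 \<partial>(lborel :: (real, 'n) vec measure))"
  proof (rule nn_integral_dominated_convergence[where w = "\<lambda>x. cnorm g1 x powe s"])
    show "AE x in lborel. cnorm (d n) x powe s \<le> cnorm g1 x powe s" for n
      using dle s1 by (intro AE_I2 epow_mono) auto
    show "AE x in lborel. (\<lambda>n. cnorm (d n) x powe s) \<longlonglongrightarrow> 0"
    proof (rule AE_I2)
      fix x
      obtain N where N: "norm (g1 x) \<le> real N" using real_arch_simple by blast
      have "cnorm (d n) x powe s = 0" if "N \<le> n" for n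
      proof -
        have "norm (g1 x) \<le> real n" using N that by linarith
        then show ?thesis by (simp add: d_def gn_def)
      qed
      then have "eventually (\<lambda>n. cnorm (d n) x powe s = 0) sequentially" unfolding eventually_sequentially by blast
      then show "(\<lambda>n. cnorm (d n) x powe s) \<longlonglongrightarrow> 0" by (rule tendsto_eventually)
    qed
  qed (use fin in auto)
  obtain D where D: "0 \<le> D" "\<forall>f\<in>morrey s s. T f \<in> borel_measurable lebesgue \<and>
      (\<integral>\<^sup>+x. cnorm (T f) x powe s \<partial>lborel) \<le> ennreal D * (\<integral>\<^sup>+x. cnorm f x powe s \<partial>lborel)"
    using Lr_bound[OF s] by blast
  note [measurable] = T_borel(1)[OF s g1] T_borel(1)[OF s gnm]
  \<comment> \<open>The s-th power turns L^s convergence into L1 convergence, from which an almost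
    everywhere convergent subsequence is extracted.\<close>
  define u where "u n x = norm (T_borel g1 x - T_borel (gn n) x) powr s" for n x
  have um [measurable]: "u n \<in> borel_measurable borel" for n unfolding u_def[abs_def] by measurable
  have ule: "(\<integral>\<^sup>+x. ennreal (u n x) \<partial>lborel) \<le> ennreal D * (\<integral>\<^sup>+x. cnorm (d n) x powe s \<partial>lborel)" for n
  proof -
    have "(\<lambda>y. d n y + gn n y) = g1" by (simp add: d_def)
    then have "AE x in lborel. T g1 x = T (d n) x + T (gn n) x" using Lr_add[OF s dm gnm, of n n] by simp
    then have "AE x in lborel. ennreal (u n x) = cnorm (T (d n)) x powe s"
      using T_borel(2)[OF s g1] T_borel(2)[OF s gnm, of n] by eventually_elim (auto simp: u_def epow_ennreal)
    then have "(\<integral>\<^sup>+x. ennreal (u n x) \<partial>lborel) = (\<integral>\<^sup>+x. cnorm (T (d n)) x powe s \<partial>lborel)" by (rule nn_integral_cong_AE)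
    also have "\<dots> \<le> ennreal D * (\<integral>\<^sup>+x. cnorm (d n) x powe s \<partial>lborel)" using D(2) dm by blast
    finally show ?thesis .
  qed
  have u0: "0 \<le> u n x" for n x by (simp add: u_def)
  have uint: "integrable lborel (u n)" for n
  proof (rule integrableI_bounded)
    have "(\<integral>\<^sup>+x. ennreal (u n x) \<partial>lborel) < top"
      by (rule le_less_trans[OF ule]) (simp add: ennreal_mult_less_top dfin)
    then show "(\<integral>\<^sup>+x. ennreal (norm (u n x)) \<partial>lborel) < \<infinity>" using u0 by simp
  qed simp
  have "(\<lambda>n. ennreal D * (\<integral>\<^sup>+x. cnorm (d n) x powe s \<partial>lborel)) \<longlonglongrightarrow> ennreal D * (\<integral>\<^sup>+x. 0 \<partial>(lborel :: (real, 'n) vec measure))"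
    by (rule ennreal_tendsto_cmult[OF _ lim]) simp
  then have dl: "(\<lambda>n. ennreal D * (\<integral>\<^sup>+x. cnorm (d n) x powe s \<partial>lborel)) \<longlonglongrightarrow> 0" by simp
  have "(\<lambda>n. \<integral>\<^sup>+x. ennreal (u n x) \<partial>lborel) \<longlonglongrightarrow> 0"
    by (rule tendsto_sandwich[OF _ _ tendsto_const dl]) (simp_all add: ule)
  then have "(\<lambda>n. ennreal (LINT x|lborel. norm (u n x))) \<longlonglongrightarrow> ennreal 0"
    using uint u0 by (simp add: nn_integral_eq_integral)
  then have "(\<lambda>n. LINT x|lborel. norm (u n x)) \<longlonglongrightarrow> 0"
    by (rule tendsto_ennrealD) auto
  from tendsto_L1_AE_subseq[OF uint this]
  obtain r :: "nat \<Rightarrow> nat" where r: "AE x in lborel. (\<lambda>n. u (r n) x) \<longlonglongrightarrow> 0" by blast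
  let ?js = "sorted_list_of_set (UNIV :: 'n set)"
  have "AE x in lborel. T (\<lambda>x. indicator (cube c l) x *\<^sub>R f x) x = T_borel g1 x"
    using Lr_cong[OF s g g1 eq] T_borel(2)[OF s g1] by eventually_elim simp
  then have "mixed_norm q (T (\<lambda>x. indicator (cube c l) x *\<^sub>R f x)) = iter_norm q ?js (cnorm (T_borel g1)) 0"
    unfolding mixed_norm_eq_mn[OF q1, symmetric] by (rule mixed_norm_AE_cong[OF q1])
  also have "\<dots> \<le> iter_norm q ?js (\<lambda>x. liminf (\<lambda>n. cnorm (T_borel (gn (r n))) x)) 0"
  proof (rule iter_norm_full_AE_mono[OF q1])
    show "AE x in lborel. cnorm (T_borel g1) x \<le> liminf (\<lambda>n. cnorm (T_borel (gn (r n))) x)"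
      using r
    proof (rule eventually_mono)
      fix x assume "(\<lambda>n. u (r n) x) \<longlonglongrightarrow> 0"
      then have "(\<lambda>n. u (r n) x powr (1 / s)) \<longlonglongrightarrow> 0 powr (1 / s)"
        using s by (intro tendsto_powr'[OF _ tendsto_const]) (auto simp: u0)
      then have "(\<lambda>n. norm (T_borel g1 x - T_borel (gn (r n)) x)) \<longlonglongrightarrow> 0"
        using s by (simp add: u_def powr_powr)
      then have "(\<lambda>n. T_borel g1 x - T_borel (gn (r n)) x) \<longlonglongrightarrow> 0" by (rule tendsto_norm_zero_cancel)
      then have "(\<lambda>n. T_borel g1 x - (T_borel g1 x - T_borel (gn (r n)) x)) \<longlonglongrightarrow> T_borel g1 x - 0" by (intro tendsto_diff tendsto_const)
      then have "(\<lambda>n. cnorm (T_borel (gn (r n))) x) \<longlonglongrightarrow> cnorm (T_borel g1) x" by (intro tendsto_ennrealI tendsto_norm) simp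
      then have "liminf (\<lambda>n. cnorm (T_borel (gn (r n))) x) = cnorm (T_borel g1) x" by (rule lim_imp_Liminf[rotated]) simp
      then show "cnorm (T_borel g1) x \<le> liminf (\<lambda>n. cnorm (T_borel (gn (r n))) x)" by simp
    qed
  qed auto
  also have "\<dots> \<le> liminf (\<lambda>n. iter_norm q ?js (cnorm (T_borel (gn (r n)))) 0)" by (rule iter_norm_liminf[OF q1]) measurable
  also have "\<dots> \<le> liminf (\<lambda>n. ennreal C * mixed_norm q g1)"
  proof (rule Liminf_mono, rule always_eventually, rule allI)
    fix n
    have "iter_norm q ?js (cnorm (T_borel (gn (r n)))) 0 \<le> ennreal C * mixed_norm q (gn (r n))"
      using C gn unfolding mixed_norm_eq_mn[OF q1] by blast
    also have "\<dots> \<le> ennreal C * mixed_norm q g1"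
      by (intro mult_left_mono mixed_norm_AE_mono[OF q1]) (auto simp: gn_def indicator_def)
    finally show "iter_norm q ?js (cnorm (T_borel (gn (r n)))) 0 \<le> ennreal C * mixed_norm q g1" .
  qed
  also have "\<dots> = ennreal C * mixed_norm q (\<lambda>x. indicator (cube c l) x *\<^sub>R f x)"
    using mixed_norm_AE_cong[OF q1 eq] by (simp add: Liminf_const)
  finally show ?thesis .
qed

end

section \<open>The Morrey estimate\<close>

text \<open>Hoelder's inequality in every coordinate gives l^(n - \<sigma>), with \<sigma> the sum
  of the reciprocals of the \<open>q $ j\<close>; together with the inverse of the Morrey weight
  this is l^(n - n/p).\<close>

lemma cube_integral_le:
  fixes f :: "('n::{finite,linorder}) cfun"
  assumes q: "\<forall>j. 1 \<le> q $ j" and p: "0 < p" and l: "0 < l" and f: "f \<in> borel_measurable lebesgue"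
  shows "(\<integral>\<^sup>+x. indicator (cube c l) x * cnorm f x \<partial>lborel) \<le> ennreal (l powr (real CARD('n) - real CARD('n) / p)) * mixed_morrey_norm p q f"
proof -
  let ?n = "real CARD('n)" and ?\<sigma> = "\<Sum>j\<in>UNIV. 1 / q $ j" and ?f = "\<lambda>x. indicator (cube c l) x *\<^sub>R f x"
  have meas: "?f \<in> borel_measurable lebesgue"
    using f by (intro borel_measurable_scaleR borel_measurable_indicator) auto
  have "(\<integral>\<^sup>+x. indicator (cube c l) x * cnorm f x \<partial>lborel) = (\<integral>\<^sup>+x. cnorm ?f x powe 1 \<partial>lborel)"
    by (intro nn_integral_cong) (auto simp: indicator_def)
  also have "\<dots> = mixed_norm (vec 1) ?f" using mixed_norm_vec[OF order_refl meas] by simp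
  also have "\<dots> \<le> ennreal (l powr (?n / 1 - ?\<sigma>)) * mixed_norm q ?f" by (rule mixed_norm_cube_compare[OF order_refl q l f])
  also have "\<dots> = ennreal (l powr (?n - ?n / p)) * (ennreal (l powr (?n / p - ?\<sigma>)) * mixed_norm q ?f)"
    using l by (simp add: mult.assoc[symmetric] flip: ennreal_mult powr_add)
  also have "\<dots> \<le> ennreal (l powr (?n - ?n / p)) * mixed_morrey_norm p q f"
    by (intro mult_left_mono mixed_morrey_norm_ge[OF p l]) simp
  finally show ?thesis .
qed

lemma tail_ratio: "0 < p \<Longrightarrow> 2 powr (- real CARD('n::finite) / p) < 1"
  using powr_less_cancel_iff[of 2 "- real CARD('n) / p" 0] by simp

context morrey_cz
begin

text \<open>On the m-th shell the kernel is at most A (2^m l / 2)^(-n), and \<open>f\<close> is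
  integrated over a cube of side 4 * 2^m l, which is 8 times 2^m l / 2; this gives 8^n. The
  remaining power -n/p of the side gives 4^(-n/p) and a geometric series with ratio
  2^(-n/p).\<close>

definition shell_const :: "real \<Rightarrow> real" where
  "shell_const p = A * 8 ^ CARD('n) * 4 powr (- real CARD('n) / p) / (1 - 2 powr (- real CARD('n) / p))"

lemma shell_const_nonneg: "0 < p \<Longrightarrow> 0 \<le> shell_const p"
  using A tail_ratio[of p, where 'n = 'n] unfolding shell_const_def by (intro divide_nonneg_nonneg) auto

lemma tail_bound:
  assumes q: "\<forall>j. 1 \<le> q $ j" and p: "0 < p" and l: "0 < l" and f: "f \<in> borel_measurable lebesgue" and x: "x \<in> cube c l"
  shows "ennreal (norm (LINT y:(- cube c (2 * l))|lebesgue. k x y * f y)) \<le> ennreal (shell_const p * l powr (- real CARD('n) / p)) * mixed_morrey_norm p q f"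
proof -
  let ?n = "real CARD('n)" and ?M = "mixed_morrey_norm p q f"
  define \<beta> where "\<beta> = 2 powr (- ?n / p)"
  have \<beta>: "0 < \<beta>" "\<beta> < 1" using tail_ratio[OF p, where 'n = 'n] by (auto simp: \<beta>_def)
  define a where "a m = A * (2 ^ m * l / 2) powr (- ?n)" for m
  have a0: "0 \<le> a m" for m using A by (simp add: a_def)
  have pt: "ennreal (norm (indicator (- cube c (2 * l)) y *\<^sub>R (k x y * f y)))
    \<le> (\<Sum>m. ennreal (a m) * (indicator (cube c (4 * (2 ^ m * l))) y * cnorm f y))" for y
  proof (cases "y \<in> cube c (2 * l)")
    case False
    let ?P = "\<lambda>m. y \<in> cube c (2 * (2 ^ m * l))"
    have "\<exists>m. ?P m"
    proof -
      obtain m where "norm (c - y) / l < 2 ^ m" using real_arch_pow[of 2 "norm (c - y) / l"] by auto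
      then have m: "norm (c - y) \<le> 2 ^ m * l" using l by (simp add: field_simps)
      have "\<bar>c $ i - y $ i\<bar> \<le> 2 ^ m * l" for i using component_le_norm_cart[of "c - y" i] m by simp
      then show ?thesis by (auto simp: mem_cube intro!: exI[of _ m])
    qed
    \<comment> \<open>The first dyadic dilate that contains \<open>y\<close>. It is not the one with
      index 0, because \<open>y\<close> lies outside \<open>cube c (2 * l)\<close>, and
      \<open>y\<close> lies outside its predecessor, which bounds the distance to the centre from
      below.\<close>
    define j where "j = (LEAST m. ?P m)"
    have j: "?P j" unfolding j_def by (rule LeastI_ex) fact
    have "j \<noteq> 0" using j False by (intro notI) simp
    then obtain m where m: "j = Suc m" by (cases j) auto
    have "\<not> ?P m" using not_less_Least[of m ?P] by (simp add: j_def[symmetric] m)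
    then obtain i where i: "2 ^ m * l < \<bar>c $ i - y $ i\<bar>" by (auto simp: mem_cube not_le)
    \<comment> \<open>Replacing the centre by \<open>x\<close> costs at most l/2, hence at most half
      of 2^m l; this is the factor 1/2 in \<open>a\<close>.\<close>
    have "\<bar>c $ i - x $ i\<bar> \<le> l / 2" using x by (simp add: mem_cube)
    moreover have "l \<le> 2 ^ m * l" using l by simp
    ultimately have "2 ^ m * l / 2 \<le> \<bar>x $ i - y $ i\<bar>" using i by arith
    also have "\<dots> \<le> norm (x - y)" using component_le_norm_cart[of "x - y" i] by simp
    finally have "norm (k x y) \<le> a m" unfolding a_def using l by (intro k_far) auto
    then have "norm (k x y * f y) \<le> a m * norm (f y)" by (simp add: norm_mult mult_right_mono)
    then have "ennreal (norm (k x y * f y)) \<le> ennreal (a m) * (indicator (cube c (4 * (2 ^ m * l))) y * cnorm f y)"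
      using j a0[of m] unfolding m by (simp add: ennreal_leI mult.assoc flip: ennreal_mult)
    also have "\<dots> \<le> (\<Sum>m. ennreal (a m) * (indicator (cube c (4 * (2 ^ m * l))) y * cnorm f y))"
      using sum_le_suminf[OF summableI, of "{m}" "\<lambda>m. ennreal (a m) * (indicator (cube c (4 * (2 ^ m * l))) y * cnorm f y)"] by simp
    finally show ?thesis using False by simp
  qed simp
  note [measurable] = f
  have [measurable]: "cube b r \<in> sets (lebesgue :: (real, 'n) vec measure)" for b r by (simp add: cube_def)
  have "ennreal (norm (LINT y:(- cube c (2 * l))|lebesgue. k x y * f y))
    \<le> (\<integral>\<^sup>+y. ennreal (norm (indicator (- cube c (2 * l)) y *\<^sub>R (k x y * f y))) \<partial>lebesgue)"
    unfolding set_lebesgue_integral_def by (rule norm_lint_le)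
  also have "\<dots> \<le> (\<integral>\<^sup>+y. (\<Sum>m. ennreal (a m) * (indicator (cube c (4 * (2 ^ m * l))) y * cnorm f y)) \<partial>lebesgue)"
    by (intro nn_integral_mono pt)
  also have "\<dots> = (\<Sum>m. \<integral>\<^sup>+y. ennreal (a m) * (indicator (cube c (4 * (2 ^ m * l))) y * cnorm f y) \<partial>lebesgue)"
    by (rule nn_integral_suminf) measurable
  also have "\<dots> \<le> (\<Sum>m. ennreal (A * 8 ^ CARD('n) * 4 powr (- ?n / p) * l powr (- ?n / p) * \<beta> ^ m) * ?M)"
  proof (intro suminf_le summableI)
    fix m
    define d where "d = 2 ^ m * l"
    have d: "0 < d" using l by (simp add: d_def)
    have "(\<integral>\<^sup>+y. ennreal (a m) * (indicator (cube c (4 * (2 ^ m * l))) y * cnorm f y) \<partial>lebesgue)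
      = ennreal (a m) * (\<integral>\<^sup>+y. indicator (cube c (4 * d)) y * cnorm f y \<partial>lborel)"
      unfolding d_def by (subst nn_integral_cmult) (auto simp: nn_integral_completion)
    also have "\<dots> \<le> ennreal (a m) * (ennreal ((4 * d) powr (?n - ?n / p)) * ?M)"
      using d by (intro mult_left_mono cube_integral_le[OF q p _ f]) auto
    also have "\<dots> = ennreal (a m * (4 * d) powr (?n - ?n / p)) * ?M"
      using a0 by (simp add: ennreal_mult mult.assoc)
    also have "a m * (4 * d) powr (?n - ?n / p) = A * 8 ^ CARD('n) * 4 powr (- ?n / p) * l powr (- ?n / p) * \<beta> ^ m"
    proof -
      have "(4 * d) powr (?n - ?n / p) = (8 * (d / 2)) powr ?n * (4 * d) powr (- ?n / p)"
        by (simp flip: powr_add)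
      also have "\<dots> = 8 powr ?n * (d / 2) powr ?n * (4 powr (- ?n / p) * (2 ^ m) powr (- ?n / p) * l powr (- ?n / p))"
        unfolding powr_mult d_def by (simp only: mult.assoc)
      also have "(2 ^ m) powr (- ?n / p) = \<beta> ^ m"
        unfolding \<beta>_def by (simp add: powr_powr mult.commute flip: powr_realpow)
      finally have e: "(4 * d) powr (?n - ?n / p) = 8 ^ CARD('n) * (d / 2) powr ?n * (4 powr (- ?n / p) * \<beta> ^ m * l powr (- ?n / p))"
        by (simp add: powr_realpow)
      have "(d / 2) powr ?n * (d / 2) powr (- ?n) = 1" using d by (simp flip: powr_add)
      then show ?thesis unfolding e a_def d_def[symmetric] by (simp add: mult.assoc mult.left_commute)
    qed
    finally show "(\<integral>\<^sup>+y. ennreal (a m) * (indicator (cube c (4 * (2 ^ m * l))) y * cnorm f y) \<partial>lebesgue)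
      \<le> ennreal (A * 8 ^ CARD('n) * 4 powr (- ?n / p) * l powr (- ?n / p) * \<beta> ^ m) * ?M" .
  qed
  also have "\<dots> = (\<Sum>m. ennreal (A * 8 ^ CARD('n) * 4 powr (- ?n / p) * l powr (- ?n / p) * \<beta> ^ m)) * ?M"
    by (rule ennreal_suminf_multc)
  also have "(\<Sum>m. ennreal (A * 8 ^ CARD('n) * 4 powr (- ?n / p) * l powr (- ?n / p) * \<beta> ^ m))
    = ennreal (A * 8 ^ CARD('n) * 4 powr (- ?n / p) * l powr (- ?n / p) * (1 / (1 - \<beta>)))"
    using \<beta> A by (intro suminf_ennreal_eq sums_mult geometric_sums) auto
  also have "A * 8 ^ CARD('n) * 4 powr (- ?n / p) * l powr (- ?n / p) * (1 / (1 - \<beta>)) = shell_const p * l powr (- ?n / p)"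
    by (simp add: shell_const_def \<beta>_def)
  finally show ?thesis .
qed

text \<open>All powers of the side cancel: the tail is bounded on the cube by a multiple of l^(-n/p)
  times the Morrey norm, the mixed norm of a constant on the cube contributes l^\<sigma>, with
  \<sigma> the sum of the reciprocals of the \<open>q $ j\<close>, and the weight is l^(n/p -
  \<sigma>).\<close>

theorem mixed_morrey_bound:
  assumes q: "\<forall>j. 1 < q $ j" and p: "1 < p" and pq: "real CARD('n) / p \<le> (\<Sum>j\<in>UNIV. 1 / q $ j)"
  shows "\<exists>C>0. \<forall>f\<in>mixed_morrey p q. mixed_morrey_norm p q (T f) \<le> ennreal C * mixed_morrey_norm p q f"
proof -
  let ?n = "real CARD('n)" and ?\<sigma> = "\<Sum>j\<in>UNIV. 1 / q $ j"
  have q1: "\<forall>j. 1 \<le> q $ j" using q by (auto intro: less_imp_le)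
  have p0: "0 < p" using p by simp
  obtain C where C: "0 \<le> C" "\<forall>g\<in>bdd_supp. mixed_norm q (T_borel g) \<le> ennreal C * mixed_norm q g" using bdd_supp_bound[OF q] by blast
  \<comment> \<open>On the mixed space the operator is the restriction from the classical Morrey
    space with the smallest exponent. The condition relating \<open>p\<close> and \<open>q\<close>
    gives s \<le> p, as the representation formula requires.\<close>
  define s where "s = Min (range (\<lambda>j. q $ j))"
  have s: "1 < s" unfolding s_def using q by (subst Min_gr_iff) auto
  have sq: "\<forall>j. s \<le> q $ j" unfolding s_def by auto
  have s1: "1 \<le> s" using s by simp
  have sp: "s \<le> p"
  proof -
    have "?\<sigma> \<le> (\<Sum>j\<in>(UNIV :: 'n set). 1 / s)"
    proof (rule sum_mono)
      fix j
      have "0 < s" "s \<le> q $ j" using s sq by auto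
      then show "1 / q $ j \<le> 1 / s" by (intro divide_left_mono) auto
    qed
    then have "?n / p \<le> ?n / s" using pq by simp
    then show ?thesis using s p by (simp add: field_simps)
  qed
  \<comment> \<open>The power of 2 is the quotient of the weights of a cube and its double; the
    second summand is the tail.\<close>
  define D where "D = C * 2 powr (?\<sigma> - ?n / p) + shell_const p"
  have D: "0 \<le> D" unfolding D_def using C shell_const_nonneg[OF p0] by simp
  have main: "mixed_morrey_norm p q (T f) \<le> ennreal D * mixed_morrey_norm p q f" if fM: "f \<in> mixed_morrey p q" for f
  proof (rule mixed_morrey_norm_leI[OF p0])
    fix c :: "(real, 'n) vec" and l :: real assume l: "0 < l"
    let ?M = "mixed_morrey_norm p q f"
    have f: "f \<in> borel_measurable lebesgue" and Mfin: "?M < top" using fM by (auto simp: mixed_morrey_def)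
    have fms: "morrey_norm p s f \<le> ?M" by (rule morrey_norm_le_mixed[OF s1 sq p0 f])
    then have fs: "f \<in> morrey p s" using f Mfin by (auto simp: mixed_morrey_def)
    have two: "1 < s \<and> s \<le> p" using s sp by simp
    have l2: "0 < 2 * l" using l by simp
    define f2 where "f2 = (\<lambda>x. indicator (cube c (2 * l)) x *\<^sub>R f x)"
    have f2m: "f2 \<in> borel_measurable lebesgue" unfolding f2_def
      using f by (intro borel_measurable_scaleR borel_measurable_indicator) auto
    have f2s: "f2 \<in> morrey s s"
    proof -
      have "ennreal ((2 * l) powr (?n / p - (\<Sum>j\<in>(UNIV :: 'n set). 1 / (vec s :: (real, 'n) vec) $ j))) * mixed_norm (vec s) f2 < top"
        unfolding f2_def using mixed_morrey_norm_ge[OF p0 l2, of "vec s" c f] fms Mfin by (meson le_less_trans)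
      then have "mixed_norm (vec s) f2 < top" using l by (auto simp: ennreal_mult_less_top)
      then show ?thesis using f2m by (simp add: morrey_iff_Lr[OF s1] flip: mixed_norm_vec[OF s1])
    qed
    have "AE x in lebesgue. x \<in> cube c l \<longrightarrow> T f x = T f2 x + (LINT y:(- cube c (2 * l))|lebesgue. k x y * f y)"
      unfolding f2_def
      by (rule ext[unfolded extends_to_morrey_def, rule_format, OF two, THEN conjunct2, rule_format, OF fs l])
    then have split: "AE x in lborel. x \<in> cube c l \<longrightarrow> T f x = T f2 x + (LINT y:(- cube c (2 * l))|lebesgue. k x y * f y)"
      unfolding AE_completion_iff .
    let ?Q = "cube c l" and ?js = "sorted_list_of_set (UNIV :: 'n set)"
    define b where "b = ennreal (shell_const p * l powr (- ?n / p)) * ?M"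
    have [measurable]: "T_borel f2 \<in> borel_measurable borel" by (rule T_borel(1)[OF s f2s])
    have w: "ennreal (l powr (?n / p - ?\<sigma>)) = ennreal (2 powr (?\<sigma> - ?n / p)) * ennreal ((2 * l) powr (?n / p - ?\<sigma>))"
      using l by (simp add: powr_mult mult.assoc[symmetric] flip: ennreal_mult powr_add)
    have "mixed_norm q (\<lambda>x. indicator ?Q x *\<^sub>R T f x) \<le> iter_norm q ?js (\<lambda>x. cnorm (T_borel f2) x + indicator ?Q x * b) 0"
      unfolding mixed_norm_eq_mn[OF q1]
    proof (rule iter_norm_full_AE_mono[OF q1])
      show "AE x in lborel. ennreal (norm (indicator ?Q x *\<^sub>R T f x)) \<le> cnorm (T_borel f2) x + indicator ?Q x * b"
        using split T_borel(2)[OF s f2s]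
      proof eventually_elim
        case (elim x)
        show ?case
        proof (cases "x \<in> ?Q")
          case True
          let ?I = "LINT y:(- cube c (2 * l))|lebesgue. k x y * f y"
          have "norm (T f x) \<le> norm (T_borel f2 x) + norm ?I" using elim True norm_triangle_ineq[of "T_borel f2 x" ?I] by simp
          then have "cnorm (T f) x \<le> cnorm (T_borel f2) x + ennreal (norm ?I)" by (simp add: ennreal_leI flip: ennreal_plus)
          also have "\<dots> \<le> cnorm (T_borel f2) x + b" unfolding b_def by (intro add_left_mono tail_bound[OF q1 p0 l f True])
          finally show ?thesis using True by simp
        qed simp
      qed
    qed auto
    also have "\<dots> \<le> iter_norm q ?js (cnorm (T_borel f2)) 0 + iter_norm q ?js (\<lambda>x. indicator ?Q x * b) 0"
      by (rule iter_norm_add[OF q1]) measurable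
    also have "\<dots> \<le> ennreal C * mixed_norm q f2 + ennreal (l powr ?\<sigma>) * b"
    proof (rule add_mono)
      have "iter_norm q ?js (cnorm (T_borel f2)) 0 = mixed_norm q (T f2)"
        unfolding mixed_norm_eq_mn[OF q1, symmetric] using T_borel(2)[OF s f2s] by (intro mixed_norm_AE_cong[OF q1]) (auto elim: eventually_mono)
      also have "\<dots> \<le> ennreal C * mixed_norm q f2"
        unfolding f2_def by (rule cube_bound[OF q s C(2) f f2s[unfolded f2_def]])
      finally show "iter_norm q ?js (cnorm (T_borel f2)) 0 \<le> ennreal C * mixed_norm q f2" .
      show "iter_norm q ?js (\<lambda>x. indicator ?Q x * b) 0 \<le> ennreal (l powr ?\<sigma>) * b"
        using iter_norm_le_cube[OF q1 l, of ?js "\<lambda>x. indicator ?Q x * b" c b 0] by (auto simp: mem_cube indicator_def split: if_splits)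
    qed
    finally have "ennreal (l powr (?n / p - ?\<sigma>)) * mixed_norm q (\<lambda>x. indicator ?Q x *\<^sub>R T f x)
      \<le> ennreal (l powr (?n / p - ?\<sigma>)) * (ennreal C * mixed_norm q f2 + ennreal (l powr ?\<sigma>) * b)"
      by (rule mult_left_mono) simp
    also have "\<dots> = ennreal C * (ennreal (l powr (?n / p - ?\<sigma>)) * mixed_norm q f2) + ennreal (l powr (?n / p - ?\<sigma>)) * ennreal (l powr ?\<sigma>) * b"
      by (simp add: distrib_left ac_simps)
    also have "ennreal (l powr (?n / p - ?\<sigma>)) * ennreal (l powr ?\<sigma>) * b = ennreal (shell_const p) * ?M"
    proof -
      have "l powr (?n / p - ?\<sigma>) * l powr ?\<sigma> * (shell_const p * l powr (- ?n / p)) = shell_const p"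
        using l by (simp add: mult.left_commute flip: powr_add)
      note e = this[symmetric]
      have "ennreal (shell_const p) = ennreal (l powr (?n / p - ?\<sigma>)) * ennreal (l powr ?\<sigma>) * ennreal (shell_const p * l powr (- ?n / p))"
        using shell_const_nonneg[OF p0] by (subst e) (simp add: ennreal_mult)
      then show ?thesis unfolding b_def by (simp only: mult.assoc)
    qed
    also have "ennreal C * (ennreal (l powr (?n / p - ?\<sigma>)) * mixed_norm q f2) + ennreal (shell_const p) * ?M
      \<le> ennreal C * (ennreal (2 powr (?\<sigma> - ?n / p)) * ?M) + ennreal (shell_const p) * ?M"
      unfolding w f2_def mult.assoc by (intro add_right_mono mult_left_mono mixed_morrey_norm_ge[OF p0 l2]) auto
    also have "\<dots> = ennreal D * ?M"
      unfolding D_def using C shell_const_nonneg[OF p0] by (simp add: ennreal_plus ennreal_mult distrib_right mult.assoc)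
    finally show "ennreal (l powr (?n / p - ?\<sigma>)) * mixed_norm q (\<lambda>x. indicator ?Q x *\<^sub>R T f x) \<le> ennreal D * ?M" .
  qed
  show ?thesis
  \<comment> \<open>Only \<open>0 \<le> D\<close> is known, so 1 is added to obtain a positive
    constant.\<close>
  proof (intro exI[of _ "D + 1"] conjI ballI)
    fix f assume "f \<in> mixed_morrey p q"
    then have "mixed_morrey_norm p q (T f) \<le> ennreal D * mixed_morrey_norm p q f" by (rule main)
    also have "\<dots> \<le> ennreal (D + 1) * mixed_morrey_norm p q f" by (intro mult_right_mono ennreal_leI) auto
    finally show "mixed_morrey_norm p q (T f) \<le> ennreal (D + 1) * mixed_morrey_norm p q f" .
  qed (use D in simp)
qed

end

theorem theorem1p12:
  fixes k :: "real ^ 'n::{finite,linorder} \<Rightarrow> (real, 'n) vec \<Rightarrow> complex"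
    and T :: "'n cfun \<Rightarrow> 'n cfun"
    and p :: real and q :: "(real, 'n) vec"
  assumes "singular_integral_operator k T"
    and "extends_to_morrey k T"
    and "\<forall>j. 1 < q $ j"
    and "1 < p"
    and "real CARD('n) / p \<le> (\<Sum>j\<in>UNIV. 1 / q $ j)"
  shows "\<exists>C>0. \<forall>f\<in>mixed_morrey p q.
    mixed_morrey_norm p q (T f) \<le> ennreal C * mixed_morrey_norm p q f"
proof -
  have k: "singular_kernel k" using assms(1) by (simp add: singular_integral_operator_def)
  obtain A1 where A1: "0 < A1" "\<And>x y. x \<noteq> y \<Longrightarrow> norm (k x y) \<le> A1 * norm (x - y) powr (- real CARD('n))"
    using k unfolding singular_kernel_def by blast
  obtain \<epsilon> A2 where A2: "0 < \<epsilon>" "0 < A2" "\<And>x y z. x \<noteq> y \<Longrightarrow> 2 * norm (x - z) \<le> norm (x - y) \<Longrightarrow>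
    norm (k x y - k z y) + norm (k y x - k y z) \<le> A2 * (norm (x - z) powr \<epsilon> / norm (x - y) powr (real CARD('n) + \<epsilon>))"
    using k unfolding singular_kernel_def by blast
  \<comment> \<open>One constant for size and smoothness. The smoothness condition bounds a sum of
    two nonnegative terms and so bounds each of them.\<close>
  define A where "A = max A1 A2"
  interpret morrey_cz k A \<epsilon> T
  proof
    show "0 < A" "0 < \<epsilon>" using A1 A2 by (auto simp: A_def)
    fix x y z :: "(real, 'n) vec" assume xy: "x \<noteq> y"
    have "A1 * norm (x - y) powr (- real CARD('n)) \<le> A * norm (x - y) powr (- real CARD('n))"
      by (intro mult_right_mono) (auto simp: A_def)
    then show "norm (k x y) \<le> A * norm (x - y) powr (- real CARD('n))" using A1(2)[OF xy] by simp
    assume h: "2 * norm (x - z) \<le> norm (x - y)"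
    have "A2 * (norm (x - z) powr \<epsilon> / norm (x - y) powr (real CARD('n) + \<epsilon>)) \<le> A * (norm (x - z) powr \<epsilon> / norm (x - y) powr (real CARD('n) + \<epsilon>))"
      by (intro mult_right_mono) (auto simp: A_def)
    then have "norm (k x y - k z y) + norm (k y x - k y z) \<le> A * (norm (x - z) powr \<epsilon> / norm (x - y) powr (real CARD('n) + \<epsilon>))"
      using A2(3)[OF xy h] by simp
    moreover have "0 \<le> norm (k x y - k z y)" "0 \<le> norm (k y x - k y z)" by simp_all
    ultimately show "norm (k x y - k z y) \<le> A * (norm (x - z) powr \<epsilon> / norm (x - y) powr (real CARD('n) + \<epsilon>))"
      and "norm (k y x - k y z) \<le> A * (norm (x - z) powr \<epsilon> / norm (x - y) powr (real CARD('n) + \<epsilon>))" by linarith+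
  qed (rule assms(2))
  show ?thesis by (rule mixed_morrey_bound[OF assms(3-5)])
qed

end
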